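(* Consider the Weighted Recursive Tree with vertex-weights $(W_i)_{i\in\mathbb{N}}$ that are i.i.d. copies of a strictly positive random variable $W$ such that (C1) $\sup\{x\in\mathbb{R}:\mathbb{P}(W\le x)<1\}=1$; (C2) there exist $a,\kappa>0$, $\tau\in(0,1)$ and $x_0\ge1$ such that $\mathbb{P}(W\ge 1-1/x)\ge a e^{-\kappa x^\tau}$ for all $x\ge x_0$. Let $\theta:=1+\mathbb{E}[W]$. Fix $k\in\mathbb{N}$, let $(d_i)_{i\in[k]}$ be $k$ integer-valued sequences $d_i=d_i(n)$ that diverge (to $+\infty$) as $n\to\infty$, and set $c_i:=\limsup_{n\to\infty} d_i/\log n$ for $i\in[k]$. Let $v_1,\dots,v_k$ be $k$ vertices selected uniformly at random without replacement from $[n]$. (i) If $c_i\in[0,1/\log\theta)$ for all $i\in[k]$, then the tuple $$\Big(\frac{\log v_i-(\log n-(1-\theta^{-1})d_i)}{\sqrt{(1-\theta^{-1})^2d_i}}\Big)_{i\in[k]},$$ conditionally on the event $\{\mathcal{Z}_n(v_i)\ge d_i\text{ for all }i\in[k]\}$, converges in distribution as $n\to\infty$ to $(M_i)_{i\in[k]}$, where $M_1,\dots,M_k$ are independent standard normal random variables. (ii) If additionally (C3) there exist $C,\rho>0$ and $y_0\in(0,1)$ such that $\mathbb{P}(W\le x)\le Cx^\rho$ for all $x\in[0,y_0]$, then the same conclusion also holds when $(c_i)_{i\in[k]}\in[1/\log\theta,\theta/(\theta-1))^k$.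
   Context: Notation: $[n]=\{1,\dots,n\}$. Weighted Recursive Tree (WRT): let $(W_i)_{i\ge1}$ be i.i.d. copies of $W$, $\mathbb{P}(W>0)=1$, and $S_n:=\sum_{i=1}^nW_i$. $\mathcal{G}_1$ is a single vertex $1$ (the root) with weight $W_1$. For $n\ge1$, a new vertex $n+1$ with weight $W_{n+1}$ is added and, conditionally on $\mathcal{G}_n$ (and the weights), is connected by one directed edge to a vertex $i\in[n]$ chosen with probability $W_i/S_n$; the result is $\mathcal{G}_{n+1}$. $\mathcal{Z}_n(i)$ denotes the in-degree of vertex $i$ in $\mathcal{G}_n$. The uniformly selected vertices $v_i$ are independent of the tree and the weights. *)

theory Defs
  imports "HOL-Probability.Probability" "Graph_Theory.Digraph"
begin

section \<open>The weighted recursive tree\<close>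

text \<open>A recursive tree is encoded by its parent map: \<open>parent (n + 1)\<close> is the vertex of \<open>{1..n}\<close> to
  which vertex \<open>n + 1\<close> is attached. An arc \<open>(m, i)\<close> points from the younger vertex \<open>m\<close> to its
  parent \<open>i\<close>, so in-degrees count children.\<close>

definition recursive_tree :: "(nat \<Rightarrow> nat) \<Rightarrow> nat \<Rightarrow> (nat, nat \<times> nat) pre_digraph" where
  "recursive_tree parent n =
     \<lparr>verts = {1..n}, arcs = (\<lambda>m. (m, parent m)) ` {2..n}, tail = fst, head = snd\<rparr>"

lemma in_degree_recursive_tree:
  "in_degree (recursive_tree parent n) i = card {m \<in> {2..n}. parent m = i}"
proof -
  have "in_arcs (recursive_tree parent n) i = (\<lambda>m. (m, parent m)) ` {m \<in> {2..n}. parent m = i}"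
    by (auto simp: in_arcs_def recursive_tree_def)
  then show ?thesis
    by (simp add: in_degree_def card_image inj_on_def)
qed

text \<open>The sigma-algebra generated by the whole weight sequence and by the parents of the vertices
  in \<open>J\<close>.\<close>

definition history ::
  "'a measure \<Rightarrow> (nat \<Rightarrow> 'a \<Rightarrow> real) \<Rightarrow> (nat \<Rightarrow> 'a \<Rightarrow> nat) \<Rightarrow> nat set \<Rightarrow> 'a measure" where
  "history M W par J =
     vimage_algebra (space M)
       (\<lambda>\<omega>. (\<lambda>j\<in>{1..}. W j \<omega>, \<lambda>m\<in>J. par m \<omega>))
       ((\<Pi>\<^sub>M j\<in>{1..}. borel) \<Otimes>\<^sub>M (\<Pi>\<^sub>M m\<in>J. count_space UNIV))"

text \<open>Here \<open>\<mu>\<close> is the law of the generic weight. Weights are indexed from 1 and parents from 2;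
  other indices are unconstrained.\<close>

locale weighted_recursive_tree = prob_space M + law: real_distribution \<mu>
  for M :: "'a measure" and \<mu> :: "real measure" +
  fixes W :: "nat \<Rightarrow> 'a \<Rightarrow> real" and par :: "nat \<Rightarrow> 'a \<Rightarrow> nat"
  assumes law_pos: "measure \<mu> {0<..} = 1"
    and weights_indep: "indep_vars (\<lambda>_. borel) W {1..}"
    and weights_distr: "\<And>j. 1 \<le> j \<Longrightarrow> distr M borel (W j) = \<mu>"
    and par_measurable: "\<And>m. 2 \<le> m \<Longrightarrow> par m \<in> M \<rightarrow>\<^sub>M count_space UNIV"
    and attachment: "\<And>n i. 1 \<le> n \<Longrightarrow> i \<in> {1..n} \<Longrightarrow>
      AE \<omega> in M.
        real_cond_exp M (history M W par {2..n}) (indicator {\<omega> \<in> space M. par (n + 1) \<omega> = i}) \<omega>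
          = W i \<omega> / (\<Sum>j=1..n. W j \<omega>)"

text \<open>For every \<open>n\<close> separately, \<open>v n\<close> is a uniformly chosen injective \<open>'k\<close>-tuple from \<open>{1..n}\<close>,
  independent of all weights and of the entire tree process. The joint law for different \<open>n\<close> is
  left arbitrary.\<close>

definition uniform_vertices ::
  "'a measure \<Rightarrow> (nat \<Rightarrow> 'a \<Rightarrow> real) \<Rightarrow> (nat \<Rightarrow> 'a \<Rightarrow> nat) \<Rightarrow> (nat \<Rightarrow> 'a \<Rightarrow> 'k::finite \<Rightarrow> nat) \<Rightarrow> bool"
where
  "uniform_vertices M W par v \<longleftrightarrow>
     (\<forall>n \<ge> CARD('k).
        v n \<in> M \<rightarrow>\<^sub>M count_space UNIV \<and>
        distr M (count_space UNIV) (v n) =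
          measure_pmf (pmf_of_set {u :: 'k \<Rightarrow> nat. inj u \<and> range u \<subseteq> {1..n}}) \<and>
        prob_space.indep_set M
          (sets (vimage_algebra (space M) (v n) (count_space UNIV)))
          (sets (history M W par {2..})))"

section \<open>Assumptions on the weight law\<close>

text \<open>The supremum is taken in \<open>ereal\<close>, where it is infinite for a law of unbounded support; the
  real-valued \<open>Sup\<close> is unspecified there.\<close>

definition cond_C1 :: "real measure \<Rightarrow> bool" where
  "cond_C1 \<mu> \<longleftrightarrow> (SUP x \<in> {x. cdf \<mu> x < 1}. ereal x) = 1"

definition cond_C2 :: "real measure \<Rightarrow> bool" where
  "cond_C2 \<mu> \<longleftrightarrow>
     (\<exists>a>0. \<exists>\<kappa>>0. \<exists>\<tau>\<in>{0<..<1}. \<exists>x0\<ge>1. \<forall>x\<ge>x0.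
        measure \<mu> {1 - 1 / x..} \<ge> a * exp (- \<kappa> * x powr \<tau>))"

definition cond_C3 :: "real measure \<Rightarrow> bool" where
  "cond_C3 \<mu> \<longleftrightarrow>
     (\<exists>C>0. \<exists>\<rho>>0. \<exists>y0\<in>{0<..<1}. \<forall>x\<in>{0..y0}. cdf \<mu> x \<le> C * x powr \<rho>)"

section \<open>Convergence in distribution of the conditioned labels\<close>

definition converges_in_law ::
  "(nat \<Rightarrow> 'b::topological_space measure) \<Rightarrow> 'b measure \<Rightarrow> bool" where
  "converges_in_law L N \<longleftrightarrow>
     (\<forall>f :: 'b \<Rightarrow> real. continuous_on UNIV f \<and> bounded (range f) \<longrightarrow>
        (\<lambda>n. \<integral>x. f x \<partial>(L n)) \<longlonglongrightarrow> (\<integral>x. f x \<partial>N))"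

definition degree_event ::
  "'a measure \<Rightarrow> (nat \<Rightarrow> 'a \<Rightarrow> nat) \<Rightarrow> (nat \<Rightarrow> 'a \<Rightarrow> 'k::finite \<Rightarrow> nat) \<Rightarrow> ('k \<Rightarrow> nat \<Rightarrow> int) \<Rightarrow> nat
    \<Rightarrow> 'a set" where
  "degree_event M par v d n =
     {\<omega> \<in> space M. \<forall>i. int (in_degree (recursive_tree (\<lambda>m. par m \<omega>) n) (v n \<omega> i)) \<ge> d i n}"

definition rescaled_labels ::
  "real \<Rightarrow> (nat \<Rightarrow> 'a \<Rightarrow> 'k::finite \<Rightarrow> nat) \<Rightarrow> ('k \<Rightarrow> nat \<Rightarrow> int) \<Rightarrow> nat \<Rightarrow> 'a \<Rightarrow> real ^ 'k" where
  "rescaled_labels \<theta> v d n \<omega> =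
     (\<chi> i. (ln (real (v n \<omega> i)) - (ln (real n) - (1 - 1 / \<theta>) * real_of_int (d i n)))
           / sqrt ((1 - 1 / \<theta>)\<^sup>2 * real_of_int (d i n)))"

text \<open>The measure \<open>uniform_measure M A\<close> is \<open>M\<close> conditioned on the event \<open>A\<close>.\<close>

definition conditional_label_law ::
  "'a measure \<Rightarrow> real \<Rightarrow> (nat \<Rightarrow> 'a \<Rightarrow> nat) \<Rightarrow> (nat \<Rightarrow> 'a \<Rightarrow> 'k::finite \<Rightarrow> nat) \<Rightarrow> ('k \<Rightarrow> nat \<Rightarrow> int)
    \<Rightarrow> nat \<Rightarrow> (real ^ 'k) measure" where
  "conditional_label_law M \<theta> par v d n =
     distr (uniform_measure M (degree_event M par v d n)) borel (rescaled_labels \<theta> v d n)"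

end

theory Submission
  imports Defs "HOL-Real_Asymp.Real_Asymp"
begin

text \<open>
  Given its weight \<open>w\<close>, vertex \<open>u\<close> gains an edge at time \<open>m \<ge> u\<close> with probability close to
  \<open>r c\<^sub>m\<close>, where \<open>r = w / (\<theta> - 1)\<close> and \<open>c\<^sub>m\<close> is close to \<open>1 / m\<close>. The twisted sums
  \<open>\<Sum>\<^sub>u u\<^bsup>i\<sigma>\<^esup> P(deg\<^sub>n(u) \<ge> d)\<close> obey a linear recursion in \<open>n\<close> and \<open>d\<close> that has the exact solutions
  \<open>x\<^sup>d \<Prod>\<^sub>m (1 + q c\<^sub>m)\<close> with \<open>x = r / (r + q)\<close>, for every complex \<open>q\<close>. The solution with
  \<open>q = 1 + i\<sigma>\<close> is the main term; the positive solutions with \<open>q = 1\<close> and \<open>q = 1 - \<beta>\<close> dominate the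
  error, which makes the estimate uniform up to \<open>d\<close> of order \<open>log n\<close>. For \<open>\<sigma>\<close> of order \<open>1 / sqrt d\<close> the factor
  \<open>(1 + i\<sigma> / (r + 1))\<^bsup>-d\<^esup>\<close> gives a Gaussian limit by Levy's theorem, provided the weight is within
  \<open>d\<^bsup>-\<xi>\<^esup>\<close> of 1 for some \<open>\<xi> > 1/2\<close>; (C2) says that this is the typical way for a degree to be large.

  For several vertices, fix deterministic upper and lower bounds for the attachment rates, valid
  outside an event of probability \<open>O(n\<^bsup>-A\<^esup>)\<close>. Replace the future of the tree by independent edges
  with these rates: the conditional probability that all degrees become large is then a
  supermartingale for the upper rates and, up to an error quadratic in the rates, a submartingale
  for the lower ones. Hence the joint tail factorises, and the one-dimensional limits multiply.
\<close>

text \<open>The event conditioned on may have polynomially small probability, so the weight sums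
  must be controlled outside probability \<open>n^-A\<close>. Concentration achieves this only above
  \<open>n^\<delta>\<close>; between \<open>\<epsilon> ln n\<close> and \<open>n^\<delta>\<close> a
  linear lower bound survives, and before that every rate is merely at most 1. Labels below
  \<open>n^\<delta>\<close> therefore need a separate Chernoff estimate.

  The threshold \<open>\<theta> / (\<theta> - 1) = 1 / gam\<close> arises twice. Against the main
  term, the error solution with \<open>q = 1 - \<beta>\<close> gains \<open>(n0 / n)^\<beta>\<close>
  and loses about \<open>exp(d \<beta> gam)\<close>. The Chernoff bound with parameter
  \<open>z < \<theta>\<close> gains \<open>(n0 / n)^\<eta>\<close> with
  \<open>\<eta> = (\<theta> - z) / (\<theta> - 1)\<close> and loses \<open>(\<theta> / z)^d\<close>,
  at most \<open>exp(d (\<theta> - 1) \<eta> / z)\<close>. For small \<open>\<beta>\<close> and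
  \<open>z\<close> near \<open>\<theta>\<close> both gains prevail as long as
  \<open>d \<le> c' ln n\<close> with \<open>c' < 1 / gam\<close>. All remaining losses are small
  powers of \<open>n\<close>, which fixes the order of choice: \<open>c'\<close>,
  \<open>\<beta>\<close>, \<open>z\<close>, \<open>\<epsilon>\<close>, \<open>A\<close>, then
  \<open>\<kappa>\<close>, and \<open>\<delta>\<close> last.\<close>

section \<open>Sums of independent indicators\<close>

text \<open>\<open>tail_prob p u n j\<close> is the probability that independent Bernoulli variables with parameters
  \<open>p l\<close>, \<open>u \<le> l < n\<close>, have sum at least \<open>j\<close>. The truncation \<open>0 - 1 = 0\<close> makes the recursion
  correct for \<open>j = 0\<close>.\<close>

primrec tail_prob :: "(nat \<Rightarrow> real) \<Rightarrow> nat \<Rightarrow> nat \<Rightarrow> nat \<Rightarrow> real" where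
  "tail_prob p u 0 j = of_bool (j = 0)"
| "tail_prob p u (Suc n) j =
     (if u \<le> n then (1 - p n) * tail_prob p u n j + p n * tail_prob p u n (j - 1) else of_bool (j = 0))"

lemma tail_prob_ge: "n \<le> u \<Longrightarrow> tail_prob p u n j = of_bool (j = 0)"
  by (cases n) auto

lemma tail_prob_zero [simp]: "tail_prob p u n 0 = 1"
  by (induction n) auto

text \<open>Conditioning on the first variable instead of the last. The defining recursion serves
  sums over \<open>u\<close> with growing \<open>n\<close>; this one serves the tree, where time
  moves forward towards a fixed horizon \<open>n\<close>.\<close>

lemma tail_prob_backward:
  "u < n \<Longrightarrow> tail_prob p u n j = (1 - p u) * tail_prob p (Suc u) n j + p u * tail_prob p (Suc u) n (j - 1)"
proof (induction n arbitrary: j)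
  case (Suc n)
  show ?case
  proof (cases "u = n")
    case True
    then show ?thesis by (simp add: tail_prob_ge)
  next
    case False
    with Suc.prems have un: "u < n" "Suc u \<le> n" "u \<le> n" by auto
    show ?thesis
      unfolding tail_prob.simps Suc.IH[OF un(1)] using un by (simp add: algebra_simps)
  qed
qed simp

text \<open>Lets vertices born at different times share one starting time: before its birth a vertex
  has rate 0.\<close>

lemma tail_prob_zero_below:
  "m \<le> u \<Longrightarrow> tail_prob (\<lambda>l. if l < u then 0 else p l) m n j = tail_prob p u n j"
  by (induction n arbitrary: j) (auto simp: tail_prob_ge)

lemma tail_prob_bounds:
  assumes "\<And>l. u \<le> l \<Longrightarrow> l < n \<Longrightarrow> 0 \<le> p l \<and> p l \<le> 1"
  shows "0 \<le> tail_prob p u n j \<and> tail_prob p u n j \<le> 1"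
  using assms
proof (induction n arbitrary: j)
  case (Suc n)
  show ?case
  proof (cases "u \<le> n")
    case True
    have IH: "0 \<le> tail_prob p u n j \<and> tail_prob p u n j \<le> 1" for j
      using Suc.IH Suc.prems by (meson less_Suc_eq)
    have p: "0 \<le> p n \<and> p n \<le> 1" using Suc.prems True by auto
    have "(1 - p n) * tail_prob p u n j + p n * tail_prob p u n (j - 1) \<le> 1"
      using IH p by (intro convex_bound_le) auto
    then show ?thesis using True IH p by auto
  qed auto
qed simp

lemma tail_prob_antimono_Suc:
  assumes "\<And>l. u \<le> l \<Longrightarrow> l < n \<Longrightarrow> 0 \<le> p l \<and> p l \<le> 1"
  shows "tail_prob p u n (Suc j) \<le> tail_prob p u n j"
  using assms
proof (induction n arbitrary: j)
  case (Suc n)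
  show ?case
  proof (cases "u \<le> n")
    case True
    have IH: "tail_prob p u n (Suc j) \<le> tail_prob p u n j" for j
      using Suc.IH Suc.prems by (meson less_Suc_eq)
    have p: "0 \<le> p n \<and> p n \<le> 1" using Suc.prems True by auto
    have "tail_prob p u n j \<le> tail_prob p u n (j - 1)"
      using IH[of "j - 1"] by (cases j) auto
    then show ?thesis using True IH p by (auto intro!: add_mono mult_left_mono)
  qed auto
qed auto

lemma tail_prob_antimono_pred:
  assumes "\<And>l. u \<le> l \<Longrightarrow> l < n \<Longrightarrow> 0 \<le> p l \<and> p l \<le> 1"
  shows "tail_prob p u n j \<le> tail_prob p u n (j - 1)"
  using tail_prob_antimono_Suc[of u n p "j - 1"] assms by (cases j) auto

text \<open>Raising the last rate moves mass from the value at \<open>j\<close> to the value at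
  \<open>j - 1\<close>, which is the larger of the two.\<close>

lemma tail_prob_mono:
  assumes "\<And>l. u \<le> l \<Longrightarrow> l < n \<Longrightarrow> 0 \<le> p l \<and> p l \<le> q l \<and> q l \<le> 1"
  shows "tail_prob p u n j \<le> tail_prob q u n j"
  using assms
proof (induction n arbitrary: j)
  case (Suc n)
  show ?case
  proof (cases "u \<le> n")
    case True
    have IH: "tail_prob p u n j \<le> tail_prob q u n j" for j
      using Suc.IH Suc.prems by (meson less_Suc_eq)
    have p: "0 \<le> p n \<and> p n \<le> q n \<and> q n \<le> 1" using Suc.prems True by auto
    have "tail_prob q u n j \<le> tail_prob q u n (j - 1)"
      by (intro tail_prob_antimono_pred) (use Suc.prems in \<open>fastforce\<close>)
    then have "0 \<le> (q n - p n) * (tail_prob q u n (j - 1) - tail_prob q u n j)"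
      using p by simp
    then have "(1 - p n) * tail_prob q u n j + p n * tail_prob q u n (j - 1)
      \<le> (1 - q n) * tail_prob q u n j + q n * tail_prob q u n (j - 1)"
      by (simp add: algebra_simps)
    moreover have "(1 - p n) * tail_prob p u n j + p n * tail_prob p u n (j - 1)
        \<le> (1 - p n) * tail_prob q u n j + p n * tail_prob q u n (j - 1)"
      using IH p by (intro add_mono mult_left_mono) auto
    ultimately show ?thesis using True by simp
  qed auto
qed auto

text \<open>The right-hand side is the expectation of \<open>z\<close> to the power of the sum, so
  this is Markov's inequality; induction on \<open>n\<close> avoids introducing the random
  variables.\<close>

lemma tail_prob_chernoff:
  fixes z :: real
  assumes "\<And>l. u \<le> l \<Longrightarrow> l < n \<Longrightarrow> 0 \<le> p l \<and> p l \<le> 1" and z: "1 \<le> z"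
  shows "z ^ j * tail_prob p u n j \<le> (\<Prod>l\<in>{u..<n}. 1 + (z - 1) * p l)"
  using assms(1)
proof (induction n arbitrary: j)
  case 0
  then show ?case by simp
next
  case (Suc n)
  show ?case
  proof (cases "u \<le> n")
    case True
    have IH: "z ^ j * tail_prob p u n j \<le> (\<Prod>l\<in>{u..<n}. 1 + (z - 1) * p l)" for j
      using Suc.IH Suc.prems by (meson less_Suc_eq)
    have p: "0 \<le> p n \<and> p n \<le> 1" using Suc.prems True by auto
    let ?Q = "\<Prod>l\<in>{u..<n}. 1 + (z - 1) * p l"
    have Q: "1 \<le> ?Q" using IH[of 0] by simp
    \<comment> \<open>For \<open>j = 0\<close> the truncated predecessor is again 0, and
      \<open>1 \<le> z * ?Q\<close> replaces the induction hypothesis at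
      \<open>j - 1\<close>.\<close>
    have "z ^ j * tail_prob p u n (j - 1) \<le> z * ?Q"
    proof (cases j)
      case 0
      have "1 * 1 \<le> z * ?Q" using z Q by (intro mult_mono) auto
      then show ?thesis using 0 by simp
    next
      case (Suc i)
      then show ?thesis using IH[of i] z by (simp add: mult.assoc mult_left_mono)
    qed
    then have "(1 - p n) * (z ^ j * tail_prob p u n j) + p n * (z ^ j * tail_prob p u n (j - 1))
       \<le> (1 - p n) * ?Q + p n * (z * ?Q)"
      using IH[of j] p by (intro add_mono mult_left_mono) auto
    also have "\<dots> = (1 + (z - 1) * p n) * ?Q" by (simp add: algebra_simps)
    finally show ?thesis using True by (simp add: algebra_simps)
  next
    case False
    then show ?thesis by simp
  qed
qed

lemma tail_prob_measurable [measurable]: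
  assumes "\<And>l. (\<lambda>x. p x l) \<in> borel_measurable M"
  shows "(\<lambda>x. tail_prob (p x) u n j) \<in> borel_measurable M"
proof (induction n arbitrary: j)
  case (Suc n)
  note [measurable] = Suc.IH assms
  show ?case by (simp, measurable)
qed simp

section \<open>Comparison and exact solutions for the recursion in \<open>n\<close> and
  \<open>d\<close>\<close>

text \<open>A maximum principle: each new value is a convex combination of two old ones, so
  domination on the edges \<open>n = n0\<close> and \<open>d = 0\<close> propagates to the whole
  quadrant.\<close>

lemma pascal_comparison:
  fixes D :: "nat \<Rightarrow> nat \<Rightarrow> 'a::real_normed_algebra_1" and E :: "nat \<Rightarrow> nat \<Rightarrow> real"
  assumes p: "\<And>n. n0 \<le> n \<Longrightarrow> 0 \<le> p n \<and> p n \<le> (1::real)"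
    and D: "\<And>n d. n0 \<le> n \<Longrightarrow> D (Suc n) (Suc d) = (1 - p n) *\<^sub>R D n (Suc d) + p n *\<^sub>R D n d"
    and E: "\<And>n d. n0 \<le> n \<Longrightarrow> E (Suc n) (Suc d) = (1 - p n) * E n (Suc d) + p n * E n d"
    and start: "\<And>d. norm (D n0 d) \<le> E n0 d"
    and edge: "\<And>n. n0 \<le> n \<Longrightarrow> norm (D n 0) \<le> E n 0"
    and n: "n0 \<le> n"
  shows "norm (D n d) \<le> E n d"
  using n
proof (induction n arbitrary: d rule: dec_induct)
  case base
  show ?case by (rule start)
next
  case (step n)
  show ?case
  proof (cases d)
    case 0
    then show ?thesis using edge step.hyps by simp
  next
    case (Suc d')
    have "norm (D (Suc n) d) \<le> norm ((1 - p n) *\<^sub>R D n (Suc d')) + norm (p n *\<^sub>R D n d')"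
      using D[OF step.hyps(1)] Suc norm_triangle_ineq by metis
    also have "\<dots> = (1 - p n) * norm (D n (Suc d')) + p n * norm (D n d')"
      using p[OF step.hyps(1)] by simp
    also have "\<dots> \<le> E (Suc n) d"
      unfolding Suc E[OF step.hyps(1)] using step.IH p[OF step.hyps(1)]
      by (intro add_mono mult_left_mono) auto
    finally show ?thesis .
  qed
qed

text \<open>Separation of variables. With \<open>x = r / (r + q)\<close> one has
  \<open>r (1 - x) = q x\<close>, hence \<open>(1 - r C) x + r C = (1 + q C) x\<close> for every
  \<open>C\<close>; this is why \<open>x\<close> does not depend on the rates.\<close>

lemma pascal_solution:
  fixes q r :: "'a::real_normed_field" and c :: "nat \<Rightarrow> real"
  assumes "r + q \<noteq> 0" "r = of_real r'" "r' \<noteq> 0" "n0 \<le> n"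
  defines "F \<equiv> \<lambda>n d. (r / (r + q)) ^ d * (\<Prod>m\<in>{n0..<n}. 1 + q * of_real (c m))"
  shows "F (Suc n) (Suc d) = (1 - r' * c n) *\<^sub>R F n (Suc d) + (r' * c n) *\<^sub>R F n d"
proof -
  have *: "(1 - r * C) * (r / (r + q)) + r * C = (1 + q * C) * (r / (r + q))" for C
    using assms(1) by (simp add: field_simps)
  define x where "x = r / (r + q)"
  define X P where "X = x ^ d" and "P = (\<Prod>m\<in>{n0..<n}. 1 + q * of_real (c m))"
  have "(1 - r * of_real (c n)) * (X * x * P) + r * of_real (c n) * (X * P)
      = ((1 - r * of_real (c n)) * x + r * of_real (c n)) * (X * P)"
    by (simp add: algebra_simps)
  also have "\<dots> = (1 + q * of_real (c n)) * x * (X * P)"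
    using * by (simp add: x_def)
  finally show ?thesis
    unfolding F_def x_def[symmetric] using assms(2,4)
    by (simp add: scaleR_conv_of_real X_def[symmetric] P_def[symmetric] mult_ac)
qed

section \<open>Sums of logarithmic phases\<close>

lemma norm_cis_diff_le: "norm (cis a - cis b) \<le> \<bar>a - b\<bar>"
proof -
  have "cis a - cis b = cis b * (cis (a - b) - 1)"
    by (simp add: right_diff_distrib cis_mult)
  then have "norm (cis a - cis b) = norm (cis (a - b) - 1)"
    by (simp add: norm_mult)
  also have "\<dots> \<le> \<bar>a - b\<bar>"
    using iexp_approx1[of "a - b" 0] by (simp add: cis_conv_exp)
  finally show ?thesis .
qed

text \<open>A weak form of Stirling's formula; the inductive step is
  \<open>n ln (1 + 1 / n) \<le> 1\<close>.\<close>

lemma ln_fact_ge: "real n * ln (real n) - real n \<le> ln (fact n)"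
proof (induction n)
  case (Suc n)
  show ?case
  proof (cases "n = 0")
    case False
    have "ln (1 + 1 / real n) \<le> 1 / real n" using False by (intro ln_add_one_self_le_self) auto
    moreover have "ln (real (Suc n)) = ln (real n) + ln (1 + 1 / real n)"
    proof -
      have "real (Suc n) = real n * (1 + 1 / real n)" using False by (simp add: field_simps)
      moreover have "0 < real n" "0 < 1 + 1 / real n" using False by (auto intro: add_pos_nonneg)
      ultimately show ?thesis using ln_mult_pos by metis
    qed
    ultimately have "real n * ln (real (Suc n)) \<le> real n * ln (real n) + 1"
      using False by (simp add: field_simps)
    moreover have "ln (fact (Suc n)) = ln (real (Suc n)) + ln (fact n :: real)"
      by (simp add: ln_mult del: of_nat_Suc)
    ultimately show ?thesis using Suc.IH by (simp add: algebra_simps)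
  qed auto
qed simp

lemma sum_ln_ratio_le: "(\<Sum>u\<in>{1..n}. ln (real n / real u)) \<le> real n"
proof (cases "n = 0")
  case False
  have "(\<Sum>u\<in>{1..n}. ln (real n / real u)) = (\<Sum>u\<in>{1..n}. ln (real n) - ln (real u))"
    by (intro sum.cong) (use False in \<open>auto simp: ln_div\<close>)
  also have "\<dots> = real n * ln (real n) - ln (fact n)"
    using ln_prod[of "{1..n}" real] by (simp add: sum_subtractf fact_prod)
  finally show ?thesis using ln_fact_ge[of n] by linarith
qed simp

text \<open>Replacing \<open>u\<close> by \<open>n\<close> changes the phase by at most
  \<open>\<bar>\<sigma>\<bar> ln (n / u)\<close>, and these logarithms sum to at most
  \<open>n\<close>; the \<open>n0\<close> missing terms cost 1 each.\<close>

lemma sum_cis_ln_approx: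
  assumes "n0 \<le> n"
  shows "norm ((\<Sum>u\<in>{n0<..n}. cis (\<sigma> * ln (real u))) - of_nat n * cis (\<sigma> * ln (real n)))
    \<le> real n0 + \<bar>\<sigma>\<bar> * real n"
proof -
  let ?z = "cis (\<sigma> * ln (real n))"
  have "(\<Sum>u\<in>{n0<..n}. cis (\<sigma> * ln (real u))) - of_nat n * ?z
     = (\<Sum>u\<in>{n0<..n}. cis (\<sigma> * ln (real u)) - ?z) - of_nat n0 * ?z"
    using assms by (simp add: sum_subtractf of_nat_diff algebra_simps)
  also have "norm \<dots> \<le> (\<Sum>u\<in>{n0<..n}. norm (cis (\<sigma> * ln (real u)) - ?z)) + real n0"
    by (intro order_trans[OF norm_triangle_ineq4] add_mono norm_sum) (simp add: norm_mult)
  also have "(\<Sum>u\<in>{n0<..n}. norm (cis (\<sigma> * ln (real u)) - ?z)) \<le> (\<Sum>u\<in>{1..n}. \<bar>\<sigma>\<bar> * ln (real n / real u))"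
  proof (rule order_trans[OF sum_mono[where g="\<lambda>u. \<bar>\<sigma>\<bar> * ln (real n / real u)"] sum_mono2])
    fix u assume u: "u \<in> {n0<..n}"
    have "norm (cis (\<sigma> * ln (real u)) - ?z) \<le> \<bar>\<sigma> * ln (real u) - \<sigma> * ln (real n)\<bar>"
      by (rule norm_cis_diff_le)
    also have "\<dots> = \<bar>\<sigma>\<bar> * ln (real n / real u)"
      using u by (simp add: right_diff_distrib[symmetric] abs_mult ln_div)
    finally show "norm (cis (\<sigma> * ln (real u)) - ?z) \<le> \<bar>\<sigma>\<bar> * ln (real n / real u)" .
  qed auto
  also have "\<dots> \<le> \<bar>\<sigma>\<bar> * real n"
    using sum_ln_ratio_le[of n] by (simp add: sum_distrib_left[symmetric] mult_left_mono)
  finally show ?thesis by simp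
qed

section \<open>Attachment rates close to \<open>1 / m\<close>\<close>

text \<open>The exponent \<open>1/4\<close> is what a deviation of order \<open>m\<^bsup>3/4\<^esup>\<close> of the sum of the first \<open>m\<close> weights
  costs.\<close>

locale harmonic_rates =
  fixes c :: "nat \<Rightarrow> real" and n0 :: nat
  assumes n0_pos: "0 < n0"
    and n0_large: "240 * real n0 powr (-1/4) \<le> 1"
    and rate: "\<And>m. n0 \<le> m \<Longrightarrow> \<bar>real m * c m - 1\<bar> \<le> 2 * real m powr (-1/4)"
begin

abbreviation h where "h \<equiv> real n0 powr (-1/4)"

lemma h_pos: "0 < h" using n0_pos by simp

lemma powr_h_le: "n0 \<le> m \<Longrightarrow> real m powr (-1/4) \<le> h"
  using n0_pos by (intro powr_mono2') auto

lemma inverse_le_powr: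
  assumes "n0 \<le> m" shows "1 / real m ^ 2 \<le> real m powr (-5/4)"
proof -
  have "real m powr (-2) \<le> real m powr (-5/4)"
    using assms n0_pos by (intro powr_mono) auto
  then show ?thesis using assms n0_pos by (simp add: powr_minus divide_simps powr_numeral)
qed

lemma inverse_Suc_diff:
  fixes m :: nat assumes "0 < m"
  shows "1 / real m - 1 / real (Suc m) \<le> 1 / real m ^ 2"
proof -
  have "1 / real m - 1 / real (Suc m) = 1 / (real m * real (Suc m))"
    using assms by (simp add: field_simps)
  also have "\<dots> \<le> 1 / real m ^ 2"
    using assms by (intro divide_left_mono) (auto simp: power2_eq_square)
  finally show ?thesis .
qed

lemma rate_diff:
  assumes "n0 \<le> m" shows "\<bar>c m - 1 / real m\<bar> \<le> 2 * real m powr (-5/4)"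
proof -
  have m: "0 < real m" using assms n0_pos by simp
  have "\<bar>c m - 1 / real m\<bar> = \<bar>real m * c m - 1\<bar> / real m"
    using m by (simp add: abs_div field_simps flip: abs_mult_pos)
  also have "\<dots> \<le> 2 * real m powr (-1/4) / real m"
    using rate[OF assms] m by (intro divide_right_mono) auto
  also have "\<dots> = 2 * real m powr (-5/4)"
    using m powr_diff[of "real m" "-1/4" 1] by simp
  finally show ?thesis .
qed

lemma rate_nonneg: assumes "n0 \<le> m" shows "0 \<le> c m"
proof -
  have "2 * real m powr (-1/4) \<le> 1" using powr_h_le[OF assms] n0_large by linarith
  then have "0 \<le> real m * c m" using rate[OF assms] by linarith
  then show ?thesis using assms n0_pos by (simp add: zero_le_mult_iff)
qed

text \<open>Turns sums of \<open>m powr (-5/4)\<close> into telescoping ones. The mean value theorem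
  at a point below \<open>2 m\<close> loses the factor \<open>1/4\<close> of the derivative and
  \<open>2 powr (-5/4) \<ge> 2/5\<close>, whence the constant 10.\<close>

lemma powr_telescope:
  fixes m :: nat assumes "0 < m"
  shows "real m powr (-5/4) \<le> 10 * (real m powr (-1/4) - real (Suc m) powr (-1/4))"
proof -
  let ?f = "\<lambda>x::real. x powr (-1/4)"
  have "\<exists>z. real m < z \<and> z < real (Suc m) \<and>
     ?f (real (Suc m)) - ?f (real m) = (real (Suc m) - real m) * ((-1/4) * z powr (-5/4))"
  proof (rule MVT2)
    fix z assume "real m \<le> z"
    then have "(?f has_real_derivative (-1/4) * z powr (-1/4 - 1)) (at z)"
      using assms by (intro has_real_derivative_powr) auto
    then show "(?f has_real_derivative (-1/4) * z powr (-5/4)) (at z)" by simp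
  qed simp
  then obtain z where z: "real m < z" "z < real (Suc m)"
    and eq: "?f (real m) - ?f (real (Suc m)) = z powr (-5/4) / 4" by auto
  have "(2/5) \<le> (2::real) powr (-5/4)"
  proof -
    \<comment> \<open>After taking fourth powers the claim is \<open>32 \<le> (5/2)^4\<close>, which
      is about 39.06.\<close>
    have "((2::real) powr (5/4)) ^ 4 = 2 powr 5" by (subst powr_power) auto
    also have "\<dots> \<le> (5/2) ^ 4" by (simp add: powr_numeral eval_nat_numeral)
    finally have "(2::real) powr (5/4) \<le> 5/2" by (subst (asm) power_mono_iff) auto
    then have "inverse (5/2) \<le> inverse ((2::real) powr (5/4))" by (intro le_imp_inverse_le) auto
    then show ?thesis by (simp add: powr_minus)
  qed
  then have "(2/5) * real m powr (-5/4) \<le> 2 powr (-5/4) * real m powr (-5/4)"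
    by (intro mult_right_mono) auto
  also have "\<dots> = (2 * real m) powr (-5/4)" using assms by (simp add: powr_mult)
  also have "\<dots> \<le> z powr (-5/4)" using z assms by (intro powr_mono2') auto
  finally show ?thesis using eq by simp
qed

lemma sum_powr_le:
  assumes "n0 \<le> n" shows "(\<Sum>m\<in>{n0..<n}. real m powr (-5/4)) \<le> 10 * h"
proof -
  have "(\<Sum>m\<in>{n0..<n}. real m powr (-5/4))
      \<le> (\<Sum>m\<in>{n0..<n}. 10 * (real m powr (-1/4) - real (Suc m) powr (-1/4)))"
    by (intro sum_mono powr_telescope) (use n0_pos in auto)
  also have "\<dots> = 10 * (h - real n powr (-1/4))"
    unfolding sum_distrib_left[symmetric]
    using assms sum_Suc_diff'[of n0 n "\<lambda>m. - (real m powr (-1/4))"] by simp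
  finally show ?thesis by (smt (verit) powr_ge_zero)
qed

lemma ln_step:
  fixes m :: nat assumes "0 < m"
  defines "L \<equiv> ln (real (Suc m) / real m)"
  shows "1 / real (Suc m) \<le> L" "L \<le> 1 / real m"
proof -
  have "L = ln (1 + 1 / real m)" using assms by (simp add: L_def field_simps)
  also have "\<dots> \<le> 1 / real m" using assms by (intro ln_add_one_self_le_self) auto
  finally show "L \<le> 1 / real m" .
  have "- L = ln (real m / real (Suc m))" using assms by (simp add: L_def ln_div del: of_nat_Suc)
  also have "\<dots> \<le> real m / real (Suc m) - 1" using assms by (intro ln_le_minus_one) auto
  also have "\<dots> = - (1 / real (Suc m))" by (simp add: field_simps)
  finally show "1 / real (Suc m) \<le> L" by simp
qed

lemma sum_rate_le:
  assumes "n0 \<le> n" shows "(\<Sum>m\<in>{n0..<n}. c m) \<le> ln (real n / real n0) + 1"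
proof -
  \<comment> \<open>The 3 is 2 from \<open>rate_diff\<close> plus 1 for replacing
    \<open>1 / (m + 1)\<close> by \<open>1 / m\<close>.\<close>
  have "c m \<le> (ln (real (Suc m)) - ln (real m)) + 3 * real m powr (-5/4)" if "n0 \<le> m" for m
  proof -
    have m: "0 < m" using that n0_pos by simp
    have "1 / real m - 1 / real (Suc m) \<le> 1 / real m ^ 2"
      using m by (rule inverse_Suc_diff)
    then have "1 / real m \<le> ln (real (Suc m) / real m) + real m powr (-5/4)"
      using ln_step(1)[OF m] inverse_le_powr[OF that] by linarith
    then show ?thesis using rate_diff[OF that] m by (simp add: ln_div abs_le_iff del: of_nat_Suc)
  qed
  then have "(\<Sum>m\<in>{n0..<n}. c m) \<le> (\<Sum>m\<in>{n0..<n}. (ln (real (Suc m)) - ln (real m)) + 3 * real m powr (-5/4))"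
    by (intro sum_mono) auto
  also have "\<dots> = ln (real n) - ln (real n0) + 3 * (\<Sum>m\<in>{n0..<n}. real m powr (-5/4))"
    using assms sum_Suc_diff'[of n0 n "\<lambda>m. ln (real m)"]
    by (simp add: sum.distrib sum_distrib_left[symmetric])
  also have "\<dots> \<le> ln (real n) - ln (real n0) + 1"
    using sum_powr_le[OF assms] n0_large by linarith
  also have "ln (real n) - ln (real n0) = ln (real n / real n0)"
    using assms n0_pos by (simp add: ln_div)
  finally show ?thesis .
qed

lemma prod_rate_le:
  assumes "n0 \<le> n" "0 \<le> a"
  shows "(\<Prod>m\<in>{n0..<n}. 1 + a * c m) \<le> exp a * (real n / real n0) powr a"
proof -
  have "(\<Prod>m\<in>{n0..<n}. 1 + a * c m) \<le> (\<Prod>m\<in>{n0..<n}. exp (a * c m))"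
    using rate_nonneg assms by (intro prod_mono) (auto intro!: add_nonneg_nonneg mult_nonneg_nonneg)
  also have "\<dots> = exp (a * (\<Sum>m\<in>{n0..<n}. c m))"
    by (simp add: exp_sum sum_distrib_left)
  also have "\<dots> \<le> exp (a * (ln (real n / real n0) + 1))"
    using sum_rate_le[OF assms(1)] assms(2) by (simp add: mult_left_mono)
  also have "\<dots> = exp a * (real n / real n0) powr a"
    using assms n0_pos by (simp add: powr_def exp_add[symmetric] algebra_simps)
  finally show ?thesis .
qed

text \<open>The sequence \<open>m powr (1 + \<i> \<sigma>)\<close> obeys the recursion of the
  product up to a factor \<open>f m\<close> per step. The \<open>f m - 1\<close> are summable with
  sum \<open>O(h)\<close>, so the product of all \<open>f m\<close> stays within \<open>O(h)\<close>
  of 1.\<close>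

lemma prod_rate_approx:
  assumes "n0 \<le> n" "\<bar>\<sigma>\<bar> \<le> 1"
  shows "norm (of_nat n0 * cis (\<sigma> * ln (real n0)) * (\<Prod>m\<in>{n0..<n}. 1 + (1 + \<i> * \<sigma>) * of_real (c m))
     - of_nat n * cis (\<sigma> * ln (real n))) \<le> 120 * h * real n"
proof -
  define f where "f m = (1 + (1 + \<i> * \<sigma>) * of_real (c m)) *
     (of_nat m * cis (\<sigma> * ln (real m)) / (of_nat (Suc m) * cis (\<sigma> * ln (real (Suc m)))))" for m
  have f1: "norm (f m - 1) \<le> 6 * real m powr (-5/4)" if m: "n0 \<le> m" for m
  proof -
    have m0: "0 < m" using m n0_pos by simp
    define L where "L = ln (real (Suc m) / real m)"
    define g where "g = (1 + (1 + \<i> * \<sigma>) * of_real (c m)) * of_real (real m / real (Suc m))"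
    have "cis (\<sigma> * ln (real m)) / cis (\<sigma> * ln (real (Suc m))) = cis (- (\<sigma> * L))"
      using m0 by (simp add: cis_divide L_def ln_div right_diff_distrib del: of_nat_Suc)
    moreover have "f m = g * (cis (\<sigma> * ln (real m)) / cis (\<sigma> * ln (real (Suc m))))"
      by (simp add: f_def g_def del: of_nat_Suc)
    ultimately have "f m = g * cis (- (\<sigma> * L))" by simp
    then have "f m - 1 = cis (- (\<sigma> * L)) * (g - cis (\<sigma> * L))"
      by (simp add: right_diff_distrib cis_mult)
    then have "norm (f m - 1) = norm (g - cis (\<sigma> * L))" by (simp add: norm_mult)
    \<comment> \<open>Because \<open>(1 / m) (1 - 1 / (m + 1)) = 1 / (m + 1)\<close>, the rate
      \<open>c m = 1 / m\<close> would give exactly \<open>g = 1 + \<i> \<sigma> / (m + 1)\<close>.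
      The three terms are the Taylor remainder of \<open>cis\<close>, the gap between
      \<open>1 / (m + 1)\<close> and \<open>L\<close>, and the deviation of \<open>c m\<close>; they
      contribute 1, 1 and 4 to the constant 6.\<close>
    also have "g - cis (\<sigma> * L) = (1 + \<i> * (\<sigma> * L) - cis (\<sigma> * L))
        + \<i> * \<sigma> * of_real (1 / real (Suc m) - L)
        + (1 + \<i> * \<sigma>) * of_real (c m - 1 / real m) * of_real (real m / real (Suc m))"
    proof -
      define K where "K = complex_of_real (1 / real (Suc m))"
      have 1: "complex_of_real (real m / real (Suc m)) = 1 - K"
      proof -
        have "real m / real (Suc m) = 1 - 1 / real (Suc m)" by (simp add: field_simps)
        then show ?thesis unfolding K_def by (simp only: of_real_diff of_real_1)
      qed
      have 2: "complex_of_real (1 / real m) * (1 - K) = K"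
        unfolding 1[symmetric] using m0 by (simp add: K_def)
      have "(1 + \<i> * \<sigma>) * of_real (c m - 1 / real m) * (1 - K)
          = (1 + \<i> * \<sigma>) * of_real (c m) * (1 - K) - (1 + \<i> * \<sigma>) * (of_real (1 / real m) * (1 - K))"
        by (simp add: algebra_simps del: of_real_divide)
      also have "\<dots> = (1 + \<i> * \<sigma>) * of_real (c m) * (1 - K) - (1 + \<i> * \<sigma>) * K"
        by (simp only: 2)
      finally show ?thesis unfolding g_def 1 of_real_diff K_def[symmetric]
        by (simp add: algebra_simps)
    qed
    also have "norm \<dots> \<le> norm (1 + \<i> * (\<sigma> * L) - cis (\<sigma> * L))
        + norm (\<i> * \<sigma> * of_real (1 / real (Suc m) - L))
        + norm ((1 + \<i> * \<sigma>) * of_real (c m - 1 / real m) * of_real (real m / real (Suc m)))"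
      by (intro order_trans[OF norm_triangle_ineq] add_mono norm_triangle_ineq) auto
    also have "norm (1 + \<i> * (\<sigma> * L) - cis (\<sigma> * L)) \<le> real m powr (-5/4)"
    proof -
      have "norm (1 + \<i> * (\<sigma> * L) - cis (\<sigma> * L)) \<le> \<bar>\<sigma> * L\<bar>\<^sup>2 / 2"
        using iexp_approx1[of "\<sigma> * L" 1] by (simp add: cis_conv_exp norm_minus_commute power2_eq_square)
      also have "\<dots> \<le> (1 / real m)\<^sup>2"
      proof -
        have "\<bar>\<sigma> * L\<bar> \<le> 1 * (1 / real m)"
        proof -
          have "0 \<le> L" unfolding L_def by (rule order_trans[OF _ ln_step(1)[OF m0]]) simp
          then have "\<bar>L\<bar> \<le> 1 / real m" using ln_step(2)[OF m0] unfolding L_def by simp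
          then show ?thesis unfolding abs_mult using assms(2) by (intro mult_mono) auto
        qed
        then have "\<bar>\<sigma> * L\<bar>\<^sup>2 \<le> (1 / real m)\<^sup>2" by (intro power_mono) auto
        then show ?thesis by (smt (verit) zero_le_power2 field_sum_of_halves)
      qed
      also have "\<dots> \<le> real m powr (-5/4)" using inverse_le_powr[OF m] by (simp add: power_divide)
      finally show ?thesis .
    qed
    also have "norm (\<i> * \<sigma> * of_real (1 / real (Suc m) - L)) \<le> real m powr (-5/4)"
    proof -
      have "norm (\<i> * \<sigma> * of_real (1 / real (Suc m) - L)) = \<bar>\<sigma>\<bar> * \<bar>1 / real (Suc m) - L\<bar>"
        by (simp add: norm_mult del: of_nat_Suc of_real_diff of_real_divide)
      also have "\<dots> \<le> 1 * (1 / real m ^ 2)"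
      proof (intro mult_mono)
        have "1 / real m - 1 / real (Suc m) \<le> 1 / real m ^ 2"
          using m0 by (rule inverse_Suc_diff)
        then show "\<bar>1 / real (Suc m) - L\<bar> \<le> 1 / real m ^ 2"
          using ln_step[OF m0] unfolding L_def by linarith
      qed (use assms in auto)
      finally show ?thesis using inverse_le_powr[OF m] by simp
    qed
    also have "norm ((1 + \<i> * \<sigma>) * of_real (c m - 1 / real m) * of_real (real m / real (Suc m)))
       \<le> 2 * (2 * real m powr (-5/4)) * 1"
      unfolding norm_mult
    proof (intro mult_mono)
      show "norm (1 + \<i> * complex_of_real \<sigma>) \<le> 2"
        using norm_triangle_ineq[of 1 "\<i> * complex_of_real \<sigma>"] assms(2) by (simp add: norm_mult)
    qed (use rate_diff[OF m] in \<open>auto simp del: of_real_diff of_real_divide of_nat_Suc\<close>)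
    finally show ?thesis by simp
  qed
  define P where "P = (\<Prod>m\<in>{n0..<n}. 1 + (1 + \<i> * \<sigma>) * of_real (c m))"
  define z :: "nat \<Rightarrow> complex" where "z m = of_nat m * cis (\<sigma> * ln (real m))" for m
  have z0: "z m \<noteq> 0" if "n0 \<le> m" for m using that n0_pos by (simp add: z_def)
  have eq: "z n0 * P = z n * (\<Prod>m\<in>{n0..<n}. f m)"
  proof -
    have "(\<Prod>m\<in>{n0..<n}. f m) = P * (\<Prod>m\<in>{n0..<n}. z m / z (Suc m))"
      unfolding f_def P_def z_def by (rule prod.distrib)
    also have "(\<Prod>m\<in>{n0..<n}. z m / z (Suc m)) = z n0 / z n"
      using assms(1)
    proof (induction n rule: dec_induct)
      case base then show ?case using z0[of n0] by simp
    next
      case (step k) then show ?case using z0[of k] z0[of "Suc k"] by simp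
    qed
    finally show ?thesis using z0[OF assms(1)] by simp
  qed
  have "norm (z n0 * P - z n) = norm (z n) * norm ((\<Prod>m\<in>{n0..<n}. 1 + (f m - 1)) - 1)"
    by (simp add: eq right_diff_distrib flip: norm_mult)
  also have "\<dots> \<le> real n * (120 * h)"
  proof (intro mult_mono)
    have "norm ((\<Prod>m\<in>{n0..<n}. 1 + (f m - 1)) - 1) \<le> (\<Prod>m\<in>{n0..<n}. 1 + norm (f m - 1)) - 1"
      by (rule norm_prod_minus1_le_prod_minus1)
    also have "(\<Prod>m\<in>{n0..<n}. 1 + norm (f m - 1)) \<le> (\<Prod>m\<in>{n0..<n}. exp (6 * real m powr (-5/4)))"
    proof (intro prod_mono conjI)
      fix m assume "m \<in> {n0..<n}"
      then have "1 + norm (f m - 1) \<le> 1 + 6 * real m powr (-5/4)" using f1 by simp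
      then show "1 + norm (f m - 1) \<le> exp (6 * real m powr (-5/4))"
        using exp_ge_add_one_self order_trans by blast
    qed simp
    also have "\<dots> = exp (6 * (\<Sum>m\<in>{n0..<n}. real m powr (-5/4)))"
      by (simp add: exp_sum sum_distrib_left)
    \<comment> \<open>60 is the constant 6 for \<open>f m - 1\<close> times the 10 of
      \<open>sum_powr_le\<close>.\<close>
    also have "\<dots> \<le> exp (60 * h)" using sum_powr_le[OF assms(1)] by simp
    also have "exp (60 * h) - 1 \<le> 120 * h"
    proof -
      have "exp (60 * h) \<le> 1 + 60 * h + (60 * h)\<^sup>2"
        using n0_large h_pos by (intro exp_bound) auto
      moreover have "(60 * h)\<^sup>2 \<le> 60 * h * 1"
        unfolding power2_eq_square using n0_large h_pos by (intro mult_left_mono) auto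
      ultimately show ?thesis by simp
    qed
    finally show "norm ((\<Prod>m\<in>{n0..<n}. 1 + (f m - 1)) - 1) \<le> 120 * h" by simp
  qed (auto simp: z_def norm_mult)
  finally show ?thesis by (simp add: z_def P_def mult_ac)
qed

text \<open>The case \<open>\<sigma> = 0\<close>. The relative error is \<open>120 h\<close>, and
  the constant 240 in the locale makes it at most one half.\<close>

lemma prod_rate_bounds:
  assumes "n0 \<le> n"
  shows "real n / 2 \<le> real n0 * (\<Prod>m\<in>{n0..<n}. 1 + c m)"
    "real n0 * (\<Prod>m\<in>{n0..<n}. 1 + c m) \<le> 2 * real n"
proof -
  have "norm (complex_of_real (real n0 * (\<Prod>m\<in>{n0..<n}. 1 + c m) - real n)) \<le> 120 * h * real n"
    using prod_rate_approx[OF assms, of 0] by simp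
  then have "\<bar>real n0 * (\<Prod>m\<in>{n0..<n}. 1 + c m) - real n\<bar> \<le> 120 * h * real n"
    unfolding norm_of_real .
  moreover have "240 * h * real n \<le> 1 * real n" using n0_large by (intro mult_right_mono) auto
  ultimately show "real n / 2 \<le> real n0 * (\<Prod>m\<in>{n0..<n}. 1 + c m)"
    "real n0 * (\<Prod>m\<in>{n0..<n}. 1 + c m) \<le> 2 * real n" by linarith+
qed

text \<open>The term \<open>u = n + 1\<close> contributes nothing, since an empty sum of indicators
  does not reach \<open>Suc d\<close>. Hence weights \<open>g u\<close> that depend on
  \<open>u\<close>, such as a phase, pass through the recursion unchanged.\<close>

lemma tail_sum_step:
  fixes g :: "nat \<Rightarrow> 'b::real_normed_field"
  assumes "n0 \<le> n"
  shows "(\<Sum>u\<in>{n0<..Suc n}. g u * of_real (tail_prob p u (Suc n) (Suc d)))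
   = (1 - p n) *\<^sub>R (\<Sum>u\<in>{n0<..n}. g u * of_real (tail_prob p u n (Suc d)))
     + p n *\<^sub>R (\<Sum>u\<in>{n0<..n}. g u * of_real (tail_prob p u n d))"
proof -
  have "{n0<..Suc n} = insert (Suc n) {n0<..n}" using assms by auto
  then have "(\<Sum>u\<in>{n0<..Suc n}. g u * of_real (tail_prob p u (Suc n) (Suc d)))
     = (\<Sum>u\<in>{n0<..n}. g u * of_real (tail_prob p u (Suc n) (Suc d)))"
    by (simp add: tail_prob_ge del: tail_prob.simps)
  also have "\<dots> = (\<Sum>u\<in>{n0<..n}. (1 - p n) *\<^sub>R (g u * of_real (tail_prob p u n (Suc d)))
     + p n *\<^sub>R (g u * of_real (tail_prob p u n d)))"
    by (intro sum.cong) (auto simp: scaleR_conv_of_real algebra_simps)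
  finally show ?thesis by (simp add: sum.distrib scaleR_right.sum)
qed

text \<open>Comparison with twice the solution for \<open>q = 1\<close>: at \<open>n = n0\<close>
  the sum is empty, and at \<open>d = 0\<close> it counts \<open>n - n0\<close> vertices, which
  \<open>prod_rate_bounds\<close> covers. Its upper half gives the second factor 2.\<close>

lemma tail_sum_le:
  assumes "n0 \<le> n" "0 < r" and p: "\<And>m. n0 \<le> m \<Longrightarrow> p m = r * c m \<and> p m \<le> 1"
  shows "(\<Sum>u\<in>{n0<..n}. tail_prob p u n d) \<le> 4 * real n * (r / (r + 1)) ^ d"
proof -
  define D where "D n d = (\<Sum>u\<in>{n0<..n}. (1::real) * of_real (tail_prob p u n d))" for n d
  define E where "E n d = 2 * real n0 * ((r / (r + 1)) ^ d * (\<Prod>m\<in>{n0..<n}. 1 + 1 * of_real (c m)))" for n d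
  have "norm (D n d) \<le> E n d"
  proof (rule pascal_comparison[where p = p and ?n0.0 = n0])
    show "0 \<le> p n \<and> p n \<le> 1" if "n0 \<le> n" for n
      using p[OF that] rate_nonneg[OF that] assms(2) by simp
    show "D (Suc n) (Suc d) = (1 - p n) *\<^sub>R D n (Suc d) + p n *\<^sub>R D n d" if "n0 \<le> n" for n d
      unfolding D_def by (rule tail_sum_step[OF that])
    show "E (Suc n) (Suc d) = (1 - p n) * E n (Suc d) + p n * E n d" if "n0 \<le> n" for n d
      using pascal_solution[of r 1 r n0 n d c, OF _ _ _ that] assms(2) p[OF that]
      unfolding E_def by (simp add: algebra_simps)
    show "norm (D n0 d) \<le> E n0 d" for d using assms(2) by (simp add: D_def E_def)
    show "norm (D n 0) \<le> E n 0" if "n0 \<le> n" for n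
      using prod_rate_bounds(1)[OF that] by (simp add: D_def E_def)
  qed (rule assms)
  also have "E n d \<le> 2 * (2 * real n) * (r / (r + 1)) ^ d"
    using prod_rate_bounds(2)[OF assms(1)] assms(2)
    unfolding E_def by (simp add: mult_left_mono mult_ac mult_right_mono)
  finally show ?thesis by (simp add: D_def)
qed

text \<open>The two edges behave differently. At \<open>d = 0\<close> the twisted sum and the exact
  solution differ by a relative error of order \<open>\<bar>\<sigma>\<bar> + h\<close>, apart from
  \<open>n0\<close> missing vertices. At \<open>n = n0\<close> the sum is empty while the exact
  solution has size \<open>n0 * norm X ^ d\<close>; under the solution with \<open>q = 1\<close>
  this would grow to the size of the main term, whereas with \<open>q = 1 - \<beta>\<close> it grows
  only like \<open>n powr (1 - \<beta>)\<close>, at the price of the larger ratio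
  \<open>y\<close>.\<close>

lemma tail_sum_char:
  assumes n: "n0 \<le> n" and r: "0 < r" and \<sigma>: "\<bar>\<sigma>\<bar> \<le> 1" and \<beta>: "0 < \<beta>" "\<beta> < 1"
    and p: "\<And>m. n0 \<le> m \<Longrightarrow> p m = r * c m \<and> p m \<le> 1"
  shows "norm ((\<Sum>u\<in>{n0<..n}. cis (\<sigma> * ln (real u)) * of_real (tail_prob p u n d))
      - of_nat n * cis (\<sigma> * ln (real n)) * (of_real r / (of_real r + (1 + \<i> * \<sigma>))) ^ d)
    \<le> real n * (600 * (\<bar>\<sigma>\<bar> + h) * (r / (r + 1)) ^ d
         + 3 * (real n0 / real n) powr \<beta> * (r / (r + (1 - \<beta>))) ^ d)"
proof -
  define S where "S n d = (\<Sum>u\<in>{n0<..n}. cis (\<sigma> * ln (real u)) * of_real (tail_prob p u n d))" for n d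
  define X where "X = of_real r / (of_real r + (1 + \<i> * complex_of_real \<sigma>))"
  define x y where "x = r / (r + 1)" and "y = r / (r + (1 - \<beta>))"
  define Z where "Z = of_nat n0 * cis (\<sigma> * ln (real n0))"
  define \<Psi> where "\<Psi> n d = Z * (X ^ d * (\<Prod>m\<in>{n0..<n}. 1 + (1 + \<i> * \<sigma>) * of_real (c m)))" for n d
  \<comment> \<open>The factor 2 makes up for the \<open>n / 2\<close> in
    \<open>prod_rate_bounds\<close>.\<close>
  define K where "K = 2 * (\<bar>\<sigma>\<bar> + 120 * h)"
  \<comment> \<open>The \<open>x\<close>-term of \<open>E\<close> absorbs the mismatch of \<open>S\<close> and \<open>\<Psi>\<close> at \<open>d = 0\<close>, the \<open>y\<close>-term the one at \<open>n = n0\<close>.\<close>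
  define E where "E n d = K * real n0 * (x ^ d * (\<Prod>m\<in>{n0..<n}. 1 + 1 * of_real (c m)))
      + real n0 * (y ^ d * (\<Prod>m\<in>{n0..<n}. 1 + (1 - \<beta>) * of_real (c m)))" for n d
  have denom: "of_real r + (1 + \<i> * complex_of_real \<sigma>) \<noteq> 0"
    using r by (simp add: complex_eq_iff)
  have Xx: "norm X \<le> x"
  proof -
    have "r + 1 \<le> norm (of_real r + (1 + \<i> * complex_of_real \<sigma>))"
      using complex_Re_le_cmod[of "of_real r + (1 + \<i> * complex_of_real \<sigma>)"] by simp
    then show ?thesis unfolding X_def x_def norm_divide using r by (simp add: frac_le)
  qed
  have xy: "0 \<le> x" "x \<le> y" using r \<beta> by (auto simp: x_def y_def frac_le)
  have K0: "0 \<le> K" using h_pos by (simp add: K_def)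
  have c0: "0 \<le> c m" if "n0 \<le> m" for m using rate_nonneg[OF that] .
  have "norm (S n d - \<Psi> n d) \<le> E n d"
  proof (rule pascal_comparison[where p = p and ?n0.0 = n0 and D = "\<lambda>n d. S n d - \<Psi> n d"])
    show "0 \<le> p n \<and> p n \<le> 1" if "n0 \<le> n" for n
      using p[OF that] rate_nonneg[OF that] r by simp
    show "S (Suc n) (Suc d) - \<Psi> (Suc n) (Suc d) =
        (1 - p n) *\<^sub>R (S n (Suc d) - \<Psi> n (Suc d)) + p n *\<^sub>R (S n d - \<Psi> n d)" if "n0 \<le> n" for n d
    proof -
      define F where "F n d = X ^ d * (\<Prod>m\<in>{n0..<n}. 1 + (1 + \<i> * \<sigma>) * of_real (c m))" for n d
      have "F (Suc n) (Suc d) = (1 - p n) *\<^sub>R F n (Suc d) + p n *\<^sub>R F n d"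
        unfolding F_def X_def p[OF that, THEN conjunct1]
        by (rule pascal_solution[of "complex_of_real r" "1 + \<i> * \<sigma>" r n0 n d c, OF denom _ _ that]) (use r in auto)
      moreover have "\<Psi> n d = Z * F n d" for n d by (simp add: \<Psi>_def F_def)
      ultimately have "\<Psi> (Suc n) (Suc d) = (1 - p n) *\<^sub>R \<Psi> n (Suc d) + p n *\<^sub>R \<Psi> n d"
        by (simp add: distrib_left)
      moreover have "S (Suc n) (Suc d) = (1 - p n) *\<^sub>R S n (Suc d) + p n *\<^sub>R S n d"
        unfolding S_def by (rule tail_sum_step[OF that])
      ultimately show ?thesis by (simp add: algebra_simps)
    qed
    show "E (Suc n) (Suc d) = (1 - p n) * E n (Suc d) + p n * E n d" if "n0 \<le> n" for n d
    proof -
      have 1: "(x ^ Suc d * (\<Prod>m\<in>{n0..<Suc n}. 1 + 1 * of_real (c m)))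
        = (1 - p n) *\<^sub>R (x ^ Suc d * (\<Prod>m\<in>{n0..<n}. 1 + 1 * of_real (c m)))
          + p n *\<^sub>R (x ^ d * (\<Prod>m\<in>{n0..<n}. 1 + 1 * of_real (c m)))"
        unfolding x_def using pascal_solution[of r 1 r n0 n d c, OF _ _ _ that] r p[OF that] by simp
      have 2: "(y ^ Suc d * (\<Prod>m\<in>{n0..<Suc n}. 1 + (1 - \<beta>) * of_real (c m)))
        = (1 - p n) *\<^sub>R (y ^ Suc d * (\<Prod>m\<in>{n0..<n}. 1 + (1 - \<beta>) * of_real (c m)))
          + p n *\<^sub>R (y ^ d * (\<Prod>m\<in>{n0..<n}. 1 + (1 - \<beta>) * of_real (c m)))"
        unfolding y_def using pascal_solution[of r "1 - \<beta>" r n0 n d c, OF _ _ _ that] r \<beta> p[OF that] by simp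
      show ?thesis unfolding E_def 1 2 by (simp add: algebra_simps)
    qed
    show "norm (S n0 d - \<Psi> n0 d) \<le> E n0 d" for d
    proof -
      have "norm (S n0 d - \<Psi> n0 d) = real n0 * norm X ^ d"
        by (simp add: S_def \<Psi>_def Z_def norm_mult norm_power)
      also have "\<dots> \<le> real n0 * y ^ d" using Xx xy by (intro mult_left_mono power_mono) auto
      also have "\<dots> \<le> E n0 d" using K0 xy by (simp add: E_def)
      finally show ?thesis .
    qed
    show "norm (S n 0 - \<Psi> n 0) \<le> E n 0" if n: "n0 \<le> n" for n
    proof -
      let ?w = "of_nat n * cis (\<sigma> * ln (real n))"
      have "norm (S n 0 - \<Psi> n 0) \<le> norm (S n 0 - ?w) + norm (\<Psi> n 0 - ?w)"
        using norm_triangle_ineq4[of "S n 0 - ?w" "\<Psi> n 0 - ?w"] by simp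
      also have "norm (S n 0 - ?w) \<le> real n0 + \<bar>\<sigma>\<bar> * real n"
        unfolding S_def using sum_cis_ln_approx[OF n] by simp
      also have "norm (\<Psi> n 0 - ?w) \<le> 120 * h * real n"
        unfolding \<Psi>_def Z_def using prod_rate_approx[OF n \<sigma>] by simp
      \<comment> \<open>The \<open>n0\<close> missing vertices are charged to the
        \<open>y\<close>-term, whose product is at least 1.\<close>
      also have "real n0 + \<bar>\<sigma>\<bar> * real n + 120 * h * real n = K * (real n / 2) + real n0 * 1"
        by (simp add: K_def algebra_simps)
      also have "\<dots> \<le> K * (real n0 * (\<Prod>m\<in>{n0..<n}. 1 + c m))
           + real n0 * (\<Prod>m\<in>{n0..<n}. 1 + (1 - \<beta>) * c m)"
        using prod_rate_bounds(1)[OF n] K0 c0 \<beta>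
        by (intro add_mono mult_left_mono prod_ge_1) auto
      finally show ?thesis by (simp add: E_def mult_ac)
    qed
  qed (rule n)
  moreover have "norm (\<Psi> n d - of_nat n * cis (\<sigma> * ln (real n)) * X ^ d) \<le> 120 * h * real n * x ^ d"
  proof -
    have "\<Psi> n d - of_nat n * cis (\<sigma> * ln (real n)) * X ^ d
      = X ^ d * (Z * (\<Prod>m\<in>{n0..<n}. 1 + (1 + \<i> * \<sigma>) * of_real (c m)) - of_nat n * cis (\<sigma> * ln (real n)))"
      by (simp add: \<Psi>_def algebra_simps)
    also have "norm \<dots> \<le> x ^ d * (120 * h * real n)"
      unfolding norm_mult norm_power Z_def using prod_rate_approx[OF n \<sigma>] Xx xy
      by (intro mult_mono power_mono) auto
    finally show ?thesis by (simp add: mult_ac)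
  qed
  ultimately have "norm (S n d - of_nat n * cis (\<sigma> * ln (real n)) * X ^ d) \<le> E n d + 120 * h * real n * x ^ d"
    using norm_triangle_ineq[of "S n d - \<Psi> n d" "\<Psi> n d - of_nat n * cis (\<sigma> * ln (real n)) * X ^ d"]
    by simp
  moreover have "E n d \<le> K * (2 * real n) * x ^ d + real n * (3 * (real n0 / real n) powr \<beta>) * y ^ d"
  proof -
    have "real n0 * (\<Prod>m\<in>{n0..<n}. 1 + (1 - \<beta>) * c m) \<le> real n0 * (exp (1 - \<beta>) * (real n / real n0) powr (1 - \<beta>))"
      using prod_rate_le[OF n, of "1 - \<beta>"] \<beta> by (intro mult_left_mono) auto
    also have "\<dots> \<le> real n0 * (3 * (real n / real n0) powr (1 - \<beta>))"
    proof -
      have "exp (1 - \<beta>) \<le> exp 1" using \<beta> by simp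
      also have "\<dots> \<le> (3::real)" by (rule exp_le)
      finally show ?thesis by (intro mult_left_mono mult_right_mono) auto
    qed
    also have "\<dots> = real n * (3 * (real n0 / real n) powr \<beta>)"
    proof -
      have "(real n0 / real n) powr \<beta> = 1 / (real n / real n0) powr \<beta>"
        using n n0_pos by (simp add: powr_divide)
      then have "real n0 * (real n / real n0) powr (1 - \<beta>) = real n * (real n0 / real n) powr \<beta>"
        using n n0_pos by (simp add: powr_diff)
      then show ?thesis by simp
    qed
    finally have 1: "real n0 * (\<Prod>m\<in>{n0..<n}. 1 + (1 - \<beta>) * c m) * y ^ d \<le> real n * (3 * (real n0 / real n) powr \<beta>) * y ^ d"
      using xy by (intro mult_right_mono) auto
    have 2: "K * (real n0 * (\<Prod>m\<in>{n0..<n}. 1 + c m)) * x ^ d \<le> K * (2 * real n) * x ^ d"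
      using prod_rate_bounds(2)[OF n] K0 xy by (intro mult_right_mono mult_left_mono) auto
    show ?thesis using 1 2 by (simp add: E_def mult_ac)
  qed
  moreover have "K * (2 * real n) * x ^ d + 120 * h * real n * x ^ d \<le> real n * (600 * (\<bar>\<sigma>\<bar> + h) * x ^ d)"
  proof -
    have "(4 * \<bar>\<sigma>\<bar> + 600 * h) * (real n * x ^ d) \<le> (600 * (\<bar>\<sigma>\<bar> + h)) * (real n * x ^ d)"
      using xy by (intro mult_right_mono) auto
    then show ?thesis by (simp add: K_def algebra_simps)
  qed
  ultimately show ?thesis unfolding S_def X_def x_def y_def by (simp add: algebra_simps)
qed

end

section \<open>The limiting degree tail of a random vertex\<close>

text \<open>The logarithm of \<open>1 / (1 + \<i> y)\<close> starts with
  \<open>- \<i> y - y^2 / 2\<close>, so both expressions expand as \<open>1 - \<i> y - y^2\<close>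
  up to order \<open>y^3\<close>.\<close>

lemma exp_char_approx:
  fixes y :: real assumes "\<bar>y\<bar> \<le> 1"
  shows "norm (1 / (1 + \<i> * y) - cis (- y) * exp (- y\<^sup>2 / 2)) \<le> 4 * \<bar>y\<bar> ^ 3"
proof -
  have y4: "y ^ 4 \<le> \<bar>y\<bar> ^ 3" using assms power_decreasing[of 3 4 "\<bar>y\<bar>"] by simp
  have nz: "1 + \<i> * complex_of_real y \<noteq> 0" by (simp add: complex_eq_iff)
  have "1 \<le> norm (1 + \<i> * complex_of_real y)"
    using complex_Re_le_cmod[of "1 + \<i> * complex_of_real y"] by simp
  then have "\<bar>y\<bar> ^ 3 / norm (1 + \<i> * complex_of_real y) \<le> \<bar>y\<bar> ^ 3 / 1"
    by (intro divide_left_mono) auto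
  moreover have "1 / (1 + \<i> * y) - (1 - \<i> * y - y\<^sup>2) = (\<i> * y ^ 3) / (1 + \<i> * complex_of_real y)"
    using nz by (simp add: field_simps power2_eq_square power3_eq_cube)
  ultimately have 1: "norm (1 / (1 + \<i> * y) - (1 - \<i> * y - y\<^sup>2)) \<le> \<bar>y\<bar> ^ 3"
    by (simp only: norm_divide norm_mult norm_ii norm_of_real power_abs mult_1_left div_by_1)
  have e0: "0 \<le> exp (- y\<^sup>2 / 2)" "exp (- y\<^sup>2 / 2) \<le> 1" by auto
  have 2: "norm (cis (- y) - (1 - \<i> * y - y\<^sup>2 / 2)) \<le> \<bar>y\<bar> ^ 3 / 6"
    using iexp_approx1[of "- y" 2]
    by (simp add: cis_conv_exp eval_nat_numeral algebra_simps)
  have 3: "\<bar>exp (- y\<^sup>2 / 2) - (1 - y\<^sup>2 / 2)\<bar> \<le> \<bar>y\<bar> ^ 3 / 2"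
  proof -
    have "1 - y\<^sup>2 / 2 \<le> exp (- y\<^sup>2 / 2)" using exp_ge_add_one_self[of "- y\<^sup>2 / 2"] by simp
    moreover have "exp (- y\<^sup>2 / 2) \<le> 1 - y\<^sup>2 / 2 + y ^ 4 / 2"
    proof -
      have "1 + y\<^sup>2 / 2 \<le> exp (y\<^sup>2 / 2)" using exp_ge_add_one_self[of "y\<^sup>2 / 2"] by simp
      then have "exp (- y\<^sup>2 / 2) \<le> 1 / (1 + y\<^sup>2 / 2)"
        by (simp add: exp_minus inverse_eq_divide frac_le add_pos_nonneg)
      also have "\<dots> \<le> 1 - y\<^sup>2 / 2 + y ^ 4 / 2"
      proof -
        have "1 \<le> (1 - y\<^sup>2 / 2 + y ^ 4 / 2) * (1 + y\<^sup>2 / 2)"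
        proof -
          have "(1 - y\<^sup>2 / 2 + y ^ 4 / 2) * (1 + y\<^sup>2 / 2) = 1 + y ^ 4 / 4 + y ^ 4 * y\<^sup>2 / 4"
            by (simp add: algebra_simps power2_eq_square power4_eq_xxxx)
          then show ?thesis by simp
        qed
        then show ?thesis by (simp add: divide_le_eq add_pos_nonneg)
      qed
      finally show ?thesis .
    qed
    ultimately show ?thesis using y4 by (auto simp: abs_le_iff)
  qed
  define E where "E = complex_of_real (exp (- y\<^sup>2 / 2))"
  have tri: "norm (A - B - C - D) \<le> norm A + norm B + norm C + norm D" for A B C D :: complex
    using norm_triangle_ineq4[of "A - B - C" D] norm_triangle_ineq4[of "A - B" C] norm_triangle_ineq4[of A B]
    by linarith
  \<comment> \<open>The last bracket is what the product of the Taylor polynomials of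
    \<open>cis (- y)\<close> and \<open>exp (- y^2 / 2)\<close> has beyond
    \<open>1 - \<i> y - y^2\<close>.\<close>
  have eq: "1 / (1 + \<i> * y) - cis (- y) * E =
      (1 / (1 + \<i> * y) - (1 - \<i> * y - y\<^sup>2))
      - (cis (- y) - (1 - \<i> * y - y\<^sup>2 / 2)) * E
      - (1 - \<i> * y - y\<^sup>2 / 2) * (E - (1 - y\<^sup>2 / 2))
      - (\<i> * y ^ 3 / 2 + y ^ 4 / 4)"
    by (simp add: algebra_simps power2_eq_square power3_eq_cube power4_eq_xxxx)
  have "norm (1 / (1 + \<i> * y) - cis (- y) * E) \<le> \<bar>y\<bar> ^ 3 + \<bar>y\<bar> ^ 3 / 6 * 1 + 3 * (\<bar>y\<bar> ^ 3 / 2) + (\<bar>y\<bar> ^ 3 / 2 + \<bar>y\<bar> ^ 3 / 4)"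
    unfolding eq
  proof (rule order_trans[OF tri], intro add_mono)
    show "norm ((cis (- y) - (1 - \<i> * y - y\<^sup>2 / 2)) * E) \<le> \<bar>y\<bar> ^ 3 / 6 * 1"
      unfolding norm_mult using 2 e0 by (intro mult_mono) (auto simp: E_def)
    show "norm ((1 - \<i> * y - y\<^sup>2 / 2) * (E - (1 - y\<^sup>2 / 2))) \<le> 3 * (\<bar>y\<bar> ^ 3 / 2)"
      unfolding norm_mult
    proof (intro mult_mono)
      have "norm (1 - \<i> * y - y\<^sup>2 / 2) \<le> norm (1 - \<i> * y) + norm (complex_of_real (y\<^sup>2 / 2))"
        using norm_triangle_ineq4[of "1 - \<i> * y" "complex_of_real (y\<^sup>2 / 2)"] by simp
      moreover have "norm (1 - \<i> * complex_of_real y) \<le> 1 + \<bar>y\<bar>"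
        using norm_triangle_ineq4[of 1 "\<i> * complex_of_real y"] by (simp add: norm_mult)
      moreover have "norm (complex_of_real (y\<^sup>2 / 2)) \<le> 1"
        unfolding norm_of_real using assms abs_square_le_1[of y] by simp
      ultimately show "norm (1 - \<i> * complex_of_real y - y\<^sup>2 / 2) \<le> 3" using assms by linarith
      have "E - (1 - y\<^sup>2 / 2) = complex_of_real (exp (- y\<^sup>2 / 2) - (1 - y\<^sup>2 / 2))" by (simp add: E_def)
      then show "norm (E - (1 - y\<^sup>2 / 2)) \<le> \<bar>y\<bar> ^ 3 / 2" using 3 by (simp only: norm_of_real)
    qed auto
    show "norm (\<i> * y ^ 3 / 2 + complex_of_real (y ^ 4 / 4)) \<le> \<bar>y\<bar> ^ 3 / 2 + \<bar>y\<bar> ^ 3 / 4"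
    proof -
      have "norm (\<i> * y ^ 3 / 2) = \<bar>y\<bar> ^ 3 / 2" by (simp add: norm_mult norm_divide norm_power)
      moreover have "norm (complex_of_real (y ^ 4 / 4)) \<le> \<bar>y\<bar> ^ 3 / 4"
        unfolding norm_of_real using y4 by simp
      ultimately show ?thesis
        using norm_triangle_ineq[of "\<i> * y ^ 3 / 2" "complex_of_real (y ^ 4 / 4)"] by linarith
    qed
  qed (rule 1)
  also have "\<dots> \<le> 4 * \<bar>y\<bar> ^ 3" by simp
  finally show ?thesis by (simp add: E_def)
qed

lemma abs_exp_diff_le:
  fixes a b :: real assumes "0 \<le> a" "0 \<le> b"
  shows "\<bar>exp (- a) - exp (- b)\<bar> \<le> \<bar>a - b\<bar>"
proof -
  have *: "exp (- a) - exp (- b) \<le> b - a" if "0 \<le> a" "a \<le> b" for a b :: real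
  proof -
    have "exp (- a) - exp (- b) = exp (- a) * (1 - exp (a - b))"
      by (simp add: right_diff_distrib mult_exp_exp)
    also have "\<dots> \<le> 1 * (b - a)"
    proof (intro mult_mono)
      show "1 - exp (a - b) \<le> b - a" using exp_ge_add_one_self[of "a - b"] by linarith
    qed (use that in auto)
    finally show ?thesis by simp
  qed
  show ?thesis
  proof (cases "a \<le> b")
    case True then show ?thesis using *[of a b] assms by auto
  next
    case False then show ?thesis using *[of b a] assms by auto
  qed
qed

text \<open>The factor \<open>cis (t * sqrt d)\<close> is the centring. The three errors come from
  approximating each of the \<open>d\<close> factors to third order in \<open>t a / sqrt d\<close>,
  from the phase \<open>t (a - 1) sqrt d\<close> that the centring leaves when \<open>a\<close> is
  not 1, and from the change of variance. The phase is what forces \<open>a - 1\<close> to be of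
  smaller order than \<open>1 / sqrt d\<close>.\<close>

lemma gamma_char_approx:
  fixes t a :: real and d :: nat
  assumes d: "0 < d" and A: "0 \<le> a" "a \<le> A" "\<bar>t\<bar> * A \<le> sqrt (real d)"
  shows "norm (cis (t * sqrt d) * (1 / (1 + \<i> * of_real (t * a / sqrt d))) ^ d - exp (- t\<^sup>2 / 2))
    \<le> 4 * (\<bar>t\<bar> * A) ^ 3 / sqrt d + \<bar>t\<bar> * \<bar>a - 1\<bar> * sqrt d + t\<^sup>2 * \<bar>a - 1\<bar> * (A + 1) / 2"
proof -
  define y where "y = t * a / sqrt d"
  have sd: "0 < sqrt (real d)" using d by simp
  have ta: "\<bar>t * a\<bar> \<le> \<bar>t\<bar> * A" unfolding abs_mult using A by (intro mult_mono) auto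
  have y1: "\<bar>y\<bar> \<le> 1" using ta A sd by (simp add: y_def abs_divide)
  have yd: "y * real d = t * a * sqrt d" using sd by (simp add: y_def field_simps real_sqrt_mult_self flip: real_sqrt_mult)
  have y2d: "y\<^sup>2 * real d = t\<^sup>2 * a\<^sup>2" using sd d by (simp add: y_def power_divide power_mult_distrib)
  have "1 \<le> norm (1 + \<i> * complex_of_real y)"
    using complex_Re_le_cmod[of "1 + \<i> * complex_of_real y"] by simp
  then have n1: "norm (1 / (1 + \<i> * complex_of_real y)) \<le> 1"
    unfolding norm_divide norm_one using le_divide_eq_1_pos divide_le_eq_1_pos
    by (metis less_le_trans zero_less_one)
  have n2: "norm (cis (- y) * exp (- y\<^sup>2 / 2)) \<le> 1" by (simp add: norm_mult)
  have pow: "(cis (- y) * exp (- y\<^sup>2 / 2)) ^ d = cis (- (t * a * sqrt d)) * exp (- (t\<^sup>2 * a\<^sup>2 / 2))"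
  proof -
    have "exp (- y\<^sup>2 / 2) ^ d = exp (real d * (- y\<^sup>2 / 2))" by (simp only: exp_of_nat_mult)
    also have "real d * (- y\<^sup>2 / 2) = - (t\<^sup>2 * a\<^sup>2 / 2)" using y2d by (simp add: mult_ac)
    finally have "exp (- y\<^sup>2 / 2) ^ d = exp (- (t\<^sup>2 * a\<^sup>2 / 2))" .
    moreover have "cis (- y) ^ d = cis (- (t * a * sqrt d))"
      using yd by (simp only: Complex.DeMoivre mult_minus_right) (simp only: mult.commute)
    ultimately show ?thesis by (simp only: power_mult_distrib of_real_power[symmetric])
  qed
  have "norm ((1 / (1 + \<i> * of_real y)) ^ d - (cis (- y) * exp (- y\<^sup>2 / 2)) ^ d)
     \<le> real d * norm (1 / (1 + \<i> * of_real y) - cis (- y) * exp (- y\<^sup>2 / 2))"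
    by (rule norm_power_diff[OF n1 n2])
  also have "\<dots> \<le> real d * (4 * \<bar>y\<bar> ^ 3)"
    using exp_char_approx[OF y1] by (intro mult_left_mono) auto
  also have "\<dots> \<le> 4 * (\<bar>t\<bar> * A) ^ 3 / sqrt d"
  proof -
    have "real d * \<bar>y\<bar> ^ 3 = \<bar>t * a\<bar> ^ 3 / sqrt d"
    proof -
      have "sqrt d ^ 3 = real d * sqrt d" by (simp add: power3_eq_cube)
      then show ?thesis using sd d by (simp add: y_def abs_divide power_divide)
    qed
    moreover have "\<bar>t * a\<bar> ^ 3 / sqrt d \<le> (\<bar>t\<bar> * A) ^ 3 / sqrt d"
      using ta sd by (intro divide_right_mono power_mono) auto
    ultimately show ?thesis by simp
  qed
  finally have 1: "norm ((1 / (1 + \<i> * of_real y)) ^ d - cis (- (t * a * sqrt d)) * exp (- (t\<^sup>2 * a\<^sup>2 / 2)))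
    \<le> 4 * (\<bar>t\<bar> * A) ^ 3 / sqrt d" unfolding pow .
  have 2: "norm (cis (t * sqrt d) * cis (- (t * a * sqrt d)) - 1) \<le> \<bar>t\<bar> * \<bar>a - 1\<bar> * sqrt d"
  proof -
    have "cis (t * sqrt d) * cis (- (t * a * sqrt d)) = cis (t * (1 - a) * sqrt d)"
      by (simp add: cis_mult algebra_simps)
    moreover have "norm (cis (t * (1 - a) * sqrt d) - cis 0) \<le> \<bar>t * (1 - a) * sqrt d - 0\<bar>"
      by (rule norm_cis_diff_le)
    ultimately show ?thesis by (simp add: abs_mult abs_minus_commute)
  qed
  have 3: "\<bar>exp (- (t\<^sup>2 * a\<^sup>2 / 2)) - exp (- (t\<^sup>2 / 2))\<bar> \<le> t\<^sup>2 * \<bar>a - 1\<bar> * (A + 1) / 2"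
  proof -
    have "\<bar>exp (- (t\<^sup>2 * a\<^sup>2 / 2)) - exp (- (t\<^sup>2 / 2))\<bar> \<le> \<bar>t\<^sup>2 * a\<^sup>2 / 2 - t\<^sup>2 / 2\<bar>"
      by (rule abs_exp_diff_le) auto
    also have "t\<^sup>2 * a\<^sup>2 / 2 - t\<^sup>2 / 2 = t\<^sup>2 * (a - 1) * (a + 1) / 2"
      by (simp add: algebra_simps power2_eq_square)
    also have "\<bar>t\<^sup>2 * (a - 1) * (a + 1) / 2\<bar> = t\<^sup>2 * \<bar>a - 1\<bar> * (a + 1) / 2"
      using A by (simp add: abs_mult)
    also have "\<dots> \<le> t\<^sup>2 * \<bar>a - 1\<bar> * (A + 1) / 2"
      using A by (intro divide_right_mono mult_left_mono) auto
    finally show ?thesis .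
  qed
  define U V where "U = (1 / (1 + \<i> * of_real y)) ^ d" and "V = cis (- (t * a * sqrt d))"
  define Q R where "Q = complex_of_real (exp (- (t\<^sup>2 * a\<^sup>2 / 2)))" and "R = complex_of_real (exp (- t\<^sup>2 / 2))"
  have "cis (t * sqrt d) * U - R
    = cis (t * sqrt d) * (U - V * Q) + (cis (t * sqrt d) * V - 1) * Q + (Q - R)"
    by (simp add: algebra_simps)
  also have "norm \<dots> \<le> norm (cis (t * sqrt d) * (U - V * Q)) + norm ((cis (t * sqrt d) * V - 1) * Q) + norm (Q - R)"
    by (intro order_trans[OF norm_triangle_ineq] add_mono norm_triangle_ineq) auto
  also have "norm (cis (t * sqrt d) * (U - V * Q)) \<le> 4 * (\<bar>t\<bar> * A) ^ 3 / sqrt d"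
    using 1 by (simp add: norm_mult U_def V_def Q_def)
  also have "norm ((cis (t * sqrt d) * V - 1) * Q) \<le> (\<bar>t\<bar> * \<bar>a - 1\<bar> * sqrt d) * 1"
    unfolding norm_mult using 2 by (intro mult_mono) (auto simp: V_def Q_def)
  also have "norm (Q - R) \<le> t\<^sup>2 * \<bar>a - 1\<bar> * (A + 1) / 2"
    using 3 by (simp add: Q_def R_def flip: of_real_diff)
  finally show ?thesis by (simp add: U_def R_def y_def)
qed

section \<open>Moments of the weight law that govern large degrees\<close>

locale weight_law = real_distribution \<mu> for \<mu> :: "real measure" +
  fixes \<theta> :: real
  assumes law_pos: "measure \<mu> {0<..} = 1"
    and C1: "cond_C1 \<mu>" and C2: "cond_C2 \<mu>"
    and theta: "\<theta> = 1 + (\<integral>x. x \<partial>\<mu>)"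
begin

lemma AE_weight_pos: "AE w in \<mu>. 0 < w"
  using AE_prob_1[OF law_pos] by simp

lemma AE_weight_le_1: "AE w in \<mu>. w \<le> 1"
proof -
  have "AE w in \<mu>. w \<le> 1 + 1 / real (Suc n)" for n
  proof -
    let ?x = "1 + 1 / real (Suc n)"
    have "\<not> cdf \<mu> ?x < 1"
    proof
      assume "cdf \<mu> ?x < 1"
      then have "ereal ?x \<le> (SUP x \<in> {x. cdf \<mu> x < 1}. ereal x)" by (intro SUP_upper) auto
      then show False using C1 unfolding cond_C1_def by (simp add: one_ereal_def)
    qed
    then have "prob {..?x} = 1" using prob_le_1[of "{..?x}"] unfolding cdf_def by linarith
    from AE_prob_1[OF this] show ?thesis by simp
  qed
  then have "AE w in \<mu>. \<forall>n. w \<le> 1 + 1 / real (Suc n)" by (simp add: AE_all_countable)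
  then show ?thesis
  proof eventually_elim
    case (elim w)
    have "(\<lambda>n. 1 + 1 / real (Suc n)) \<longlonglongrightarrow> 1 + 0"
      by (intro tendsto_add tendsto_const LIMSEQ_Suc[OF lim_1_over_n])
    then have "w \<le> 1 + 0" by (rule LIMSEQ_le_const) (intro exI[of _ 0] allI impI elim[rule_format])
    then show ?case by simp
  qed
qed

lemma integrable_bounded_measurable:
  fixes f :: "real \<Rightarrow> 'b::{banach,second_countable_topology}"
  assumes "f \<in> borel_measurable borel" "\<And>w. 0 < w \<Longrightarrow> w \<le> 1 \<Longrightarrow> norm (f w) \<le> B"
  shows "integrable \<mu> f"
  by (rule integrable_const_bound[where B=B])
    (use assms AE_weight_pos AE_weight_le_1 in \<open>auto elim: AE_mp\<close>)

lemma theta_gt_1: "1 < \<theta>" and theta_le_2: "\<theta> \<le> 2"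
proof -
  have int: "integrable \<mu> (\<lambda>x. x)"
    by (rule integrable_bounded_measurable[where B=1]) auto
  have "0 \<le> (\<integral>x. x \<partial>\<mu>)"
    by (rule integral_nonneg_AE) (use AE_weight_pos in auto)
  moreover have "(\<integral>x. x \<partial>\<mu>) \<noteq> 0"
  proof
    assume "(\<integral>x. x \<partial>\<mu>) = 0"
    moreover have "AE x in \<mu>. 0 \<le> x" using AE_weight_pos by eventually_elim auto
    ultimately have "AE x in \<mu>. x = 0" using integral_nonneg_eq_0_iff_AE[OF int] by blast
    with AE_weight_pos have "AE x in \<mu>. False" by eventually_elim auto
    then show False by simp
  qed
  ultimately show "1 < \<theta>" unfolding theta by simp
  have "(\<integral>x. x \<partial>\<mu>) \<le> (\<integral>x. 1 \<partial>\<mu>)"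
    by (rule integral_mono_AE[OF int]) (use AE_weight_le_1 in auto)
  then show "\<theta> \<le> 2" unfolding theta using prob_space by simp
qed

text \<open>\<open>geo w ^ d\<close> is the limiting probability that a uniform vertex of weight \<open>w\<close> has degree at least
  \<open>d\<close>: it is \<open>x ^ d\<close> for \<open>q = 1\<close>.\<close>

definition geo :: "real \<Rightarrow> real" where "geo w = w / (w + (\<theta> - 1))"
text \<open>Centring and scale of \<open>ln (n / v)\<close> are \<open>gam d\<close> and
  \<open>gam sqrt d\<close>; its reciprocal is the threshold for \<open>d / ln n\<close>.\<close>

definition gam :: real where "gam = 1 - 1 / \<theta>"
definition geo_moment :: "nat \<Rightarrow> real" where "geo_moment d = (\<integral>w. geo w ^ d \<partial>\<mu>)"

lemma gam_pos: "0 < gam"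
  using theta_gt_1 by (simp add: gam_def)

lemma geo_measurable [measurable]: "geo \<in> borel_measurable borel"
  unfolding geo_def by measurable

lemma geo_nonneg: "0 < w \<Longrightarrow> 0 \<le> geo w" using theta_gt_1 by (simp add: geo_def)

text \<open>Exactly, \<open>\<theta> * geo w = 1 - (\<theta> - 1) / (w + (\<theta> - 1)) * (1 -
  w)\<close>, and the coefficient of \<open>1 - w\<close> is at least \<open>gam\<close>. A weight
  below 1 thus costs a factor exponential in \<open>d (1 - w)\<close>.\<close>

lemma geo_upper:
  assumes "0 < w" "w \<le> 1" shows "\<theta> * geo w \<le> exp (- gam * (1 - w))"
proof -
  have "gam * (1 - w) \<le> ((\<theta> - 1) / (w + (\<theta> - 1))) * (1 - w)"
  proof (intro mult_right_mono)
    have "gam = (\<theta> - 1) / \<theta>" using theta_gt_1 by (simp add: gam_def field_simps)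
    also have "\<dots> \<le> (\<theta> - 1) / (w + (\<theta> - 1))" using assms theta_gt_1 by (intro divide_left_mono) auto
    finally show "gam \<le> (\<theta> - 1) / (w + (\<theta> - 1))" .
  qed (use assms in auto)
  moreover have "\<theta> * geo w = 1 - ((\<theta> - 1) / (w + (\<theta> - 1))) * (1 - w)"
    using assms theta_gt_1 by (simp add: geo_def field_simps)
  ultimately have "\<theta> * geo w \<le> 1 + (- gam * (1 - w))" by simp
  also have "\<dots> \<le> exp (- gam * (1 - w))" by (rule exp_ge_add_one_self)
  finally show ?thesis .
qed

lemma geo_lower: assumes "0 < w" "w \<le> 1" shows "w \<le> \<theta> * geo w"
proof -
  have "w * (w + (\<theta> - 1)) \<le> w * \<theta>" using assms by (intro mult_left_mono) auto
  then show ?thesis using assms theta_gt_1 by (simp add: geo_def pos_le_divide_eq mult_ac)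
qed

lemma geo_le: assumes "0 < w" "w \<le> 1" shows "geo w \<le> 1 / \<theta>"
proof -
  have "gam * (1 - w) \<ge> 0" using gam_pos assms by simp
  then have "\<theta> * geo w \<le> 1" using geo_upper[OF assms] by (smt (verit) exp_le_one_iff mult_minus_left)
  then show ?thesis using theta_gt_1 by (simp add: field_simps)
qed

lemma geo_power_le: assumes "0 < w" "w \<le> 1" shows "geo w ^ d \<le> (1 / \<theta>) ^ d"
  using geo_le[OF assms] geo_nonneg[OF assms(1)] by (rule power_mono)

lemma integrable_geo_power: "integrable \<mu> (\<lambda>w. geo w ^ d)"
proof (rule integrable_bounded_measurable[where B=1])
  fix w :: real assume w: "0 < w" "w \<le> 1"
  have "(1 / \<theta>) ^ d \<le> 1" using theta_gt_1 by (intro power_le_one) auto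
  then show "norm (geo w ^ d) \<le> 1" using geo_power_le[OF w, of d] geo_nonneg[OF w(1)] by simp
qed simp

lemma geo_moment_le: "geo_moment d \<le> (1 / \<theta>) ^ d"
proof -
  have "geo_moment d \<le> (\<integral>w. (1 / \<theta>) ^ d \<partial>\<mu>)"
    unfolding geo_moment_def
    by (rule integral_mono_AE[OF integrable_geo_power]) 
      (use AE_weight_pos AE_weight_le_1 geo_power_le in \<open>auto elim: AE_mp\<close>)
  then show ?thesis using prob_space by simp
qed

text \<open>A weight of at least \<open>1 - 1 / x\<close> costs
  \<open>exp (- \<kappa> x^\<tau>)\<close> by (C2), and then a factor of about
  \<open>exp (- d / x)\<close> remains. The choice \<open>x = d powr (1 / (1 + \<tau>))\<close>
  balances the exponents, since then \<open>d / x = x^\<tau>\<close>.\<close>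

lemma geo_moment_lower:
  obtains a \<kappa> \<tau> D where "0 < a" "0 < \<kappa>" "0 < \<tau>" "\<tau> < 1"
    "\<And>d. D \<le> d \<Longrightarrow> a * exp (- \<kappa> * real d powr (\<tau> / (1 + \<tau>))) \<le> \<theta> ^ d * geo_moment d"
proof -
  obtain a \<kappa> \<tau> x0 where a: "0 < a" "0 < \<kappa>" and \<tau>: "0 < \<tau>" "\<tau> < 1" and x0: "1 \<le> x0"
    and C: "\<And>x. x0 \<le> x \<Longrightarrow> a * exp (- \<kappa> * x powr \<tau>) \<le> measure \<mu> {1 - 1 / x..}"
    using C2 unfolding cond_C2_def by auto
  \<comment> \<open>The 2 ensures \<open>1 / x \<le> 1/2\<close>, the range in which
    \<open>ln (1 - X) \<ge> - 2 X\<close>.\<close>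
  have "eventually (\<lambda>d::nat. max x0 2 \<le> real d powr (1 / (1 + \<tau>))) sequentially"
  proof -
    have "filterlim (\<lambda>d::nat. real d powr (1 / (1 + \<tau>))) at_top sequentially"
      using \<tau> by real_asymp
    then show ?thesis unfolding filterlim_at_top by blast
  qed
  then obtain D where D: "\<And>d. D \<le> d \<Longrightarrow> max x0 2 \<le> real d powr (1 / (1 + \<tau>))"
    unfolding eventually_sequentially by blast
  have "a * exp (- (\<kappa> + 2) * real d powr (\<tau> / (1 + \<tau>))) \<le> \<theta> ^ d * geo_moment d" if d: "D \<le> d" for d
  proof -
    define x where "x = real d powr (1 / (1 + \<tau>))"
    define s where "s = real d powr (\<tau> / (1 + \<tau>))"
    have x: "x0 \<le> x" "2 \<le> x" using D[OF d] by (auto simp: x_def)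
    have d0: "0 < real d" using x(2) by (cases "d = 0") (auto simp: x_def)
    have xs: "x powr \<tau> = s" by (simp add: x_def s_def powr_powr)
    have dx: "real d / x = s"
    proof -
      have "\<tau> / (1 + \<tau>) = 1 - 1 / (1 + \<tau>)" using \<tau> by (simp add: field_simps)
      then show ?thesis unfolding s_def x_def using d0 by (simp add: powr_diff)
    qed
    have low: "exp (- 2 * s) \<le> (\<theta> * geo w) ^ d" if w: "0 < w" "w \<le> 1" "1 - 1 / x \<le> w" for w
    proof -
      have x1: "0 \<le> 1 / x" "1 / x \<le> 1 / 2" using x by (auto simp: field_simps)
      have "- 2 * X \<le> ln (1 - X)" if X: "0 \<le> X" "X \<le> 1 / 2" for X :: real
      proof -
        have "X\<^sup>2 \<le> X / 2" using mult_left_mono[OF X(2,1)] by (simp add: power2_eq_square)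
        then show ?thesis using ln_one_minus_pos_lower_bound[OF X] by linarith
      qed
      from this[OF x1] have "- 2 * (1 / x) \<le> ln (1 - 1 / x)" .
      then have "exp (- 2 * (1 / x)) \<le> exp (ln (1 - 1 / x))" by (simp only: exp_le_cancel_iff)
      also have "\<dots> = 1 - 1 / x" using x by simp
      also have "\<dots> \<le> \<theta> * geo w" using geo_lower[OF w(1,2)] w(3) by linarith
      finally have "exp (- 2 * (1 / x)) ^ d \<le> (\<theta> * geo w) ^ d" by (rule power_mono) simp
      also have "exp (- 2 * (1 / x)) ^ d = exp (real d * (- 2 * (1 / x)))" by (simp only: exp_of_nat_mult)
      also have "real d * (- 2 * (1 / x)) = - 2 * s" unfolding dx[symmetric] by simp
      finally show ?thesis .
    qed
    have "a * exp (- \<kappa> * s) \<le> measure \<mu> {1 - 1 / x..}" using C[OF x(1)] xs by simp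
    then have "exp (- 2 * s) * (a * exp (- \<kappa> * s)) \<le> exp (- 2 * s) * measure \<mu> {1 - 1 / x..}"
      by (intro mult_left_mono) auto
    also have "\<dots> = (\<integral>w. indicator {1 - 1 / x..} w * exp (- 2 * s) \<partial>\<mu>)" by simp
    also have "\<dots> \<le> (\<integral>w. (\<theta> * geo w) ^ d \<partial>\<mu>)"
    proof (rule integral_mono_AE)
      show "integrable \<mu> (\<lambda>w. (\<theta> * geo w) ^ d)"
        unfolding power_mult_distrib by (intro integrable_mult_right integrable_geo_power)
      show "AE w in \<mu>. indicator {1 - 1 / x..} w * exp (- 2 * s) \<le> (\<theta> * geo w) ^ d"
        using AE_weight_pos AE_weight_le_1
        by eventually_elim (use theta_gt_1 in \<open>auto simp: indicator_def low[simplified] intro!: zero_le_power mult_nonneg_nonneg geo_nonneg\<close>)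
    qed (rule integrable_bounded_measurable[where B=1], auto simp: indicator_def s_def)
    also have "\<dots> = \<theta> ^ d * geo_moment d" by (simp add: power_mult_distrib geo_moment_def)
    finally show ?thesis by (simp add: s_def[symmetric] exp_add[symmetric] algebra_simps mult_exp_exp)
  qed
  then show thesis using a \<tau> by (intro that[of a "\<kappa> + 2" \<tau> D]) auto
qed

lemma geo_moment_pos: "0 < geo_moment d"
proof -
  have "0 \<le> geo_moment d" unfolding geo_moment_def
    by (rule integral_nonneg_AE) (use AE_weight_pos geo_nonneg in \<open>auto elim: AE_mp\<close>)
  moreover have "geo_moment d \<noteq> 0"
  proof
    assume "geo_moment d = 0"
    moreover have "AE w in \<mu>. 0 \<le> geo w ^ d"
      using AE_weight_pos by eventually_elim (use geo_nonneg in auto)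
    ultimately have "AE w in \<mu>. geo w ^ d = 0"
      unfolding geo_moment_def using integral_nonneg_eq_0_iff_AE[OF integrable_geo_power[of d]] by blast
    with AE_weight_pos have "AE w in \<mu>. False"
      by eventually_elim (use theta_gt_1 in \<open>auto simp: geo_def add_pos_pos\<close>)
    then show False by simp
  qed
  ultimately show ?thesis by simp
qed

text \<open>The correction in \<open>geo_moment_lower\<close> has exponent
  \<open>\<tau> / (1 + \<tau>) < 1\<close> in \<open>d\<close>, so any exponential factor beats
  it.\<close>

lemma geo_moment_subexp:
  assumes "0 < \<eta>"
  shows "eventually (\<lambda>d. (1 / \<theta>) ^ d * exp (- \<eta> * real d) \<le> geo_moment d) sequentially"
proof -
  obtain a \<kappa> \<tau> D where a: "0 < a" "0 < \<kappa>" "0 < \<tau>" "\<tau> < 1"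
    and low: "\<And>d. D \<le> d \<Longrightarrow> a * exp (- \<kappa> * real d powr (\<tau> / (1 + \<tau>))) \<le> \<theta> ^ d * geo_moment d"
    using geo_moment_lower by blast
  have "\<tau> / (1 + \<tau>) < 1" using a by (simp add: field_simps)
  then have "filterlim (\<lambda>d::nat. a * exp (\<eta> * real d - \<kappa> * real d powr (\<tau> / (1 + \<tau>)))) at_top sequentially"
    using a assms by real_asymp
  then have "eventually (\<lambda>d. 1 \<le> a * exp (\<eta> * real d - \<kappa> * real d powr (\<tau> / (1 + \<tau>)))) sequentially"
    by (simp add: filterlim_at_top)
  with eventually_ge_at_top[of D] show ?thesis
  proof eventually_elim
    case (elim d)
    have "exp (- \<eta> * real d) * 1 \<le> exp (- \<eta> * real d) * (a * exp (\<eta> * real d - \<kappa> * real d powr (\<tau> / (1 + \<tau>))))"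
      using elim(2) by (intro mult_left_mono) auto
    also have "\<dots> = a * exp (- \<kappa> * real d powr (\<tau> / (1 + \<tau>)))"
      by (simp add: mult_exp_exp)
    also have "\<dots> \<le> \<theta> ^ d * geo_moment d" by (rule low[OF elim(1)])
    finally show ?case using theta_gt_1 by (simp add: power_one_over field_simps)
  qed
qed

text \<open>Weights below \<open>1 - d^-\<xi>\<close> lose \<open>exp (- gam d^(1-\<xi>))\<close>
  against \<open>\<theta>^-d\<close>, while the full moment loses only
  \<open>exp (- \<kappa> d^s)\<close> with \<open>s = \<tau> / (1 + \<tau>)\<close>. This asks for
  \<open>1 - \<xi> > s\<close>, and the Gaussian limit asks for \<open>\<xi> > 1/2\<close>; both are
  possible because \<open>\<tau> < 1\<close> gives \<open>s < 1/2\<close>.\<close>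

lemma far_weights_negligible:
  obtains \<xi> where "1/2 < \<xi>" "\<xi> < 1"
    "(\<lambda>d. (\<integral>w. indicator {..<1 - real d powr (- \<xi>)} w * geo w ^ d \<partial>\<mu>) / geo_moment d) \<longlonglongrightarrow> 0"
proof -
  obtain a \<kappa> \<tau> D where a: "0 < a" "0 < \<kappa>" "0 < \<tau>" "\<tau> < 1"
    and low: "\<And>d. D \<le> d \<Longrightarrow> a * exp (- \<kappa> * real d powr (\<tau> / (1 + \<tau>))) \<le> \<theta> ^ d * geo_moment d"
    using geo_moment_lower by blast
  define s where "s = \<tau> / (1 + \<tau>)"
  have s: "0 < s" "s < 1/2" using a by (auto simp: s_def field_simps)
  \<comment> \<open>\<open>1 - \<xi>\<close> is the midpoint of \<open>s\<close> and
    \<open>1/2\<close>.\<close>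
  define \<xi> where "\<xi> = 1 - (s + 1/2) / 2"
  have \<xi>: "1/2 < \<xi>" "\<xi> < 1" "s < 1 - \<xi>" using s by (auto simp: \<xi>_def)
  let ?F = "\<lambda>d. \<integral>w. indicator {..<1 - real d powr (- \<xi>)} w * geo w ^ d \<partial>\<mu>"
  have F0: "0 \<le> ?F d" for d
    by (rule integral_nonneg_AE) (use AE_weight_pos geo_nonneg in \<open>auto elim: AE_mp\<close>)
  have upper: "?F d \<le> (1 / \<theta>) ^ d * exp (- gam * real d powr (1 - \<xi>))" if d: "0 < d" for d
  proof -
    have "?F d \<le> (\<integral>w. (1 / \<theta>) ^ d * exp (- gam * real d powr (1 - \<xi>)) \<partial>\<mu>)"
    proof (rule integral_mono_AE)
      show "integrable \<mu> (\<lambda>w. indicator {..<1 - real d powr (- \<xi>)} w * geo w ^ d)"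
      proof (rule integrable_bounded_measurable[where B="(1 / \<theta>) ^ d"])
        fix w :: real assume w: "0 < w" "w \<le> 1"
        then show "norm (indicator {..<1 - real d powr (- \<xi>)} w * geo w ^ d) \<le> (1 / \<theta>) ^ d"
          using geo_power_le[OF w, of d] geo_nonneg theta_gt_1 by (auto simp: indicator_def)
      qed simp
      show "AE w in \<mu>. indicator {..<1 - real d powr (- \<xi>)} w * geo w ^ d
          \<le> (1 / \<theta>) ^ d * exp (- gam * real d powr (1 - \<xi>))"
        using AE_weight_pos AE_weight_le_1
      proof eventually_elim
        case (elim w)
        show ?case
        proof (cases "w < 1 - real d powr (- \<xi>)")
          case True
          have "(\<theta> * geo w) ^ d \<le> exp (- gam * (1 - w)) ^ d"
            using geo_upper[OF elim] geo_nonneg elim theta_gt_1 by (intro power_mono) auto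
          also have "\<dots> = exp (real d * (- gam * (1 - w)))" by (simp only: exp_of_nat_mult)
          also have "\<dots> \<le> exp (- gam * real d powr (1 - \<xi>))"
          proof -
            have "real d * real d powr (- \<xi>) \<le> real d * (1 - w)" using True by (intro mult_left_mono) auto
            moreover have "real d * real d powr (- \<xi>) = real d powr (1 - \<xi>)"
              using d by (simp add: powr_diff powr_minus divide_inverse)
            ultimately have "gam * real d powr (1 - \<xi>) \<le> gam * (real d * (1 - w))"
              using gam_pos by (intro mult_left_mono) auto
            then show ?thesis by (simp add: mult_ac)
          qed
          finally show ?thesis using True theta_gt_1 by (simp add: power_mult_distrib power_one_over field_simps)
        next
          case False
          then show ?thesis using theta_gt_1 by simp
        qed
      qed
    qed simp
    then show ?thesis using prob_space by simp
  qed
  have "(\<lambda>d. exp (\<kappa> * real d powr s - gam * real d powr (1 - \<xi>)) / a) \<longlonglongrightarrow> 0"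
    using s \<xi> a gam_pos by real_asymp
  moreover have "eventually (\<lambda>d. norm (?F d / geo_moment d) \<le> exp (\<kappa> * real d powr s - gam * real d powr (1 - \<xi>)) / a) sequentially"
    using eventually_ge_at_top[of D] eventually_gt_at_top[of 0]
  proof eventually_elim
    case (elim d)
    have "?F d \<le> (1 / \<theta>) ^ d * exp (- gam * real d powr (1 - \<xi>)) * 1"
      using upper elim by simp
    also have "\<dots> \<le> (1 / \<theta>) ^ d * exp (- gam * real d powr (1 - \<xi>)) *
         (\<theta> ^ d * geo_moment d / (a * exp (- \<kappa> * real d powr s)))"
      using low[OF elim(1)] a theta_gt_1 by (intro mult_left_mono) (auto simp: s_def)
    also have "\<dots> = geo_moment d * (exp (\<kappa> * real d powr s - gam * real d powr (1 - \<xi>)) / a)"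
      using theta_gt_1 a by (simp add: power_one_over exp_minus exp_diff field_simps)
    finally have "?F d / geo_moment d \<le> exp (\<kappa> * real d powr s - gam * real d powr (1 - \<xi>)) / a"
      using geo_moment_pos[of d] by (simp add: divide_le_eq mult_ac)
    then show ?case using F0[of d] geo_moment_pos[of d] by simp
  qed
  ultimately have "(\<lambda>d. ?F d / geo_moment d) \<longlonglongrightarrow> 0" by (rule Lim_null_comparison[rotated])
  then show thesis using that \<xi> by blast
qed

lemma inverse_gam: "1 / gam = \<theta> / (\<theta> - 1)"
  using theta_gt_1 by (simp add: gam_def field_simps)

lemma geo_ratio: assumes "0 < w" shows "w / (\<theta> - 1) / (w / (\<theta> - 1) + 1) = geo w"
proof -
  have *: "w / e / (w / e + 1) = w / (w + e)" if "0 < e" for e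
    using that assms by (simp add: field_simps)
  show ?thesis using *[of "\<theta> - 1"] theta_gt_1 by (simp add: geo_def)
qed

text \<open>The error of \<open>gamma_char_approx\<close> with \<open>A = 1 / gam\<close> and with
  \<open>\<bar>a - 1\<bar>\<close> replaced by its bound for weights within
  \<open>d powr (- \<xi>)\<close> of 1.\<close>

definition char_err :: "real \<Rightarrow> real \<Rightarrow> nat \<Rightarrow> real" where
  "char_err \<xi> t d = 4 * (\<bar>t\<bar> * (1 / gam)) ^ 3 / sqrt d + \<bar>t\<bar> * (real d powr (- \<xi>) / (\<theta> - 1)) * sqrt d
     + t\<^sup>2 * (real d powr (- \<xi>) / (\<theta> - 1)) * (1 / gam + 1) / 2"

lemma char_err_tendsto:
  assumes "1/2 < \<xi>" shows "char_err \<xi> t \<longlonglongrightarrow> 0"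
proof -
  have 1: "(\<lambda>d. 4 * (\<bar>t\<bar> * (1 / gam)) ^ 3 / sqrt (real d)) \<longlonglongrightarrow> 0" by real_asymp
  have 2: "(\<lambda>d. real d powr (- \<xi>)) \<longlonglongrightarrow> 0" using assms by real_asymp
  have 3: "(\<lambda>d. real d powr (- \<xi>) * sqrt (real d)) \<longlonglongrightarrow> 0" using assms by real_asymp
  have "(\<lambda>d. 4 * (\<bar>t\<bar> * (1 / gam)) ^ 3 / sqrt (real d) + \<bar>t\<bar> / (\<theta> - 1) * (real d powr (- \<xi>) * sqrt (real d))
    + real d powr (- \<xi>) * (t\<^sup>2 / (\<theta> - 1) * (1 / gam + 1) / 2)) \<longlonglongrightarrow> 0 + \<bar>t\<bar> / (\<theta> - 1) * 0 + 0 * (t\<^sup>2 / (\<theta> - 1) * (1 / gam + 1) / 2)"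
    by (intro tendsto_add tendsto_mult tendsto_const 1 2 3)
  then show ?thesis unfolding char_err_def by (simp add: mult_ac)
qed

text \<open>Joins \<open>tail_sum_char\<close> to \<open>gamma_char_approx\<close>: with
  \<open>a = \<theta> / (w + (\<theta> - 1))\<close>, which is 1 at \<open>w = 1\<close>, the
  complex ratio becomes \<open>X = geo w / (1 + \<i> t a / sqrt d)\<close>. The rest turns the ratio
  \<open>y\<close> of the error solution into \<open>geo w\<close> times a factor independent of
  \<open>w\<close>.\<close>

lemma char_near_weight:
  fixes n n0 d :: nat
  assumes rates: "harmonic_rates c n0" and n: "n0 \<le> n" and d: "0 < d"
    and w: "0 < w" "w \<le> 1" "1 - w \<le> real d powr (- \<xi>)" and small: "real d powr (- \<xi>) / (\<theta> - 1) \<le> \<beta>"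
    and \<beta>: "0 < \<beta>" "\<beta> < 1" "2 * \<beta> < 1 / gam"
    and t: "\<bar>t\<bar> * (1 / gam) \<le> sqrt (real d)"
    and p: "\<And>m. n0 \<le> m \<Longrightarrow> p m = w / (\<theta> - 1) * c m \<and> p m \<le> 1"
  defines "\<sigma> \<equiv> t / (gam * sqrt d)"
  shows "norm (cis (t * sqrt d) * cis (- (\<sigma> * ln (real n))) *
        (\<Sum>u\<in>{n0<..n}. cis (\<sigma> * ln (real u)) * of_real (tail_prob p u n d)) / of_nat n
        - exp (- t\<^sup>2 / 2) * of_real (geo w ^ d))
    \<le> (600 * (\<bar>\<sigma>\<bar> + real n0 powr (-1/4))
        + 3 * (real n0 / real n) powr \<beta> * exp (real d * (\<beta> / (1 / gam - 2 * \<beta>)))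
        + char_err \<xi> t d) * geo w ^ d"
proof -
  interpret harmonic_rates c n0 by (rule rates)
  define r where "r = w / (\<theta> - 1)"
  define S where "S = (\<Sum>u\<in>{n0<..n}. cis (\<sigma> * ln (real u)) * of_real (tail_prob p u n d))"
  define X where "X = complex_of_real r / (of_real r + (1 + \<i> * complex_of_real \<sigma>))"
  define a where "a = \<theta> / (w + (\<theta> - 1))"
  define y where "y = r / (r + (1 - \<beta>))"
  have n_pos: "0 < real n" using n n0_pos by simp
  have r: "0 < r" using w theta_gt_1 by (simp add: r_def)
  have sd: "0 < sqrt (real d)" using d by simp
  have \<sigma>1: "\<bar>\<sigma>\<bar> \<le> 1"
  proof -
    have "\<bar>\<sigma>\<bar> = \<bar>t\<bar> * (1 / gam) / sqrt d" using gam_pos sd by (simp add: \<sigma>_def abs_divide abs_mult)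
    also have "\<dots> \<le> 1" by (subst divide_le_eq_1_pos) (use t sd in auto)
    finally show ?thesis .
  qed
  have geo_r: "r / (r + 1) = geo w"
    unfolding r_def by (rule geo_ratio[OF w(1)])
  have g0: "0 \<le> geo w" using geo_nonneg w by simp
  have a: "0 \<le> a" "a \<le> 1 / gam" "\<bar>a - 1\<bar> \<le> real d powr (- \<xi>) / (\<theta> - 1)"
  proof -
    show "0 \<le> a" using theta_gt_1 w by (simp add: a_def)
    show "a \<le> 1 / gam" unfolding a_def inverse_gam using theta_gt_1 w by (intro divide_left_mono) auto
    have "a - 1 = (1 - w) / (w + (\<theta> - 1))" using theta_gt_1 w by (simp add: a_def field_simps)
    moreover have "0 \<le> (1 - w) / (w + (\<theta> - 1))" using theta_gt_1 w by simp
    moreover have "(1 - w) / (w + (\<theta> - 1)) \<le> real d powr (- \<xi>) / (\<theta> - 1)"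
      using theta_gt_1 w by (intro frac_le) auto
    ultimately show "\<bar>a - 1\<bar> \<le> real d powr (- \<xi>) / (\<theta> - 1)"
      by (simp only: abs_of_nonneg)
  qed
  have X: "X = of_real (geo w) * (1 / (1 + \<i> * of_real (t * a / sqrt d)))"
  proof -
    have "\<sigma> / (r + 1) = t * a / sqrt d"
    proof -
      have "gam * (r + 1) = 1 / a" using theta_gt_1 w by (simp add: gam_def r_def a_def field_simps)
      then have "\<sigma> / (r + 1) = t / (1 / a * sqrt d)" unfolding \<sigma>_def by (metis divide_divide_eq_left mult.commute mult.left_commute)
      then show ?thesis by (simp add: field_simps)
    qed
    then have e: "\<sigma> = (r + 1) * (t * a / sqrt d)" using r by (simp add: field_simps)
    have "of_real r + (1 + \<i> * complex_of_real \<sigma>) = of_real (r + 1) * (1 + \<i> * of_real (t * a / sqrt d))"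
      unfolding e by (simp add: algebra_simps)
    then show ?thesis unfolding X_def geo_r[symmetric] by simp
  qed
  have A: "norm (S - of_nat n * cis (\<sigma> * ln (real n)) * X ^ d)
    \<le> real n * (600 * (\<bar>\<sigma>\<bar> + h) * geo w ^ d + 3 * (real n0 / real n) powr \<beta> * y ^ d)"
    unfolding S_def X_def y_def geo_r[symmetric]
    by (rule tail_sum_char[OF n r \<sigma>1 \<beta>(1,2)]) (unfold r_def, rule p)
  define U where "U = cis (t * sqrt d) * cis (- (\<sigma> * ln (real n))) / of_nat n"
  have normU: "norm U = 1 / real n" by (simp add: U_def norm_divide norm_mult)
  have UX: "U * (of_nat n * cis (\<sigma> * ln (real n)) * X ^ d) = cis (t * sqrt d) * X ^ d"
  proof -
    have "cis (- (\<sigma> * ln (real n))) * cis (\<sigma> * ln (real n)) = 1" by (simp add: cis_mult)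
    then have "U * (of_nat n * cis (\<sigma> * ln (real n))) = cis (t * sqrt d)"
      using n_pos unfolding U_def by (simp add: mult_ac)
    then show ?thesis by (metis mult.assoc)
  qed
  have UA: "U * S - cis (t * sqrt d) * X ^ d = U * (S - of_nat n * cis (\<sigma> * ln (real n)) * X ^ d)"
    by (simp only: right_diff_distrib UX)
  have 1: "norm (U * S - cis (t * sqrt d) * X ^ d)
      \<le> 600 * (\<bar>\<sigma>\<bar> + h) * geo w ^ d + 3 * (real n0 / real n) powr \<beta> * y ^ d"
  proof -
    have "norm (U * S - cis (t * sqrt d) * X ^ d) = norm (S - of_nat n * cis (\<sigma> * ln (real n)) * X ^ d) / real n"
      unfolding UA norm_mult normU by simp
    then show ?thesis using A n_pos by (simp add: divide_le_eq mult.commute)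
  qed
  have 2: "norm (cis (t * sqrt d) * X ^ d - exp (- t\<^sup>2 / 2) * of_real (geo w ^ d)) \<le> char_err \<xi> t d * geo w ^ d"
  proof -
    have eq: "cis (t * sqrt d) * X ^ d - exp (- t\<^sup>2 / 2) * of_real (geo w ^ d)
      = of_real (geo w ^ d) * (cis (t * sqrt d) * (1 / (1 + \<i> * of_real (t * a / sqrt d))) ^ d - exp (- t\<^sup>2 / 2))"
      unfolding X power_mult_distrib of_real_power by (simp add: right_diff_distrib mult_ac)
    have "norm (cis (t * sqrt d) * (1 / (1 + \<i> * of_real (t * a / sqrt d))) ^ d - exp (- t\<^sup>2 / 2))
      \<le> char_err \<xi> t d"
    proof (rule order_trans[OF gamma_char_approx[OF d a(1,2) t]])
      show "4 * (\<bar>t\<bar> * (1 / gam)) ^ 3 / sqrt d + \<bar>t\<bar> * \<bar>a - 1\<bar> * sqrt d + t\<^sup>2 * \<bar>a - 1\<bar> * (1 / gam + 1) / 2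
        \<le> char_err \<xi> t d"
        unfolding char_err_def using a(3) gam_pos
        by (intro add_mono order_refl divide_right_mono mult_right_mono mult_left_mono) auto
    qed
    moreover have "norm (complex_of_real (geo w ^ d)) = geo w ^ d" using g0 by (simp only: norm_of_real) simp
    ultimately show ?thesis unfolding eq norm_mult
      by (subst mult.commute) (use g0 in \<open>simp only: mult_right_mono zero_le_power\<close>)
  qed
  have y: "y ^ d \<le> exp (real d * (\<beta> / (1 / gam - 2 * \<beta>))) * geo w ^ d"
  proof -
    \<comment> \<open>One \<open>\<beta>\<close> is the shift of \<open>q\<close>; the other bounds
      \<open>(1 - w) / (\<theta> - 1)\<close>, by which \<open>r + 1\<close> falls short of
      \<open>1 / gam\<close>.\<close>
    have r1: "1 / gam - 2 * \<beta> \<le> r + (1 - \<beta>)"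
    proof -
      have "r + 1 = 1 / gam - (1 - w) / (\<theta> - 1)"
      proof -
        have "w / e + 1 = (1 + e) / e - (1 - w) / e" if "0 < e" for e
          using that by (simp add: field_simps)
        from this[of "\<theta> - 1"] show ?thesis unfolding inverse_gam r_def using theta_gt_1 by simp
      qed
      moreover have "(1 - w) / (\<theta> - 1) \<le> \<beta>"
        using small w theta_gt_1 by (meson divide_right_mono diff_gt_0_iff_gt less_imp_le order_trans)
      ultimately show ?thesis by simp
    qed
    have "y = geo w * (1 + \<beta> / (r + (1 - \<beta>)))"
    proof -
      have "r / (r + b) = r / (r + 1) * (1 + (1 - b) / (r + b))" if "0 < b" for b
      proof -
        have "1 + (1 - b) / (r + b) = (r + 1) / (r + b)" using r that by (simp add: field_simps)
        then show ?thesis using r by simp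
      qed
      from this[of "1 - \<beta>"] show ?thesis unfolding y_def geo_r[symmetric] using \<beta> by simp
    qed
    also have "\<dots> \<le> geo w * exp (\<beta> / (r + (1 - \<beta>)))"
      using g0 by (intro mult_left_mono exp_ge_add_one_self)
    also have "\<dots> \<le> geo w * exp (\<beta> / (1 / gam - 2 * \<beta>))"
      using g0 r1 \<beta> by (intro mult_left_mono) (auto intro: divide_left_mono)
    finally have "y ^ d \<le> (geo w * exp (\<beta> / (1 / gam - 2 * \<beta>))) ^ d"
      using r \<beta> by (intro power_mono) (auto simp: y_def)
    also have "\<dots> = exp (real d * (\<beta> / (1 / gam - 2 * \<beta>))) * geo w ^ d"
      by (simp only: power_mult_distrib exp_of_nat_mult mult.commute)
    finally show ?thesis .
  qed
  have "norm (U * S - exp (- t\<^sup>2 / 2) * of_real (geo w ^ d))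
    \<le> norm (U * S - cis (t * sqrt d) * X ^ d) + norm (cis (t * sqrt d) * X ^ d - exp (- t\<^sup>2 / 2) * of_real (geo w ^ d))"
    using norm_triangle_ineq[of "U * S - cis (t * sqrt d) * X ^ d" "cis (t * sqrt d) * X ^ d - exp (- t\<^sup>2 / 2) * of_real (geo w ^ d)"]
    by simp
  also have "\<dots> \<le> 600 * (\<bar>\<sigma>\<bar> + h) * geo w ^ d
       + 3 * (real n0 / real n) powr \<beta> * (exp (real d * (\<beta> / (1 / gam - 2 * \<beta>))) * geo w ^ d) + char_err \<xi> t d * geo w ^ d"
    using 1 2 mult_left_mono[OF y, of "3 * (real n0 / real n) powr \<beta>"] by simp
  finally show ?thesis by (simp add: U_def S_def algebra_simps)
qed

lemma char_any_weight:
  fixes n n0 d :: nat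
  assumes rates: "harmonic_rates c n0" and n: "n0 \<le> n" and w: "0 < w"
    and p: "\<And>m. n0 \<le> m \<Longrightarrow> p m = w / (\<theta> - 1) * c m \<and> p m \<le> 1"
  shows "(\<Sum>u\<in>{n0<..n}. tail_prob p u n d) \<le> 4 * real n * geo w ^ d"
    and "u \<in> {n0<..n} \<Longrightarrow> 0 \<le> tail_prob p u n d \<and> tail_prob p u n d \<le> 1"
proof -
  interpret harmonic_rates c n0 by (rule rates)
  have r: "0 < w / (\<theta> - 1)" using w theta_gt_1 by simp
  show "(\<Sum>u\<in>{n0<..n}. tail_prob p u n d) \<le> 4 * real n * geo w ^ d"
    unfolding geo_ratio[OF w, symmetric] by (rule tail_sum_le[OF n r]) (use p in blast)
  show "0 \<le> tail_prob p u n d \<and> tail_prob p u n d \<le> 1" if "u \<in> {n0<..n}"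
  proof (rule tail_prob_bounds)
    fix l assume "u \<le> l" "l < n"
    then have "n0 \<le> l" using that by simp
    then show "0 \<le> p l \<and> p l \<le> 1" using p[of l] mult_nonneg_nonneg[of "w / (\<theta> - 1)" "c l"] r rate_nonneg[of l]
      by linarith
  qed
qed

end

section \<open>Convergence of a single label\<close>

definition cutoff :: "real \<Rightarrow> nat \<Rightarrow> nat" where "cutoff \<delta> n = nat \<lceil>real n powr \<delta>\<rceil>"

lemma cutoff_bounds: "real n powr \<delta> \<le> real (cutoff \<delta> n)" "real (cutoff \<delta> n) \<le> real n powr \<delta> + 1"
proof -
  have "real (cutoff \<delta> n) = of_int \<lceil>real n powr \<delta>\<rceil>" by (simp add: cutoff_def)
  then show "real n powr \<delta> \<le> real (cutoff \<delta> n)" "real (cutoff \<delta> n) \<le> real n powr \<delta> + 1"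
    by linarith+
qed

lemma cutoff_at_top: "0 < \<delta> \<Longrightarrow> filterlim (cutoff \<delta>) at_top sequentially"
proof -
  assume "0 < \<delta>"
  then have "filterlim (\<lambda>n::nat. real n powr \<delta>) at_top sequentially" by real_asymp
  then have "filterlim (\<lambda>n. real (cutoff \<delta> n)) at_top sequentially"
    by (rule filterlim_at_top_mono) (simp add: cutoff_bounds)
  then show ?thesis by (simp add: filterlim_sequentially_iff_filterlim_real)
qed

lemma cutoff_powr_tendsto:
  assumes "0 < \<delta>" shows "(\<lambda>n. real (cutoff \<delta> n) powr (-1/4)) \<longlonglongrightarrow> 0"
proof -
  have "filterlim (\<lambda>n. real (cutoff \<delta> n)) at_top sequentially"
    by (rule filterlim_compose[OF filterlim_real_sequentially cutoff_at_top[OF assms]])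
  moreover have "((\<lambda>x::real. x powr (-1/4)) \<longlongrightarrow> 0) at_top" by real_asymp
  ultimately show ?thesis by (rule filterlim_compose[rotated])
qed

text \<open>The last condition on \<open>\<delta>\<close> makes the error term with exponent \<open>\<beta>\<close> in \<open>tail_sum_char\<close> negligible: its
  ratio to the main term is \<open>(n0 / n)\<^bsup>\<beta>\<^esup> exp(d \<beta> / (1 / gam - 2 \<beta>))\<close> with \<open>n0 \<approx> n\<^bsup>\<delta>\<^esup>\<close> and
  \<open>d \<le> c' log n\<close>.\<close>

locale label_rates = weight_law +
  fixes c :: "nat \<Rightarrow> real" and p :: "nat \<Rightarrow> real \<Rightarrow> nat \<Rightarrow> real" and d :: "nat \<Rightarrow> nat" and c' \<beta> \<delta> :: real
  assumes d_top: "filterlim d at_top sequentially"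
    and d_le: "eventually (\<lambda>n. real (d n) \<le> c' * ln (real n)) sequentially"
    and c'_nonneg: "0 \<le> c'"
    and beta: "0 < \<beta>" "\<beta> < 1" "2 * \<beta> < 1 / gam"
    and delta: "0 < \<delta>" "\<delta> < 1/2" "c' < (1 / gam - 2 * \<beta>) * (1 - 2 * \<delta>)"
    and rates: "eventually (\<lambda>m. \<bar>real m * c m - 1\<bar> \<le> 2 * real m powr (-1/4)) sequentially"
    and p_eq: "\<And>n w l. cutoff \<delta> n \<le> l \<Longrightarrow> p n w l = w / (\<theta> - 1) * c l"
    and p_measurable [measurable]: "\<And>n l. (\<lambda>w. p n w l) \<in> borel_measurable borel"
begin

abbreviation "n0 \<equiv> cutoff \<delta>"
definition "good_n n \<longleftrightarrow> harmonic_rates c (n0 n) \<and> n0 n \<le> n \<and> 0 < n \<and>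
  (\<forall>w l. 0 < w \<longrightarrow> w \<le> 1 \<longrightarrow> n0 n \<le> l \<longrightarrow> p n w l = w / (\<theta> - 1) * c l \<and> p n w l \<le> 1)"

lemma eventually_good: "eventually good_n sequentially"
proof -
  note top = cutoff_at_top[OF delta(1)]
  obtain m0 where m0: "\<And>m. m0 \<le> m \<Longrightarrow> \<bar>real m * c m - 1\<bar> \<le> 2 * real m powr (-1/4)"
    using rates unfolding eventually_sequentially by blast
  have "eventually (\<lambda>n. n0 n \<le> n) sequentially"
  proof -
    have "eventually (\<lambda>n::nat. real n powr \<delta> + 1 \<le> real n) sequentially"
      using delta by real_asymp
    then show ?thesis
      by eventually_elim (use cutoff_bounds in \<open>meson of_nat_le_iff order_trans\<close>)
  qed
  moreover have "eventually (\<lambda>n. m0 \<le> n0 n) sequentially" using top by (simp add: filterlim_at_top)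
  \<comment> \<open>With \<open>l * c l \<le> 3\<close> the rate is at most
    \<open>3 / ((\<theta> - 1) l)\<close>; this size of the cutoff makes it a probability.\<close>
  moreover have "eventually (\<lambda>n. Suc (nat \<lceil>3 / (\<theta> - 1)\<rceil>) \<le> n0 n) sequentially" using top by (simp add: filterlim_at_top)
  moreover have "eventually (\<lambda>n. real (n0 n) powr (-1/4) < 1 / 240) sequentially"
    by (rule order_tendstoD[OF cutoff_powr_tendsto[OF delta(1)]]) simp
  ultimately show ?thesis using eventually_gt_at_top[of 0]
  proof eventually_elim
    case (elim n)
    have n0: "0 < n0 n" "3 / (\<theta> - 1) \<le> real (n0 n)" using elim(3) by linarith+
    interpret harmonic_rates c "n0 n"
      by unfold_locales (use n0 elim m0 in auto)
    have "p n w l = w / (\<theta> - 1) * c l \<and> p n w l \<le> 1" if w: "0 < w" "w \<le> 1" and l: "n0 n \<le> l" for w l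
    proof -
      have l0: "0 < real l" using l n0 by simp
      have "2 * real l powr (-1/4) \<le> 1" using powr_h_le[OF l] elim(4) by linarith
      then have "real l * c l \<le> 3" using rate[OF l] by linarith
      then have cl: "c l \<le> 3 / real l" using l0 by (simp add: le_divide_eq mult.commute)
      have "w / (\<theta> - 1) * c l \<le> 1 / (\<theta> - 1) * (3 / real l)"
        using w theta_gt_1 cl rate_nonneg[OF l] by (intro mult_mono divide_right_mono) auto
      also have "\<dots> = 3 / (\<theta> - 1) / real l" by simp
      also have "\<dots> \<le> 1" 
      proof -
        have "real (n0 n) \<le> real l" using l by simp
        then show ?thesis using n0 l0 by (subst divide_le_eq_1_pos) linarith+
      qed
      finally show ?thesis using p_eq[OF l] by simp
    qed
    then show ?case unfolding good_n_def using elim harmonic_rates_axioms by blast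
  qed
qed

lemma good_nD:
  assumes "good_n n"
  shows "harmonic_rates c (n0 n)" "n0 n \<le> n" "0 < n"
    "\<And>w l. 0 < w \<Longrightarrow> w \<le> 1 \<Longrightarrow> n0 n \<le> l \<Longrightarrow> p n w l = w / (\<theta> - 1) * c l \<and> p n w l \<le> 1"
  using assms unfolding good_n_def by blast+

text \<open>In the model with independent edges, \<open>n * geo_moment (d n)\<close> is
  asymptotically the expected number of vertices of degree at least \<open>d n\<close>. So these
  weights are in the limit a probability distribution on labels.\<close>

definition label_weight :: "nat \<Rightarrow> nat \<Rightarrow> real" where
  "label_weight n u = (\<integral>w. tail_prob (p n w) u n (d n) \<partial>\<mu>) / (real n * geo_moment (d n))"

definition label_pos :: "nat \<Rightarrow> nat \<Rightarrow> real" where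
  "label_pos n u = (ln (real u) - (ln (real n) - gam * real (d n))) / (gam * sqrt (real (d n)))"

lemma tail_bounds:
  assumes "good_n n" "0 < w" "w \<le> 1" "u \<in> {n0 n<..n}"
  shows "0 \<le> tail_prob (p n w) u n j" "tail_prob (p n w) u n j \<le> 1"
  using char_any_weight(2)[OF good_nD(1,2)[OF assms(1)] assms(2) good_nD(4)[OF assms(1-3)] assms(4), of j]
  by blast+

lemma integrable_tail:
  assumes "good_n n" "u \<in> {n0 n<..n}"
  shows "integrable \<mu> (\<lambda>w. tail_prob (p n w) u n j)"
  by (rule integrable_bounded_measurable[where B=1])
    (use tail_bounds[OF assms(1) _ _ assms(2)] in auto)

lemma label_weight_nonneg:
  assumes "good_n n" "u \<in> {n0 n<..n}" shows "0 \<le> label_weight n u"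
proof -
  have "0 \<le> (\<integral>w. tail_prob (p n w) u n (d n) \<partial>\<mu>)"
    by (rule integral_nonneg_AE)
      (use AE_weight_pos AE_weight_le_1 in \<open>eventually_elim, use tail_bounds[OF assms(1) _ _ assms(2)] in auto\<close>)
  then show ?thesis unfolding label_weight_def using geo_moment_pos by (simp add: less_imp_le)
qed

text \<open>Stated for every degree \<open>j\<close>, because the quadratic error of the joint lower
  bound involves degree \<open>d - 1\<close>.\<close>

lemma sum_tail_le:
  assumes "good_n n"
  shows "(\<Sum>u\<in>{n0 n<..n}. \<integral>w. tail_prob (p n w) u n j \<partial>\<mu>) \<le> 4 * real n * geo_moment j"
proof -
  have "(\<Sum>u\<in>{n0 n<..n}. \<integral>w. tail_prob (p n w) u n j \<partial>\<mu>) = (\<integral>w. (\<Sum>u\<in>{n0 n<..n}. tail_prob (p n w) u n j) \<partial>\<mu>)"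
    by (subst Bochner_Integration.integral_sum) (use integrable_tail[OF assms] in auto)
  also have "\<dots> \<le> (\<integral>w. 4 * real n * geo w ^ j \<partial>\<mu>)"
  proof (rule integral_mono_AE)
    show "integrable \<mu> (\<lambda>w. \<Sum>u\<in>{n0 n<..n}. tail_prob (p n w) u n j)"
      by (intro Bochner_Integration.integrable_sum integrable_tail assms)
    show "AE w in \<mu>. (\<Sum>u\<in>{n0 n<..n}. tail_prob (p n w) u n j) \<le> 4 * real n * geo w ^ j"
      using AE_weight_pos AE_weight_le_1
      by eventually_elim (rule char_any_weight(1)[OF good_nD(1,2)[OF assms] _ good_nD(4)[OF assms]])
  qed (intro integrable_mult_right integrable_geo_power)
  finally show ?thesis by (simp add: geo_moment_def)
qed

definition far_part :: "real \<Rightarrow> nat \<Rightarrow> real" where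
  "far_part \<xi> k = (\<integral>w. indicator {..<1 - real k powr (- \<xi>)} w * geo w ^ k \<partial>\<mu>) / geo_moment k"

definition near_err :: "real \<Rightarrow> real \<Rightarrow> nat \<Rightarrow> real" where
  "near_err \<xi> t n = 600 * (\<bar>t / (gam * sqrt (d n))\<bar> + real (n0 n) powr (-1/4))
        + 3 * (real (n0 n) / real n) powr \<beta> * exp (real (d n) * (\<beta> / (1 / gam - 2 * \<beta>)))
        + char_err \<xi> t (d n)"

text \<open>Integration over the weight. Near weights give the main term; for far weights only
  absolute values are bounded, by \<open>4 + 1 = 5\<close> times \<open>geo w ^ D\<close>, and
  \<open>far_part\<close> measures their share of the moment.\<close>

lemma label_char_bound:
  assumes good: "good_n n" and d: "0 < d n"
    and small: "real (d n) powr (- \<xi>) / (\<theta> - 1) \<le> \<beta>"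
    and t: "\<bar>t\<bar> * (1 / gam) \<le> sqrt (real (d n))"
    and err: "0 \<le> near_err \<xi> t n"
  shows "norm ((\<Sum>u\<in>{n0 n<..n}. of_real (label_weight n u) * cis (t * label_pos n u)) - exp (- t\<^sup>2 / 2))
     \<le> near_err \<xi> t n + 5 * far_part \<xi> (d n)"
proof -
  define D where "D = d n"
  define \<sigma> where "\<sigma> = t / (gam * sqrt D)"
  define U where "U = cis (t * sqrt D) * cis (- (\<sigma> * ln (real n)))"
  define T where "T w u = tail_prob (p n w) u n D" for w u
  define F where "F w = U * (\<Sum>u\<in>{n0 n<..n}. cis (\<sigma> * ln (real u)) * of_real (T w u)) / of_nat n" for w
  define G where "G = geo_moment D"
  define E where "E = complex_of_real (exp (- t\<^sup>2 / 2))"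
  have n: "0 < n" "n0 n \<le> n" using good by (auto simp: good_n_def)
  have G: "0 < G" using geo_moment_pos by (simp add: G_def)
  have pos: "cis (t * label_pos n u) = U * cis (\<sigma> * ln (real u))" for u
  proof -
    have "t * label_pos n u = t * sqrt D + (- (\<sigma> * ln (real n))) + \<sigma> * ln (real u)"
    proof -
      have "t * label_pos n u = \<sigma> * (ln (real u) - (ln (real n) - gam * real D))"
        by (simp add: label_pos_def \<sigma>_def D_def)
      also have "\<dots> = \<sigma> * ln (real u) - \<sigma> * ln (real n) + \<sigma> * (gam * real D)"
        by (simp add: algebra_simps)
      also have "\<sigma> * (gam * real D) = t * (real D / sqrt D)" using gam_pos by (simp add: \<sigma>_def)
      also have "real D / sqrt D = sqrt D" by (rule real_div_sqrt) simp
      finally show ?thesis by simp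
    qed
    then show ?thesis by (simp add: U_def cis_mult)
  qed
  have intT: "integrable \<mu> (\<lambda>w. T w u)" if "u \<in> {n0 n<..n}" for u
    unfolding T_def by (rule integrable_tail[OF good that])
  have intF: "integrable \<mu> F" unfolding F_def
    by (intro integrable_divide integrable_mult_right Bochner_Integration.integrable_sum)
      (use intT in auto)
  have intG: "integrable \<mu> (\<lambda>w. E * complex_of_real (geo w ^ D))"
    by (intro integrable_mult_right integrable_of_real integrable_geo_power)
  have "(\<Sum>u\<in>{n0 n<..n}. of_real (label_weight n u) * cis (t * label_pos n u)) = (\<integral>w. F w \<partial>\<mu>) / of_real G"
  proof -
    have "(\<integral>w. F w \<partial>\<mu>) = U * (\<Sum>u\<in>{n0 n<..n}. cis (\<sigma> * ln (real u)) * of_real (\<integral>w. T w u \<partial>\<mu>)) / of_nat n"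
      unfolding F_def using intT by (simp add: Bochner_Integration.integral_sum)
    then show ?thesis
      by (simp add: label_weight_def pos G_def D_def T_def sum_distrib_left sum_divide_distrib mult_ac)
  qed
  moreover have "E = (\<integral>w. E * complex_of_real (geo w ^ D) \<partial>\<mu>) / of_real G"
    using G by (simp add: G_def geo_moment_def del: of_real_power)
  ultimately have eq: "(\<Sum>u\<in>{n0 n<..n}. of_real (label_weight n u) * cis (t * label_pos n u)) - E
     = (\<integral>w. F w - E * complex_of_real (geo w ^ D) \<partial>\<mu>) / of_real G"
    using intF intG by (metis Bochner_Integration.integral_diff diff_divide_distrib)
  have bound: "norm (F w - E * complex_of_real (geo w ^ D))
      \<le> near_err \<xi> t n * geo w ^ D + 5 * (indicator {..<1 - real D powr (- \<xi>)} w * geo w ^ D)"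
    if w: "0 < w" "w \<le> 1" for w
  proof -
    have g: "0 \<le> geo w ^ D" using geo_nonneg[OF w(1)] by simp
    have P: "\<And>m. n0 n \<le> m \<Longrightarrow> p n w m = w / (\<theta> - 1) * c m \<and> p n w m \<le> 1" and H: "harmonic_rates c (n0 n)"
      using good_nD(4)[OF good w] good_nD(1)[OF good] by blast+
    show ?thesis
    proof (cases "w < 1 - real D powr (- \<xi>)")
      case False
      then have "norm (F w - E * complex_of_real (geo w ^ D)) \<le> near_err \<xi> t n * geo w ^ D"
        unfolding F_def U_def E_def \<sigma>_def near_err_def D_def T_def
        using char_near_weight[OF H n(2) d w _ small beta t P] by (simp add: D_def)
      then show ?thesis using False by simp
    next
      case True
      have "norm (F w) = norm (\<Sum>u\<in>{n0 n<..n}. cis (\<sigma> * ln (real u)) * of_real (T w u)) / real n"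
        by (simp add: F_def U_def norm_divide norm_mult)
      also have "\<dots> \<le> (\<Sum>u\<in>{n0 n<..n}. T w u) / real n"
        using tail_bounds(1)[OF good w]
        by (intro divide_right_mono sum_norm_le) (auto simp: norm_mult T_def)
      also have "\<dots> \<le> 4 * real n * geo w ^ D / real n"
        unfolding T_def by (intro divide_right_mono char_any_weight(1)[OF H n(2) w(1) P]) auto
      also have "\<dots> = 4 * geo w ^ D" using n by simp
      finally have "norm (F w) \<le> 4 * geo w ^ D" .
      moreover have "norm (E * complex_of_real (geo w ^ D)) \<le> 1 * geo w ^ D"
        unfolding norm_mult by (intro mult_mono) (use g in \<open>simp_all add: E_def del: of_real_power\<close>)
      ultimately have "norm (F w - E * complex_of_real (geo w ^ D)) \<le> 5 * geo w ^ D"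
        using norm_triangle_ineq4[of "F w" "E * complex_of_real (geo w ^ D)"] by linarith
      moreover have "0 \<le> near_err \<xi> t n * geo w ^ D" using g err by simp
      ultimately show ?thesis using True by simp
    qed
  qed
  have intfar: "integrable \<mu> (\<lambda>w. indicator {..<1 - real D powr (- \<xi>)} w * geo w ^ D)"
    by (rule Bochner_Integration.integrable_bound[OF integrable_geo_power[of D]])
      (auto simp: indicator_def)
  have "norm (\<integral>w. F w - E * complex_of_real (geo w ^ D) \<partial>\<mu>)
     \<le> (\<integral>w. near_err \<xi> t n * geo w ^ D + 5 * (indicator {..<1 - real D powr (- \<xi>)} w * geo w ^ D) \<partial>\<mu>)"
  proof (rule order_trans[OF integral_norm_bound integral_mono_AE])
    show "integrable \<mu> (\<lambda>w. norm (F w - E * complex_of_real (geo w ^ D)))"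
      by (intro integrable_norm Bochner_Integration.integrable_diff intF intG)
    show "integrable \<mu> (\<lambda>w. near_err \<xi> t n * geo w ^ D + 5 * (indicator {..<1 - real D powr (- \<xi>)} w * geo w ^ D))"
      by (intro Bochner_Integration.integrable_add integrable_mult_right integrable_geo_power intfar)
    show "AE w in \<mu>. norm (F w - E * complex_of_real (geo w ^ D))
      \<le> near_err \<xi> t n * geo w ^ D + 5 * (indicator {..<1 - real D powr (- \<xi>)} w * geo w ^ D)"
      using AE_weight_pos AE_weight_le_1 by eventually_elim (rule bound)
  qed
  also have "\<dots> = (near_err \<xi> t n + 5 * far_part \<xi> D) * G"
    using G integrable_geo_power[of D] intfar by (simp add: far_part_def geo_moment_def G_def distrib_right)
  finally have "norm (\<integral>w. F w - E * complex_of_real (geo w ^ D) \<partial>\<mu>) / G \<le> near_err \<xi> t n + 5 * far_part \<xi> D"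
    using G by (simp add: divide_le_eq)
  then show ?thesis unfolding E_def[symmetric] eq using G by (simp add: norm_divide D_def)
qed

lemma near_err_tendsto:
  assumes "1/2 < \<xi>" shows "near_err \<xi> t \<longlonglongrightarrow> 0"
proof -
  have rd: "filterlim (\<lambda>n. real (d n)) at_top sequentially"
    by (rule filterlim_compose[OF filterlim_real_sequentially d_top])
  have 1: "(\<lambda>n. \<bar>t / (gam * sqrt (real (d n)))\<bar>) \<longlonglongrightarrow> 0"
  proof -
    have "((\<lambda>x::real. 1 / sqrt x) \<longlongrightarrow> 0) at_top" by real_asymp
    from tendsto_mult_right_zero[OF filterlim_compose[OF this rd], of "\<bar>t\<bar> / gam"]
    show ?thesis using gam_pos by (simp add: abs_divide abs_mult)
  qed
  have 2: "(\<lambda>n. char_err \<xi> t (d n)) \<longlonglongrightarrow> 0"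
    by (rule filterlim_compose[OF char_err_tendsto[OF assms] d_top])
  \<comment> \<open>The cutoff contributes \<open>n powr (\<beta> (\<delta> - 1))\<close> and the
    exponential at most \<open>n powr (\<beta> (1 - 2 \<delta>))\<close>. The 2 in the assumption on
    \<open>c'\<close> leaves the decay \<open>n powr (- \<beta> \<delta>)\<close>.\<close>
  have 3: "(\<lambda>n. 3 * (real (n0 n) / real n) powr \<beta> * exp (real (d n) * (\<beta> / (1 / gam - 2 * \<beta>)))) \<longlonglongrightarrow> 0"
  proof (rule Lim_null_comparison)
    have B: "0 < 1 / gam - 2 * \<beta>" using beta by simp
    have slope: "c' / (1 / gam - 2 * \<beta>) < 1 - 2 * \<delta>" using delta B by (simp add: divide_less_eq mult.commute)
    show "eventually (\<lambda>n. norm (3 * (real (n0 n) / real n) powr \<beta> * exp (real (d n) * (\<beta> / (1 / gam - 2 * \<beta>))))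
       \<le> 3 * 2 powr \<beta> * real n powr (- (\<beta> * \<delta>))) sequentially"
      using d_le eventually_ge_at_top[of 2]
    proof eventually_elim
      case (elim n)
      have n: "1 \<le> real n" "0 < real n" "0 \<le> ln (real n)" using elim by auto
      have "real (n0 n) \<le> 2 * real n powr \<delta>"
        using cutoff_bounds(2)[of \<delta> n] ge_one_powr_ge_zero[OF n(1), of \<delta>] delta by linarith
      then have "real (n0 n) / real n \<le> 2 * real n powr \<delta> / real n" by (rule divide_right_mono) simp
      also have "\<dots> = 2 * real n powr (\<delta> - 1)" using n by (simp add: powr_diff)
      finally have "(real (n0 n) / real n) powr \<beta> \<le> (2 * real n powr (\<delta> - 1)) powr \<beta>"
        using beta by (intro powr_mono2) auto
      also have "\<dots> = 2 powr \<beta> * real n powr (\<beta> * (\<delta> - 1))" by (simp add: powr_mult powr_powr mult.commute)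
      finally have A: "(real (n0 n) / real n) powr \<beta> \<le> 2 powr \<beta> * real n powr (\<beta> * (\<delta> - 1))" .
      have "real (d n) * (\<beta> / (1 / gam - 2 * \<beta>)) \<le> c' * ln (real n) * (\<beta> / (1 / gam - 2 * \<beta>))"
        using elim B beta by (intro mult_right_mono) auto
      also have "\<dots> = ln (real n) * \<beta> * (c' / (1 / gam - 2 * \<beta>))" by simp
      also have "\<dots> \<le> ln (real n) * \<beta> * (1 - 2 * \<delta>)" using slope n beta by (intro mult_left_mono) auto
      finally have "exp (real (d n) * (\<beta> / (1 / gam - 2 * \<beta>))) \<le> real n powr (\<beta> * (1 - 2 * \<delta>))"
        using n by (simp add: powr_def mult_ac)
      then have "(real (n0 n) / real n) powr \<beta> * exp (real (d n) * (\<beta> / (1 / gam - 2 * \<beta>)))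
         \<le> (2 powr \<beta> * real n powr (\<beta> * (\<delta> - 1))) * real n powr (\<beta> * (1 - 2 * \<delta>))"
        using A by (intro mult_mono) auto
      also have "\<dots> = 2 powr \<beta> * real n powr (\<beta> * (\<delta> - 1) + \<beta> * (1 - 2 * \<delta>))"
        by (simp only: powr_add mult.assoc)
      also have "\<beta> * (\<delta> - 1) + \<beta> * (1 - 2 * \<delta>) = - (\<beta> * \<delta>)" by (simp add: algebra_simps)
      finally show ?case by simp
    qed
    show "(\<lambda>n. 3 * 2 powr \<beta> * real n powr (- (\<beta> * \<delta>))) \<longlonglongrightarrow> 0"
      using beta delta by real_asymp
  qed
  have "(\<lambda>n. 600 * (\<bar>t / (gam * sqrt (d n))\<bar> + real (n0 n) powr (-1/4))
        + 3 * (real (n0 n) / real n) powr \<beta> * exp (real (d n) * (\<beta> / (1 / gam - 2 * \<beta>)))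
        + char_err \<xi> t (d n)) \<longlonglongrightarrow> 600 * (0 + 0) + 0 + 0"
    by (intro tendsto_add tendsto_mult tendsto_const 1 2 3 cutoff_powr_tendsto delta)
  then show ?thesis unfolding near_err_def by simp
qed

theorem label_char_tendsto:
  "(\<lambda>n. \<Sum>u\<in>{n0 n<..n}. of_real (label_weight n u) * cis (t * label_pos n u)) \<longlonglongrightarrow> of_real (exp (- t\<^sup>2 / 2))"
proof -
  obtain \<xi> where \<xi>: "1/2 < \<xi>" "\<xi> < 1" and far: "far_part \<xi> \<longlonglongrightarrow> 0"
    unfolding far_part_def by (rule far_weights_negligible)
  have rd: "filterlim (\<lambda>n. real (d n)) at_top sequentially"
    by (rule filterlim_compose[OF filterlim_real_sequentially d_top])
  have e1: "eventually (\<lambda>n. 0 < d n) sequentially"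
    using d_top[unfolded filterlim_at_top, rule_format, of 1] by eventually_elim simp
  have e2: "eventually (\<lambda>n. real (d n) powr (- \<xi>) / (\<theta> - 1) \<le> \<beta>) sequentially"
  proof -
    have "((\<lambda>x. x powr (- \<xi>) / (\<theta> - 1)) \<longlongrightarrow> 0) at_top" using \<xi> theta_gt_1 by real_asymp
    from filterlim_compose[OF this rd] have "eventually (\<lambda>n. real (d n) powr (- \<xi>) / (\<theta> - 1) < \<beta>) sequentially"
      by (rule order_tendstoD) (use beta in simp)
    then show ?thesis by eventually_elim simp
  qed
  have e3: "eventually (\<lambda>n. \<bar>t\<bar> * (1 / gam) \<le> sqrt (real (d n))) sequentially"
    using filterlim_compose[OF sqrt_at_top rd] unfolding filterlim_at_top by blast
  have tend: "(\<lambda>n. near_err \<xi> t n + 5 * far_part \<xi> (d n)) \<longlonglongrightarrow> 0 + 5 * 0"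
    by (intro tendsto_add tendsto_mult tendsto_const near_err_tendsto \<xi> filterlim_compose[OF far d_top])
  show ?thesis
  proof (rule LIM_zero_cancel, rule Lim_null_comparison)
    show "(\<lambda>n. near_err \<xi> t n + 5 * far_part \<xi> (d n)) \<longlonglongrightarrow> 0" using tend by simp
    show "eventually (\<lambda>n. norm ((\<Sum>u\<in>{n0 n<..n}. of_real (label_weight n u) * cis (t * label_pos n u)) - of_real (exp (- t\<^sup>2 / 2)))
      \<le> near_err \<xi> t n + 5 * far_part \<xi> (d n)) sequentially"
      using eventually_good e1 e2 e3
    proof eventually_elim
      case (elim n)
      have "0 \<le> near_err \<xi> t n"
        unfolding near_err_def char_err_def using gam_pos theta_gt_1
        by (intro add_nonneg_nonneg mult_nonneg_nonneg divide_nonneg_nonneg) auto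
      then show ?case using label_char_bound[OF elim] by simp
    qed
  qed
qed

end

section \<open>Levy continuity for finite weighted point sets\<close>

lemma std_normal_real_distribution: "real_distribution std_normal_distribution"
  by (rule real_dist_normal_dist)

lemma std_normal_UNIV: "measure std_normal_distribution UNIV = 1"
  using prob_space.prob_space[of std_normal_distribution] prob_space_normal_density[of 1 0] by simp

lemma std_normal_singleton: "measure std_normal_distribution {x} = 0"
proof -
  have "AE y in lborel. y \<noteq> x" using AE_lborel_singleton[of x] .
  then have "emeasure std_normal_distribution {x} = 0"
    by (subst emeasure_density) (auto intro!: nn_integral_0_iff_AE[THEN iffD2] simp: indicator_def elim: AE_mp)
  then show ?thesis by (simp add: measure_def)
qed

text \<open>The weights need not have total mass 1. The hypothesis at \<open>t = 0\<close> says that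
  the total tends to 1, so normalising does not change the limits.\<close>

lemma discrete_levy_normal:
  fixes q y :: "nat \<Rightarrow> 'a \<Rightarrow> real" and A :: "nat \<Rightarrow> 'a set"
  assumes fin: "\<And>n. finite (A n)"
    and nonneg: "eventually (\<lambda>n. \<forall>u\<in>A n. 0 \<le> q n u) sequentially"
    and char: "\<And>t. (\<lambda>n. \<Sum>u\<in>A n. of_real (q n u) * cis (t * y n u)) \<longlonglongrightarrow> of_real (exp (- t\<^sup>2 / 2))"
  shows "(\<lambda>n. \<Sum>u\<in>A n. q n u) \<longlonglongrightarrow> 1"
    and "(\<lambda>n. \<Sum>u\<in>{u\<in>A n. y n u \<le> a}. q n u) \<longlonglongrightarrow> cdf std_normal_distribution a"
proof -
  define tot where "tot n = (\<Sum>u\<in>A n. q n u)" for n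
  have "(\<lambda>n. complex_of_real (tot n)) \<longlonglongrightarrow> complex_of_real 1"
    using char[of 0] by (simp add: tot_def)
  then have tot: "tot \<longlonglongrightarrow> 1" by (simp only: tendsto_of_real_iff)
  then show "(\<lambda>n. \<Sum>u\<in>A n. q n u) \<longlonglongrightarrow> 1" unfolding tot_def .
  define good where "good n \<longleftrightarrow> (\<forall>u\<in>A n. 0 \<le> q n u) \<and> 0 < tot n" for n
  have good: "eventually good sequentially"
  proof -
    have "eventually (\<lambda>n. 0 < tot n) sequentially" by (rule order_tendstoD(1)[OF tot]) simp
    with nonneg show ?thesis unfolding good_def by eventually_elim auto
  qed
  \<comment> \<open>\<open>levy_continuity\<close> wants a distribution for every \<open>n\<close>;
    the normal law is a placeholder for the finitely many bad \<open>n\<close>.\<close>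
  define N where "N n = (if good n then distr (point_measure (A n) (\<lambda>u. ennreal (q n u / tot n))) borel (y n)
     else std_normal_distribution)" for n
  have meas: "y n \<in> point_measure (A n) f \<rightarrow>\<^sub>M borel" for n f
    by (simp add: point_measure_def measurable_def)
  have emA: "emeasure (point_measure (A n) (\<lambda>u. ennreal (q n u / tot n))) B = ennreal ((\<Sum>u\<in>B. q n u) / tot n)"
    if "good n" "B \<subseteq> A n" for n B
  proof -
    have "emeasure (point_measure (A n) (\<lambda>u. ennreal (q n u / tot n))) B = (\<Sum>u\<in>B. ennreal (q n u / tot n))"
      using that fin by (intro emeasure_point_measure_finite) auto
    also have "\<dots> = ennreal (\<Sum>u\<in>B. q n u / tot n)"
      using that by (intro sum_ennreal) (auto simp: good_def)
    finally show ?thesis by (simp add: sum_divide_distrib)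
  qed
  have N: "real_distribution (N n)" for n
  proof (cases "good n")
    case True
    then have "prob_space (point_measure (A n) (\<lambda>u. ennreal (q n u / tot n)))"
      using emA[OF True order_refl] by (intro prob_spaceI) (simp add: space_point_measure tot_def[symmetric] good_def)
    then have "prob_space (N n)"
      using True meas by (simp add: N_def prob_space.prob_space_distr)
    then show ?thesis using True by (simp add: N_def real_distribution_def real_distribution_axioms_def)
  next
    case False then show ?thesis by (simp add: N_def std_normal_real_distribution)
  qed
  have "weak_conv_m N std_normal_distribution"
  proof (rule levy_continuity[OF N std_normal_real_distribution])
    fix t :: real
    have "(\<lambda>n. (\<Sum>u\<in>A n. of_real (q n u) * cis (t * y n u)) / complex_of_real (tot n)) \<longlonglongrightarrow> of_real (exp (- t\<^sup>2 / 2)) / of_real 1"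
      by (intro tendsto_divide char tendsto_of_real tot) auto
    moreover have "eventually (\<lambda>n. (\<Sum>u\<in>A n. of_real (q n u) * cis (t * y n u)) / complex_of_real (tot n) = char (N n) t) sequentially"
      using good
    proof eventually_elim
      case (elim n)
      have "char (N n) t = (\<integral>u. cis (t * y n u) \<partial>point_measure (A n) (\<lambda>u. ennreal (q n u / tot n)))"
        using elim meas unfolding char_def N_def by (simp add: integral_distr cis_conv_exp)
      also have "\<dots> = (\<Sum>u\<in>A n. (q n u / tot n) *\<^sub>R cis (t * y n u))"
        using elim fin by (intro lebesgue_integral_point_measure_finite) (auto simp: good_def)
      also have "\<dots> = (\<Sum>u\<in>A n. of_real (q n u) * cis (t * y n u)) / complex_of_real (tot n)"
        by (simp add: sum_divide_distrib scaleR_conv_of_real)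
      finally show ?case by simp
    qed
    ultimately show "(\<lambda>n. char (N n) t) \<longlonglongrightarrow> char std_normal_distribution t"
      by (simp add: char_std_normal_distribution Lim_transform_eventually)
  qed
  moreover have "isCont (cdf std_normal_distribution) a"
  proof -
    interpret real_distribution std_normal_distribution by (rule std_normal_real_distribution)
    show ?thesis by (simp add: isCont_cdf std_normal_singleton)
  qed
  ultimately have "(\<lambda>n. cdf (N n) a) \<longlonglongrightarrow> cdf std_normal_distribution a"
    unfolding weak_conv_m_def weak_conv_def by blast
  then have "(\<lambda>n. tot n * cdf (N n) a) \<longlonglongrightarrow> 1 * cdf std_normal_distribution a"
    by (intro tendsto_mult tot)
  moreover have "eventually (\<lambda>n. tot n * cdf (N n) a = (\<Sum>u\<in>{u\<in>A n. y n u \<le> a}. q n u)) sequentially"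
    using good
  proof eventually_elim
    case (elim n)
    have "cdf (N n) a = measure (point_measure (A n) (\<lambda>u. ennreal (q n u / tot n))) {u\<in>A n. y n u \<le> a}"
      using elim meas unfolding cdf_def N_def
      by (auto simp: measure_distr space_point_measure vimage_def intro!: arg_cong2[where f=measure])
    also have "\<dots> = (\<Sum>u\<in>{u\<in>A n. y n u \<le> a}. q n u) / tot n"
      unfolding measure_def using elim emA[OF elim, of "{u\<in>A n. y n u \<le> a}"]
      by (simp add: good_def) (intro enn2real_ennreal divide_nonneg_pos sum_nonneg, auto)
    finally show ?case using elim by (simp add: good_def)
  qed
  ultimately show "(\<lambda>n. \<Sum>u\<in>{u\<in>A n. y n u \<le> a}. q n u) \<longlonglongrightarrow> cdf std_normal_distribution a"
    by (simp add: Lim_transform_eventually)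
qed

text \<open>\<open>UNIV\<close> serves the conditioning event, half-open intervals serve the cells.
  The case \<open>a = b\<close> gives the empty interval.\<close>

lemma discrete_levy_normal_interval:
  fixes q y :: "nat \<Rightarrow> 'a \<Rightarrow> real" and A :: "nat \<Rightarrow> 'a set"
  assumes fin: "\<And>n. finite (A n)"
    and nonneg: "eventually (\<lambda>n. \<forall>u\<in>A n. 0 \<le> q n u) sequentially"
    and char: "\<And>t. (\<lambda>n. \<Sum>u\<in>A n. of_real (q n u) * cis (t * y n u)) \<longlonglongrightarrow> of_real (exp (- t\<^sup>2 / 2))"
    and I: "I = UNIV \<or> (\<exists>a b. a \<le> b \<and> I = {a<..b})"
  shows "(\<lambda>n. \<Sum>u\<in>{u\<in>A n. y n u \<in> I}. q n u) \<longlonglongrightarrow> measure std_normal_distribution I"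
proof -
  interpret real_distribution std_normal_distribution by (rule std_normal_real_distribution)
  note lev = discrete_levy_normal[OF fin nonneg char]
  from I show ?thesis
  proof (elim disjE exE conjE)
    assume "I = UNIV"
    then show ?thesis using lev(1) prob_space by simp
  next
    fix a b assume ab: "a \<le> b" "I = {a<..b}"
    have "(\<Sum>u\<in>{u\<in>A n. y n u \<in> I}. q n u) = (\<Sum>u\<in>{u\<in>A n. y n u \<le> b}. q n u) - (\<Sum>u\<in>{u\<in>A n. y n u \<le> a}. q n u)" for n
    proof -
      have "{u\<in>A n. y n u \<in> I} = {u\<in>A n. y n u \<le> b} - {u\<in>A n. y n u \<le> a}" using ab by auto
      then show ?thesis using fin ab by (simp add: sum_diff Collect_mono_iff)
    qed
    moreover have "cdf std_normal_distribution b - cdf std_normal_distribution a = measure std_normal_distribution I"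
      using ab cdf_diff_eq[of a b] by (cases "a = b") auto
    ultimately show ?thesis using tendsto_diff[OF lev(2)[of b] lev(2)[of a]] by simp
  qed
qed

section \<open>Size of single label weights and removal of small labels\<close>

context label_rates
begin

lemma label_interval_tendsto:
  assumes "I = UNIV \<or> (\<exists>a b. a \<le> b \<and> I = {a<..b})"
  shows "(\<lambda>n. \<Sum>u\<in>{u\<in>{n0 n<..n}. label_pos n u \<in> I}. label_weight n u) \<longlonglongrightarrow> measure std_normal_distribution I"
  using eventually_good label_weight_nonneg
  by (intro discrete_levy_normal_interval label_char_tendsto assms) (auto elim: eventually_mono)

text \<open>A factor subexponential in \<open>d\<close> is below any power of \<open>n\<close>,
  since \<open>d\<close> is at most of order \<open>ln n\<close>.\<close>

lemma moment_ratio: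
  assumes "0 < \<eta>"
  shows "eventually (\<lambda>n. (1 / \<theta>) ^ d n \<le> real n powr \<eta> * geo_moment (d n)) sequentially"
proof -
  \<comment> \<open>The \<open>+ 1\<close> keeps the quotient meaningful for
    \<open>c' = 0\<close>.\<close>
  define e where "e = \<eta> / (c' + 1)"
  have e: "0 < e" "e * c' \<le> \<eta>" using assms c'_nonneg by (auto simp: e_def field_simps)
  have "eventually (\<lambda>n. (1 / \<theta>) ^ d n * exp (- e * real (d n)) \<le> geo_moment (d n)) sequentially"
    using filterlim_iff[THEN iffD1, OF d_top] geo_moment_subexp[OF e(1)] by blast
  then show ?thesis using d_le eventually_ge_at_top[of 1]
  proof eventually_elim
    case (elim n)
    have "e * real (d n) \<le> e * (c' * ln (real n))" using elim e by (intro mult_left_mono) auto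
    also have "\<dots> \<le> \<eta> * ln (real n)" using e elim by (simp add: mult.assoc[symmetric] mult_right_mono)
    finally have "exp (e * real (d n)) \<le> real n powr \<eta>" using elim by (simp add: powr_def)
    then have "exp (e * real (d n)) * geo_moment (d n) \<le> real n powr \<eta> * geo_moment (d n)"
      using geo_moment_pos by (simp add: mult_right_mono less_imp_le)
    moreover have "(1 / \<theta>) ^ d n \<le> exp (e * real (d n)) * geo_moment (d n)"
    proof -
      have "exp (e * real (d n)) * ((1 / \<theta>) ^ d n * exp (- e * real (d n))) \<le> exp (e * real (d n)) * geo_moment (d n)"
        by (rule mult_left_mono[OF elim(1)]) simp
      moreover have "exp (e * real (d n)) * ((1 / \<theta>) ^ d n * exp (- e * real (d n))) = (1 / \<theta>) ^ d n"
      proof -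
        have "exp x * (X * exp (- x)) = X" for x X :: real by (simp add: exp_minus)
        then show ?thesis by (simp only: mult_minus_left)
      qed
      ultimately show ?thesis by (simp only:)
    qed
    ultimately show ?case by simp
  qed
qed

text \<open>Chernoff bound with \<open>z = \<theta>\<close>: then \<open>(z - 1) p \<le> c\<close>,
  and the product is of order \<open>n / n0\<close> for every label beyond the cutoff. Small
  individual weights later rule out coincidences among the labels.\<close>

lemma label_weight_le:
  assumes good: "good_n n" and u: "u \<in> {n0 n<..n}"
  shows "label_weight n u \<le> 2 * (1 / \<theta>) ^ d n / (real (n0 n) * geo_moment (d n))"
proof -
  interpret harmonic_rates c "n0 n" by (rule good_nD(1)[OF good])
  have n: "0 < real n" "n0 n \<le> n" using good_nD[OF good] by auto
  have T: "tail_prob (p n w) u n (d n) \<le> (1 / \<theta>) ^ d n * (2 * real n / real (n0 n))" if w: "0 < w" "w \<le> 1" for w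
  proof -
    have "\<theta> ^ d n * tail_prob (p n w) u n (d n) \<le> (\<Prod>l\<in>{u..<n}. 1 + (\<theta> - 1) * p n w l)"
    proof (rule tail_prob_chernoff)
      fix l assume "u \<le> l" "l < n"
      then have l: "n0 n \<le> l" using u by simp
      show "0 \<le> p n w l \<and> p n w l \<le> 1"
        using good_nD(4)[OF good w l] rate_nonneg[OF l] w theta_gt_1 by (metis mult_nonneg_nonneg divide_nonneg_pos diff_gt_0_iff_gt less_imp_le)
    qed (use theta_gt_1 in simp)
    also have "\<dots> \<le> (\<Prod>l\<in>{u..<n}. 1 + c l)"
    proof (rule prod_mono)
      fix l assume "l \<in> {u..<n}"
      then have l: "n0 n \<le> l" using u by simp
      have "(\<theta> - 1) * p n w l = w * c l" using good_nD(4)[OF good w l] theta_gt_1 by simp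
      moreover have "w * c l \<le> 1 * c l" using w rate_nonneg[OF l] by (intro mult_right_mono) auto
      moreover have "0 \<le> w * c l" using w rate_nonneg[OF l] by simp
      ultimately show "0 \<le> 1 + (\<theta> - 1) * p n w l \<and> 1 + (\<theta> - 1) * p n w l \<le> 1 + c l" by simp
    qed
    also have "\<dots> \<le> (\<Prod>l\<in>{n0 n..<n}. 1 + c l)"
      by (rule prod_mono2) (use u rate_nonneg in auto)
    also have "\<dots> \<le> 2 * real n / real (n0 n)"
      using prod_rate_bounds(2)[OF n(2)] n0_pos by (simp add: le_divide_eq mult.commute)
    finally have "(1 / \<theta>) ^ d n * (\<theta> ^ d n * tail_prob (p n w) u n (d n)) \<le> (1 / \<theta>) ^ d n * (2 * real n / real (n0 n))"
      using theta_gt_1 by (intro mult_left_mono) auto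
    then show ?thesis using theta_gt_1 by (simp add: power_one_over)
  qed
  have "(\<integral>w. tail_prob (p n w) u n (d n) \<partial>\<mu>) \<le> (\<integral>w. (1 / \<theta>) ^ d n * (2 * real n / real (n0 n)) \<partial>\<mu>)"
    by (rule integral_mono_AE[OF integrable_tail[OF good u]])
      (use AE_weight_pos AE_weight_le_1 in \<open>simp, eventually_elim, use T in simp\<close>)
  then have "label_weight n u \<le> (1 / \<theta>) ^ d n * (2 * real n / real (n0 n)) / (real n * geo_moment (d n))"
    unfolding label_weight_def using n geo_moment_pos[of "d n"] prob_space by (intro divide_right_mono) auto
  then show ?thesis using n by (simp add: mult_ac)
qed

lemma max_label_weight_tendsto:
  "(\<lambda>n. 2 * (1 / \<theta>) ^ d n / (real (n0 n) * geo_moment (d n))) \<longlonglongrightarrow> 0"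
proof (rule Lim_null_comparison)
  show "(\<lambda>n. 2 * real n powr (- \<delta> / 2)) \<longlonglongrightarrow> 0" using delta by real_asymp
  show "eventually (\<lambda>n. norm (2 * (1 / \<theta>) ^ d n / (real (n0 n) * geo_moment (d n))) \<le> 2 * real n powr (- \<delta> / 2)) sequentially"
    using moment_ratio[OF half_gt_zero[OF delta(1)]] eventually_gt_at_top[of 0]
  proof eventually_elim
    case (elim n)
    have G: "0 < geo_moment (d n)" by (rule geo_moment_pos)
    have n: "0 < real n powr \<delta>" "real n powr \<delta> \<le> real (n0 n)" using elim cutoff_bounds by auto
    have "2 * (1 / \<theta>) ^ d n / (real (n0 n) * geo_moment (d n))
       \<le> 2 * (real n powr (\<delta> / 2) * geo_moment (d n)) / (real n powr \<delta> * geo_moment (d n))"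
      using elim(1) G n delta by (intro frac_le mult_left_mono mult_right_mono mult_pos_pos) auto
    also have "\<dots> = 2 * (real n powr (\<delta> / 2) / real n powr \<delta>)" using G by simp
    also have "real n powr (\<delta> / 2) / real n powr \<delta> = real n powr (- \<delta> / 2)"
      by (simp add: powr_diff[symmetric])
    finally show ?case using G theta_gt_1 by simp
  qed
qed

text \<open>Chernoff bound with \<open>z < \<theta>\<close>. Summing over the labels up to the
  cutoff gains \<open>(n0 / n)^\<eta>\<close> and loses \<open>(\<theta> / z)^d\<close>, at most
  \<open>n\<close> to the power \<open>c' (\<theta> - 1) / z * \<eta>\<close>; the poorly controlled
  rates below the cutoff lose a further \<open>n^\<epsilon>\<close>. \<open>gap\<close> says that
  the gain prevails.\<close>

lemma small_labels_negligible:
  fixes z \<epsilon> C0 :: real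
  assumes z: "1 \<le> z" "z < \<theta>"
  defines "\<eta> \<equiv> (\<theta> - z) / (\<theta> - 1)"
  assumes gap: "c' * (\<theta> - 1) / z * \<eta> + \<epsilon> < \<eta> * (1 - \<delta>)"
    and p01: "eventually (\<lambda>n. \<forall>w l. 0 < w \<longrightarrow> w \<le> 1 \<longrightarrow> l < n0 n \<longrightarrow> 0 \<le> p n w l \<and> p n w l \<le> 1) sequentially"
    and sum_p: "eventually (\<lambda>n. \<forall>w. 0 < w \<longrightarrow> w \<le> 1 \<longrightarrow> (\<Sum>l\<in>{1..<n0 n}. p n w l) \<le> \<epsilon> * ln (real n) + C0) sequentially"
  shows "(\<lambda>n. \<Sum>u\<in>{1..n0 n}. label_weight n u) \<longlonglongrightarrow> 0"
proof -
  have \<eta>: "0 < \<eta>" "\<eta> \<le> 1" using z by (auto simp: \<eta>_def field_simps)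
  define g where "g = \<eta> * (1 - \<delta>) - (c' * (\<theta> - 1) / z * \<eta> + \<epsilon>)"
  have g: "0 < g" using gap by (simp add: g_def)
  define K where "K = exp (C0 + 1) * 2 powr \<eta>"
  have K: "0 < K" by (simp add: K_def)
  show ?thesis
  proof (rule Lim_null_comparison)
    show "(\<lambda>n. K * real n powr (- g / 2)) \<longlonglongrightarrow> 0" using g by real_asymp
    show "eventually (\<lambda>n. norm (\<Sum>u\<in>{1..n0 n}. label_weight n u) \<le> K * real n powr (- g / 2)) sequentially"
      using eventually_good p01 sum_p moment_ratio[OF half_gt_zero[OF g]] d_le eventually_gt_at_top[of 1]
    proof eventually_elim
      case (elim n)
      note good = elim(1)
      interpret harmonic_rates c "n0 n" by (rule good_nD(1)[OF good])
      have n: "1 < real n" "n0 n \<le> n" using elim good_nD[OF good] by auto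
      define D where "D = d n"
      define G where "G = geo_moment D"
      define B where "B = (1 / z) ^ D * (exp (\<epsilon> * ln (real n) + C0) * (exp 1 * (real n / real (n0 n)) powr (1 - \<eta>)))"
      have z0: "0 < z" using z by simp
      have \<eta>': "(z - 1) / (\<theta> - 1) = 1 - \<eta>" using theta_gt_1 by (simp add: \<eta>_def field_simps)
      have p_bounds: "0 \<le> p n w l \<and> p n w l \<le> 1" if w: "0 < w" "w \<le> 1" for w l
      proof (cases "l < n0 n")
        case True then show ?thesis using elim(2) w by blast
      next
        case False
        then show ?thesis using good_nD(4)[OF good w, of l] rate_nonneg[of l] w theta_gt_1
          by (metis mult_nonneg_nonneg divide_nonneg_pos diff_gt_0_iff_gt less_imp_le not_less)
      qed
      have T: "0 \<le> tail_prob (p n w) u n D \<and> tail_prob (p n w) u n D \<le> B" if w: "0 < w" "w \<le> 1" and u: "1 \<le> u" for w u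
      proof
        show "0 \<le> tail_prob (p n w) u n D" using tail_prob_bounds[of u n "p n w"] p_bounds[OF w] by blast
        have pos: "1 \<le> 1 + (z - 1) * p n w l" for l using p_bounds[OF w, of l] z by simp
        have "z ^ D * tail_prob (p n w) u n D \<le> (\<Prod>l\<in>{u..<n}. 1 + (z - 1) * p n w l)"
          using tail_prob_chernoff[of u n "p n w" z D] p_bounds[OF w] z by blast
        also have "\<dots> \<le> (\<Prod>l\<in>{1..<n}. 1 + (z - 1) * p n w l)"
        proof (rule prod_mono2)
          show "0 \<le> 1 + (z - 1) * p n w l" for l using pos[of l] by simp
        qed (use u pos in auto)
        also have "{1..<n} = {1..<n0 n} \<union> {n0 n..<n}" using n0_pos n by auto
        also have "(\<Prod>l\<in>\<dots>. 1 + (z - 1) * p n w l)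
           = (\<Prod>l\<in>{1..<n0 n}. 1 + (z - 1) * p n w l) * (\<Prod>l\<in>{n0 n..<n}. 1 + (z - 1) * p n w l)"
          by (rule prod.union_disjoint) auto
        also have "\<dots> \<le> exp (\<epsilon> * ln (real n) + C0) * (exp 1 * (real n / real (n0 n)) powr (1 - \<eta>))"
        proof (rule mult_mono)
          have "(\<Prod>l\<in>{1..<n0 n}. 1 + (z - 1) * p n w l) \<le> (\<Prod>l\<in>{1..<n0 n}. exp (p n w l))"
          proof (rule prod_mono, rule conjI)
            fix l
            \<comment> \<open>Here \<open>z - 1 \<le> 1\<close>, since
              \<open>z < \<theta> \<le> 2\<close>.\<close>
            have "1 + (z - 1) * p n w l \<le> 1 + 1 * p n w l"
              using p_bounds[OF w, of l] z theta_le_2 by (intro add_mono mult_right_mono) auto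
            also have "\<dots> \<le> exp (p n w l)" using exp_ge_add_one_self[of "p n w l"] by simp
            finally show "1 + (z - 1) * p n w l \<le> exp (p n w l)" .
            show "0 \<le> 1 + (z - 1) * p n w l" using pos[of l] by simp
          qed
          also have "\<dots> = exp (\<Sum>l\<in>{1..<n0 n}. p n w l)" by (simp add: exp_sum)
          also have "\<dots> \<le> exp (\<epsilon> * ln (real n) + C0)" using elim(3) w by simp
          finally show "(\<Prod>l\<in>{1..<n0 n}. 1 + (z - 1) * p n w l) \<le> exp (\<epsilon> * ln (real n) + C0)" .
          have "(\<Prod>l\<in>{n0 n..<n}. 1 + (z - 1) * p n w l) \<le> (\<Prod>l\<in>{n0 n..<n}. 1 + (1 - \<eta>) * c l)"
          proof (rule prod_mono, rule conjI)
            fix l assume "l \<in> {n0 n..<n}"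
            then have l: "n0 n \<le> l" by simp
            have "(z - 1) * p n w l = w * ((1 - \<eta>) * c l)"
              using good_nD(4)[OF good w l] \<eta>'[symmetric] by simp
            also have "\<dots> \<le> 1 * ((1 - \<eta>) * c l)" using w rate_nonneg[OF l] \<eta> by (intro mult_right_mono) auto
            finally show "1 + (z - 1) * p n w l \<le> 1 + (1 - \<eta>) * c l" by simp
            show "0 \<le> 1 + (z - 1) * p n w l" using pos[of l] by simp
          qed
          also have "\<dots> \<le> exp (1 - \<eta>) * (real n / real (n0 n)) powr (1 - \<eta>)"
            using prod_rate_le[OF n(2), of "1 - \<eta>"] \<eta> by simp
          also have "\<dots> \<le> exp 1 * (real n / real (n0 n)) powr (1 - \<eta>)"
            using \<eta> by (intro mult_right_mono) auto
          finally show "(\<Prod>l\<in>{n0 n..<n}. 1 + (z - 1) * p n w l) \<le> exp 1 * (real n / real (n0 n)) powr (1 - \<eta>)" .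
          show "0 \<le> (\<Prod>l\<in>{n0 n..<n}. 1 + (z - 1) * p n w l)"
            by (intro prod_nonneg) (use pos in \<open>meson order_trans zero_le_one\<close>)
        qed simp
        finally show "tail_prob (p n w) u n D \<le> B"
        proof -
          assume "z ^ D * tail_prob (p n w) u n D \<le> exp (\<epsilon> * ln (real n) + C0) * (exp 1 * (real n / real (n0 n)) powr (1 - \<eta>))"
          then have "(1 / z) ^ D * (z ^ D * tail_prob (p n w) u n D) \<le> B"
            unfolding B_def using z0 by (intro mult_left_mono) auto
          then show ?thesis using z0 by (simp add: power_one_over)
        qed
      qed
      have int: "0 \<le> (\<integral>w. tail_prob (p n w) u n D \<partial>\<mu>) \<and> (\<integral>w. tail_prob (p n w) u n D \<partial>\<mu>) \<le> B" if u: "1 \<le> u" for u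
      proof
        show "0 \<le> (\<integral>w. tail_prob (p n w) u n D \<partial>\<mu>)"
          by (rule integral_nonneg_AE) (use AE_weight_pos AE_weight_le_1 in \<open>eventually_elim, use T u in auto\<close>)
        have "(\<integral>w. tail_prob (p n w) u n D \<partial>\<mu>) \<le> (\<integral>w. B \<partial>\<mu>)"
        proof (rule integral_mono_AE)
          show "integrable \<mu> (\<lambda>w. tail_prob (p n w) u n D)"
            by (rule integrable_bounded_measurable[where B=B]) (use T u in auto)
          show "AE w in \<mu>. tail_prob (p n w) u n D \<le> B"
            using AE_weight_pos AE_weight_le_1 by eventually_elim (use T u in auto)
        qed simp
        then show "(\<integral>w. tail_prob (p n w) u n D \<partial>\<mu>) \<le> B" using prob_space by simp
      qed
      have G: "0 < G" by (simp add: G_def geo_moment_pos)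
      have nn: "0 \<le> (\<Sum>u\<in>{1..n0 n}. label_weight n u)"
        using int G n unfolding label_weight_def G_def[symmetric] D_def[symmetric] by (intro sum_nonneg) auto
      have "(\<Sum>u\<in>{1..n0 n}. label_weight n u) \<le> (\<Sum>u\<in>{1..n0 n}. B / (real n * G))"
        using int G n unfolding label_weight_def G_def D_def[symmetric]
        by (intro sum_mono divide_right_mono) auto
      also have "\<dots> = real (n0 n) / real n * (B / G)" by simp
      also have "\<dots> \<le> K * real n powr (- g / 2)"
      proof -
        have A1: "real (n0 n) / real n * (real n / real (n0 n)) powr (1 - \<eta>) = (real (n0 n) / real n) powr \<eta>"
        proof -
          have "(real n / real (n0 n)) powr (1 - \<eta>) = (real n / real (n0 n)) * (real n / real (n0 n)) powr (- \<eta>)"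
            using n n0_pos by (simp add: powr_diff powr_minus divide_inverse)
          also have "(real n / real (n0 n)) powr (- \<eta>) = (real (n0 n) / real n) powr \<eta>"
            using n n0_pos by (simp add: powr_minus powr_divide)
          finally show ?thesis using n n0_pos by simp
        qed
        have A2: "(real (n0 n) / real n) powr \<eta> \<le> 2 powr \<eta> * real n powr (- (\<eta> * (1 - \<delta>)))"
        proof -
          have "real (n0 n) \<le> 2 * real n powr \<delta>"
            using cutoff_bounds(2)[of \<delta> n] ge_one_powr_ge_zero[of "real n" \<delta>] n delta by linarith
          then have "real (n0 n) / real n \<le> 2 * real n powr \<delta> / real n" by (rule divide_right_mono) simp
          also have "\<dots> = 2 * real n powr (\<delta> - 1)" using n by (simp add: powr_diff)
          finally have "(real (n0 n) / real n) powr \<eta> \<le> (2 * real n powr (\<delta> - 1)) powr \<eta>"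
            using \<eta> by (intro powr_mono2) auto
          also have "\<dots> = 2 powr \<eta> * real n powr (- (\<eta> * (1 - \<delta>)))"
            by (simp add: powr_mult powr_powr algebra_simps)
          finally show ?thesis .
        qed
        \<comment> \<open>Write \<open>\<theta> / z = 1 + (\<theta> - z) / z\<close> with
          \<open>\<theta> - z = (\<theta> - 1) \<eta>\<close>. The remaining
          \<open>\<theta>^-D / G\<close> is subpolynomial and may use up half of the gap
          \<open>g\<close>.\<close>
        have A3: "(1 / z) ^ D / G \<le> real n powr (c' * (\<theta> - 1) / z * \<eta> + g / 2)"
        proof -
          have "(\<theta> / z) ^ D \<le> exp ((\<theta> - z) / z) ^ D"
            using z0 z exp_ge_add_one_self[of "(\<theta> - z) / z"] by (intro power_mono) (auto simp: field_simps)
          also have "\<dots> = exp (real D * ((\<theta> - z) / z))" by (simp only: exp_of_nat_mult)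
          also have "\<dots> \<le> exp (c' * ln (real n) * ((\<theta> - z) / z))"
            unfolding exp_le_cancel_iff using elim(5) z z0 by (intro mult_right_mono) (auto simp: D_def)
          also have "c' * ln (real n) * ((\<theta> - z) / z) = (c' * (\<theta> - 1) / z * \<eta>) * ln (real n)"
            using theta_gt_1 by (simp add: \<eta>_def)
          also have "exp \<dots> = real n powr (c' * (\<theta> - 1) / z * \<eta>)" using n by (simp add: powr_def)
          finally have "(\<theta> / z) ^ D \<le> real n powr (c' * (\<theta> - 1) / z * \<eta>)" .
          moreover have "(1 / \<theta>) ^ D / G \<le> real n powr (g / 2)"
            using elim(4) G by (simp add: D_def G_def divide_le_eq)
          ultimately have "(\<theta> / z) ^ D * ((1 / \<theta>) ^ D / G) \<le> real n powr (c' * (\<theta> - 1) / z * \<eta>) * real n powr (g / 2)"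
            using G theta_gt_1 by (intro mult_mono) auto
          moreover have "(\<theta> / z) ^ D * ((1 / \<theta>) ^ D / G) = (1 / z) ^ D / G"
            using theta_gt_1 by (simp add: power_divide)
          ultimately show ?thesis by (metis powr_add)
        qed
        have "real (n0 n) / real n * (B / G) = exp (C0 + 1) * real n powr \<epsilon> * ((1 / z) ^ D / G) *
           (real (n0 n) / real n * (real n / real (n0 n)) powr (1 - \<eta>))"
          using n by (simp add: B_def exp_add powr_def[of "real n" \<epsilon>] mult_ac)
        also have "\<dots> \<le> exp (C0 + 1) * real n powr \<epsilon> * real n powr (c' * (\<theta> - 1) / z * \<eta> + g / 2)
             * (2 powr \<eta> * real n powr (- (\<eta> * (1 - \<delta>))))"
          unfolding A1 using A2 A3 z0 G by (intro mult_mono mult_left_mono) auto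
        also have "\<dots> = K * (real n powr \<epsilon> * real n powr (c' * (\<theta> - 1) / z * \<eta> + g / 2) * real n powr (- (\<eta> * (1 - \<delta>))))"
          by (simp add: K_def)
        also have "real n powr \<epsilon> * real n powr (c' * (\<theta> - 1) / z * \<eta> + g / 2) * real n powr (- (\<eta> * (1 - \<delta>)))
           = real n powr (\<epsilon> + (c' * (\<theta> - 1) / z * \<eta> + g / 2) + (- (\<eta> * (1 - \<delta>))))"
          by (simp only: powr_add)
        also have "\<epsilon> + (c' * (\<theta> - 1) / z * \<eta> + g / 2) + (- (\<eta> * (1 - \<delta>))) = - g / 2"
          by (simp add: g_def field_simps)
        finally show ?thesis .
      qed
      finally show ?case using nn by simp
    qed
  qed
qed

end

section \<open>Comparison of the tree with independent edges\<close>

lemma sum_prod_remove_nonneg: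
  fixes a b x :: "'i \<Rightarrow> real"
  assumes "finite I" "\<And>i. i \<in> I \<Longrightarrow> 0 \<le> a i" "\<And>i. i \<in> I \<Longrightarrow> 0 \<le> b i" "\<And>i. i \<in> I \<Longrightarrow> 0 \<le> x i"
  shows "0 \<le> (\<Sum>i\<in>I. x i * b i * (\<Prod>j\<in>I - {i}. a j))"
  using assms by (intro sum_nonneg mult_nonneg_nonneg prod_nonneg) auto

lemma sum_prod_remove_insert:
  fixes a b x :: "'i \<Rightarrow> real"
  assumes "finite I" "k \<notin> I"
  shows "(\<Sum>i\<in>insert k I. x i * b i * (\<Prod>j\<in>insert k I - {i}. a j))
    = x k * b k * (\<Prod>j\<in>I. a j) + a k * (\<Sum>i\<in>I. x i * b i * (\<Prod>j\<in>I - {i}. a j))"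
proof -
  have "(\<Prod>j\<in>insert k I - {i}. a j) = a k * (\<Prod>j\<in>I - {i}. a j)" if "i \<in> I" for i
  proof -
    have "insert k I - {i} = insert k (I - {i})" using assms that by auto
    then show ?thesis using assms by simp
  qed
  then have "(\<Sum>i\<in>I. x i * b i * (\<Prod>j\<in>insert k I - {i}. a j)) = a k * (\<Sum>i\<in>I. x i * b i * (\<Prod>j\<in>I - {i}. a j))"
    by (simp add: sum_distrib_left mult_ac)
  moreover have "insert k I - {k} = I" using assms by auto
  ultimately show ?thesis using assms by simp
qed

text \<open>Mixed terms of the product are nonnegative and dropped. The tree produces exactly the
  first-order expression on the left, since one edge reaches only one vertex.\<close>

lemma prod_linear_lower:
  fixes a b x :: "'i \<Rightarrow> real"
  assumes "finite I" "\<And>i. i \<in> I \<Longrightarrow> 0 \<le> a i" "\<And>i. i \<in> I \<Longrightarrow> 0 \<le> b i" "\<And>i. i \<in> I \<Longrightarrow> 0 \<le> x i"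
  shows "(\<Prod>i\<in>I. a i) + (\<Sum>i\<in>I. x i * b i * (\<Prod>j\<in>I - {i}. a j)) \<le> (\<Prod>i\<in>I. a i + x i * b i)"
  using assms
proof (induction I rule: finite_induct)
  case (insert k I)
  let ?L = "\<Sum>i\<in>I. x i * b i * (\<Prod>j\<in>I - {i}. a j)" and ?A = "\<Prod>i\<in>I. a i"
  have L: "0 \<le> ?L" using insert by (intro sum_prod_remove_nonneg) auto
  have "(\<Prod>i\<in>insert k I. a i) + (\<Sum>i\<in>insert k I. x i * b i * (\<Prod>j\<in>insert k I - {i}. a j))
     = (a k + x k * b k) * ?A + a k * ?L"
    unfolding sum_prod_remove_insert[OF insert.hyps] using insert.hyps by (simp add: algebra_simps)
  also have "\<dots> \<le> (a k + x k * b k) * (?A + ?L)"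
    using L insert.prems by (simp add: distrib_left distrib_right)
  also have "\<dots> \<le> (a k + x k * b k) * (\<Prod>i\<in>I. a i + x i * b i)"
    using insert by (intro mult_left_mono) auto
  finally show ?case using insert by simp
qed simp

text \<open>The induction carries three bounds at once: a new factor multiplies the old linear part,
  which is bounded by \<open>(\<Sum>i\<in>I. x i)\<close> times the full product, and that yields
  the quadratic term; the constant part is bounded by the full product.\<close>

lemma prod_linear_upper:
  fixes a b x :: "'i \<Rightarrow> real"
  assumes "finite I" "\<And>i. i \<in> I \<Longrightarrow> 0 \<le> a i" "\<And>i. i \<in> I \<Longrightarrow> 0 \<le> b i" "\<And>i. i \<in> I \<Longrightarrow> 0 \<le> x i \<and> x i \<le> 1"
  shows "(\<Prod>i\<in>I. a i + x i * b i) \<le> (\<Prod>i\<in>I. a i) + (\<Sum>i\<in>I. x i * b i * (\<Prod>j\<in>I - {i}. a j))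
     + (\<Sum>i\<in>I. x i)\<^sup>2 * (\<Prod>i\<in>I. a i + b i)"
proof -
  have "(\<Prod>i\<in>I. a i + x i * b i) \<le> (\<Prod>i\<in>I. a i) + (\<Sum>i\<in>I. x i * b i * (\<Prod>j\<in>I - {i}. a j))
     + (\<Sum>i\<in>I. x i)\<^sup>2 * (\<Prod>i\<in>I. a i + b i) \<and>
     (\<Sum>i\<in>I. x i * b i * (\<Prod>j\<in>I - {i}. a j)) \<le> (\<Sum>i\<in>I. x i) * (\<Prod>i\<in>I. a i + b i) \<and> (\<Prod>i\<in>I. a i) \<le> (\<Prod>i\<in>I. a i + b i)"
    using assms
  proof (induction I rule: finite_induct)
    case (insert k I)
    let ?L = "\<Sum>i\<in>I. x i * b i * (\<Prod>j\<in>I - {i}. a j)" and ?A = "\<Prod>i\<in>I. a i" and ?Q = "\<Prod>i\<in>I. a i + b i" and ?P = "\<Sum>i\<in>I. x i"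
    have IH: "(\<Prod>i\<in>I. a i + x i * b i) \<le> ?A + ?L + ?P\<^sup>2 * ?Q" "?L \<le> ?P * ?Q" "?A \<le> ?Q"
      using insert.IH insert.prems by auto
    have k: "0 \<le> a k" "0 \<le> b k" "0 \<le> x k" "x k \<le> 1" using insert.prems by auto
    have Q: "0 \<le> ?Q" using insert.prems by (intro prod_nonneg) auto
    have P: "0 \<le> ?P" using insert.prems by (intro sum_nonneg) auto
    have A: "0 \<le> ?A" using insert.prems by (intro prod_nonneg) auto
    have xb: "x k * b k \<le> b k" "0 \<le> x k * b k" using k mult_right_mono[of "x k" 1 "b k"] by auto
    have 1: "(a k + x k * b k) * (\<Prod>i\<in>I. a i + x i * b i) \<le> a k * ?A + (x k * b k * ?A + a k * ?L) + (x k + ?P)\<^sup>2 * ((a k + b k) * ?Q)"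
    proof -
      have "(a k + x k * b k) * (\<Prod>i\<in>I. a i + x i * b i) \<le> (a k + x k * b k) * (?A + ?L + ?P\<^sup>2 * ?Q)"
        using k IH xb by (intro mult_left_mono) auto
      also have "\<dots> = a k * ?A + (x k * b k * ?A + a k * ?L) + (x k * b k) * ?L + (a k + x k * b k) * (?P\<^sup>2 * ?Q)"
        by (simp add: algebra_simps)
      also have "(x k * b k) * ?L \<le> (x k * b k) * (?P * ?Q)" using IH xb by (intro mult_left_mono) auto
      also have "(x k * b k) * (?P * ?Q) \<le> x k * (a k + b k) * (?P * ?Q)"
        using k P Q by (intro mult_right_mono mult_left_mono) auto
      also have "(a k + x k * b k) * (?P\<^sup>2 * ?Q) \<le> (a k + b k) * (?P\<^sup>2 * ?Q)"
        using xb Q by (intro mult_right_mono) auto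
      finally have "(a k + x k * b k) * (\<Prod>i\<in>I. a i + x i * b i)
         \<le> a k * ?A + (x k * b k * ?A + a k * ?L) + (x k * ?P + ?P\<^sup>2) * ((a k + b k) * ?Q)"
        by (simp add: algebra_simps)
      also have "(x k * ?P + ?P\<^sup>2) * ((a k + b k) * ?Q) \<le> (x k + ?P)\<^sup>2 * ((a k + b k) * ?Q)"
        using k P Q by (intro mult_right_mono) (auto simp: power2_eq_square algebra_simps)
      finally show ?thesis by simp
    qed
    have 2: "x k * b k * ?A + a k * ?L \<le> (x k + ?P) * ((a k + b k) * ?Q)"
    proof -
      have "x k * b k * ?A \<le> x k * b k * ?Q" using IH xb by (intro mult_left_mono) auto
      moreover have "a k * ?L \<le> a k * (?P * ?Q)" using IH k by (intro mult_left_mono) auto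
      moreover have "0 \<le> x k * (a k * ?Q) + ?P * (b k * ?Q)" using k P Q by simp
      ultimately show ?thesis by (simp add: algebra_simps)
    qed
    have 3: "a k * ?A \<le> (a k + b k) * ?Q" using k IH A Q by (intro mult_mono) auto
    show ?case unfolding sum_prod_remove_insert[OF insert.hyps] using 1 2 3 insert.hyps by simp
  qed simp
  then show ?thesis by simp
qed

section \<open>History sigma-algebras and the attachment rule\<close>

context weighted_recursive_tree
begin

lemma W_measurable [measurable]: "1 \<le> j \<Longrightarrow> W j \<in> borel_measurable M"
  using weights_indep unfolding indep_vars_def by auto

lemma history_map_measurable:
  assumes "J \<subseteq> {2..}"
  shows "(\<lambda>\<omega>. (\<lambda>j\<in>{1..}. W j \<omega>, \<lambda>m\<in>J. par m \<omega>)) \<in> M \<rightarrow>\<^sub>M ((\<Pi>\<^sub>M j\<in>{1..}. borel) \<Otimes>\<^sub>M (\<Pi>\<^sub>M m\<in>J. count_space UNIV))"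
proof (rule measurable_Pair)
  show "(\<lambda>\<omega>. \<lambda>j\<in>{1..}. W j \<omega>) \<in> M \<rightarrow>\<^sub>M (\<Pi>\<^sub>M j\<in>{1..}. borel)"
    by (rule measurable_restrict) simp
  show "(\<lambda>\<omega>. \<lambda>m\<in>J. par m \<omega>) \<in> M \<rightarrow>\<^sub>M (\<Pi>\<^sub>M m\<in>J. count_space UNIV)"
    by (rule measurable_restrict) (use assms par_measurable in auto)
qed

lemma space_history [simp]: "space (history M W par J) = space M"
  by (simp add: history_def)

lemma subalgebra_history: "J \<subseteq> {2..} \<Longrightarrow> subalgebra M (history M W par J)"
  unfolding subalgebra_def history_def
  using measurable_sets[OF history_map_measurable] history_map_measurable[THEN measurable_space]
  by (auto simp: sets_vimage_algebra2 Pi_def)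

lemma history_map_history:
  "(\<lambda>\<omega>. (\<lambda>j\<in>{1..}. W j \<omega>, \<lambda>m\<in>J. par m \<omega>)) \<in> history M W par J \<rightarrow>\<^sub>M ((\<Pi>\<^sub>M j\<in>{1..}. borel) \<Otimes>\<^sub>M (\<Pi>\<^sub>M m\<in>J. count_space UNIV))"
  unfolding history_def by (rule measurable_vimage_algebra1) (auto simp: space_pair_measure space_PiM)

lemma W_history [measurable]: "1 \<le> j \<Longrightarrow> W j \<in> borel_measurable (history M W par J)"
proof -
  assume j: "1 \<le> j"
  have "(\<lambda>\<omega>. fst (\<lambda>j\<in>{1..}. W j \<omega>, \<lambda>m\<in>J. par m \<omega>) j) \<in> borel_measurable (history M W par J)"
    by (rule measurable_compose[OF measurable_compose[OF history_map_history measurable_fst] measurable_component_singleton])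
      (use j in auto)
  then show ?thesis using j by simp
qed

lemma par_history: "m \<in> J \<Longrightarrow> par m \<in> history M W par J \<rightarrow>\<^sub>M count_space UNIV"
proof -
  assume m: "m \<in> J"
  have "(\<lambda>\<omega>. snd (\<lambda>j\<in>{1..}. W j \<omega>, \<lambda>m\<in>J. par m \<omega>) m) \<in> history M W par J \<rightarrow>\<^sub>M count_space UNIV"
    by (rule measurable_compose[OF measurable_compose[OF history_map_history measurable_snd] measurable_component_singleton[OF m]])
  then show ?thesis using m by simp
qed

definition deg :: "nat \<Rightarrow> nat \<Rightarrow> 'a \<Rightarrow> nat" where
  "deg l u \<omega> = card {m \<in> {2..l}. par m \<omega> = u}"

lemma deg_1 [simp]: "deg (Suc 0) u \<omega> = 0" by (simp add: deg_def)

lemma deg_Suc: "1 \<le> l \<Longrightarrow> deg (Suc l) u \<omega> = deg l u \<omega> + of_bool (par (Suc l) \<omega> = u)"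
proof -
  assume l: "1 \<le> l"
  have "{m \<in> {2..Suc l}. par m \<omega> = u} = {m \<in> {2..l}. par m \<omega> = u} \<union> (if par (Suc l) \<omega> = u then {Suc l} else {})"
    using l by (auto simp: le_Suc_eq)
  then show ?thesis by (auto simp: deg_def card_insert_if)
qed

lemma deg_history: assumes "{2..l} \<subseteq> J" shows "deg l u \<in> history M W par J \<rightarrow>\<^sub>M count_space UNIV"
proof -
  have "deg l u = (\<lambda>\<omega>. \<Sum>m\<in>{2..l}. if par m \<omega> = u then 1 else 0)"
    by (auto simp: deg_def sum.If_cases fun_eq_iff Int_def)
  moreover have "(\<lambda>\<omega>. if par m \<omega> = u then 1 else 0 :: nat) \<in> history M W par J \<rightarrow>\<^sub>M count_space UNIV" if "m \<in> {2..l}" for m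
    by (rule measurable_compose[OF par_history]) (use assms that in auto)
  ultimately show ?thesis by (simp only:) (intro measurable_sum_nat, auto)
qed

lemma AE_W_pos: "1 \<le> j \<Longrightarrow> AE \<omega> in M. 0 < W j \<omega>"
proof -
  assume j: "1 \<le> j"
  have "AE w in \<mu>. w \<in> {0<..}" by (rule law.AE_prob_1[OF law_pos])
  then have "AE w in distr M borel (W j). w \<in> {0<..}" unfolding weights_distr[OF j] .
  from AE_distrD[OF W_measurable[OF j] this] show ?thesis by simp
qed

lemma AE_W_pos_all: "AE \<omega> in M. \<forall>j\<ge>1. 0 < W j \<omega>"
  using AE_W_pos by (simp add: AE_all_countable)

definition wsum :: "nat \<Rightarrow> 'a \<Rightarrow> real" where "wsum n \<omega> = (\<Sum>j=1..n. W j \<omega>)"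

lemma wsum_history [measurable]: "wsum n \<in> borel_measurable (history M W par J)"
  unfolding wsum_def by (intro borel_measurable_sum W_history) auto

text \<open>The attachment rule in integrated form, tested against a bounded history-measurable
  factor. Later arguments use conditional expectation only through this identity.\<close>

lemma attachment_integral:
  assumes n: "1 \<le> n" "i \<in> {1..n}" and f: "f \<in> borel_measurable (history M W par {2..n})"
    and bounded: "AE \<omega> in M. \<bar>f \<omega>\<bar> \<le> B"
  shows "(\<integral>\<omega>. f \<omega> * indicator {\<omega> \<in> space M. par (Suc n) \<omega> = i} \<omega> \<partial>M) = (\<integral>\<omega>. f \<omega> * (W i \<omega> / wsum n \<omega>) \<partial>M)"
proof -
  let ?F = "history M W par {2..n}"
  let ?g = "indicator {\<omega> \<in> space M. par (Suc n) \<omega> = i} :: 'a \<Rightarrow> real"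
  have sub: "subalgebra M ?F" by (rule subalgebra_history) auto
  interpret S: finite_measure_subalgebra M ?F
    by unfold_locales (rule sub)
  have fM: "f \<in> borel_measurable M" by (rule measurable_from_subalg[OF sub f])
  have g: "?g \<in> borel_measurable M"
  proof -
    have "{\<omega> \<in> space M. par (Suc n) \<omega> = i} \<in> sets M"
      using measurable_sets[OF par_measurable[of "Suc n"], of "{i}"] n by (simp add: vimage_def Int_def conj_commute)
    then show ?thesis by simp
  qed
  have int: "integrable M (\<lambda>\<omega>. f \<omega> * ?g \<omega>)"
  proof (rule integrable_const_bound[where B=B])
    show "AE \<omega> in M. norm (f \<omega> * ?g \<omega>) \<le> B"
      using bounded by eventually_elim (auto simp: indicator_def)
  qed (intro borel_measurable_times fM g)
  have "(\<integral>\<omega>. f \<omega> * ?g \<omega> \<partial>M) = (\<integral>\<omega>. f \<omega> * real_cond_exp M ?F ?g \<omega> \<partial>M)"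
    by (rule S.real_cond_exp_intg(2)[OF int f g, symmetric])
  also have "\<dots> = (\<integral>\<omega>. f \<omega> * (W i \<omega> / wsum n \<omega>) \<partial>M)"
  proof (rule integral_cong_AE)
    show "(\<lambda>\<omega>. f \<omega> * (W i \<omega> / wsum n \<omega>)) \<in> borel_measurable M"
      using n fM measurable_from_subalg[OF sub wsum_history] by (intro borel_measurable_times borel_measurable_divide) auto
    show "AE \<omega> in M. f \<omega> * real_cond_exp M ?F ?g \<omega> = f \<omega> * (W i \<omega> / wsum n \<omega>)"
      using attachment[OF n] by eventually_elim (simp add: wsum_def)
  qed (use fM in simp)
  finally show ?thesis .
qed

text \<open>The locale constrains \<open>par\<close> only through the probabilities
  \<open>W i / wsum n\<close>. For \<open>i \<le> n\<close> these add up to 1, so no mass is left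
  for other values.\<close>

lemma AE_par: "1 \<le> n \<Longrightarrow> AE \<omega> in M. par (Suc n) \<omega> \<in> {1..n}"
proof -
  assume n: "1 \<le> n"
  let ?E = "\<lambda>i. {\<omega> \<in> space M. par (Suc n) \<omega> = i}"
  have E: "?E i \<in> sets M" for i
    using measurable_sets[OF par_measurable[of "Suc n"], of "{i}"] n by (simp add: vimage_def Int_def conj_commute)
  have int: "integrable M (\<lambda>\<omega>. W i \<omega> / wsum n \<omega>)" if i: "i \<in> {1..n}" for i
  proof (rule integrable_const_bound[where B=1])
    show "AE \<omega> in M. norm (W i \<omega> / wsum n \<omega>) \<le> 1"
      using AE_W_pos_all
    proof eventually_elim
      case (elim \<omega>)
      have "W i \<omega> \<le> wsum n \<omega>" unfolding wsum_def by (rule member_le_sum) (use i elim in \<open>auto intro: less_imp_le\<close>)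
      moreover have "0 < W i \<omega>" using i elim by auto
      ultimately show ?case by (simp add: divide_le_eq_1)
    qed
    show "(\<lambda>\<omega>. W i \<omega> / wsum n \<omega>) \<in> borel_measurable M"
      unfolding wsum_def using i by (intro borel_measurable_divide borel_measurable_sum) auto
  qed
  have "prob (\<Union>i\<in>{1..n}. ?E i) = (\<Sum>i\<in>{1..n}. prob (?E i))"
    by (rule finite_measure_finite_Union) (use E in \<open>auto simp: disjoint_family_on_def\<close>)
  also have "\<dots> = (\<Sum>i\<in>{1..n}. \<integral>\<omega>. W i \<omega> / wsum n \<omega> \<partial>M)"
    using attachment_integral[OF n, of _ "\<lambda>_. 1" 1] E by (intro sum.cong) auto
  also have "\<dots> = (\<integral>\<omega>. (\<Sum>i\<in>{1..n}. W i \<omega> / wsum n \<omega>) \<partial>M)"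
    using int by (simp add: Bochner_Integration.integral_sum)
  also have "\<dots> = (\<integral>\<omega>. 1 \<partial>M)"
  proof (rule integral_cong_AE)
    show "AE \<omega> in M. (\<Sum>i\<in>{1..n}. W i \<omega> / wsum n \<omega>) = 1"
      using AE_W_pos_all
    proof eventually_elim
      case (elim \<omega>)
      have "0 < wsum n \<omega>" unfolding wsum_def by (rule sum_pos) (use n elim in auto)
      moreover have "(\<Sum>i\<in>{1..n}. W i \<omega> / wsum n \<omega>) = (\<Sum>i\<in>{1..n}. W i \<omega>) / wsum n \<omega>"
        by (simp only: sum_divide_distrib)
      moreover have "(\<Sum>i\<in>{1..n}. W i \<omega>) = wsum n \<omega>" by (simp only: wsum_def)
      ultimately show ?case by simp
    qed
  qed (use int in \<open>auto intro!: borel_measurable_sum\<close>)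
  finally have "prob (\<Union>i\<in>{1..n}. ?E i) = 1" using prob_space by simp
  then have "AE \<omega> in M. \<omega> \<in> (\<Union>i\<in>{1..n}. ?E i)" by (rule AE_prob_1)
  then show ?thesis by eventually_elim auto
qed

end

text \<open>The bounds are required on \<open>(0, 1]\<close>, where the weights lie almost
  surely.\<close>

definition rate_fun :: "(real \<Rightarrow> nat \<Rightarrow> real) \<Rightarrow> bool" where
  "rate_fun P \<longleftrightarrow> (\<forall>m. (\<lambda>w. P w m) \<in> borel_measurable borel) \<and> (\<forall>w m. 0 < w \<longrightarrow> w \<le> 1 \<longrightarrow> 0 \<le> P w m \<and> P w m \<le> 1)"

lemma rate_fun_measurable: "rate_fun P \<Longrightarrow> (\<lambda>w. P w m) \<in> borel_measurable borel"
  by (simp add: rate_fun_def)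

lemma rate_fun_bounds: "rate_fun P \<Longrightarrow> 0 < w \<Longrightarrow> w \<le> 1 \<Longrightarrow> 0 \<le> P w m \<and> P w m \<le> 1"
  by (simp add: rate_fun_def)

locale weighted_tree = weighted_recursive_tree M \<mu> W par + wl: weight_law \<mu> \<theta>
  for M :: "'a measure" and \<mu> :: "real measure" and W :: "nat \<Rightarrow> 'a \<Rightarrow> real" and par :: "nat \<Rightarrow> 'a \<Rightarrow> nat" and \<theta> :: real
begin

lemma AE_W_unit: "AE \<omega> in M. \<forall>j\<ge>1. 0 < W j \<omega> \<and> W j \<omega> \<le> 1"
proof -
  have "AE \<omega> in M. 1 \<le> j \<longrightarrow> 0 < W j \<omega> \<and> W j \<omega> \<le> 1" for j
  proof (cases "1 \<le> j")
    case True
    have "AE w in distr M borel (W j). w \<le> 1" unfolding weights_distr[OF True] by (rule wl.AE_weight_le_1)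
    from AE_distrD[OF W_measurable[OF True] this] AE_W_pos[OF True] show ?thesis by eventually_elim simp
  qed simp
  then show ?thesis by (simp add: AE_all_countable)
qed

lemma integral_tail_nonneg:
  assumes "rate_fun P" shows "0 \<le> (\<integral>w. tail_prob (P w) u n j \<partial>\<mu>)"
proof (rule integral_nonneg_AE)
  show "AE w in \<mu>. 0 \<le> tail_prob (P w) u n j"
    using wl.AE_weight_pos wl.AE_weight_le_1
    by eventually_elim (use tail_prob_bounds rate_fun_bounds[OF assms] in blast)
qed

text \<open>The value 0 before birth lets all vertices, born or not, be treated from one common time
  on.\<close>

definition hazard :: "(real \<Rightarrow> nat \<Rightarrow> real) \<Rightarrow> nat \<Rightarrow> 'a \<Rightarrow> nat \<Rightarrow> real" where
  "hazard P u \<omega> m = (if m < u then 0 else P (W u \<omega>) m)"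

text \<open>\<open>joint_tail P u n k l\<close> is the conditional probability given \<open>G\<^sub>l\<close> that every \<open>u i\<close> reaches degree
  \<open>k i\<close> by time \<open>n\<close>, if after time \<open>l\<close> edges arrive independently with rates \<open>P\<close>.\<close>

definition joint_tail :: "(real \<Rightarrow> nat \<Rightarrow> real) \<Rightarrow> ('k::finite \<Rightarrow> nat) \<Rightarrow> nat \<Rightarrow> ('k \<Rightarrow> nat) \<Rightarrow> nat \<Rightarrow> 'a \<Rightarrow> real" where
  "joint_tail P u n k l \<omega> = (\<Prod>i\<in>UNIV. tail_prob (hazard P (u i) \<omega>) l n (k i - deg l (u i) \<omega>))"

definition attach_rate :: "nat \<Rightarrow> nat \<Rightarrow> 'a \<Rightarrow> real" where
  "attach_rate u l \<omega> = (if u \<le> l then W u \<omega> / wsum l \<omega> else 0)"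

lemma attach_rate_bounds:
  "AE \<omega> in M. \<forall>u\<ge>1. \<forall>l. 0 \<le> attach_rate u l \<omega> \<and> attach_rate u l \<omega> \<le> 1"
  using AE_W_unit
proof eventually_elim
  case (elim \<omega>)
  show ?case
  proof (intro allI impI)
    fix u l :: nat assume u: "1 \<le> u"
    show "0 \<le> attach_rate u l \<omega> \<and> attach_rate u l \<omega> \<le> 1"
    proof (cases "u \<le> l")
      case True
      have "W u \<omega> \<le> wsum l \<omega>" unfolding wsum_def by (rule member_le_sum) (use u True elim in \<open>auto intro: less_imp_le\<close>)
      moreover have "0 < W u \<omega>" using u elim by auto
      ultimately show ?thesis using True by (simp add: attach_rate_def divide_le_eq_1)
    qed (simp add: attach_rate_def)
  qed
qed

lemma bounded_integrable:
  fixes f :: "'a \<Rightarrow> real"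
  assumes "f \<in> borel_measurable M" "AE \<omega> in M. \<bar>f \<omega>\<bar> \<le> B"
  shows "integrable M f"
  by (rule integrable_const_bound[where B=B]) (use assms in auto)

lemma attach_rate_measurable: "1 \<le> u \<Longrightarrow> attach_rate u l \<in> borel_measurable M"
proof -
  assume u: "1 \<le> u"
  have "wsum l \<in> borel_measurable M"
    unfolding wsum_def by (intro borel_measurable_sum) auto
  then show ?thesis
    unfolding attach_rate_def using u by (cases "u \<le> l") (auto intro!: borel_measurable_divide)
qed

text \<open>As \<open>u\<close> is injective, at most one factor of the product changes in a step.
  The conditional expectation is therefore affine in the rates, without mixed terms.\<close>

lemma attach_step:
  fixes u :: "'k::finite \<Rightarrow> nat" and a b :: "'k \<Rightarrow> 'a \<Rightarrow> real"
  assumes l: "1 \<le> l" and u: "inj u" "\<And>i. 1 \<le> u i"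
    and g: "g \<in> borel_measurable (history M W par {2..l})" "AE \<omega> in M. 0 \<le> g \<omega> \<and> g \<omega> \<le> 1"
    and a: "\<And>i. a i \<in> borel_measurable (history M W par {2..l})" "AE \<omega> in M. \<forall>i. 0 \<le> a i \<omega> \<and> a i \<omega> \<le> 1"
    and b: "\<And>i. b i \<in> borel_measurable (history M W par {2..l})" "AE \<omega> in M. \<forall>i. 0 \<le> b i \<omega> \<and> b i \<omega> \<le> 1"
  shows "(\<integral>\<omega>. g \<omega> * (\<Prod>i\<in>UNIV. if par (Suc l) \<omega> = u i then a i \<omega> + b i \<omega> else a i \<omega>) \<partial>M)
    = (\<integral>\<omega>. g \<omega> * ((\<Prod>i\<in>UNIV. a i \<omega>) + (\<Sum>i\<in>UNIV. attach_rate (u i) l \<omega> * b i \<omega> * (\<Prod>j\<in>UNIV - {i}. a j \<omega>))) \<partial>M)"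
proof -
  let ?F = "history M W par {2..l}"
  let ?ind = "\<lambda>i. indicator {\<omega> \<in> space M. par (Suc l) \<omega> = u i} :: 'a \<Rightarrow> real"
  define f where "f i \<omega> = g \<omega> * (b i \<omega> * (\<Prod>j\<in>UNIV - {i}. a j \<omega>))" for i \<omega>
  define f0 where "f0 \<omega> = g \<omega> * (\<Prod>i\<in>UNIV. a i \<omega>)" for \<omega>
  have sub: "subalgebra M ?F" by (rule subalgebra_history) auto
  have fF: "f i \<in> borel_measurable ?F" for i
    unfolding f_def by (intro borel_measurable_times borel_measurable_prod g a b)
  have f0F: "f0 \<in> borel_measurable ?F"
    unfolding f0_def by (intro borel_measurable_times borel_measurable_prod g a b)
  note fM = measurable_from_subalg[OF sub fF] and f0M = measurable_from_subalg[OF sub f0F]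
  have fb: "AE \<omega> in M. \<forall>i. 0 \<le> f i \<omega> \<and> f i \<omega> \<le> 1"
    using g(2) a(2) b(2)
  proof eventually_elim
    case (elim \<omega>)
    have "0 \<le> (\<Prod>j\<in>UNIV - {i}. a j \<omega>) \<and> (\<Prod>j\<in>UNIV - {i}. a j \<omega>) \<le> 1" for i
      using elim by (auto intro!: prod_nonneg prod_le_1)
    then show ?case unfolding f_def using elim by (auto intro!: mult_nonneg_nonneg mult_le_one)
  qed
  have f0b: "AE \<omega> in M. 0 \<le> f0 \<omega> \<and> f0 \<omega> \<le> 1"
    using g(2) a(2)
  proof eventually_elim
    case (elim \<omega>)
    have "0 \<le> (\<Prod>j\<in>UNIV. a j \<omega>) \<and> (\<Prod>j\<in>UNIV. a j \<omega>) \<le> 1"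
      using elim by (auto intro!: prod_nonneg prod_le_1)
    then show ?case unfolding f0_def using elim by (auto intro!: mult_nonneg_nonneg mult_le_one)
  qed
  have indM: "?ind i \<in> borel_measurable M" for i
  proof -
    have "{\<omega> \<in> space M. par (Suc l) \<omega> = u i} \<in> sets M"
      using measurable_sets[OF par_measurable[of "Suc l"], of "{u i}"] l by (simp add: vimage_def Int_def conj_commute)
    then show ?thesis by simp
  qed
  have int1: "integrable M (\<lambda>\<omega>. f i \<omega> * ?ind i \<omega>)" for i
  proof (rule bounded_integrable[where B=1])
    show "AE \<omega> in M. \<bar>f i \<omega> * ?ind i \<omega>\<bar> \<le> 1" using fb by eventually_elim (auto simp: indicator_def)
  qed (intro borel_measurable_times fM indM)
  have int2: "integrable M (\<lambda>\<omega>. f i \<omega> * attach_rate (u i) l \<omega>)" for i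
  proof (rule bounded_integrable[where B=1])
    show "AE \<omega> in M. \<bar>f i \<omega> * attach_rate (u i) l \<omega>\<bar> \<le> 1"
      using fb attach_rate_bounds by eventually_elim (use u in \<open>auto intro!: mult_le_one simp: abs_mult\<close>)
  qed (intro borel_measurable_times fM attach_rate_measurable u)
  have int0: "integrable M f0"
    by (rule bounded_integrable[where B=1]) (use f0M f0b in auto)
  have pt: "(\<Prod>i\<in>UNIV. if x = u i then A i + B i else A i)
     = (\<Prod>i\<in>UNIV. A i) + (\<Sum>i\<in>UNIV. of_bool (x = u i) * (B i * (\<Prod>j\<in>UNIV - {i}. A j)))" for x and A B :: "'k \<Rightarrow> real"
  proof (cases "\<exists>k. x = u k")
    case True
    then obtain k where k: "x = u k" by blast
    have uk: "u k = u i \<longleftrightarrow> i = k" for i using u(1) by (auto simp: inj_def)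
    have "(\<Prod>i\<in>UNIV. if x = u i then A i + B i else A i) = (A k + B k) * (\<Prod>i\<in>UNIV - {k}. A i)"
      unfolding k uk by (subst prod.remove[of _ k]) auto
    moreover have "(\<Prod>i\<in>UNIV. A i) = A k * (\<Prod>i\<in>UNIV - {k}. A i)" by (subst prod.remove[of _ k]) auto
    moreover have "(\<Sum>i\<in>UNIV. of_bool (x = u i) * (B i * (\<Prod>j\<in>UNIV - {i}. A j))) = B k * (\<Prod>i\<in>UNIV - {k}. A i)"
      unfolding k uk by (subst sum.remove[of _ k]) auto
    ultimately show ?thesis by (simp add: distrib_right)
  qed auto
  have step: "(\<integral>\<omega>. f i \<omega> * ?ind i \<omega> \<partial>M) = (\<integral>\<omega>. f i \<omega> * attach_rate (u i) l \<omega> \<partial>M)" for i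
  proof (cases "u i \<le> l")
    case True
    then have "u i \<in> {1..l}" using u by auto
    moreover have "AE \<omega> in M. \<bar>f i \<omega>\<bar> \<le> 1" using fb by eventually_elim auto
    ultimately show ?thesis using attachment_integral[OF l _ fF] True by (simp add: attach_rate_def)
  next
    case False
    \<comment> \<open>A vertex born after time \<open>l\<close> cannot be a parent yet by
      \<open>AE_par\<close>, and its \<open>attach_rate\<close> is 0.\<close>
    have "(\<integral>\<omega>. f i \<omega> * ?ind i \<omega> \<partial>M) = (\<integral>\<omega>. f i \<omega> * attach_rate (u i) l \<omega> \<partial>M)"
    proof (rule integral_cong_AE)
      show "AE \<omega> in M. f i \<omega> * ?ind i \<omega> = f i \<omega> * attach_rate (u i) l \<omega>"
        using AE_par[OF l] by eventually_elim (use False in \<open>auto simp: attach_rate_def indicator_def\<close>)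
    qed (use int1 int2 in \<open>auto intro: borel_measurable_integrable\<close>)
    then show ?thesis .
  qed
  have "(\<integral>\<omega>. g \<omega> * (\<Prod>i\<in>UNIV. if par (Suc l) \<omega> = u i then a i \<omega> + b i \<omega> else a i \<omega>) \<partial>M)
     = (\<integral>\<omega>. f0 \<omega> + (\<Sum>i\<in>UNIV. f i \<omega> * ?ind i \<omega>) \<partial>M)"
    unfolding pt by (intro Bochner_Integration.integral_cong) 
      (auto simp: f_def f0_def indicator_def distrib_left sum_distrib_left mult_ac intro!: sum.cong)
  also have "\<dots> = (\<integral>\<omega>. f0 \<omega> \<partial>M) + (\<Sum>i\<in>UNIV. \<integral>\<omega>. f i \<omega> * ?ind i \<omega> \<partial>M)"
    by (subst Bochner_Integration.integral_add[OF int0 Bochner_Integration.integrable_sum[OF int1]],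
        subst Bochner_Integration.integral_sum[OF int1]) rule
  also have "\<dots> = (\<integral>\<omega>. f0 \<omega> \<partial>M) + (\<Sum>i\<in>UNIV. \<integral>\<omega>. f i \<omega> * attach_rate (u i) l \<omega> \<partial>M)"
    unfolding step ..
  also have "\<dots> = (\<integral>\<omega>. f0 \<omega> + (\<Sum>i\<in>UNIV. f i \<omega> * attach_rate (u i) l \<omega>) \<partial>M)"
    by (subst Bochner_Integration.integral_add[OF int0 Bochner_Integration.integrable_sum[OF int2]],
        subst Bochner_Integration.integral_sum[OF int2]) rule
  also have "\<dots> = (\<integral>\<omega>. g \<omega> * ((\<Prod>i\<in>UNIV. a i \<omega>) + (\<Sum>i\<in>UNIV. attach_rate (u i) l \<omega> * b i \<omega> * (\<Prod>j\<in>UNIV - {i}. a j \<omega>))) \<partial>M)"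
    by (intro Bochner_Integration.integral_cong) 
      (auto simp: f_def f0_def distrib_left sum_distrib_left mult_ac intro!: sum.cong)
  finally show ?thesis .
qed

lemma tail_prob_history:
  assumes P: "rate_fun P" and u: "1 \<le> u"
  shows "(\<lambda>\<omega>. tail_prob (hazard P u \<omega>) l' n (k - deg l u \<omega>)) \<in> borel_measurable (history M W par {2..l})"
proof (rule measurable_compose_countable[where f = "\<lambda>j \<omega>. tail_prob (hazard P u \<omega>) l' n (k - j)"])
  show "deg l u \<in> history M W par {2..l} \<rightarrow>\<^sub>M count_space UNIV" by (rule deg_history) simp
  show "(\<lambda>\<omega>. tail_prob (hazard P u \<omega>) l' n (k - j)) \<in> borel_measurable (history M W par {2..l})" for j
  proof (rule tail_prob_measurable)
    show "(\<lambda>\<omega>. hazard P u \<omega> m) \<in> borel_measurable (history M W par {2..l})" for m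
      unfolding hazard_def using measurable_compose[OF W_history[OF u] rate_fun_measurable[OF P]] by auto
  qed
qed

lemma tail_prob_history':
  assumes P: "rate_fun P" and u: "1 \<le> u"
  shows "(\<lambda>\<omega>. tail_prob (hazard P u \<omega>) l' n (k - deg l u \<omega>)) \<in> borel_measurable M"
  by (rule measurable_from_subalg[OF subalgebra_history tail_prob_history[OF assms]]) auto

lemma joint_tail_measurable:
  assumes P: "rate_fun P" and u: "\<And>i. 1 \<le> u i"
  shows "joint_tail P u n k l \<in> borel_measurable M"
  unfolding joint_tail_def by (intro borel_measurable_prod tail_prob_history' assms)

lemma hazard_bounds:
  assumes P: "rate_fun P"
  shows "AE \<omega> in M. \<forall>u\<ge>1. \<forall>m. 0 \<le> hazard P u \<omega> m \<and> hazard P u \<omega> m \<le> 1"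
  using AE_W_unit by eventually_elim (use rate_fun_bounds[OF P] in \<open>auto simp: hazard_def\<close>)

lemma joint_tail_bounds:
  assumes P: "rate_fun P" and u: "\<And>i. 1 \<le> u i"
  shows "AE \<omega> in M. 0 \<le> joint_tail P u n k l \<omega> \<and> joint_tail P u n k l \<omega> \<le> 1"
  using hazard_bounds[OF P]
proof eventually_elim
  case (elim \<omega>)
  have "0 \<le> tail_prob (hazard P (u i) \<omega>) l n j \<and> tail_prob (hazard P (u i) \<omega>) l n j \<le> 1" for i j
    by (rule tail_prob_bounds) (use elim u in auto)
  then show ?case unfolding joint_tail_def by (auto intro!: prod_nonneg prod_le_1)
qed

text \<open>\<open>a i\<close> is the tail if vertex \<open>u i\<close> gets no edge in this step,
  \<open>a i + b i\<close> the tail if it gets one. As \<open>g\<close> is measurable even for the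
  history with \<open>J = {}\<close>, it is a function of the weights; so one event of good weights
  can be kept at all times. The fourth claim prepares the quadratic error: the full product is a
  joint tail at degrees \<open>k i - 1\<close>.\<close>

lemma joint_tail_step:
  fixes u :: "'k::finite \<Rightarrow> nat" and k :: "'k \<Rightarrow> nat"
  assumes l: "1 \<le> l" "l < n" and u: "inj u" "\<And>i. 1 \<le> u i"
    and g: "\<And>J. g \<in> borel_measurable (history M W par J)" "AE \<omega> in M. 0 \<le> g \<omega> \<and> g \<omega> \<le> 1"
    and P: "rate_fun P"
  defines "a \<equiv> \<lambda>i \<omega>. tail_prob (hazard P (u i) \<omega>) (Suc l) n (k i - deg l (u i) \<omega>)"
  defines "b \<equiv> \<lambda>i \<omega>. tail_prob (hazard P (u i) \<omega>) (Suc l) n (k i - 1 - deg l (u i) \<omega>) - a i \<omega>"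
  shows "(\<integral>\<omega>. g \<omega> * joint_tail P u n k (Suc l) \<omega> \<partial>M) =
     (\<integral>\<omega>. g \<omega> * ((\<Prod>i\<in>UNIV. a i \<omega>) + (\<Sum>i\<in>UNIV. attach_rate (u i) l \<omega> * b i \<omega> * (\<Prod>j\<in>UNIV - {i}. a j \<omega>))) \<partial>M)"
    "joint_tail P u n k l \<omega> = (\<Prod>i\<in>UNIV. a i \<omega> + hazard P (u i) \<omega> l * b i \<omega>)"
    "AE \<omega> in M. \<forall>i. 0 \<le> a i \<omega> \<and> a i \<omega> \<le> 1 \<and> 0 \<le> b i \<omega> \<and> b i \<omega> \<le> 1"
    "AE \<omega> in M. (\<Prod>i\<in>UNIV. a i \<omega> + b i \<omega>) \<le> joint_tail P u n (\<lambda>i. k i - 1) l \<omega>"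
    "(\<lambda>\<omega>. g \<omega> * ((\<Prod>i\<in>UNIV. a i \<omega>) + (\<Sum>i\<in>UNIV. attach_rate (u i) l \<omega> * b i \<omega> * (\<Prod>j\<in>UNIV - {i}. a j \<omega>)))) \<in> borel_measurable M"
proof -
  have aF: "a i \<in> borel_measurable (history M W par {2..l})" for i
    unfolding a_def by (rule tail_prob_history[OF P u(2)])
  have bF: "b i \<in> borel_measurable (history M W par {2..l})" for i
    unfolding b_def by (intro borel_measurable_diff aF tail_prob_history[OF P u(2)])
  have sub: "subalgebra M (history M W par {2..l})" by (rule subalgebra_history) auto
  show ab: "AE \<omega> in M. \<forall>i. 0 \<le> a i \<omega> \<and> a i \<omega> \<le> 1 \<and> 0 \<le> b i \<omega> \<and> b i \<omega> \<le> 1"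
    using hazard_bounds[OF P]
  proof eventually_elim
    case (elim \<omega>)
    have T: "0 \<le> tail_prob (hazard P (u i) \<omega>) (Suc l) n j \<and> tail_prob (hazard P (u i) \<omega>) (Suc l) n j \<le> 1" for i j
      by (rule tail_prob_bounds) (use elim u in auto)
    have "a i \<omega> \<le> tail_prob (hazard P (u i) \<omega>) (Suc l) n (k i - 1 - deg l (u i) \<omega>)" for i
    proof -
      have "tail_prob (hazard P (u i) \<omega>) (Suc l) n (k i - deg l (u i) \<omega>) \<le> tail_prob (hazard P (u i) \<omega>) (Suc l) n (k i - deg l (u i) \<omega> - 1)"
        by (rule tail_prob_antimono_pred) (use elim u in auto)
      then show ?thesis by (simp add: a_def diff_commute)
    qed
    then show ?case using T unfolding a_def b_def by (smt (verit))
  qed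
  have "joint_tail P u n k (Suc l) \<omega> = (\<Prod>i\<in>UNIV. if par (Suc l) \<omega> = u i then a i \<omega> + b i \<omega> else a i \<omega>)" for \<omega>
    unfolding joint_tail_def a_def b_def deg_Suc[OF l(1)] by (intro prod.cong) (auto simp: diff_commute)
  then show "(\<integral>\<omega>. g \<omega> * joint_tail P u n k (Suc l) \<omega> \<partial>M) =
     (\<integral>\<omega>. g \<omega> * ((\<Prod>i\<in>UNIV. a i \<omega>) + (\<Sum>i\<in>UNIV. attach_rate (u i) l \<omega> * b i \<omega> * (\<Prod>j\<in>UNIV - {i}. a j \<omega>))) \<partial>M)"
    using attach_step[OF l(1) u g(1) g(2) aF _ bF] ab by (simp add: eventually_mono)
  show "joint_tail P u n k l \<omega> = (\<Prod>i\<in>UNIV. a i \<omega> + hazard P (u i) \<omega> l * b i \<omega>)"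
    unfolding joint_tail_def tail_prob_backward[OF l(2)] a_def b_def
    by (intro prod.cong) (auto simp: algebra_simps diff_commute)
  show "AE \<omega> in M. (\<Prod>i\<in>UNIV. a i \<omega> + b i \<omega>) \<le> joint_tail P u n (\<lambda>i. k i - 1) l \<omega>"
    using hazard_bounds[OF P] ab
  proof eventually_elim
    case (elim \<omega>)
    have T: "tail_prob (hazard P (u i) \<omega>) (Suc l) n j \<le> tail_prob (hazard P (u i) \<omega>) l n j" for i j
    proof -
      have "tail_prob (hazard P (u i) \<omega>) (Suc l) n j \<le> tail_prob (hazard P (u i) \<omega>) (Suc l) n (j - 1)"
        by (rule tail_prob_antimono_pred) (use elim u in auto)
      then have "0 \<le> hazard P (u i) \<omega> l * (tail_prob (hazard P (u i) \<omega>) (Suc l) n (j - 1) - tail_prob (hazard P (u i) \<omega>) (Suc l) n j)"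
        using elim u by simp
      then show ?thesis unfolding tail_prob_backward[OF l(2)] by (simp add: algebra_simps)
    qed
    show ?case unfolding joint_tail_def
    proof (rule prod_mono, rule conjI)
      fix i
      show "0 \<le> a i \<omega> + b i \<omega>" using elim by simp
      show "a i \<omega> + b i \<omega> \<le> tail_prob (hazard P (u i) \<omega>) l n (k i - 1 - deg l (u i) \<omega>)"
        using T unfolding b_def by simp
    qed
  qed
  show "(\<lambda>\<omega>. g \<omega> * ((\<Prod>i\<in>UNIV. a i \<omega>) + (\<Sum>i\<in>UNIV. attach_rate (u i) l \<omega> * b i \<omega> * (\<Prod>j\<in>UNIV - {i}. a j \<omega>)))) \<in> borel_measurable M"
    by (intro borel_measurable_times borel_measurable_add borel_measurable_sum borel_measurable_prod attach_rate_measurable u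
        measurable_from_subalg[OF sub aF] measurable_from_subalg[OF sub bF] measurable_from_subalg[OF sub g(1)])
qed

lemma integrable_joint_tail:
  assumes P: "rate_fun P" and u: "\<And>i. 1 \<le> u i"
    and g: "g \<in> borel_measurable M" "AE \<omega> in M. 0 \<le> g \<omega> \<and> g \<omega> \<le> 1"
  shows "integrable M (\<lambda>\<omega>. g \<omega> * joint_tail P u n k l \<omega>)"
proof (rule bounded_integrable[where B=1])
  show "AE \<omega> in M. \<bar>g \<omega> * joint_tail P u n k l \<omega>\<bar> \<le> 1"
    using g(2) joint_tail_bounds[OF P, of u n k l, OF u] by eventually_elim (auto simp: abs_mult intro!: mult_le_one)
qed (intro borel_measurable_times g joint_tail_measurable P u)

text \<open>A true step yields only the first-order terms, a comparison step the full product with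
  larger rates; so the expectation cannot increase with time.\<close>

lemma joint_tail_upper:
  fixes u :: "'k::finite \<Rightarrow> nat"
  assumes u: "inj u" "\<And>i. 1 \<le> u i"
    and g: "\<And>J. g \<in> borel_measurable (history M W par J)" "AE \<omega> in M. 0 \<le> g \<omega> \<and> g \<omega> \<le> 1"
    and P: "rate_fun P"
    and dom: "AE \<omega> in M. g \<omega> \<noteq> 0 \<longrightarrow> (\<forall>v l. 1 \<le> v \<longrightarrow> v \<le> l \<longrightarrow> l < n \<longrightarrow> W v \<omega> / wsum l \<omega> \<le> P (W v \<omega>) l)"
    and l: "1 \<le> l" "l \<le> m" "m \<le> n"
  shows "(\<integral>\<omega>. g \<omega> * joint_tail P u n k m \<omega> \<partial>M) \<le> (\<integral>\<omega>. g \<omega> * joint_tail P u n k l \<omega> \<partial>M)"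
  using l(2,1)
proof (induction l rule: inc_induct)
  case base show ?case by simp
next
  case (step l)
  have gM: "g \<in> borel_measurable M" by (rule measurable_from_subalg[OF subalgebra_history g(1), of "{}"]) auto
  have int: "integrable M (\<lambda>\<omega>. g \<omega> * joint_tail P u n k l \<omega>)" for l
    by (rule integrable_joint_tail[OF P u(2) gM g(2)])
  have ln: "l < n" using step.hyps l by simp
  note js = joint_tail_step[OF step.prems ln u g P, of k]
  have "(\<integral>\<omega>. g \<omega> * joint_tail P u n k (Suc l) \<omega> \<partial>M) \<le> (\<integral>\<omega>. g \<omega> * joint_tail P u n k l \<omega> \<partial>M)"
    unfolding js(1)
  proof (rule integral_mono_AE)
    let ?a = "\<lambda>i \<omega>. tail_prob (hazard P (u i) \<omega>) (Suc l) n (k i - deg l (u i) \<omega>)"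
    let ?b = "\<lambda>i \<omega>. tail_prob (hazard P (u i) \<omega>) (Suc l) n (k i - 1 - deg l (u i) \<omega>) - ?a i \<omega>"
    let ?L = "\<lambda>\<omega>. g \<omega> * ((\<Prod>i\<in>UNIV. ?a i \<omega>) + (\<Sum>i\<in>UNIV. attach_rate (u i) l \<omega> * ?b i \<omega> * (\<Prod>j\<in>UNIV - {i}. ?a j \<omega>)))"
    have aux: "0 \<le> x \<and> x \<le> y \<Longrightarrow> norm x \<le> norm y" for x y :: real by auto
    have *: "AE \<omega> in M. 0 \<le> ?L \<omega> \<and> ?L \<omega> \<le> g \<omega> * joint_tail P u n k l \<omega>"
      using js(3) g(2) dom attach_rate_bounds
    proof eventually_elim
      case (elim \<omega>)
      have ab: "0 \<le> ?a i \<omega>" "0 \<le> ?b i \<omega>" "0 \<le> attach_rate (u i) l \<omega>" for i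
        using elim(1,4) u by auto
      have nn: "0 \<le> (\<Prod>i\<in>UNIV. ?a i \<omega>) + (\<Sum>i\<in>UNIV. attach_rate (u i) l \<omega> * ?b i \<omega> * (\<Prod>j\<in>UNIV - {i}. ?a j \<omega>))"
        using ab by (intro add_nonneg_nonneg prod_nonneg sum_prod_remove_nonneg) auto
      show ?case
      proof (cases "g \<omega> = 0")
        case False
        have "(\<Prod>i\<in>UNIV. ?a i \<omega>) + (\<Sum>i\<in>UNIV. attach_rate (u i) l \<omega> * ?b i \<omega> * (\<Prod>j\<in>UNIV - {i}. ?a j \<omega>))
          \<le> (\<Prod>i\<in>UNIV. ?a i \<omega> + attach_rate (u i) l \<omega> * ?b i \<omega>)"
          by (rule prod_linear_lower) (use ab in auto)
        also have "\<dots> \<le> (\<Prod>i\<in>UNIV. ?a i \<omega> + hazard P (u i) \<omega> l * ?b i \<omega>)"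
        proof (rule prod_mono, rule conjI)
          fix i
          show "0 \<le> ?a i \<omega> + attach_rate (u i) l \<omega> * ?b i \<omega>" using ab by (intro add_nonneg_nonneg mult_nonneg_nonneg)
          have "attach_rate (u i) l \<omega> \<le> hazard P (u i) \<omega> l"
            using elim(3) False u ln by (auto simp: attach_rate_def hazard_def)
          then show "?a i \<omega> + attach_rate (u i) l \<omega> * ?b i \<omega> \<le> ?a i \<omega> + hazard P (u i) \<omega> l * ?b i \<omega>"
            using ab by (intro add_left_mono mult_right_mono)
        qed
        also have "\<dots> = joint_tail P u n k l \<omega>" by (rule js(2)[symmetric])
        finally show ?thesis using nn elim(2) by (auto intro!: mult_left_mono)
      qed auto
    qed
    then show "AE \<omega> in M. ?L \<omega> \<le> g \<omega> * joint_tail P u n k l \<omega>" by eventually_elim blast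
    show "integrable M ?L"
    proof (rule Bochner_Integration.integrable_bound[OF int[of l] js(5)])
      show "AE \<omega> in M. norm (?L \<omega>) \<le> norm (g \<omega> * joint_tail P u n k l \<omega>)"
        using * by eventually_elim (rule aux)
    qed
    show "integrable M (\<lambda>\<omega>. g \<omega> * joint_tail P u n k l \<omega>)" by (rule int)
  qed
  then show ?case using step.IH step.prems by simp
qed

text \<open>At most one of the vertices gains an edge in a single step, whereas independent edges may arrive
  together; \<open>\<eta> l\<close> bounds the probability of the latter.\<close>

lemma joint_tail_lower:
  fixes u :: "'k::finite \<Rightarrow> nat"
  assumes u: "inj u" "\<And>i. 1 \<le> u i"
    and g: "\<And>J. g \<in> borel_measurable (history M W par J)" "AE \<omega> in M. 0 \<le> g \<omega> \<and> g \<omega> \<le> 1"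
    and P: "rate_fun P"
    and dom: "AE \<omega> in M. g \<omega> \<noteq> 0 \<longrightarrow> (\<forall>v l. v \<in> range u \<longrightarrow> v \<le> l \<longrightarrow> l < n \<longrightarrow> P (W v \<omega>) l \<le> W v \<omega> / wsum l \<omega>)"
    and small: "\<And>l. AE \<omega> in M. (\<Sum>i\<in>UNIV. hazard P (u i) \<omega> l)\<^sup>2 \<le> \<eta> l"
    and e: "\<And>l. 1 \<le> l \<Longrightarrow> l \<le> n \<Longrightarrow> (\<integral>\<omega>. g \<omega> * joint_tail P u n (\<lambda>i. k i - 1) l \<omega> \<partial>M) \<le> e"
    and eta: "\<And>l. 0 \<le> \<eta> l"
    and l: "1 \<le> l" "l \<le> n"
  shows "(\<integral>\<omega>. g \<omega> * joint_tail P u n k l \<omega> \<partial>M) - (\<Sum>m\<in>{l..<n}. \<eta> m) * e \<le> (\<integral>\<omega>. g \<omega> * joint_tail P u n k n \<omega> \<partial>M)"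
  using l(2,1)
proof (induction l rule: inc_induct)
  case base show ?case by simp
next
  case (step l)
  have gM: "g \<in> borel_measurable M" by (rule measurable_from_subalg[OF subalgebra_history g(1), of "{}"]) auto
  have int: "integrable M (\<lambda>\<omega>. g \<omega> * joint_tail P u n k l \<omega>)" for k l
    by (rule integrable_joint_tail[OF P u(2) gM g(2)])
  note js = joint_tail_step[OF step.prems step.hyps(2) u g P, of k]
  let ?a = "\<lambda>i \<omega>. tail_prob (hazard P (u i) \<omega>) (Suc l) n (k i - deg l (u i) \<omega>)"
  let ?b = "\<lambda>i \<omega>. tail_prob (hazard P (u i) \<omega>) (Suc l) n (k i - 1 - deg l (u i) \<omega>) - ?a i \<omega>"
  let ?L = "\<lambda>\<omega>. g \<omega> * ((\<Prod>i\<in>UNIV. ?a i \<omega>) + (\<Sum>i\<in>UNIV. attach_rate (u i) l \<omega> * ?b i \<omega> * (\<Prod>j\<in>UNIV - {i}. ?a j \<omega>)))"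
  let ?K = "\<lambda>\<omega>. g \<omega> * joint_tail P u n (\<lambda>i. k i - 1) l \<omega>"
  have intL: "integrable M ?L"
  proof (rule bounded_integrable[where B="1 + real (CARD('k))"])
    show "AE \<omega> in M. \<bar>?L \<omega>\<bar> \<le> 1 + real CARD('k)"
      using js(3) g(2) attach_rate_bounds
    proof eventually_elim
      case (elim \<omega>)
      have ab: "0 \<le> ?a i \<omega>" "?a i \<omega> \<le> 1" "0 \<le> ?b i \<omega>" "?b i \<omega> \<le> 1" "0 \<le> attach_rate (u i) l \<omega>" "attach_rate (u i) l \<omega> \<le> 1" for i
        using elim(1,3) u by auto
      have A: "0 \<le> (\<Prod>j\<in>S. ?a j \<omega>) \<and> (\<Prod>j\<in>S. ?a j \<omega>) \<le> 1" for S
        using ab by (intro conjI prod_nonneg prod_le_1) auto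
      have t: "0 \<le> attach_rate (u i) l \<omega> * ?b i \<omega> * (\<Prod>j\<in>UNIV - {i}. ?a j \<omega>) \<and>
         attach_rate (u i) l \<omega> * ?b i \<omega> * (\<Prod>j\<in>UNIV - {i}. ?a j \<omega>) \<le> 1" for i
        using ab[of i] A by (intro conjI mult_nonneg_nonneg mult_le_one) auto
      have "0 \<le> (\<Sum>i\<in>UNIV. attach_rate (u i) l \<omega> * ?b i \<omega> * (\<Prod>j\<in>UNIV - {i}. ?a j \<omega>))"
        using t by (intro sum_nonneg) auto
      moreover have "(\<Sum>i\<in>UNIV. attach_rate (u i) l \<omega> * ?b i \<omega> * (\<Prod>j\<in>UNIV - {i}. ?a j \<omega>)) \<le> (\<Sum>i\<in>(UNIV::'k set). 1)"
        using t by (intro sum_mono) auto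
      ultimately have "0 \<le> ?L \<omega> \<and> ?L \<omega> \<le> 1 * (1 + real CARD('k))"
        using A[of UNIV] elim(2) by (intro conjI mult_nonneg_nonneg mult_mono) auto
      then show ?case by simp
    qed
  qed (rule js(5))
  have "(\<integral>\<omega>. g \<omega> * joint_tail P u n k l \<omega> \<partial>M) \<le> (\<integral>\<omega>. ?L \<omega> + \<eta> l * ?K \<omega> \<partial>M)"
  proof (rule integral_mono_AE)
    show "integrable M (\<lambda>\<omega>. ?L \<omega> + \<eta> l * ?K \<omega>)"
      by (intro Bochner_Integration.integrable_add integrable_mult_right int intL)
    show "AE \<omega> in M. g \<omega> * joint_tail P u n k l \<omega> \<le> ?L \<omega> + \<eta> l * ?K \<omega>"
      using js(3,4) g(2) dom attach_rate_bounds small[of l] hazard_bounds[OF P]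
    proof eventually_elim
      case (elim \<omega>)
      have ab: "0 \<le> ?a i \<omega>" "0 \<le> ?b i \<omega>" "0 \<le> attach_rate (u i) l \<omega>" "0 \<le> hazard P (u i) \<omega> l" "hazard P (u i) \<omega> l \<le> 1" for i
        using elim(1,5,7) u by auto
      show ?case
      proof (cases "g \<omega> = 0")
        case False
        have "joint_tail P u n k l \<omega> = (\<Prod>i\<in>UNIV. ?a i \<omega> + hazard P (u i) \<omega> l * ?b i \<omega>)" by (rule js(2))
        also have "\<dots> \<le> (\<Prod>i\<in>UNIV. ?a i \<omega>) + (\<Sum>i\<in>UNIV. hazard P (u i) \<omega> l * ?b i \<omega> * (\<Prod>j\<in>UNIV - {i}. ?a j \<omega>))
             + (\<Sum>i\<in>UNIV. hazard P (u i) \<omega> l)\<^sup>2 * (\<Prod>i\<in>UNIV. ?a i \<omega> + ?b i \<omega>)"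
          by (rule prod_linear_upper) (use ab in auto)
        also have "(\<Sum>i\<in>UNIV. hazard P (u i) \<omega> l * ?b i \<omega> * (\<Prod>j\<in>UNIV - {i}. ?a j \<omega>))
            \<le> (\<Sum>i\<in>UNIV. attach_rate (u i) l \<omega> * ?b i \<omega> * (\<Prod>j\<in>UNIV - {i}. ?a j \<omega>))"
        proof (intro sum_mono mult_right_mono prod_nonneg ab)
          fix i show "hazard P (u i) \<omega> l \<le> attach_rate (u i) l \<omega>"
            using elim(4) False step.hyps by (auto simp: attach_rate_def hazard_def)
        qed
        \<comment> \<open>The product is kept as a joint tail at degrees \<open>k i - 1\<close>
          rather than bounded by 1. The error is then a small multiple of the probability of nearly
          the same rare event.\<close>
        also have "(\<Sum>i\<in>UNIV. hazard P (u i) \<omega> l)\<^sup>2 * (\<Prod>i\<in>UNIV. ?a i \<omega> + ?b i \<omega>) \<le> \<eta> l * joint_tail P u n (\<lambda>i. k i - 1) l \<omega>"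
          using elim(2,6) ab eta by (intro mult_mono prod_nonneg add_nonneg_nonneg) auto
        finally have "joint_tail P u n k l \<omega> \<le> (\<Prod>i\<in>UNIV. ?a i \<omega>) + (\<Sum>i\<in>UNIV. attach_rate (u i) l \<omega> * ?b i \<omega> * (\<Prod>j\<in>UNIV - {i}. ?a j \<omega>))
           + \<eta> l * joint_tail P u n (\<lambda>i. k i - 1) l \<omega>" by simp
        then have "g \<omega> * joint_tail P u n k l \<omega> \<le> g \<omega> * ((\<Prod>i\<in>UNIV. ?a i \<omega>) + (\<Sum>i\<in>UNIV. attach_rate (u i) l \<omega> * ?b i \<omega> * (\<Prod>j\<in>UNIV - {i}. ?a j \<omega>))
           + \<eta> l * joint_tail P u n (\<lambda>i. k i - 1) l \<omega>)"
          using elim(3) by (intro mult_left_mono) auto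
        then show ?thesis by (simp only: distrib_left mult_ac)
      qed simp
    qed
  qed (rule int)
  also have "\<dots> = (\<integral>\<omega>. ?L \<omega> \<partial>M) + \<eta> l * (\<integral>\<omega>. ?K \<omega> \<partial>M)"
    using intL int by simp
  also have "(\<integral>\<omega>. ?L \<omega> \<partial>M) = (\<integral>\<omega>. g \<omega> * joint_tail P u n k (Suc l) \<omega> \<partial>M)" by (rule js(1)[symmetric])
  also have "\<eta> l * (\<integral>\<omega>. ?K \<omega> \<partial>M) \<le> \<eta> l * e"
    using e[of l] eta step by (intro mult_left_mono) auto
  finally have "(\<integral>\<omega>. g \<omega> * joint_tail P u n k l \<omega> \<partial>M) - \<eta> l * e \<le> (\<integral>\<omega>. g \<omega> * joint_tail P u n k (Suc l) \<omega> \<partial>M)" by simp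
  moreover have "(\<Sum>m\<in>{l..<n}. \<eta> m) = \<eta> l + (\<Sum>m\<in>{Suc l..<n}. \<eta> m)"
    using step.hyps by (simp add: sum.atLeast_Suc_lessThan)
  ultimately show ?case using step.IH step.prems by (simp add: distrib_right)
qed

end

section \<open>Concentration of the weight sums\<close>

lemma harmonic_sum_le: "(\<Sum>l\<in>{1..n}. 1 / real l) \<le> 1 + ln (real n)"
proof (cases n)
  case (Suc m)
  have "harm (Suc m) - ln (real (Suc m)) \<le> harm (Suc 0) - ln (real (Suc 0))"
    using decseqD[OF decseq_harm_diff_ln, of 0 m] by simp
  then show ?thesis using Suc by (simp add: harm_def inverse_eq_divide)
qed simp

context weight_law
begin

lemma laplace_tendsto_0: "(\<lambda>k::nat. \<integral>w. exp (- real k * w) \<partial>\<mu>) \<longlonglongrightarrow> 0"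
proof -
  have "(\<lambda>k::nat. \<integral>w. exp (- real k * w) \<partial>\<mu>) \<longlonglongrightarrow> (\<integral>w. 0 \<partial>\<mu>)"
  proof (rule integral_dominated_convergence[where w="\<lambda>_. 1"])
    show "AE w in \<mu>. (\<lambda>k. exp (- real k * w)) \<longlonglongrightarrow> 0"
      using AE_weight_pos by eventually_elim real_asymp
    show "AE w in \<mu>. norm (exp (- real k * w)) \<le> 1" for k
      using AE_weight_pos by eventually_elim simp
  qed auto
  then show ?thesis by simp
qed

end

context weighted_tree
begin

lemma W_expectation: "1 \<le> j \<Longrightarrow> f \<in> borel_measurable borel \<Longrightarrow> expectation (\<lambda>\<omega>. f (W j \<omega>)) = (\<integral>w. f w \<partial>\<mu>)"
  for f :: "real \<Rightarrow> real"
proof -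
  assume j: "1 \<le> j" and f: "f \<in> borel_measurable borel"
  have "(\<integral>w. f w \<partial>\<mu>) = (\<integral>w. f w \<partial>distr M borel (W j))" using weights_distr[OF j] by simp
  also have "\<dots> = expectation (\<lambda>\<omega>. f (W j \<omega>))" by (rule integral_distr[OF W_measurable[OF j] f])
  finally show ?thesis by simp
qed

lemma wsum_measurable [measurable]: "wsum n \<in> borel_measurable M"
  unfolding wsum_def by (intro borel_measurable_sum) auto

text \<open>A relative deviation of order \<open>n powr (-1/4)\<close> is still summable along the
  rates, and its exponent \<open>(n powr (3/4))^2 / n = sqrt n\<close> beats every power of the
  final time as soon as \<open>n\<close> is a power of that time.\<close>

lemma wsum_hoeffding:
  assumes n: "0 < n"
  shows "prob {\<omega> \<in> space M. \<bar>wsum n \<omega> - real n * (\<theta> - 1)\<bar> \<ge> (\<theta> - 1) * real n powr (3/4)}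
    \<le> 2 * exp (- 2 * (\<theta> - 1)\<^sup>2 * sqrt (real n))"
proof -
  interpret H: Hoeffding_ineq M "{1..n}" W "\<lambda>_. 0" "\<lambda>_. 1" "\<Sum>i\<in>{1..n}. expectation (W i)"
  proof unfold_locales
    show "indep_vars (\<lambda>_. borel) W {1..n}" by (rule indep_vars_subset[OF weights_indep]) auto
    show "AE x in M. W i x \<in> {0..1}" if "i \<in> {1..n}" for i
      using AE_W_unit by eventually_elim (use that in \<open>auto intro: less_imp_le\<close>)
  qed auto
  have "(\<Sum>i\<in>{1..n}. expectation (W i)) = (\<Sum>i\<in>{1..n}. \<theta> - 1)"
    using W_expectation[of _ "\<lambda>x. x"] wl.theta by (intro sum.cong) auto
  also have "\<dots> = real n * (\<theta> - 1)" by simp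
  finally have mean: "(\<Sum>i\<in>{1..n}. expectation (W i)) = real n * (\<theta> - 1)" .
  have "prob {x\<in>space M. \<bar>(\<Sum>i\<in>{1..n}. W i x) - (\<Sum>i\<in>{1..n}. expectation (W i))\<bar> \<ge> (\<theta> - 1) * real n powr (3/4)}
    \<le> 2 * exp (-2 * ((\<theta> - 1) * real n powr (3/4))\<^sup>2 / (\<Sum>i\<in>{1..n}. (1 - 0)\<^sup>2))"
    by (rule H.Hoeffding_ineq_abs_ge) (use n wl.theta_gt_1 in auto)
  moreover have "((\<theta> - 1) * real n powr (3/4))\<^sup>2 / (\<Sum>i\<in>{1..n}. (1 - 0)\<^sup>2) = (\<theta> - 1)\<^sup>2 * sqrt (real n)"
  proof -
    have "(real n powr (3/4))\<^sup>2 = real n powr (3/2)"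
      by (simp add: power2_eq_square powr_add[symmetric])
    also have "\<dots> = real n * sqrt (real n)" using n powr_add[of "real n" 1 "1/2"] by (simp add: powr_half_sqrt)
    finally show ?thesis using n by (simp add: power_mult_distrib)
  qed
  ultimately show ?thesis unfolding mean wsum_def times_divide_eq_right[symmetric]
    by (simp only: mult.assoc)
qed

text \<open>Exponential Markov inequality for \<open>exp (- k * wsum m)\<close> with
  \<open>\<kappa> = 1 / k\<close>, where \<open>k\<close> is so large that the Laplace transform of
  the weight at \<open>k\<close> is below \<open>exp (- (B + 1))\<close>. The extra 1 pays for the
  threshold \<open>exp (- m)\<close>. Any exponent \<open>B\<close> is reached, at the price of a
  small \<open>\<kappa>\<close>.\<close>

lemma wsum_laplace:
  fixes B :: real
  obtains \<kappa> where "0 < \<kappa>" "\<And>m. prob {\<omega> \<in> space M. wsum m \<omega> \<le> \<kappa> * real m} \<le> exp (- B * real m)"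
proof -
  have "eventually (\<lambda>k::nat. (\<integral>w. exp (- real k * w) \<partial>\<mu>) < exp (- (B + 1))) sequentially"
    by (rule order_tendstoD[OF wl.laplace_tendsto_0]) simp
  then have "eventually (\<lambda>k::nat. 0 < k \<and> (\<integral>w. exp (- real k * w) \<partial>\<mu>) < exp (- (B + 1))) sequentially"
    using eventually_gt_at_top[of 0] by eventually_elim simp
  then obtain k :: nat where k: "0 < k" and lap: "(\<integral>w. exp (- real k * w) \<partial>\<mu>) < exp (- (B + 1))"
    by (auto simp: eventually_sequentially)
  have "prob {\<omega> \<in> space M. wsum m \<omega> \<le> (1 / real k) * real m} \<le> exp (- B * real m)" for m
  proof -
    let ?X = "\<lambda>j \<omega>. exp (- real k * W j \<omega>)"
    have ind: "indep_vars (\<lambda>_. borel) ?X {1..m}"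
      by (rule indep_vars_compose2[OF indep_vars_subset[OF weights_indep]]) auto
    have int: "integrable M (?X j)" if "j \<in> {1..m}" for j
    proof (rule bounded_integrable[where B=1])
      show "AE \<omega> in M. \<bar>?X j \<omega>\<bar> \<le> 1" using AE_W_unit by eventually_elim (use that in auto)
      show "?X j \<in> borel_measurable M" using measurable_compose[OF W_measurable[of j], of "\<lambda>w. exp (- real k * w)" borel] that by simp
    qed
    have eq: "(\<Prod>j\<in>{1..m}. ?X j \<omega>) = exp (- real k * wsum m \<omega>)" for \<omega>
      by (simp add: wsum_def exp_sum[symmetric] sum_distrib_left sum_negf)
    have "expectation (\<lambda>\<omega>. exp (- real k * wsum m \<omega>)) = (\<Prod>j\<in>{1..m}. expectation (?X j))"
      using indep_vars_lebesgue_integral[OF _ ind int] unfolding eq by simp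
    also have "\<dots> = (\<Prod>j\<in>{1..m}. \<integral>w. exp (- real k * w) \<partial>\<mu>)"
      by (intro prod.cong W_expectation) auto
    also have "\<dots> = (\<integral>w. exp (- real k * w) \<partial>\<mu>) ^ m" by simp
    also have "\<dots> \<le> exp (- (B + 1)) ^ m" using lap by (intro power_mono integral_nonneg_AE) auto
    finally have E: "expectation (\<lambda>\<omega>. exp (- real k * wsum m \<omega>)) \<le> exp (- (B + 1)) ^ m" .
    have "prob {\<omega> \<in> space M. wsum m \<omega> \<le> (1 / real k) * real m} = prob {\<omega> \<in> space M. exp (- real k * wsum m \<omega>) \<ge> exp (- real m)}"
      using k by (intro arg_cong[where f=prob]) (auto simp: field_simps)
    also have "\<dots> \<le> expectation (\<lambda>\<omega>. exp (- real k * wsum m \<omega>)) / exp (- real m)"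
    proof (rule integral_Markov_inequality_measure[where A="space M"])
      show "integrable M (\<lambda>\<omega>. exp (- real k * wsum m \<omega>))"
        unfolding eq[symmetric] using indep_vars_integrable[OF _ ind int] by simp
    qed auto
    also have "\<dots> \<le> exp (- (B + 1)) ^ m / exp (- real m)" using E by (rule divide_right_mono) simp
    also have "\<dots> = exp (- B * real m)"
      by (simp add: exp_of_nat_mult[symmetric] exp_diff[symmetric] algebra_simps del: exp_of_nat_mult)
    finally show ?thesis .
  qed
  then show thesis using k by (intro that[of "1 / real k"]) auto
qed

text \<open>Up to time \<open>\<epsilon> log n\<close> nothing can be guaranteed with probability \<open>1 - n\<^bsup>-A\<^esup>\<close>; from there to
  \<open>n\<^bsup>\<delta>\<^esup>\<close> only a linear lower bound on the weight sums is kept.\<close>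

definition log_cut :: "real \<Rightarrow> nat \<Rightarrow> nat" where "log_cut \<epsilon> n = nat \<lceil>\<epsilon> * ln (real n)\<rceil>"

definition sums_ok :: "real \<Rightarrow> real \<Rightarrow> real \<Rightarrow> nat \<Rightarrow> 'a \<Rightarrow> bool" where
  "sums_ok \<epsilon> \<kappa> \<delta> n \<omega> \<longleftrightarrow> (\<forall>m. max 1 (log_cut \<epsilon> n) \<le> m \<and> m < n \<longrightarrow> \<kappa> * real m < wsum m \<omega>)
     \<and> (\<forall>m. cutoff \<delta> n \<le> m \<and> m < n \<longrightarrow> \<bar>wsum m \<omega> - real m * (\<theta> - 1)\<bar> < (\<theta> - 1) * real m powr (3/4))"

lemma sums_ok_history: "{\<omega> \<in> space M. sums_ok \<epsilon> \<kappa> \<delta> n \<omega>} \<in> sets (history M W par J)"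
proof -
  have [measurable]: "wsum m \<in> borel_measurable (history M W par J)" for m by (rule wsum_history)
  have "{\<omega> \<in> space (history M W par J). sums_ok \<epsilon> \<kappa> \<delta> n \<omega>} \<in> sets (history M W par J)"
    unfolding sums_ok_def by measurable
  then show ?thesis by simp
qed

text \<open>The order of quantifiers matters: \<open>\<kappa>\<close> depends on \<open>A\<close>
  and \<open>\<epsilon>\<close> only, and \<open>\<delta>\<close> is later chosen at most
  \<open>\<kappa> \<epsilon>\<close>.\<close>

lemma sums_ok_prob:
  assumes A: "0 < A" and \<epsilon>: "0 < \<epsilon>"
  obtains \<kappa> where "0 < \<kappa>"
    "\<And>\<delta>. 0 < \<delta> \<Longrightarrow> eventually (\<lambda>n. prob {\<omega> \<in> space M. \<not> sums_ok \<epsilon> \<kappa> \<delta> n \<omega>} \<le> 2 * real n powr (- A)) sequentially"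
proof -
  \<comment> \<open>For \<open>m \<ge> \<epsilon> ln n\<close> the failure probability becomes
    \<open>n powr (- (A + 1))\<close>; the union bound over \<open>m < n\<close> costs one
    power.\<close>
  define B where "B = (A + 1) / \<epsilon>"
  have B: "0 < B" "B * \<epsilon> = A + 1" using A \<epsilon> by (auto simp: B_def)
  obtain \<kappa> where \<kappa>: "0 < \<kappa>" and lap: "\<And>m. prob {\<omega> \<in> space M. wsum m \<omega> \<le> \<kappa> * real m} \<le> exp (- B * real m)"
    using wsum_laplace by blast
  have e: "0 < \<theta> - 1" using wl.theta_gt_1 by simp
  have "eventually (\<lambda>n. prob {\<omega> \<in> space M. \<not> sums_ok \<epsilon> \<kappa> \<delta> n \<omega>} \<le> 2 * real n powr (- A)) sequentially"
    if \<delta>: "0 < \<delta>" for \<delta>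
  proof -
    have "eventually (\<lambda>n. real n * (2 * exp (- 2 * (\<theta> - 1)\<^sup>2 * sqrt (real n powr \<delta>))) \<le> real n powr (- A)) sequentially"
    proof -
      have "0 < 2 * (\<theta> - 1)\<^sup>2" using e by simp
      then have "eventually (\<lambda>n::nat. real n * (2 * exp (- (C * sqrt (real n powr \<delta>)))) \<le> real n powr (- A)) sequentially"
        if "0 < C" for C using \<delta> A that by real_asymp
      from this[OF \<open>0 < 2 * (\<theta> - 1)\<^sup>2\<close>] show ?thesis by simp
    qed
    then show ?thesis using eventually_gt_at_top[of 1]
    proof eventually_elim
      case (elim n)
      define I1 where "I1 = {max 1 (log_cut \<epsilon> n)..<n}"
      define I2 where "I2 = {max 1 (cutoff \<delta> n)..<n}"
      let ?E1 = "\<lambda>m. {\<omega> \<in> space M. wsum m \<omega> \<le> \<kappa> * real m}"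
      let ?E2 = "\<lambda>m. {\<omega> \<in> space M. \<bar>wsum m \<omega> - real m * (\<theta> - 1)\<bar> \<ge> (\<theta> - 1) * real m powr (3/4)}"
      have ncut: "0 < cutoff \<delta> n" 
      proof -
        have "0 < real n powr \<delta>" using elim by simp
        then show ?thesis using cutoff_bounds(1)[of n \<delta>] by linarith
      qed
      have "{\<omega> \<in> space M. \<not> sums_ok \<epsilon> \<kappa> \<delta> n \<omega>} \<subseteq> (\<Union>m\<in>I1. ?E1 m) \<union> (\<Union>m\<in>I2. ?E2 m)"
        using ncut by (auto simp: sums_ok_def I1_def I2_def not_less)
      then have "prob {\<omega> \<in> space M. \<not> sums_ok \<epsilon> \<kappa> \<delta> n \<omega>} \<le> prob ((\<Union>m\<in>I1. ?E1 m) \<union> (\<Union>m\<in>I2. ?E2 m))"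
        by (intro finite_measure_mono) (auto simp: I1_def I2_def)
      also have "\<dots> \<le> prob (\<Union>m\<in>I1. ?E1 m) + prob (\<Union>m\<in>I2. ?E2 m)"
        by (rule measure_Un_le) (auto simp: I1_def I2_def)
      also have "prob (\<Union>m\<in>I1. ?E1 m) \<le> (\<Sum>m\<in>I1. prob (?E1 m))"
        by (rule measure_UNION_le) (auto simp: I1_def)
      also have "\<dots> \<le> (\<Sum>m\<in>I1. real n powr (- (A + 1)))"
      proof (rule sum_mono)
        fix m assume "m \<in> I1"
        then have "\<epsilon> * ln (real n) \<le> real m" by (auto simp: I1_def log_cut_def)
        then have "B * (\<epsilon> * ln (real n)) \<le> B * real m" using B by (intro mult_left_mono) auto
        then have "(A + 1) * ln (real n) \<le> B * real m" using B by (simp add: mult.assoc[symmetric])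
        then have "- B * real m \<le> - (A + 1) * ln (real n)" by (simp only: mult_minus_left neg_le_iff_le)
        then have "exp (- B * real m) \<le> real n powr (- (A + 1))"
        proof -
          have "real n \<noteq> 0" using elim by simp
          with \<open>- B * real m \<le> - (A + 1) * ln (real n)\<close> show ?thesis
            by (simp only: powr_def if_False exp_le_cancel_iff)
        qed
        then show "prob (?E1 m) \<le> real n powr (- (A + 1))" using lap[of m] by linarith
      qed
      also have "\<dots> \<le> real n * real n powr (- (A + 1))"
        by (simp add: I1_def mult_right_mono)
      also have "\<dots> = real n powr (- A)" using elim powr_add[of "real n" 1 "- (A + 1)"] by simp
      also have "prob (\<Union>m\<in>I2. ?E2 m) \<le> (\<Sum>m\<in>I2. prob (?E2 m))"
        by (rule measure_UNION_le) (auto simp: I2_def)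
      also have "\<dots> \<le> (\<Sum>m\<in>I2. 2 * exp (- 2 * (\<theta> - 1)\<^sup>2 * sqrt (real n powr \<delta>)))"
      proof (rule sum_mono)
        fix m assume m: "m \<in> I2"
        then have "real n powr \<delta> \<le> real m" using cutoff_bounds(1)[of n \<delta>] by (auto simp: I2_def)
        then have "(\<theta> - 1)\<^sup>2 * sqrt (real n powr \<delta>) \<le> (\<theta> - 1)\<^sup>2 * sqrt (real m)" by (intro mult_left_mono) auto
        then have *: "2 * exp (- 2 * (\<theta> - 1)\<^sup>2 * sqrt (real m)) \<le> 2 * exp (- 2 * (\<theta> - 1)\<^sup>2 * sqrt (real n powr \<delta>))" by simp
        have "0 < m" using m by (simp add: I2_def)
        from order_trans[OF wsum_hoeffding[OF this] *]
        show "prob (?E2 m) \<le> 2 * exp (- 2 * (\<theta> - 1)\<^sup>2 * sqrt (real n powr \<delta>))" .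
      qed
      also have "\<dots> \<le> real n * (2 * exp (- 2 * (\<theta> - 1)\<^sup>2 * sqrt (real n powr \<delta>)))"
        by (simp add: I2_def mult_right_mono)
      also have "\<dots> \<le> real n powr (- A)" by (rule elim(1))
      finally show ?case by simp
    qed
  qed
  with \<kappa> show thesis by (rule that)
qed

end

section \<open>Deterministic rates above and below the attachment rates\<close>

text \<open>Reciprocals of the extreme values of \<open>wsum m / (\<theta> - 1)\<close> that
  \<open>sums_ok\<close> allows above the cutoff.\<close>

definition rate_up :: "nat \<Rightarrow> real" where "rate_up m = 1 / (real m * (1 - real m powr (-1/4)))"
definition rate_down :: "nat \<Rightarrow> real" where "rate_down m = 1 / (real m * (1 + real m powr (-1/4)))"

lemma rate_up_harmonic: "eventually (\<lambda>m. \<bar>real m * rate_up m - 1\<bar> \<le> 2 * real m powr (-1/4)) sequentially"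
proof -
  have "(\<lambda>m::nat. real m powr (-1/4)) \<longlonglongrightarrow> 0" by real_asymp
  then have "eventually (\<lambda>m. real m powr (-1/4) < 1/2) sequentially" by (rule order_tendstoD) simp
  then show ?thesis using eventually_gt_at_top[of 0]
  proof eventually_elim
    case (elim m)
    define x where "x = real m powr (-1/4)"
    have x: "0 \<le> x" "x < 1/2" using elim by (auto simp: x_def)
    have eq: "real m * rate_up m - 1 = x / (1 - x)"
      unfolding rate_up_def x_def[symmetric] using elim x by (simp add: field_simps)
    also have "\<dots> \<le> x / (1/2)" using x by (intro divide_left_mono) auto
    finally have "real m * rate_up m - 1 \<le> 2 * x" by simp
    moreover have "0 \<le> x / (1 - x)" using x by simp
    ultimately show ?case unfolding x_def[symmetric] using eq by linarith
  qed
qed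

lemma rate_down_harmonic: "eventually (\<lambda>m. \<bar>real m * rate_down m - 1\<bar> \<le> 2 * real m powr (-1/4)) sequentially"
  using eventually_gt_at_top[of 0]
proof eventually_elim
  case (elim m)
  define x where "x = real m powr (-1/4)"
  have x: "0 \<le> x" by (simp add: x_def)
  have "real m * rate_down m - 1 = - (x / (1 + x))"
    unfolding rate_down_def x_def[symmetric] using elim x by (simp add: divide_simps)
  moreover have "x / (1 + x) \<le> x / 1" using x by (intro divide_left_mono) auto
  moreover have "0 \<le> x / (1 + x)" using x by simp
  ultimately show ?case unfolding x_def[symmetric] using x by linarith
qed

context weighted_tree
begin

text \<open>Three regimes: the concentrated one, in the middle the bound
  \<open>W / wsum \<le> 1 / (\<kappa> l)\<close> from the linear lower bound on the sums, and at the
  start the trivial bound 1. The \<open>min\<close> keeps the middle value a probability.\<close>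

definition p_up :: "real \<Rightarrow> real \<Rightarrow> real \<Rightarrow> nat \<Rightarrow> real \<Rightarrow> nat \<Rightarrow> real" where
  "p_up \<epsilon> \<kappa> \<delta> n w l = (if cutoff \<delta> n \<le> l then w / (\<theta> - 1) * rate_up l
     else if l < max 1 (log_cut \<epsilon> n) then 1 else min 1 (1 / (\<kappa> * real l)))"

text \<open>Rate 0 below the cutoff is harmless, because the lower bound is applied to vertices born
  after it.\<close>

definition p_down :: "real \<Rightarrow> nat \<Rightarrow> real \<Rightarrow> nat \<Rightarrow> real" where
  "p_down \<delta> n w l = (if cutoff \<delta> n \<le> l then w / (\<theta> - 1) * rate_down l else 0)"

lemma powr_quarter_lt_1: "2 \<le> m \<Longrightarrow> real m powr (-1/4) < 1"
  using powr_less_mono2_neg[of "-1/4" 1 "real m"] by simp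

lemma dom_up:
  assumes ok: "sums_ok \<epsilon> \<kappa> \<delta> n \<omega>" and W: "\<forall>j\<ge>1. 0 < W j \<omega> \<and> W j \<omega> \<le> 1" and \<kappa>: "0 < \<kappa>"
    and n0: "2 \<le> cutoff \<delta> n" and v: "1 \<le> v" "v \<le> l" "l < n"
  shows "W v \<omega> / wsum l \<omega> \<le> p_up \<epsilon> \<kappa> \<delta> n (W v \<omega>) l"
proof -
  have Wv: "0 < W v \<omega>" "W v \<omega> \<le> 1" using W v by auto
  have le: "W v \<omega> \<le> wsum l \<omega>"
    unfolding wsum_def by (rule member_le_sum) (use v W in \<open>auto intro: less_imp_le\<close>)
  then have le1: "W v \<omega> / wsum l \<omega> \<le> 1" using Wv by (simp add: divide_le_eq_1)
  show ?thesis
  proof (cases "cutoff \<delta> n \<le> l")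
    case True
    define x where "x = real l powr (-1/4)"
    have l: "2 \<le> l" using n0 True by simp
    have x: "0 \<le> x" "x < 1" using powr_quarter_lt_1[OF l] by (auto simp: x_def)
    have "\<bar>wsum l \<omega> - real l * (\<theta> - 1)\<bar> < (\<theta> - 1) * real l powr (3/4)"
      using ok True v unfolding sums_ok_def by blast
    moreover have "real l powr (3/4) = real l * x"
      using l powr_add[of "real l" 1 "-1/4"] by (simp add: x_def)
    ultimately have "\<bar>wsum l \<omega> - real l * (\<theta> - 1)\<bar> < (\<theta> - 1) * (real l * x)" by simp
    then have "(\<theta> - 1) * (real l * (1 - x)) \<le> wsum l \<omega>" by (simp add: algebra_simps)
    then have "W v \<omega> / wsum l \<omega> \<le> W v \<omega> / ((\<theta> - 1) * (real l * (1 - x)))"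
      using Wv x l wl.theta_gt_1 le by (intro divide_left_mono mult_pos_pos) auto
    then show ?thesis using True by (simp add: p_up_def rate_up_def x_def)
  next
    case False
    show ?thesis
    proof (cases "l < max 1 (log_cut \<epsilon> n)")
      case True
      then show ?thesis using False le1 by (simp add: p_up_def)
    next
      case nl: False
      then have "\<kappa> * real l < wsum l \<omega>" using ok v unfolding sums_ok_def by (meson not_less)
      then have "W v \<omega> / wsum l \<omega> \<le> 1 / (\<kappa> * real l)"
        using Wv \<kappa> v by (intro frac_le) auto
      then show ?thesis using False nl le1 by (simp add: p_up_def)
    qed
  qed
qed

lemma dom_down:
  assumes ok: "sums_ok \<epsilon> \<kappa> \<delta> n \<omega>" and W: "\<forall>j\<ge>1. 0 < W j \<omega> \<and> W j \<omega> \<le> 1"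
    and n0: "2 \<le> cutoff \<delta> n" and v: "cutoff \<delta> n \<le> v" "v \<le> l" "l < n"
  shows "p_down \<delta> n (W v \<omega>) l \<le> W v \<omega> / wsum l \<omega>"
proof -
  have Wv: "0 < W v \<omega>" "W v \<omega> \<le> 1" using W v n0 by auto
  have le: "W v \<omega> \<le> wsum l \<omega>"
    unfolding wsum_def by (rule member_le_sum) (use v n0 W in \<open>auto intro: less_imp_le\<close>)
  define x where "x = real l powr (-1/4)"
  have l: "2 \<le> l" "cutoff \<delta> n \<le> l" using n0 v by auto
  have x: "0 \<le> x" by (simp add: x_def)
  have "\<bar>wsum l \<omega> - real l * (\<theta> - 1)\<bar> < (\<theta> - 1) * real l powr (3/4)"
    using ok l v unfolding sums_ok_def by blast
  moreover have "real l powr (3/4) = real l * x"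
    using l powr_add[of "real l" 1 "-1/4"] by (simp add: x_def)
  ultimately have "\<bar>wsum l \<omega> - real l * (\<theta> - 1)\<bar> < (\<theta> - 1) * (real l * x)" by simp
  then have "wsum l \<omega> \<le> (\<theta> - 1) * (real l * (1 + x))" by (simp add: algebra_simps)
  then have "W v \<omega> / ((\<theta> - 1) * (real l * (1 + x))) \<le> W v \<omega> / wsum l \<omega>"
    using Wv le x l wl.theta_gt_1 by (intro divide_left_mono mult_pos_pos) auto
  then show ?thesis using l by (simp add: p_down_def rate_down_def x_def)
qed

lemma sum_p_up:
  assumes \<kappa>: "0 < \<kappa>" and \<epsilon>: "0 < \<epsilon>" and \<delta>: "0 < \<delta>"
  shows "eventually (\<lambda>n. \<forall>w. 0 < w \<longrightarrow> w \<le> 1 \<longrightarrow> (\<Sum>l\<in>{1..<cutoff \<delta> n}. p_up \<epsilon> \<kappa> \<delta> n w l)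
      \<le> (\<epsilon> + \<delta> / \<kappa>) * ln (real n) + (2 + 2 / \<kappa>)) sequentially"
  using eventually_gt_at_top[of 1]
proof eventually_elim
  case (elim n)
  have L: "0 < ln (real n)" using elim by simp
  show ?case
  proof (intro allI impI)
    fix w :: real assume w: "0 < w" "w \<le> 1"
    let ?lo = "max 1 (log_cut \<epsilon> n)"
    have "(\<Sum>l\<in>{1..<cutoff \<delta> n}. p_up \<epsilon> \<kappa> \<delta> n w l) \<le> (\<Sum>l\<in>{1..<cutoff \<delta> n}. of_bool (l < ?lo) + 1 / (\<kappa> * real l))"
      using \<kappa> by (intro sum_mono) (auto simp: p_up_def min_def)
    also have "\<dots> = (\<Sum>l\<in>{1..<cutoff \<delta> n}. of_bool (l < ?lo)) + (\<Sum>l\<in>{1..<cutoff \<delta> n}. 1 / (\<kappa> * real l))"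
      by (rule sum.distrib)
    also have "(\<Sum>l\<in>{1..<cutoff \<delta> n}. of_bool (l < ?lo) :: real) \<le> \<epsilon> * ln (real n) + 2"
    proof -
      have "(\<Sum>l\<in>{1..<cutoff \<delta> n}. of_bool (l < ?lo) :: real) = real (card ({1..<cutoff \<delta> n} \<inter> {l. l < ?lo}))"
        by (simp add: of_bool_def sum.If_cases)
      also have "card ({1..<cutoff \<delta> n} \<inter> {l. l < ?lo}) \<le> card {..<?lo}" by (rule card_mono) auto
      also have "real (card {..<?lo}) \<le> \<epsilon> * ln (real n) + 2"
      proof -
        have "0 \<le> \<epsilon> * ln (real n)" using L \<epsilon> by simp
        moreover have "real (log_cut \<epsilon> n) = of_int \<lceil>\<epsilon> * ln (real n)\<rceil>"
          using calculation by (simp add: log_cut_def)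
        ultimately show ?thesis by simp linarith
      qed
      finally show ?thesis by simp
    qed
    also have "(\<Sum>l\<in>{1..<cutoff \<delta> n}. 1 / (\<kappa> * real l)) \<le> (1 / \<kappa>) * (2 + \<delta> * ln (real n))"
    proof -
      have "(\<Sum>l\<in>{1..<cutoff \<delta> n}. 1 / (\<kappa> * real l)) = (1 / \<kappa>) * (\<Sum>l\<in>{1..<cutoff \<delta> n}. 1 / real l)"
        by (simp add: sum_distrib_left)
      also have "(\<Sum>l\<in>{1..<cutoff \<delta> n}. 1 / real l) \<le> (\<Sum>l\<in>{1..cutoff \<delta> n}. 1 / real l)"
        by (intro sum_mono2) auto
      also have "\<dots> \<le> 1 + ln (real (cutoff \<delta> n))" by (rule harmonic_sum_le)
      also have "ln (real (cutoff \<delta> n)) \<le> 1 + \<delta> * ln (real n)"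
      proof -
        have p1: "1 \<le> real n powr \<delta>" using elim \<delta> by (intro ge_one_powr_ge_zero) auto
        have "ln (real (cutoff \<delta> n)) \<le> ln (2 * real n powr \<delta>)"
          using cutoff_bounds(1)[of n \<delta>] cutoff_bounds(2)[of \<delta> n] p1 by (subst ln_le_cancel_iff) linarith+
        also have "\<dots> = ln 2 + \<delta> * ln (real n)" using elim by (simp add: ln_mult ln_powr)
        finally show ?thesis using ln_2_less_1 by simp
      qed
      finally show ?thesis using \<kappa> by (simp add: divide_right_mono)
    qed
    finally show "(\<Sum>l\<in>{1..<cutoff \<delta> n}. p_up \<epsilon> \<kappa> \<delta> n w l) \<le> (\<epsilon> + \<delta> / \<kappa>) * ln (real n) + (2 + 2 / \<kappa>)"
      by (simp add: distrib_right add_divide_distrib)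
  qed
qed

lemma p_up_measurable: "(\<lambda>w. p_up \<epsilon> \<kappa> \<delta> n w l) \<in> borel_measurable borel"
  unfolding p_up_def by simp

lemma p_down_measurable: "(\<lambda>w. p_down \<delta> n w l) \<in> borel_measurable borel"
  unfolding p_down_def by simp

lemma label_rates_up:
  assumes "filterlim d at_top sequentially" "eventually (\<lambda>n. real (d n) \<le> c' * ln (real n)) sequentially"
    "0 \<le> c'" "0 < \<beta>" "\<beta> < 1" "2 * \<beta> < 1 / wl.gam" "0 < \<delta>" "\<delta> < 1/2" "c' < (1 / wl.gam - 2 * \<beta>) * (1 - 2 * \<delta>)"
  shows "label_rates \<mu> \<theta> rate_up (p_up \<epsilon> \<kappa> \<delta>) d c' \<beta> \<delta>"
  using assms rate_up_harmonic p_up_measurable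
  by unfold_locales (auto simp: p_up_def)

lemma label_rates_down:
  assumes "filterlim d at_top sequentially" "eventually (\<lambda>n. real (d n) \<le> c' * ln (real n)) sequentially"
    "0 \<le> c'" "0 < \<beta>" "\<beta> < 1" "2 * \<beta> < 1 / wl.gam" "0 < \<delta>" "\<delta> < 1/2" "c' < (1 / wl.gam - 2 * \<beta>) * (1 - 2 * \<delta>)"
  shows "label_rates \<mu> \<theta> rate_down (p_down \<delta>) d c' \<beta> \<delta>"
  using assms rate_down_harmonic p_down_measurable
  by unfold_locales (auto simp: p_down_def)

end

context label_rates
begin

lemma rate_fun_good:
  assumes good: "good_n n" and low: "\<And>w l. 0 < w \<Longrightarrow> w \<le> 1 \<Longrightarrow> l < n0 n \<Longrightarrow> 0 \<le> p n w l \<and> p n w l \<le> 1"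
  shows "rate_fun (p n)"
proof -
  interpret harmonic_rates c "n0 n" by (rule good_nD(1)[OF good])
  have "0 \<le> p n w l \<and> p n w l \<le> 1" if w: "0 < w" "w \<le> 1" for w l
  proof (cases "l < n0 n")
    case True then show ?thesis using low w by blast
  next
    case False
    then have l: "n0 n \<le> l" by simp
    have "0 \<le> w / (\<theta> - 1) * c l" using rate_nonneg[OF l] w theta_gt_1 by simp
    then show ?thesis using good_nD(4)[OF good w l] by simp
  qed
  then show ?thesis using p_measurable by (simp add: rate_fun_def)
qed

end

section \<open>Joint degree tails of fixed vertices\<close>

context weighted_tree
begin

lemma joint_tail_final:
  "joint_tail P u n k n \<omega> = of_bool (\<forall>i. k i \<le> deg n (u i) \<omega>)"
proof (cases "\<forall>i. k i \<le> deg n (u i) \<omega>")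
  case True
  then show ?thesis by (simp add: joint_tail_def tail_prob_ge)
next
  case False
  then obtain i where "\<not> k i \<le> deg n (u i) \<omega>" by blast
  then have "tail_prob (hazard P (u i) \<omega>) n n (k i - deg n (u i) \<omega>) = 0" by (simp add: tail_prob_ge)
  then have "joint_tail P u n k n \<omega> = 0" unfolding joint_tail_def by (intro prod_zero) auto
  then show ?thesis using False by auto
qed

text \<open>At time 1 there are no edges, so only the weights of distinct vertices enter, and their
  independence gives the product.\<close>

lemma joint_tail_start:
  fixes u :: "'k::finite \<Rightarrow> nat"
  assumes u: "inj u" "\<And>i. 1 \<le> u i" and P: "rate_fun P"
  shows "expectation (joint_tail P u n k 1) = (\<Prod>i\<in>UNIV. \<integral>w. tail_prob (P w) (u i) n (k i) \<partial>\<mu>)"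
proof -
  \<comment> \<open>Indexed by vertices rather than by \<open>i\<close>, to match the index set of
    the independent family \<open>W\<close>.\<close>
  define f where "f j w = tail_prob (P w) j n (k (inv u j))" for j w
  have fm: "f j \<in> borel_measurable borel" for j
    unfolding f_def by (rule tail_prob_measurable) (rule rate_fun_measurable[OF P])
  have eqf: "joint_tail P u n k 1 \<omega> = (\<Prod>j\<in>range u. f j (W j \<omega>))" for \<omega>
  proof -
    have "tail_prob (hazard P (u i) \<omega>) 1 n (k i) = f (u i) (W (u i) \<omega>)" for i
    proof -
      have "tail_prob (hazard P (u i) \<omega>) 1 n (k i) = tail_prob (P (W (u i) \<omega>)) (u i) n (k i)"
        unfolding hazard_def by (rule tail_prob_zero_below[OF u(2)])
      then show ?thesis using u(1) by (simp add: f_def)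
    qed
    then show ?thesis unfolding joint_tail_def using u(1) by (simp add: prod.reindex)
  qed
  have "expectation (joint_tail P u n k 1) = expectation (\<lambda>\<omega>. \<Prod>j\<in>range u. f j (W j \<omega>))"
    by (rule Bochner_Integration.integral_cong[OF refl eqf])
  also have "\<dots> = (\<Prod>j\<in>range u. expectation (\<lambda>\<omega>. f j (W j \<omega>)))"
  proof (rule indep_vars_lebesgue_integral)
    show "indep_vars (\<lambda>_. borel) (\<lambda>j \<omega>. f j (W j \<omega>)) (range u)"
      by (rule indep_vars_compose2[OF indep_vars_subset[OF weights_indep]]) (use u fm in auto)
    show "integrable M (\<lambda>\<omega>. f j (W j \<omega>))" if "j \<in> range u" for j
    proof (rule bounded_integrable[where B=1])
      have j: "1 \<le> j" using that u(2) by auto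
      show "AE \<omega> in M. \<bar>f j (W j \<omega>)\<bar> \<le> 1"
        using AE_W_unit
      proof eventually_elim
        case (elim \<omega>)
        have "0 \<le> f j (W j \<omega>) \<and> f j (W j \<omega>) \<le> 1"
          unfolding f_def by (rule tail_prob_bounds) (use elim j rate_fun_bounds[OF P] in auto)
        then show ?case by simp
      qed
      show "(\<lambda>\<omega>. f j (W j \<omega>)) \<in> borel_measurable M" by (rule measurable_compose[OF W_measurable[OF j] fm])
    qed
  qed simp
  also have "\<dots> = (\<Prod>j\<in>range u. \<integral>w. f j w \<partial>\<mu>)"
    by (intro prod.cong W_expectation fm) (use u in auto)
  also have "\<dots> = (\<Prod>i\<in>UNIV. \<integral>w. tail_prob (P w) (u i) n (k i) \<partial>\<mu>)"
    using u(1) by (simp add: prod.reindex f_def)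
  finally show ?thesis .
qed

definition deg_event :: "('k \<Rightarrow> nat) \<Rightarrow> nat \<Rightarrow> ('k \<Rightarrow> nat) \<Rightarrow> 'a set" where
  "deg_event u n k = {\<omega> \<in> space M. \<forall>i. k i \<le> deg n (u i) \<omega>}"

lemma deg_measurable: "deg l u \<in> M \<rightarrow>\<^sub>M count_space UNIV"
  by (rule measurable_from_subalg[OF subalgebra_history deg_history[OF order_refl]]) auto

lemma deg_event_sets: "deg_event (u :: 'k::finite \<Rightarrow> nat) n k \<in> sets M"
proof -
  have "{\<omega> \<in> space M. k i \<le> deg n (u i) \<omega>} \<in> sets M" for i
    using measurable_sets[OF deg_measurable[of n "u i"], of "{k i..}"] by (simp add: vimage_def Int_def conj_commute)
  then have "(\<Inter>i\<in>UNIV. {\<omega> \<in> space M. k i \<le> deg n (u i) \<omega>}) \<in> sets M"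
    by (intro sets.finite_INT) auto
  moreover have "(\<Inter>i\<in>UNIV. {\<omega> \<in> space M. k i \<le> deg n (u i) \<omega>}) = deg_event u n k"
    by (auto simp: deg_event_def)
  ultimately show ?thesis by simp
qed

lemma deg_event_indicator:
  fixes u :: "'k::finite \<Rightarrow> nat"
  shows "integrable M (indicator (deg_event u n k) :: 'a \<Rightarrow> real)"
    "expectation (indicator (deg_event u n k)) = prob (deg_event u n k)"
proof -
  have "deg_event u n k \<inter> space M = deg_event u n k" by (auto simp: deg_event_def)
  then show "expectation (indicator (deg_event u n k)) = prob (deg_event u n k)" by simp
  show "integrable M (indicator (deg_event u n k) :: 'a \<Rightarrow> real)"
    by (rule bounded_integrable[OF borel_measurable_indicator[OF deg_event_sets], where B=1]) (auto simp: indicator_def)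
qed

lemma ok_indicator:
  fixes \<epsilon> \<kappa> \<delta> n
  defines "g \<equiv> indicator {\<omega> \<in> space M. sums_ok \<epsilon> \<kappa> \<delta> n \<omega>} :: 'a \<Rightarrow> real"
  shows "g \<in> borel_measurable (history M W par J)" "AE \<omega> in M. 0 \<le> g \<omega> \<and> g \<omega> \<le> 1" "g \<in> borel_measurable M"
    "integrable M g"
proof -
  show m: "g \<in> borel_measurable (history M W par J)" for J
    unfolding g_def by (rule borel_measurable_indicator) (rule sums_ok_history)
  show gM: "g \<in> borel_measurable M"
    by (rule measurable_from_subalg[OF subalgebra_history m, of "{}"]) auto
  show b: "AE \<omega> in M. 0 \<le> g \<omega> \<and> g \<omega> \<le> 1" by (auto simp: g_def indicator_def)
  show "integrable M g" by (rule bounded_integrable[OF gM, where B=1]) (use b in auto)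
qed

lemma not_ok_sets: "{\<omega> \<in> space M. \<not> sums_ok \<epsilon> \<kappa> \<delta> n \<omega>} \<in> sets M"
proof -
  have "{\<omega> \<in> space M. sums_ok \<epsilon> \<kappa> \<delta> n \<omega>} \<in> sets M"
    using sums_ok_history[of \<epsilon> \<kappa> \<delta> n "{}"] subalgebra_history[of "{}"] by (auto simp: subalgebra_def)
  then have "space M - {\<omega> \<in> space M. sums_ok \<epsilon> \<kappa> \<delta> n \<omega>} \<in> sets M" by auto
  moreover have "space M - {\<omega> \<in> space M. sums_ok \<epsilon> \<kappa> \<delta> n \<omega>} = {\<omega> \<in> space M. \<not> sums_ok \<epsilon> \<kappa> \<delta> n \<omega>}" by auto
  ultimately show ?thesis by simp
qed

text \<open>The first claim is the supermartingale bound from time 1 to time \<open>n\<close>, where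
  the joint tail is an indicator. The second, at intermediate times, feeds the error term of
  \<open>deg_event_lower\<close>.\<close>

lemma deg_event_upper:
  fixes u :: "'k::finite \<Rightarrow> nat"
  assumes u: "inj u" "\<And>i. 1 \<le> u i" and P: "rate_fun (p_up \<epsilon> \<kappa> \<delta> n)"
    and n: "1 \<le> n" and \<kappa>: "0 < \<kappa>" and n0: "2 \<le> cutoff \<delta> n"
  shows "prob (deg_event u n k) \<le> (\<Prod>i\<in>UNIV. \<integral>w. tail_prob (p_up \<epsilon> \<kappa> \<delta> n w) (u i) n (k i) \<partial>\<mu>)
      + prob {\<omega> \<in> space M. \<not> sums_ok \<epsilon> \<kappa> \<delta> n \<omega>}"
    and "1 \<le> l \<Longrightarrow> l \<le> n \<Longrightarrow> expectation (\<lambda>\<omega>. indicator {\<omega> \<in> space M. sums_ok \<epsilon> \<kappa> \<delta> n \<omega>} \<omega> * joint_tail (p_up \<epsilon> \<kappa> \<delta> n) u n k l \<omega>)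
      \<le> (\<Prod>i\<in>UNIV. \<integral>w. tail_prob (p_up \<epsilon> \<kappa> \<delta> n w) (u i) n (k i) \<partial>\<mu>)"
proof -
  let ?P = "p_up \<epsilon> \<kappa> \<delta> n"
  let ?ok = "{\<omega> \<in> space M. sums_ok \<epsilon> \<kappa> \<delta> n \<omega>}"
  let ?bad = "{\<omega> \<in> space M. \<not> sums_ok \<epsilon> \<kappa> \<delta> n \<omega>}"
  let ?g = "indicator ?ok :: 'a \<Rightarrow> real"
  note g = ok_indicator[where \<epsilon>=\<epsilon> and \<kappa>=\<kappa> and \<delta>=\<delta> and n=n]
  note int = integrable_joint_tail[OF P, of u, OF u(2) g(3,2)]
  have dom: "AE \<omega> in M. ?g \<omega> \<noteq> 0 \<longrightarrow> (\<forall>v l. 1 \<le> v \<longrightarrow> v \<le> l \<longrightarrow> l < n \<longrightarrow> W v \<omega> / wsum l \<omega> \<le> ?P (W v \<omega>) l)"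
    using AE_W_unit by eventually_elim (use dom_up[OF _ _ \<kappa> n0] in \<open>auto simp: indicator_def\<close>)
  have start: "expectation (\<lambda>\<omega>. ?g \<omega> * joint_tail ?P u n k 1 \<omega>) \<le> (\<Prod>i\<in>UNIV. \<integral>w. tail_prob (?P w) (u i) n (k i) \<partial>\<mu>)"
  proof -
    have "expectation (\<lambda>\<omega>. ?g \<omega> * joint_tail ?P u n k 1 \<omega>) \<le> expectation (joint_tail ?P u n k 1)"
    proof (rule integral_mono_AE[OF int])
      show "integrable M (joint_tail ?P u n k 1)"
        by (rule bounded_integrable[OF joint_tail_measurable[OF P u(2)], where B=1])
          (use joint_tail_bounds[OF P, of u n k 1, OF u(2)] in \<open>eventually_elim, simp\<close>)
      show "AE \<omega> in M. ?g \<omega> * joint_tail ?P u n k 1 \<omega> \<le> joint_tail ?P u n k 1 \<omega>"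
        using joint_tail_bounds[OF P, of u n k 1, OF u(2)] by eventually_elim (auto simp: indicator_def)
    qed
    then show ?thesis unfolding joint_tail_start[OF u P] .
  qed
  have mid: "expectation (\<lambda>\<omega>. ?g \<omega> * joint_tail ?P u n k l \<omega>) \<le> (\<Prod>i\<in>UNIV. \<integral>w. tail_prob (?P w) (u i) n (k i) \<partial>\<mu>)"
    if "1 \<le> l" "l \<le> n" for l
    using joint_tail_upper[OF u g(1,2) P dom _ that, of k] start by simp
  then show "1 \<le> l \<Longrightarrow> l \<le> n \<Longrightarrow> expectation (\<lambda>\<omega>. ?g \<omega> * joint_tail ?P u n k l \<omega>)
      \<le> (\<Prod>i\<in>UNIV. \<integral>w. tail_prob (?P w) (u i) n (k i) \<partial>\<mu>)" .
  have "prob (deg_event u n k) = expectation (indicator (deg_event u n k))"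
    by (rule deg_event_indicator(2)[symmetric])
  also have "\<dots> \<le> expectation (\<lambda>\<omega>. ?g \<omega> * joint_tail ?P u n k n \<omega> + indicator ?bad \<omega>)"
  proof (rule integral_mono[OF deg_event_indicator(1)])
    show "integrable M (\<lambda>\<omega>. ?g \<omega> * joint_tail ?P u n k n \<omega> + indicator ?bad \<omega>)"
      using int not_ok_sets by (intro Bochner_Integration.integrable_add) (auto simp: emeasure_eq_measure)
    show "indicator (deg_event u n k) \<omega> \<le> ?g \<omega> * joint_tail ?P u n k n \<omega> + indicator ?bad \<omega>" for \<omega>
      unfolding joint_tail_final by (auto simp: indicator_def deg_event_def)
  qed
  also have "\<dots> = expectation (\<lambda>\<omega>. ?g \<omega> * joint_tail ?P u n k n \<omega>) + prob ?bad"
    using int not_ok_sets by (subst Bochner_Integration.integral_add) (auto simp: emeasure_eq_measure)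
  also have "\<dots> \<le> (\<Prod>i\<in>UNIV. \<integral>w. tail_prob (?P w) (u i) n (k i) \<partial>\<mu>) + prob ?bad"
    using mid[OF n order_refl] by simp
  finally show "prob (deg_event u n k) \<le> (\<Prod>i\<in>UNIV. \<integral>w. tail_prob (?P w) (u i) n (k i) \<partial>\<mu>) + prob ?bad" .
qed

text \<open>Beyond the cutoff the squared rates are of order \<open>1 / m^2\<close>, so their sum is
  of order \<open>1 / cutoff \<delta> n\<close>; the factor with \<open>k i - 1\<close> is the joint
  tail that multiplies this error.\<close>

lemma deg_event_lower:
  fixes u :: "'k::finite \<Rightarrow> nat"
  assumes u: "inj u" "\<And>i. cutoff \<delta> n < u i" and P: "rate_fun (p_up \<epsilon> \<kappa> \<delta> n)" and Q: "rate_fun (p_down \<delta> n)"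
    and n: "1 \<le> n" and \<kappa>: "0 < \<kappa>" and n0: "2 \<le> cutoff \<delta> n"
    and QP: "\<And>w l. 0 < w \<Longrightarrow> w \<le> 1 \<Longrightarrow> p_down \<delta> n w l \<le> p_up \<epsilon> \<kappa> \<delta> n w l"
  shows "(\<Prod>i\<in>UNIV. \<integral>w. tail_prob (p_down \<delta> n w) (u i) n (k i) \<partial>\<mu>)
      - prob {\<omega> \<in> space M. \<not> sums_ok \<epsilon> \<kappa> \<delta> n \<omega>}
      - 2 * (real CARD('k) / (\<theta> - 1))\<^sup>2 / real (cutoff \<delta> n)
        * (\<Prod>i\<in>UNIV. \<integral>w. tail_prob (p_up \<epsilon> \<kappa> \<delta> n w) (u i) n (k i - 1) \<partial>\<mu>)
    \<le> prob (deg_event u n k)"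
proof -
  let ?P = "p_up \<epsilon> \<kappa> \<delta> n"
  let ?Q = "p_down \<delta> n"
  let ?ok = "{\<omega> \<in> space M. sums_ok \<epsilon> \<kappa> \<delta> n \<omega>}"
  let ?bad = "{\<omega> \<in> space M. \<not> sums_ok \<epsilon> \<kappa> \<delta> n \<omega>}"
  let ?g = "indicator ?ok :: 'a \<Rightarrow> real"
  define e where "e = (\<Prod>i\<in>UNIV. \<integral>w. tail_prob (?P w) (u i) n (k i - 1) \<partial>\<mu>)"
  define K where "K = (real CARD('k) / (\<theta> - 1))\<^sup>2"
  define \<eta> where "\<eta> l = (if l < cutoff \<delta> n then 0 else K / real l ^ 2)" for l
  have u1: "1 \<le> u i" for i using u(2)[of i] by simp
  have th: "0 < \<theta> - 1" using wl.theta_gt_1 by simp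
  note g = ok_indicator[where \<epsilon>=\<epsilon> and \<kappa>=\<kappa> and \<delta>=\<delta> and n=n]
  note intQ = integrable_joint_tail[OF Q, of u, OF u1 g(3,2)]
  note intP = integrable_joint_tail[OF P, of u, OF u1 g(3,2)]
  have e0: "0 \<le> e" unfolding e_def by (intro prod_nonneg ballI integral_tail_nonneg P)
  have dom: "AE \<omega> in M. ?g \<omega> \<noteq> 0 \<longrightarrow> (\<forall>v l. v \<in> range u \<longrightarrow> v \<le> l \<longrightarrow> l < n \<longrightarrow> ?Q (W v \<omega>) l \<le> W v \<omega> / wsum l \<omega>)"
    using AE_W_unit
  proof eventually_elim
    case (elim \<omega>)
    show ?case
    proof (intro impI allI)
      fix v l assume a: "?g \<omega> \<noteq> 0" "v \<in> range u" "v \<le> l" "l < n"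
      then have "sums_ok \<epsilon> \<kappa> \<delta> n \<omega>" "cutoff \<delta> n \<le> v" using u(2) by (auto simp: indicator_def less_imp_le split: if_splits)
      then show "?Q (W v \<omega>) l \<le> W v \<omega> / wsum l \<omega>" using dom_down elim n0 a by blast
    qed
  qed
  have small: "AE \<omega> in M. (\<Sum>i\<in>UNIV. hazard ?Q (u i) \<omega> l)\<^sup>2 \<le> \<eta> l" for l
    using AE_W_unit hazard_bounds[OF Q]
  proof eventually_elim
    case (elim \<omega>)
    show ?case
    proof (cases "l < cutoff \<delta> n")
      case True
      then have "hazard ?Q (u i) \<omega> l = 0" for i by (auto simp: hazard_def p_down_def)
      then show ?thesis using True by (simp add: \<eta>_def)
    next
      case False
      then have l: "0 < real l" using n0 by simp
      have "hazard ?Q (u i) \<omega> l \<le> 1 / ((\<theta> - 1) * real l)" for i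
      proof -
        have Wu: "0 < W (u i) \<omega>" "W (u i) \<omega> \<le> 1" using elim(1) u1 by auto
        have "rate_down l \<le> 1 / real l"
          unfolding rate_down_def using l by (intro divide_left_mono mult_pos_pos add_pos_nonneg) auto
        then have "W (u i) \<omega> / (\<theta> - 1) * rate_down l \<le> 1 / (\<theta> - 1) * (1 / real l)"
          using Wu th l by (intro mult_mono divide_right_mono) (auto simp: rate_down_def)
        then show ?thesis using False th l by (simp add: hazard_def p_down_def)
      qed
      then have "(\<Sum>i\<in>UNIV. hazard ?Q (u i) \<omega> l) \<le> (\<Sum>i\<in>(UNIV::'k set). 1 / ((\<theta> - 1) * real l))"
        by (intro sum_mono) auto
      also have "\<dots> = real CARD('k) / (\<theta> - 1) / real l" by simp
      finally have "(\<Sum>i\<in>UNIV. hazard ?Q (u i) \<omega> l)\<^sup>2 \<le> (real CARD('k) / (\<theta> - 1) / real l)\<^sup>2"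
        using elim(2) u1 by (intro power_mono sum_nonneg) auto
      then show ?thesis using False by (simp add: \<eta>_def K_def power_divide power_mult_distrib)
    qed
  qed
  have sum\<eta>: "(\<Sum>m\<in>{1..<n}. \<eta> m) \<le> 2 * K / real (cutoff \<delta> n)"
  proof -
    have K0: "0 \<le> K" by (simp add: K_def)
    have "(\<Sum>m\<in>{1..<n}. \<eta> m) \<le> (\<Sum>m\<in>{cutoff \<delta> n..<max n (cutoff \<delta> n)}. K / real m ^ 2)"
    proof -
      have "(\<Sum>m\<in>{1..<n}. \<eta> m) = (\<Sum>m\<in>{1..<n} \<inter> {m. cutoff \<delta> n \<le> m}. \<eta> m)"
        by (rule sum.mono_neutral_right) (auto simp: \<eta>_def)
      also have "\<dots> = (\<Sum>m\<in>{1..<n} \<inter> {m. cutoff \<delta> n \<le> m}. K / real m ^ 2)"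
        by (rule sum.cong) (auto simp: \<eta>_def)
      also have "\<dots> \<le> (\<Sum>m\<in>{cutoff \<delta> n..<max n (cutoff \<delta> n)}. K / real m ^ 2)"
        using K0 by (intro sum_mono2) auto
      finally show ?thesis .
    qed
    also have "\<dots> \<le> (\<Sum>m\<in>{cutoff \<delta> n..<max n (cutoff \<delta> n)}. - (2 * K / real (Suc m)) - (- (2 * K / real m)))"
    proof (rule sum_mono)
      fix m assume "m \<in> {cutoff \<delta> n..<max n (cutoff \<delta> n)}"
      then have m: "1 \<le> real m" using n0 by auto
      have "1 / real m ^ 2 \<le> 2 * (1 / real m - 1 / real (Suc m))"
      proof -
        have "1 / real m - 1 / real (Suc m) = 1 / (real m * real (Suc m))" using m by (simp add: field_simps)
        also have "\<dots> \<ge> 1 / (real m * (2 * real m))" using m by (intro divide_left_mono mult_left_mono mult_pos_pos) auto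
        finally show ?thesis using m by (simp add: power2_eq_square)
      qed
      then have "K * (1 / real m ^ 2) \<le> K * (2 * (1 / real m - 1 / real (Suc m)))" using K0 by (rule mult_left_mono)
      then show "K / real m ^ 2 \<le> - (2 * K / real (Suc m)) - (- (2 * K / real m))" by (simp add: algebra_simps)
    qed
    also have "\<dots> = - (2 * K / real (max n (cutoff \<delta> n))) - (- (2 * K / real (cutoff \<delta> n)))"
      by (rule sum_Suc_diff') simp
    also have "\<dots> \<le> 2 * K / real (cutoff \<delta> n)" using K0 by simp
    finally show ?thesis .
  qed
  \<comment> \<open>Upper estimates at intermediate times come from domination of the attachment
    rates, so the tail is first enlarged to the upper rates.\<close>
  have e: "(\<integral>\<omega>. ?g \<omega> * joint_tail ?Q u n (\<lambda>i. k i - 1) l \<omega> \<partial>M) \<le> e" if l: "1 \<le> l" "l \<le> n" for l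
  proof -
    have "(\<integral>\<omega>. ?g \<omega> * joint_tail ?Q u n (\<lambda>i. k i - 1) l \<omega> \<partial>M) \<le> (\<integral>\<omega>. ?g \<omega> * joint_tail ?P u n (\<lambda>i. k i - 1) l \<omega> \<partial>M)"
    proof (rule integral_mono_AE[OF intQ intP])
      show "AE \<omega> in M. ?g \<omega> * joint_tail ?Q u n (\<lambda>i. k i - 1) l \<omega> \<le> ?g \<omega> * joint_tail ?P u n (\<lambda>i. k i - 1) l \<omega>"
        using AE_W_unit hazard_bounds[OF Q] hazard_bounds[OF P]
      proof eventually_elim
        case (elim \<omega>)
        have "hazard ?Q (u i) \<omega> m \<le> hazard ?P (u i) \<omega> m" for i m
          using QP[of "W (u i) \<omega>" m] elim(1) u1 by (simp add: hazard_def)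
        then have "tail_prob (hazard ?Q (u i) \<omega>) l n j \<le> tail_prob (hazard ?P (u i) \<omega>) l n j" for i j
          using elim u1 by (intro tail_prob_mono) auto
        moreover have "0 \<le> tail_prob (hazard ?Q (u i) \<omega>) l n j" for i j
          using tail_prob_bounds[of l n "hazard ?Q (u i) \<omega>" j] elim u1 by auto
        ultimately have "joint_tail ?Q u n (\<lambda>i. k i - 1) l \<omega> \<le> joint_tail ?P u n (\<lambda>i. k i - 1) l \<omega>"
          unfolding joint_tail_def by (intro prod_mono) auto
        then show ?case by (auto simp: indicator_def)
      qed
    qed
    also have "\<dots> \<le> e" unfolding e_def by (rule deg_event_upper(2)[OF u(1) u1 P n \<kappa> n0 l])
    finally show ?thesis .
  qed
  have "(\<integral>\<omega>. ?g \<omega> * joint_tail ?Q u n k 1 \<omega> \<partial>M) - (\<Sum>m\<in>{1..<n}. \<eta> m) * e \<le> (\<integral>\<omega>. ?g \<omega> * joint_tail ?Q u n k n \<omega> \<partial>M)"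
    by (rule joint_tail_lower[OF u(1) u1 g(1,2) Q dom small e _ order_refl n]) (auto simp: \<eta>_def K_def)
  also have "\<dots> \<le> (\<integral>\<omega>. indicator (deg_event u n k) \<omega> \<partial>M)"
  proof (rule integral_mono[OF intQ deg_event_indicator(1)])
    show "?g \<omega> * joint_tail ?Q u n k n \<omega> \<le> indicator (deg_event u n k) \<omega>" for \<omega>
      unfolding joint_tail_final by (auto simp: indicator_def deg_event_def)
  qed
  also have "\<dots> = prob (deg_event u n k)" by (rule deg_event_indicator(2))
  finally have 1: "(\<integral>\<omega>. ?g \<omega> * joint_tail ?Q u n k 1 \<omega> \<partial>M) - (\<Sum>m\<in>{1..<n}. \<eta> m) * e \<le> prob (deg_event u n k)" .
  have 2: "(\<Sum>m\<in>{1..<n}. \<eta> m) * e \<le> 2 * K / real (cutoff \<delta> n) * e" using sum\<eta> e0 by (rule mult_right_mono)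
  have "expectation (joint_tail ?Q u n k 1) \<le> (\<integral>\<omega>. ?g \<omega> * joint_tail ?Q u n k 1 \<omega> + indicator ?bad \<omega> \<partial>M)"
  proof (rule integral_mono_AE)
    show "integrable M (joint_tail ?Q u n k 1)"
      by (rule bounded_integrable[OF joint_tail_measurable[OF Q u1], where B=1])
        (use joint_tail_bounds[OF Q, of u n k 1, OF u1] in \<open>eventually_elim, simp\<close>)
    show "integrable M (\<lambda>\<omega>. ?g \<omega> * joint_tail ?Q u n k 1 \<omega> + indicator ?bad \<omega>)"
      using intQ not_ok_sets by (intro Bochner_Integration.integrable_add) (auto simp: emeasure_eq_measure)
    show "AE \<omega> in M. joint_tail ?Q u n k 1 \<omega> \<le> ?g \<omega> * joint_tail ?Q u n k 1 \<omega> + indicator ?bad \<omega>"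
      using joint_tail_bounds[OF Q, of u n k 1, OF u1] AE_space by eventually_elim (auto simp: indicator_def)
  qed
  also have "\<dots> = (\<integral>\<omega>. ?g \<omega> * joint_tail ?Q u n k 1 \<omega> \<partial>M) + prob ?bad"
    using intQ not_ok_sets by (subst Bochner_Integration.integral_add) (auto simp: emeasure_eq_measure)
  finally have 3: "(\<Prod>i\<in>UNIV. \<integral>w. tail_prob (?Q w) (u i) n (k i) \<partial>\<mu>) \<le> (\<integral>\<omega>. ?g \<omega> * joint_tail ?Q u n k 1 \<omega> \<partial>M) + prob ?bad"
    unfolding joint_tail_start[OF u(1) u1 Q] .
  show ?thesis using 1 2 3 unfolding K_def[symmetric] e_def[symmetric] by linarith
qed

end

section \<open>Tuples with coinciding labels\<close>

text \<open>The constraint \<open>u i = u j\<close> removes one summation: the factor at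
  \<open>j\<close> is bounded by \<open>m\<close>, and forgetting coordinate \<open>j\<close> is
  injective because \<open>u i\<close> still determines it.\<close>

lemma sum_coincidence_le:
  fixes f :: "'k::finite \<Rightarrow> nat \<Rightarrow> real"
  assumes fin: "\<And>l. finite (S l)" and nonneg: "\<And>l x. x \<in> S l \<Longrightarrow> 0 \<le> f l x"
    and m: "\<And>x. x \<in> S j \<Longrightarrow> f j x \<le> m" "0 \<le> m" and ij: "i \<noteq> j"
  shows "(\<Sum>u\<in>{u \<in> PiE UNIV S. u i = u j}. \<Prod>l\<in>UNIV. f l (u l)) \<le> m * (\<Prod>l\<in>UNIV - {j}. \<Sum>x\<in>S l. f l x)"
proof -
  let ?A = "{u \<in> PiE UNIV S. u i = u j}"
  let ?r = "\<lambda>u. restrict u (UNIV - {j})"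
  have inj: "inj_on ?r ?A"
  proof (rule inj_onI)
    fix u v assume uv: "u \<in> ?A" "v \<in> ?A" "?r u = ?r v"
    have eq: "u l = v l" if "l \<noteq> j" for l using fun_cong[OF uv(3), of l] that by simp
    then have "u j = v j" using uv(1,2) ij by (metis (mono_tags, lifting) mem_Collect_eq)
    then show "u = v" using eq by (metis ext)
  qed
  have "(\<Sum>u\<in>?A. \<Prod>l\<in>UNIV. f l (u l)) \<le> (\<Sum>u\<in>?A. m * (\<Prod>l\<in>UNIV - {j}. f l (?r u l)))"
  proof (rule sum_mono)
    fix u assume u: "u \<in> ?A"
    have S: "u l \<in> S l" for l using u by (auto simp: PiE_def)
    have "(\<Prod>l\<in>UNIV. f l (u l)) = f j (u j) * (\<Prod>l\<in>UNIV - {j}. f l (u l))"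
      by (rule prod.remove) auto
    also have "\<dots> \<le> m * (\<Prod>l\<in>UNIV - {j}. f l (u l))"
      using m(1)[OF S] nonneg[OF S] by (intro mult_right_mono prod_nonneg) auto
    finally show "(\<Prod>l\<in>UNIV. f l (u l)) \<le> m * (\<Prod>l\<in>UNIV - {j}. f l (?r u l))" by simp
  qed
  also have "\<dots> = m * (\<Sum>v\<in>?r ` ?A. \<Prod>l\<in>UNIV - {j}. f l (v l))"
    by (subst sum.reindex[OF inj]) (simp add: sum_distrib_left)
  also have "\<dots> \<le> m * (\<Sum>v\<in>PiE (UNIV - {j}) S. \<Prod>l\<in>UNIV - {j}. f l (v l))"
  proof (intro mult_left_mono sum_mono2 m prod_nonneg)
    show "finite (PiE (UNIV - {j}) S)" by (rule finite_PiE) (use fin in auto)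
    show "?r ` ?A \<subseteq> PiE (UNIV - {j}) S" by (auto simp: PiE_def Pi_def)
  qed (use nonneg in \<open>auto simp: PiE_def\<close>)
  also have "(\<Sum>v\<in>PiE (UNIV - {j}) S. \<Prod>l\<in>UNIV - {j}. f l (v l)) = (\<Prod>l\<in>UNIV - {j}. \<Sum>x\<in>S l. f l x)"
    by (rule prod_sum_PiE[symmetric]) (use fin in auto)
  finally show ?thesis .
qed

lemma sum_UNION_le:
  fixes g :: "'a \<Rightarrow> real"
  assumes "finite T" "\<And>x. x \<in> T \<Longrightarrow> finite (C x)" "\<And>x u. x \<in> T \<Longrightarrow> u \<in> C x \<Longrightarrow> 0 \<le> g u"
  shows "(\<Sum>u\<in>(\<Union>x\<in>T. C x). g u) \<le> (\<Sum>x\<in>T. \<Sum>u\<in>C x. g u)"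
  using assms
proof (induction T rule: finite_induct)
  case (insert x T)
  have "0 \<le> (\<Sum>u\<in>C x \<inter> (\<Union>y\<in>T. C y). g u)"
    by (rule sum_nonneg) (use insert.prems(2)[of x] in blast)
  moreover have "(\<Sum>u\<in>C x \<union> (\<Union>y\<in>T. C y). g u) = (\<Sum>u\<in>C x. g u) + (\<Sum>u\<in>(\<Union>y\<in>T. C y). g u) - (\<Sum>u\<in>C x \<inter> (\<Union>y\<in>T. C y). g u)"
    using insert.hyps insert.prems(1) by (intro sum_Un) blast+
  moreover have "(\<Sum>u\<in>(\<Union>y\<in>T. C y). g u) \<le> (\<Sum>y\<in>T. \<Sum>u\<in>C y. g u)"
    by (rule insert.IH) (use insert.prems in blast)+
  ultimately show ?case using insert.hyps by simp
qed simp

section \<open>Convergence of several labels\<close>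

text \<open>The condition \<open>gap\<close> makes vertices below \<open>n\<^bsup>\<delta>\<^esup>\<close> negligible by a Chernoff bound with parameter \<open>z\<close>;
  \<open>A\<close> makes the bad event negligible against the probability, at least
  \<open>\<theta>\<^bsup>-k c' log n - o(log n)\<^esup>\<close>, that all degrees are large.\<close>

locale joint_labels = weighted_tree M \<mu> W par \<theta>
  for M :: "'a measure" and \<mu> :: "real measure" and W :: "nat \<Rightarrow> 'a \<Rightarrow> real" and par :: "nat \<Rightarrow> 'a \<Rightarrow> nat" and \<theta> :: real +
  fixes d :: "'k::finite \<Rightarrow> nat \<Rightarrow> nat" and c' \<beta> \<delta> \<epsilon> \<kappa> z A :: real
  assumes d_top: "\<And>i. filterlim (d i) at_top sequentially"
    and d_le: "\<And>i. eventually (\<lambda>n. real (d i n) \<le> c' * ln (real n)) sequentially"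
    and c'_nonneg: "0 \<le> c'"
    and beta: "0 < \<beta>" "\<beta> < 1" "2 * \<beta> < 1 / wl.gam"
    and delta: "0 < \<delta>" "\<delta> < 1/2" "c' < (1 / wl.gam - 2 * \<beta>) * (1 - 2 * \<delta>)"
    and eps: "0 < \<epsilon>" and kap: "0 < \<kappa>" and z: "1 \<le> z" "z < \<theta>"
    and gap: "c' * (\<theta> - 1) / z * ((\<theta> - z) / (\<theta> - 1)) + (\<epsilon> + \<delta> / \<kappa>) < (\<theta> - z) / (\<theta> - 1) * (1 - \<delta>)"
    and A: "real CARD('k) * (c' * ln \<theta> + 1) < A"
    and ok_prob: "eventually (\<lambda>n. prob {\<omega> \<in> space M. \<not> sums_ok \<epsilon> \<kappa> \<delta> n \<omega>} \<le> 2 * real n powr (- A)) sequentially"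

sublocale joint_labels \<subseteq> up: label_rates \<mu> \<theta> rate_up "p_up \<epsilon> \<kappa> \<delta>" "d i" c' \<beta> \<delta> for i
  by (rule label_rates_up) (rule d_top d_le c'_nonneg beta delta)+

sublocale joint_labels \<subseteq> down: label_rates \<mu> \<theta> rate_down "p_down \<delta>" "d i" c' \<beta> \<delta> for i
  by (rule label_rates_down) (rule d_top d_le c'_nonneg beta delta)+

context joint_labels
begin

abbreviation "G i n \<equiv> wl.geo_moment (d i n)"

definition pos :: "'k \<Rightarrow> nat \<Rightarrow> nat \<Rightarrow> real" where
  "pos i n u = (ln (real u) - (ln (real n) - wl.gam * real (d i n))) / (wl.gam * sqrt (real (d i n)))"

lemma pos_up: "up.label_pos i n u = pos i n u" by (simp add: up.label_pos_def pos_def)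
lemma pos_down: "down.label_pos i n u = pos i n u" by (simp add: down.label_pos_def pos_def)

text \<open>Each \<open>G i n\<close> is at least \<open>n powr (- (c' ln \<theta> + 1/2))\<close>,
  where the half covers the subpolynomial factor of \<open>moment_ratio\<close>. The product is then
  at least \<open>n powr (- B)\<close> with \<open>B < A\<close>.\<close>

lemma bad_negligible: "(\<lambda>n. 2 * real n powr (- A) / (\<Prod>i\<in>UNIV. G i n)) \<longlonglongrightarrow> 0"
proof (rule Lim_null_comparison)
  define K where "K = real CARD('k)"
  define B where "B = K * (c' * ln \<theta> + 1/2)"
  have K: "1 \<le> K" unfolding K_def using zero_less_card_finite[where 'a='k] by linarith
  have B: "B < A" using A K c'_nonneg by (simp add: B_def K_def[symmetric] distrib_left)
  show "(\<lambda>n. 2 * real n powr (B - A)) \<longlonglongrightarrow> 0" using B by real_asymp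
  have "eventually (\<lambda>n. \<forall>i. (1 / \<theta>) ^ d i n \<le> real n powr (1/2) * G i n) sequentially"
    by (rule eventually_all_finite) (rule up.moment_ratio, simp)
  moreover have "eventually (\<lambda>n. \<forall>i. real (d i n) \<le> c' * ln (real n)) sequentially"
    by (rule eventually_all_finite) (rule d_le)
  ultimately show "eventually (\<lambda>n. norm (2 * real n powr (- A) / (\<Prod>i\<in>UNIV. G i n)) \<le> 2 * real n powr (B - A)) sequentially"
    using eventually_gt_at_top[of 0]
  proof eventually_elim
    case (elim n)
    have th: "1 < \<theta>" by (rule wl.theta_gt_1)
    have n: "0 < real n" using elim by simp
    have low: "real n powr (- (c' * ln \<theta> + 1/2)) \<le> G i n" for i
    proof -
      have "ln \<theta> * real (d i n) \<le> ln \<theta> * (c' * ln (real n))" using elim th by (intro mult_left_mono) auto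
      then have "exp (- (ln \<theta> * (c' * ln (real n)))) \<le> exp (- (ln \<theta> * real (d i n)))" by simp
      also have "\<dots> = (1 / \<theta>) ^ d i n"
        using th by (simp add: exp_minus mult.commute[of "ln \<theta>"] exp_of_nat_mult power_one_over inverse_eq_divide)
      also have "\<dots> \<le> real n powr (1/2) * G i n" using elim by blast
      finally have "real n powr (- (c' * ln \<theta>)) \<le> real n powr (1/2) * G i n" using n by (simp add: powr_def mult_ac)
      then have "real n powr (- (1/2)) * real n powr (- (c' * ln \<theta>)) \<le> real n powr (- (1/2)) * (real n powr (1/2) * G i n)"
        by (intro mult_left_mono) auto
      also have "\<dots> = G i n" using n by (simp add: powr_minus)
      also have "real n powr (- (1/2)) * real n powr (- (c' * ln \<theta>)) = real n powr (- (c' * ln \<theta> + 1/2))"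
        by (simp only: powr_add[symmetric]) (simp add: algebra_simps)
      finally show ?thesis .
    qed
    have Gpos: "0 < (\<Prod>i\<in>UNIV. G i n)" using wl.geo_moment_pos by (intro prod_pos) auto
    have "real n powr (- B) = (\<Prod>i\<in>(UNIV::'k set). real n powr (- (c' * ln \<theta> + 1/2)))"
    proof -
      have "(real n powr (- (c' * ln \<theta> + 1/2))) ^ CARD('k) = real n powr (real CARD('k) * (- (c' * ln \<theta> + 1/2)))"
        by (rule powr_power) (use n in simp)
      also have "real CARD('k) * (- (c' * ln \<theta> + 1/2)) = - B" by (simp only: B_def K_def mult_minus_right)
      finally show ?thesis by (simp only: prod_constant)
    qed
    also have "\<dots> \<le> (\<Prod>i\<in>UNIV. G i n)" using low by (intro prod_mono) auto
    finally have low: "real n powr (- B) \<le> (\<Prod>i\<in>UNIV. G i n)" .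
    have "2 * real n powr (- A) / (\<Prod>i\<in>UNIV. G i n) \<le> 2 * real n powr (- A) / real n powr (- B)"
      using low n Gpos by (intro divide_left_mono mult_pos_pos) auto
    also have "\<dots> = 2 * (real n powr (- A) / real n powr (- B))" by simp
    also have "real n powr (- A) / real n powr (- B) = real n powr (B - A)"
      by (subst powr_diff[symmetric]) simp
    finally show ?case using Gpos by simp
  qed
qed

definition box :: "('k \<Rightarrow> real set) \<Rightarrow> nat \<Rightarrow> ('k \<Rightarrow> nat) set" where
  "box I n = PiE UNIV (\<lambda>i. {u \<in> {1..n}. pos i n u \<in> I i})"

text \<open>Expected number of injective tuples with labels in the box and large degrees, over its
  asymptotic total. Dividing by \<open>n ^ CARD('k)\<close> instead of the number of injective
  tuples is immaterial, as this factor cancels in conditional probabilities.\<close>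

definition box_mass :: "('k \<Rightarrow> real set) \<Rightarrow> nat \<Rightarrow> real" where
  "box_mass I n = (\<Sum>u\<in>{u \<in> box I n. inj u}. prob (deg_event u n (\<lambda>i. d i n))) / (real n ^ CARD('k) * (\<Prod>i\<in>UNIV. G i n))"

lemma finite_box: "finite (box I n)"
  unfolding box_def by (rule finite_PiE) auto

lemma eventually_setup:
  "eventually (\<lambda>n. 0 < n \<and> 2 \<le> cutoff \<delta> n \<and> rate_fun (p_up \<epsilon> \<kappa> \<delta> n) \<and> rate_fun (p_down \<delta> n)
     \<and> (\<forall>w l. 0 < w \<longrightarrow> w \<le> 1 \<longrightarrow> p_down \<delta> n w l \<le> p_up \<epsilon> \<kappa> \<delta> n w l)
     \<and> up.good_n n \<and> down.good_n n) sequentially"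
proof -
  have "eventually (\<lambda>n. 2 \<le> cutoff \<delta> n) sequentially"
    using cutoff_at_top[OF delta(1)] by (simp add: filterlim_at_top)
  then show ?thesis using up.eventually_good down.eventually_good eventually_gt_at_top[of 0]
  proof eventually_elim
    case (elim n)
    have 1: "rate_fun (p_up \<epsilon> \<kappa> \<delta> n)"
      by (rule up.rate_fun_good[OF elim(2)]) (use kap in \<open>auto simp: p_up_def\<close>)
    have 2: "rate_fun (p_down \<delta> n)"
      by (rule down.rate_fun_good[OF elim(3)]) (auto simp: p_down_def)
    have "p_down \<delta> n w l \<le> p_up \<epsilon> \<kappa> \<delta> n w l" if w: "0 < w" "w \<le> 1" for w l
    proof (cases "cutoff \<delta> n \<le> l")
      case True
      define x where "x = real l powr (-1/4)"
      have l: "2 \<le> l" using True elim by simp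
      have x: "0 \<le> x" "x < 1" using powr_quarter_lt_1[OF l] by (auto simp: x_def)
      have "rate_down l \<le> rate_up l" unfolding rate_down_def rate_up_def x_def[symmetric]
        using l x by (intro divide_left_mono mult_left_mono mult_pos_pos) auto
      then have "w / (\<theta> - 1) * rate_down l \<le> w / (\<theta> - 1) * rate_up l"
        using w wl.theta_gt_1 by (intro mult_left_mono) auto
      then show ?thesis using True by (simp add: p_down_def p_up_def)
    next
      case False
      then show ?thesis using kap by (simp add: p_down_def p_up_def)
    qed
    then show ?case using 1 2 elim by auto
  qed
qed

text \<open>The upper bound on \<open>box_mass\<close> runs over all labels, so those up to the
  cutoff have to be included here; \<open>small_labels_negligible\<close> shows that they carry no
  mass.\<close>

lemma up_interval_tendsto:
  assumes "I = UNIV \<or> (\<exists>a b. a \<le> b \<and> I = {a<..b})"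
  shows "(\<lambda>n. \<Sum>u\<in>{u\<in>{1..n}. pos i n u \<in> I}. up.label_weight i n u) \<longlonglongrightarrow> measure std_normal_distribution I"
proof -
  have small: "(\<lambda>n. \<Sum>u\<in>{1..cutoff \<delta> n}. up.label_weight i n u) \<longlonglongrightarrow> 0"
  proof (rule up.small_labels_negligible[OF z gap])
    show "eventually (\<lambda>n. \<forall>w l. 0 < w \<longrightarrow> w \<le> 1 \<longrightarrow> l < cutoff \<delta> n \<longrightarrow> 0 \<le> p_up \<epsilon> \<kappa> \<delta> n w l \<and> p_up \<epsilon> \<kappa> \<delta> n w l \<le> 1) sequentially"
      using kap by (auto simp: p_up_def)
    show "eventually (\<lambda>n. \<forall>w. 0 < w \<longrightarrow> w \<le> 1 \<longrightarrow> (\<Sum>l\<in>{1..<cutoff \<delta> n}. p_up \<epsilon> \<kappa> \<delta> n w l)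
      \<le> (\<epsilon> + \<delta> / \<kappa>) * ln (real n) + (2 + 2 / \<kappa>)) sequentially"
      by (rule sum_p_up[OF kap eps delta(1)])
  qed
  have main: "(\<lambda>n. \<Sum>u\<in>{u\<in>{cutoff \<delta> n<..n}. pos i n u \<in> I}. up.label_weight i n u) \<longlonglongrightarrow> measure std_normal_distribution I"
    using up.label_interval_tendsto[OF assms, of i] by (simp add: pos_up)
  have nonneg: "0 \<le> up.label_weight i n u" if r: "rate_fun (p_up \<epsilon> \<kappa> \<delta> n)" for n u
    unfolding up.label_weight_def using integral_tail_nonneg[OF r] wl.geo_moment_pos by (simp add: less_imp_le)
  have "(\<lambda>n. (\<Sum>u\<in>{u\<in>{1..cutoff \<delta> n}. u \<le> n \<and> pos i n u \<in> I}. up.label_weight i n u)) \<longlonglongrightarrow> 0"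
  proof (rule tendsto_sandwich[OF _ _ tendsto_const small])
    show "eventually (\<lambda>n. 0 \<le> (\<Sum>u\<in>{u\<in>{1..cutoff \<delta> n}. u \<le> n \<and> pos i n u \<in> I}. up.label_weight i n u)) sequentially"
      using eventually_setup by eventually_elim (use nonneg in \<open>auto intro!: sum_nonneg\<close>)
    show "eventually (\<lambda>n. (\<Sum>u\<in>{u\<in>{1..cutoff \<delta> n}. u \<le> n \<and> pos i n u \<in> I}. up.label_weight i n u)
        \<le> (\<Sum>u\<in>{1..cutoff \<delta> n}. up.label_weight i n u)) sequentially"
      using eventually_setup by eventually_elim (use nonneg in \<open>auto intro!: sum_mono2\<close>)
  qed
  from tendsto_add[OF this main]
  have "(\<lambda>n. (\<Sum>u\<in>{u\<in>{1..cutoff \<delta> n}. u \<le> n \<and> pos i n u \<in> I}. up.label_weight i n u)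
    + (\<Sum>u\<in>{u\<in>{cutoff \<delta> n<..n}. pos i n u \<in> I}. up.label_weight i n u)) \<longlonglongrightarrow> measure std_normal_distribution I"
    by simp
  moreover have "(\<Sum>u\<in>{u\<in>{1..cutoff \<delta> n}. u \<le> n \<and> pos i n u \<in> I}. up.label_weight i n u)
    + (\<Sum>u\<in>{u\<in>{cutoff \<delta> n<..n}. pos i n u \<in> I}. up.label_weight i n u) = (\<Sum>u\<in>{u\<in>{1..n}. pos i n u \<in> I}. up.label_weight i n u)" for n
    by (subst sum.union_disjoint[symmetric]) (auto intro!: sum.cong)
  ultimately show ?thesis by simp
qed

text \<open>For an upper bound the non-injective tuples may be added; after that the sum over the
  box factorises.\<close>

lemma box_mass_upper:
  "eventually (\<lambda>n. box_mass I n \<le> (\<Prod>i\<in>UNIV. \<Sum>u\<in>{u\<in>{1..n}. pos i n u \<in> I i}. up.label_weight i n u)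
      + 2 * real n powr (- A) / (\<Prod>i\<in>UNIV. G i n)) sequentially"
  using eventually_setup ok_prob
proof eventually_elim
  case (elim n)
  then have n: "0 < n" and n0: "2 \<le> cutoff \<delta> n" and P: "rate_fun (p_up \<epsilon> \<kappa> \<delta> n)" by auto
  define b where "b = 2 * real n powr (- A)"
  define f where "f i u = (\<integral>w. tail_prob (p_up \<epsilon> \<kappa> \<delta> n w) u n (d i n) \<partial>\<mu>)" for i u
  define S where "S i = {u \<in> {1..n}. pos i n u \<in> I i}" for i
  define N where "N = real n ^ CARD('k) * (\<Prod>i\<in>UNIV. G i n)"
  have N: "0 < N" unfolding N_def using n wl.geo_moment_pos by (intro mult_pos_pos prod_pos zero_less_power) auto
  have b0: "0 \<le> b" by (simp add: b_def)
  have f0: "0 \<le> f i u" for i u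
    unfolding f_def by (rule integral_tail_nonneg[OF P])
  have "(\<Sum>u\<in>{u \<in> box I n. inj u}. prob (deg_event u n (\<lambda>i. d i n)))
     \<le> (\<Sum>u\<in>{u \<in> box I n. inj u}. (\<Prod>i\<in>UNIV. f i (u i)) + b)"
  proof (rule sum_mono)
    fix u assume u: "u \<in> {u \<in> box I n. inj u}"
    then have "1 \<le> u i" for i by (auto simp: box_def PiE_def Pi_def)
    then show "prob (deg_event u n (\<lambda>i. d i n)) \<le> (\<Prod>i\<in>UNIV. f i (u i)) + b"
      using deg_event_upper(1)[of u \<epsilon> \<kappa> \<delta> n "\<lambda>i. d i n"] u P n kap n0 elim(2) unfolding f_def b_def by fastforce
  qed
  also have "\<dots> \<le> (\<Sum>u\<in>box I n. (\<Prod>i\<in>UNIV. f i (u i)) + b)"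
    using finite_box f0 b0 by (intro sum_mono2) (auto intro!: add_nonneg_nonneg prod_nonneg)
  also have "\<dots> = (\<Prod>i\<in>UNIV. \<Sum>u\<in>S i. f i u) + real (card (box I n)) * b"
    unfolding sum.distrib box_def S_def by (subst prod_sum_PiE) auto
  also have "\<dots> \<le> (\<Prod>i\<in>UNIV. \<Sum>u\<in>S i. f i u) + real n ^ CARD('k) * b"
  proof -
    have "card (box I n) \<le> card (PiE (UNIV :: 'k set) (\<lambda>_. {1..n}))"
      unfolding box_def by (intro card_mono finite_PiE PiE_mono) auto
    also have "\<dots> = n ^ CARD('k)" by (simp add: card_PiE)
    finally have "real (card (box I n)) \<le> real n ^ CARD('k)" by (metis of_nat_le_iff of_nat_power)
    then show ?thesis using b0 by (intro add_left_mono mult_right_mono) auto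
  qed
  finally have "box_mass I n \<le> ((\<Prod>i\<in>UNIV. \<Sum>u\<in>S i. f i u) + real n ^ CARD('k) * b) / N"
    unfolding box_mass_def N_def[symmetric] using N by (intro divide_right_mono) auto
  also have "\<dots> = (\<Prod>i\<in>UNIV. \<Sum>u\<in>S i. f i u) / N + b / (\<Prod>i\<in>UNIV. G i n)"
    using n by (simp add: add_divide_distrib N_def)
  also have "(\<Prod>i\<in>UNIV. \<Sum>u\<in>S i. f i u) / N = (\<Prod>i\<in>UNIV. \<Sum>u\<in>S i. up.label_weight i n u)"
    by (simp add: N_def up.label_weight_def f_def sum_divide_distrib[symmetric] prod_dividef prod.distrib)
  finally show ?case by (simp add: S_def b_def)
qed

text \<open>Restricted to labels beyond the cutoff, the product of sums suffers three losses:
  coinciding labels, bad weights, and the quadratic error. The last carries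
  \<open>n powr (- \<delta>)\<close> against a joint tail at degrees \<open>d i n - 1\<close> that
  exceeds the main order by at most a constant times \<open>n powr (\<delta> / 2)\<close>.\<close>

lemma box_mass_lower:
  obtains r where "r \<longlonglongrightarrow> 0" "eventually (\<lambda>n. (\<Prod>i\<in>UNIV. \<Sum>u\<in>{u\<in>{cutoff \<delta> n<..n}. pos i n u \<in> I i}. down.label_weight i n u) - r n \<le> box_mass I n) sequentially"
proof -
  define K where "K = (real CARD('k) / (\<theta> - 1))\<^sup>2"
  \<comment> \<open>Over all \<open>CARD('k)\<close> coordinates this costs
    \<open>n powr (\<delta> / 2)\<close>, half of what the cutoff provides.\<close>
  define \<eta>0 where "\<eta>0 = \<delta> / (2 * real CARD('k))"
  have card: "0 < real CARD('k)" using zero_less_card_finite[where 'a='k] by simp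
  have \<eta>0: "0 < \<eta>0" "real CARD('k) * \<eta>0 = \<delta> / 2" using delta card by (auto simp: \<eta>0_def)
  have th: "1 < \<theta>" by (rule wl.theta_gt_1)
  define mx where "mx j n = 2 * (1 / \<theta>) ^ d j n / (real (cutoff \<delta> n) * G j n)" for j n
  have mx: "mx j \<longlonglongrightarrow> 0" for j unfolding mx_def by (rule down.max_label_weight_tendsto)
  have mx0: "0 \<le> mx j n" for j n using th wl.geo_moment_pos by (simp add: mx_def less_imp_le)
  define r where "r n = (\<Sum>(i, j)\<in>{(i, j). i \<noteq> j}. mx j n * 2 ^ CARD('k))
     + 2 * real n powr (- A) / (\<Prod>i\<in>UNIV. G i n)
     + 2 * K * (4 * \<theta>) ^ CARD('k) * real n powr (- \<delta> / 2)" for n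
  have r: "r \<longlonglongrightarrow> 0"
  proof -
    have "(\<lambda>n. \<Sum>(i, j)\<in>{(i, j). i \<noteq> j}. mx j n * 2 ^ CARD('k)) \<longlonglongrightarrow> (\<Sum>(i::'k, j::'k)\<in>{(i, j). i \<noteq> j}. 0 * 2 ^ CARD('k))"
      by (intro tendsto_sum) (auto intro!: tendsto_mult mx)
    moreover have "(\<lambda>n. real n powr (- \<delta> / 2)) \<longlonglongrightarrow> 0" using delta by real_asymp
    ultimately have "r \<longlonglongrightarrow> (\<Sum>(i::'k, j::'k)\<in>{(i, j). i \<noteq> j}. 0 * 2 ^ CARD('k)) + 0 + 2 * K * (4 * \<theta>) ^ CARD('k) * 0"
      unfolding r_def by (intro tendsto_add tendsto_mult tendsto_const bad_negligible)
    then show ?thesis by simp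
  qed
  have tot: "eventually (\<lambda>n. \<forall>i. (\<Sum>u\<in>{cutoff \<delta> n<..n}. down.label_weight i n u) \<le> 2) sequentially"
  proof (rule eventually_all_finite)
    fix i
    have "(\<lambda>n. \<Sum>u\<in>{cutoff \<delta> n<..n}. down.label_weight i n u) \<longlonglongrightarrow> 1"
    proof -
      have "{u \<in> {cutoff \<delta> n<..n}. down.label_pos i n u \<in> UNIV} = {cutoff \<delta> n<..n}" for n by auto
      then show ?thesis using down.label_interval_tendsto[of UNIV i] std_normal_UNIV
        by (simp only:) simp
    qed
    then have "eventually (\<lambda>n. (\<Sum>u\<in>{cutoff \<delta> n<..n}. down.label_weight i n u) < 2) sequentially"
      by (rule order_tendstoD) simp
    then show "eventually (\<lambda>n. (\<Sum>u\<in>{cutoff \<delta> n<..n}. down.label_weight i n u) \<le> 2) sequentially"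
      by eventually_elim simp
  qed
  have d1: "eventually (\<lambda>n. \<forall>i. 1 \<le> d i n) sequentially"
    by (rule eventually_all_finite) (use d_top in \<open>simp add: filterlim_at_top\<close>)
  have rat: "eventually (\<lambda>n. \<forall>i. (1 / \<theta>) ^ d i n \<le> real n powr \<eta>0 * G i n) sequentially"
    by (rule eventually_all_finite) (rule up.moment_ratio[OF \<eta>0(1)])
  have "eventually (\<lambda>n. (\<Prod>i\<in>UNIV. \<Sum>u\<in>{u\<in>{cutoff \<delta> n<..n}. pos i n u \<in> I i}. down.label_weight i n u) - r n \<le> box_mass I n) sequentially"
    using eventually_setup ok_prob tot d1 rat
  proof eventually_elim
    case (elim n)
    then have n: "0 < n" and n0: "2 \<le> cutoff \<delta> n" and P: "rate_fun (p_up \<epsilon> \<kappa> \<delta> n)" and Q: "rate_fun (p_down \<delta> n)"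
      and QP: "\<And>w l. 0 < w \<Longrightarrow> w \<le> 1 \<Longrightarrow> p_down \<delta> n w l \<le> p_up \<epsilon> \<kappa> \<delta> n w l"
      and gu: "up.good_n n" and gd: "down.good_n n" by auto
    define b where "b = 2 * real n powr (- A)"
    define q where "q i u = down.label_weight i n u" for i u
    define f where "f i u = (\<integral>w. tail_prob (p_down \<delta> n w) u n (d i n) \<partial>\<mu>)" for i u
    define e where "e i u = (\<integral>w. tail_prob (p_up \<epsilon> \<kappa> \<delta> n w) u n (d i n - 1) \<partial>\<mu>)" for i u
    define S where "S i = {u \<in> {cutoff \<delta> n<..n}. pos i n u \<in> I i}" for i
    define N where "N = real n ^ CARD('k) * (\<Prod>i\<in>UNIV. G i n)"
    define X where "X = PiE UNIV S"
    have finS: "finite (S i)" for i by (simp add: S_def)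
    have finX: "finite X" unfolding X_def by (rule finite_PiE) (auto simp: finS)
    have N: "0 < N" unfolding N_def using n wl.geo_moment_pos by (intro mult_pos_pos prod_pos zero_less_power) auto
    have b0: "0 \<le> b" by (simp add: b_def)
    have K0: "0 \<le> K" by (simp add: K_def)
    have e0: "0 \<le> e i u" for i u
      unfolding e_def by (rule integral_tail_nonneg[OF P])
    have q0: "0 \<le> q i u" if "u \<in> {cutoff \<delta> n<..n}" for i u
      unfolding q_def by (rule down.label_weight_nonneg[OF gd that])
    have qf: "(\<Prod>i\<in>UNIV. q i (u i)) = (\<Prod>i\<in>UNIV. f i (u i)) / N" for u
      by (simp add: q_def down.label_weight_def f_def N_def prod_dividef prod.distrib)
    have XS: "u i \<in> S i" if "u \<in> X" for u i using that by (auto simp: X_def PiE_def)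
    have Xq: "0 \<le> q i (u i)" if "u \<in> X" for u i using q0 XS[OF that, of i] by (simp add: S_def)
    have lower: "(\<Prod>i\<in>UNIV. f i (u i)) - b - 2 * K / real (cutoff \<delta> n) * (\<Prod>i\<in>UNIV. e i (u i)) \<le> prob (deg_event u n (\<lambda>i. d i n))"
      if u: "u \<in> X" "inj u" for u
    proof -
      have "cutoff \<delta> n < u i" for i using XS[OF u(1), of i] by (simp add: S_def)
      from deg_event_lower[OF u(2) this P Q _ kap n0 QP, of "\<lambda>i. d i n"] n elim(2)
      show ?thesis unfolding f_def e_def b_def K_def by simp
    qed
    have "(\<Sum>u\<in>{u\<in>X. inj u}. (\<Prod>i\<in>UNIV. f i (u i)) - b - 2 * K / real (cutoff \<delta> n) * (\<Prod>i\<in>UNIV. e i (u i)))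
       \<le> (\<Sum>u\<in>{u\<in>X. inj u}. prob (deg_event u n (\<lambda>i. d i n)))"
      by (intro sum_mono lower) auto
    also have "\<dots> \<le> (\<Sum>u\<in>{u\<in>box I n. inj u}. prob (deg_event u n (\<lambda>i. d i n)))"
    proof (rule sum_mono2)
      have "X \<subseteq> box I n" unfolding X_def box_def by (rule PiE_mono) (auto simp: S_def)
      then show "{u\<in>X. inj u} \<subseteq> {u\<in>box I n. inj u}" by auto
    qed (use finite_box in auto)
    finally have "(\<Sum>u\<in>{u\<in>X. inj u}. (\<Prod>i\<in>UNIV. f i (u i)) - b - 2 * K / real (cutoff \<delta> n) * (\<Prod>i\<in>UNIV. e i (u i))) / N \<le> box_mass I n"
      unfolding box_mass_def N_def[symmetric] using N by (intro divide_right_mono) auto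
    moreover have "(\<Sum>u\<in>{u\<in>X. inj u}. (\<Prod>i\<in>UNIV. f i (u i)) - b - 2 * K / real (cutoff \<delta> n) * (\<Prod>i\<in>UNIV. e i (u i))) / N
       = (\<Sum>u\<in>{u\<in>X. inj u}. \<Prod>i\<in>UNIV. q i (u i)) - real (card {u\<in>X. inj u}) * b / N
         - 2 * K / real (cutoff \<delta> n) * ((\<Sum>u\<in>{u\<in>X. inj u}. \<Prod>i\<in>UNIV. e i (u i)) / N)"
      unfolding qf by (simp add: sum_subtractf sum_divide_distrib[symmetric] sum_distrib_left[symmetric] diff_divide_distrib)
    moreover have "real (card {u\<in>X. inj u}) * b / N \<le> b / (\<Prod>i\<in>UNIV. G i n)"
    proof -
      have "card {u\<in>X. inj u} \<le> card (PiE (UNIV :: 'k set) (\<lambda>_. {1..n}))"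
      proof (intro card_mono finite_PiE subsetI)
        fix u assume "u \<in> {u\<in>X. inj u}"
        then have "1 \<le> u i \<and> u i \<le> n" for i using XS[of u i] by (auto simp: S_def)
        then show "u \<in> PiE UNIV (\<lambda>_. {1..n})" by (simp add: PiE_def Pi_def)
      qed auto
      also have "\<dots> = n ^ CARD('k)" by (simp add: card_PiE)
      finally have "real (card {u\<in>X. inj u}) \<le> real n ^ CARD('k)" by (metis of_nat_le_iff of_nat_power)
      then have "real (card {u\<in>X. inj u}) * b / N \<le> real n ^ CARD('k) * b / N"
        using b0 N by (intro divide_right_mono mult_right_mono) auto
      then show ?thesis using n by (simp add: N_def)
    qed
    moreover have "2 * K / real (cutoff \<delta> n) * ((\<Sum>u\<in>{u\<in>X. inj u}. \<Prod>i\<in>UNIV. e i (u i)) / N) \<le> 2 * K * (4 * \<theta>) ^ CARD('k) * real n powr (- \<delta> / 2)"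
    proof -
      have "(\<Sum>u\<in>{u\<in>X. inj u}. \<Prod>i\<in>UNIV. e i (u i)) \<le> (\<Sum>u\<in>PiE UNIV (\<lambda>_::'k. {cutoff \<delta> n<..n}). \<Prod>i\<in>UNIV. e i (u i))"
        using e0 by (intro sum_mono2 finite_PiE prod_nonneg) (auto simp: X_def S_def PiE_def Pi_def)
      also have "\<dots> = (\<Prod>i\<in>UNIV. \<Sum>u\<in>{cutoff \<delta> n<..n}. e i u)" by (rule prod_sum_PiE[symmetric]) auto
      also have "\<dots> \<le> (\<Prod>i\<in>UNIV. (4 * \<theta> * real n powr \<eta>0) * (real n * G i n))"
      proof (rule prod_mono, rule conjI)
        fix i
        show "0 \<le> (\<Sum>u\<in>{cutoff \<delta> n<..n}. e i u)" using e0 by (intro sum_nonneg) auto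
        \<comment> \<open>Moments at \<open>d - 1\<close> and \<open>d\<close> are compared through
          the power of \<open>1 / \<theta>\<close>, which costs one factor \<open>\<theta>\<close>
          and a small power of \<open>n\<close>.\<close>
        have "wl.geo_moment (d i n - 1) \<le> (1 / \<theta>) ^ (d i n - 1)" by (rule wl.geo_moment_le)
        also have "(1 / \<theta>) ^ (d i n - 1) = \<theta> * (1 / \<theta>) ^ d i n"
          using elim(4)[rule_format, of i] th by (cases "d i n") auto
        also have "\<dots> \<le> \<theta> * (real n powr \<eta>0 * G i n)" using elim(5) th by (intro mult_left_mono) auto
        finally have "4 * real n * wl.geo_moment (d i n - 1) \<le> 4 * real n * (\<theta> * (real n powr \<eta>0 * G i n))"
          by (rule mult_left_mono) simp
        moreover have "(\<Sum>u\<in>{cutoff \<delta> n<..n}. e i u) \<le> 4 * real n * wl.geo_moment (d i n - 1)"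
          unfolding e_def by (rule up.sum_tail_le[OF gu])
        ultimately show "(\<Sum>u\<in>{cutoff \<delta> n<..n}. e i u) \<le> (4 * \<theta> * real n powr \<eta>0) * (real n * G i n)"
          by (simp add: mult_ac)
      qed
      also have "\<dots> = (4 * \<theta>) ^ CARD('k) * real n powr (\<delta> / 2) * N"
      proof -
        have "(real n powr \<eta>0) ^ CARD('k) = real n powr (\<delta> / 2)"
        proof -
          have "(real n powr \<eta>0) ^ CARD('k) = real n powr (real CARD('k) * \<eta>0)"
            using n by (simp add: powr_power mult.commute)
          then show ?thesis unfolding \<eta>0(2) .
        qed
        then show ?thesis by (simp add: N_def prod.distrib power_mult_distrib)
      qed
      finally have "(\<Sum>u\<in>{u\<in>X. inj u}. \<Prod>i\<in>UNIV. e i (u i)) / N \<le> (4 * \<theta>) ^ CARD('k) * real n powr (\<delta> / 2)"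
        using N by (simp add: divide_le_eq)
      then have "2 * K / real (cutoff \<delta> n) * ((\<Sum>u\<in>{u\<in>X. inj u}. \<Prod>i\<in>UNIV. e i (u i)) / N)
          \<le> 2 * K / real n powr \<delta> * ((4 * \<theta>) ^ CARD('k) * real n powr (\<delta> / 2))"
        using cutoff_bounds(1)[of n \<delta>] n K0 N e0 by (intro mult_mono frac_le divide_nonneg_pos sum_nonneg prod_nonneg) auto
      also have "\<dots> = 2 * K * (4 * \<theta>) ^ CARD('k) * (real n powr (\<delta> / 2) / real n powr \<delta>)" by simp
      also have "real n powr (\<delta> / 2) / real n powr \<delta> = real n powr (- \<delta> / 2)" by (simp add: powr_diff[symmetric])
      finally show ?thesis .
    qed
    moreover have "(\<Prod>i\<in>UNIV. \<Sum>u\<in>S i. q i u) - (\<Sum>(i, j)\<in>{(i, j). i \<noteq> j}. mx j n * 2 ^ CARD('k)) \<le> (\<Sum>u\<in>{u\<in>X. inj u}. \<Prod>i\<in>UNIV. q i (u i))"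
    proof -
      have "(\<Sum>u\<in>{u\<in>X. \<not> inj u}. \<Prod>i\<in>UNIV. q i (u i)) \<le> (\<Sum>u\<in>(\<Union>(i, j)\<in>{(i, j). i \<noteq> j}. {u\<in>X. u i = u j}). \<Prod>i\<in>UNIV. q i (u i))"
        using finX Xq by (intro sum_mono2 prod_nonneg) (auto simp: inj_def)
      also have "\<dots> \<le> (\<Sum>(i, j)\<in>{(i, j). i \<noteq> j}. \<Sum>u\<in>{u\<in>X. u i = u j}. \<Prod>l\<in>UNIV. q l (u l))"
      proof -
        from sum_UNION_le[of "{(i, j). i \<noteq> j}" "\<lambda>(i, j). {u\<in>X. u i = u j}" "\<lambda>u. \<Prod>i\<in>UNIV. q i (u i)"]
        show ?thesis using finX Xq by (auto simp: case_prod_unfold intro!: prod_nonneg)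
      qed
      also have "\<dots> \<le> (\<Sum>(i, j)\<in>{(i, j). i \<noteq> j}. mx j n * 2 ^ CARD('k))"
      proof (rule sum_mono, clarify)
        fix i j :: 'k assume ij: "i \<noteq> j"
        have "(\<Sum>u\<in>{u\<in>X. u i = u j}. \<Prod>l\<in>UNIV. q l (u l)) \<le> mx j n * (\<Prod>l\<in>UNIV - {j}. \<Sum>x\<in>S l. q l x)"
          unfolding X_def
        proof (rule sum_coincidence_le[OF finS _ _ mx0 ij])
          show "0 \<le> q l x" if "x \<in> S l" for l x using q0 that by (simp add: S_def)
          show "q j x \<le> mx j n" if "x \<in> S j" for x
            unfolding q_def mx_def by (rule down.label_weight_le[OF gd]) (use that in \<open>simp add: S_def\<close>)
        qed
        also have "(\<Prod>l\<in>UNIV - {j}. \<Sum>x\<in>S l. q l x) \<le> (\<Prod>l\<in>UNIV - {j}. 2)"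
        proof (rule prod_mono, rule conjI)
          fix l
          show "0 \<le> (\<Sum>x\<in>S l. q l x)" using q0 by (intro sum_nonneg) (simp add: S_def)
          have "(\<Sum>x\<in>S l. q l x) \<le> (\<Sum>x\<in>{cutoff \<delta> n<..n}. q l x)" using q0 by (intro sum_mono2) (auto simp: S_def)
          then show "(\<Sum>x\<in>S l. q l x) \<le> 2" using elim(3)[rule_format, of l] by (simp add: q_def)
        qed
        also have "(\<Prod>l\<in>UNIV - {j}. 2) \<le> (2::real) ^ CARD('k)" by (simp add: power_increasing)
        finally show "(\<Sum>u\<in>{u\<in>X. u i = u j}. \<Prod>l\<in>UNIV. q l (u l)) \<le> mx j n * 2 ^ CARD('k)"
          using mx0 by (simp add: mult_left_mono)
      qed
      finally have ni: "(\<Sum>u\<in>{u\<in>X. \<not> inj u}. \<Prod>i\<in>UNIV. q i (u i)) \<le> (\<Sum>(i, j)\<in>{(i, j). i \<noteq> j}. mx j n * 2 ^ CARD('k))" .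
      have "(\<Prod>i\<in>UNIV. \<Sum>u\<in>S i. q i u) = (\<Sum>u\<in>X. \<Prod>i\<in>UNIV. q i (u i))"
        unfolding X_def by (rule prod_sum_PiE) (auto simp: finS)
      also have "\<dots> = (\<Sum>u\<in>{u\<in>X. inj u}. \<Prod>i\<in>UNIV. q i (u i)) + (\<Sum>u\<in>{u\<in>X. \<not> inj u}. \<Prod>i\<in>UNIV. q i (u i))"
        using finX by (subst sum.union_disjoint[symmetric]) (auto intro!: sum.cong)
      finally show ?thesis using ni by linarith
    qed
    ultimately have "(\<Prod>i\<in>UNIV. \<Sum>u\<in>S i. q i u) - r n \<le> box_mass I n"
      unfolding r_def b_def by linarith
    then show ?case by (simp add: S_def q_def)
  qed
  with r show thesis by (rule that)
qed

theorem box_mass_tendsto: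
  assumes I: "\<And>i. I i = UNIV \<or> (\<exists>a b. a \<le> b \<and> I i = {a<..b})"
  shows "box_mass I \<longlonglongrightarrow> (\<Prod>i\<in>UNIV. measure std_normal_distribution (I i))"
proof -
  obtain r where r: "r \<longlonglongrightarrow> 0" and low: "eventually (\<lambda>n. (\<Prod>i\<in>UNIV. \<Sum>u\<in>{u\<in>{cutoff \<delta> n<..n}. pos i n u \<in> I i}. down.label_weight i n u) - r n \<le> box_mass I n) sequentially"
    by (rule box_mass_lower)
  have D: "(\<lambda>n. \<Sum>u\<in>{u\<in>{cutoff \<delta> n<..n}. pos i n u \<in> I i}. down.label_weight i n u) \<longlonglongrightarrow> measure std_normal_distribution (I i)" for i
    using down.label_interval_tendsto[OF I[of i], of i] by (simp add: pos_down)
  have "(\<lambda>n. (\<Prod>i\<in>UNIV. \<Sum>u\<in>{u\<in>{cutoff \<delta> n<..n}. pos i n u \<in> I i}. down.label_weight i n u) - r n) \<longlonglongrightarrow> (\<Prod>i\<in>UNIV. measure std_normal_distribution (I i)) - 0"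
    by (intro tendsto_diff tendsto_prod D r)
  moreover have "(\<lambda>n. (\<Prod>i\<in>UNIV. \<Sum>u\<in>{u\<in>{1..n}. pos i n u \<in> I i}. up.label_weight i n u) + 2 * real n powr (- A) / (\<Prod>i\<in>UNIV. G i n)) \<longlonglongrightarrow> (\<Prod>i\<in>UNIV. measure std_normal_distribution (I i)) + 0"
    by (intro tendsto_add tendsto_prod up_interval_tendsto I bad_negligible)
  ultimately show ?thesis
    using tendsto_sandwich[OF low box_mass_upper] by simp
qed

end

section \<open>Convergence in law from half-open cells\<close>

text \<open>Half-open, so that the cells of a grid are disjoint and fill a cube exactly.\<close>

definition cell :: "real ^ 'k \<Rightarrow> real ^ 'k \<Rightarrow> (real ^ 'k) set" where
  "cell a b = {x. \<forall>i. a $ i < x $ i \<and> x $ i \<le> b $ i}"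

lemma cell_borel: "cell a b \<in> sets borel"
proof -
  have eq: "cell a b = (\<Inter>i\<in>UNIV. {x. a $ i < x $ i} \<inter> {x. x $ i \<le> b $ i})"
    unfolding cell_def by blast
  have "{x. a $ i < x $ i} \<in> sets borel" "{x. x $ i \<le> b $ i} \<in> sets borel" for i
    by (rule borel_open[OF open_halfspace_component_gt_cart]) (rule borel_closed[OF closed_halfspace_component_le_cart])
  then show ?thesis unfolding eq by (intro sets.finite_INT sets.Int) simp_all
qed

lemma norm_le_of_components:
  fixes x :: "real ^ 'k"
  assumes "\<And>i. \<bar>x $ i\<bar> \<le> e" shows "norm x \<le> real CARD('k) * e"
proof -
  have "norm x \<le> (\<Sum>i\<in>UNIV. \<bar>x $ i\<bar>)" by (rule norm_le_l1_cart)
  also have "\<dots> \<le> (\<Sum>i\<in>(UNIV::'k set). e)" by (intro sum_mono assms)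
  finally show ?thesis by simp
qed

text \<open>A continuous \<open>f\<close> is replaced by a step function on a fine grid inside a
  large cube. The hypothesis gives the limits of the finitely many cell masses, and applied to the
  cube itself it gives tightness.\<close>

lemma converges_in_law_of_cells:
  fixes L :: "nat \<Rightarrow> (real ^ 'k) measure" and N :: "(real ^ 'k) measure"
  assumes L: "eventually (\<lambda>n. prob_space (L n) \<and> sets (L n) = sets borel) sequentially"
    and N: "prob_space N" "sets N = sets borel"
    and cells: "\<And>a b. (\<And>i. a $ i \<le> b $ i) \<Longrightarrow> (\<lambda>n. measure (L n) (cell a b)) \<longlonglongrightarrow> measure N (cell a b)"
  shows "converges_in_law L N"
  unfolding converges_in_law_def
proof (intro allI impI, elim conjE)
  fix f :: "real ^ 'k \<Rightarrow> real"
  assume cont: "continuous_on UNIV f" and bdd: "bounded (range f)"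
  obtain B where "0 < B" "\<forall>y\<in>range f. norm y \<le> B"
    using bdd unfolding bounded_pos by blast
  then have B: "0 < B" "\<And>x. \<bar>f x\<bar> \<le> B" by simp_all
  have fm: "f \<in> borel_measurable borel" using cont by (rule borel_measurable_continuous_onI)
  have spN: "space N = UNIV" using sets_eq_imp_space_eq[OF N(2)] by simp
  show "(\<lambda>n. \<integral>x. f x \<partial>(L n)) \<longlonglongrightarrow> (\<integral>x. f x \<partial>N)"
  proof (rule tendstoI)
    fix e0 :: real assume e0: "0 < e0"
    \<comment> \<open>The total error is at most \<open>3 e + 2 B e\<close>: an \<open>e\<close>
      each for the two step approximations and for the finite sums, and \<open>B e\<close> twice for
      the mass outside the cube.\<close>
    define e where "e = e0 / (4 + 4 * B)"
    have e: "0 < e" "(4 + 4 * B) * e = e0" using e0 B by (auto simp: e_def)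
    define V where "V r = cell (\<chi> i::'k. - real r) (\<chi> i. real r)" for r :: nat
    have "(\<lambda>r. measure N (V r)) \<longlonglongrightarrow> measure N (\<Union>r. V r)"
    proof (rule finite_measure.finite_Lim_measure_incseq)
      show "finite_measure N" using N(1) by (rule prob_space.finite_measure)
      show "range V \<subseteq> sets N" using cell_borel N(2) by (auto simp: V_def)
      show "incseq V"
      proof (rule incseq_SucI, rule subsetI)
        fix n and x :: "real ^ 'k" assume x: "x \<in> V n"
        have "- real (Suc n) < x $ i \<and> x $ i \<le> real (Suc n)" for i
        proof -
          have "- real n < x $ i \<and> x $ i \<le> real n" using x by (simp add: V_def cell_def)
          then show ?thesis by simp
        qed
        then show "x \<in> V (Suc n)" by (simp add: V_def cell_def)
      qed
    qed
    moreover have "(\<Union>r. V r) = UNIV"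
    proof -
      have "\<exists>r. x \<in> V r" for x :: "real ^ 'k"
      proof -
        obtain r :: nat where "norm x < real r" using reals_Archimedean2 by blast
        then have "\<bar>x $ i\<bar> < real r" for i using component_le_norm_cart[of x i] by linarith
        then have "- real r < x $ i \<and> x $ i \<le> real r" for i unfolding abs_less_iff by (smt (verit))
        then have "x \<in> V r" by (simp add: V_def cell_def)
        then show ?thesis by blast
      qed
      then show ?thesis by auto
    qed
    ultimately have "(\<lambda>r. measure N (V r)) \<longlonglongrightarrow> 1"
      using prob_space.prob_space[OF N(1)] spN by simp
    then have "eventually (\<lambda>r. 1 - e < measure N (V r)) sequentially"
      using e by (intro order_tendstoD) auto
    with eventually_gt_at_top[of 0] have "eventually (\<lambda>r. 0 < r \<and> 1 - e < measure N (V r)) sequentially"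
      by eventually_elim simp
    then obtain r where r: "0 < r" "1 - e < measure N (V r)" by (auto simp: eventually_sequentially)
    define K where "K = cbox (\<chi> i::'k. - real r) (\<chi> i. real r)"
    have inK: "x \<in> K \<longleftrightarrow> (\<forall>i. - real r \<le> x $ i \<and> x $ i \<le> real r)" for x
      by (simp add: K_def mem_box_cart)
    have "uniformly_continuous_on K f"
    proof (rule compact_uniformly_continuous)
      show "continuous_on K f" by (rule continuous_on_subset[OF cont]) simp
      show "compact K" unfolding K_def by (rule compact_cbox)
    qed
    then have "\<exists>s>0. \<forall>x\<in>K. \<forall>y\<in>K. dist y x < s \<longrightarrow> dist (f y) (f x) < e"
      using e(1) unfolding uniformly_continuous_on_def by blast
    then obtain s where s: "0 < s" "\<And>x y. x \<in> K \<Longrightarrow> y \<in> K \<Longrightarrow> dist y x < s \<Longrightarrow> dist (f y) (f x) < e"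
      by blast
    \<comment> \<open>The mesh is \<open>1 / m\<close>, so the upper corner of a cell is within
      \<open>CARD('k) / m < s\<close> of all its points.\<close>
    obtain m :: nat where m: "real CARD('k) / s < real m" using reals_Archimedean2 by blast
    have "0 \<le> real CARD('k) / s" using s by simp
    then have m0: "0 < real m" using m by linarith
    \<comment> \<open>Coordinate \<open>i\<close> of cell \<open>z\<close> runs from
      \<open>z i / m\<close> to \<open>(z i + 1) / m\<close>; these indices fill the half-open cube
      of half-width \<open>r\<close> without remainder.\<close>
    define Z :: "('k \<Rightarrow> int) set" where "Z = PiE UNIV (\<lambda>_. {- int r * int m..<int r * int m})"
    have finZ: "finite Z" unfolding Z_def by (rule finite_PiE) auto
    define lo hi where "lo z = (\<chi> i. real_of_int (z i) / real m)" and "hi z = (\<chi> i. real_of_int (z i + 1) / real m)" for z :: "'k \<Rightarrow> int"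
    define g where "g x = (\<Sum>z\<in>Z. f (hi z) * indicator (cell (lo z) (hi z)) x)" for x
    \<comment> \<open>Half-openness makes \<open>\<lceil>x $ i * m\<rceil> - 1\<close> the only
      index whose cell contains \<open>x\<close>, so a single summand survives.\<close>
    have g_in: "g x = f (hi z)" if x: "x \<in> V r" and z: "z = (\<lambda>i. \<lceil>x $ i * real m\<rceil> - 1)" for x z
    proof -
      have "x \<in> cell (lo y) (hi y) \<longleftrightarrow> y = z" for y
      proof -
        have "x \<in> cell (lo y) (hi y) \<longleftrightarrow> (\<forall>i. real_of_int (y i) < x $ i * real m \<and> x $ i * real m \<le> real_of_int (y i + 1))"
          using m0 by (simp add: cell_def lo_def hi_def divide_less_eq le_divide_eq)
        also have "\<dots> \<longleftrightarrow> (\<forall>i. \<lceil>x $ i * real m\<rceil> = y i + 1)" by (simp add: ceiling_eq_iff)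
        also have "\<dots> \<longleftrightarrow> y = z" unfolding z by (auto simp: fun_eq_iff algebra_simps)
        finally show ?thesis .
      qed
      moreover have "z \<in> Z"
      proof -
        have "- int r * int m \<le> z i \<and> z i < int r * int m" for i
        proof -
          have "- real r < x $ i" "x $ i \<le> real r" using x by (auto simp: V_def cell_def)
          then have "- real r * real m < x $ i * real m" "x $ i * real m \<le> real r * real m"
            using m0 by (blast intro: mult_strict_right_mono mult_right_mono less_imp_le)+
          then have "real_of_int (- int r * int m) < x $ i * real m" "x $ i * real m \<le> real_of_int (int r * int m)" by auto
          then have "- int r * int m < \<lceil>x $ i * real m\<rceil>" "\<lceil>x $ i * real m\<rceil> \<le> int r * int m"
            by (simp_all only: less_ceiling_iff ceiling_le_iff)
          then show ?thesis unfolding z by simp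
        qed
        then show ?thesis by (simp add: Z_def PiE_def Pi_def)
      qed
      ultimately have "g x = (\<Sum>y\<in>Z. if y = z then f (hi y) else 0)" unfolding g_def
        by (intro sum.cong) (auto simp: indicator_def)
      then show ?thesis using finZ \<open>z \<in> Z\<close> by (simp add: sum.delta)
    qed
    have g_out: "g x = 0" if out: "x \<notin> V r" for x
    proof -
      have "x \<notin> cell (lo z) (hi z)" if z: "z \<in> Z" for z
      proof
        assume c: "x \<in> cell (lo z) (hi z)"
        have "- real r < x $ i \<and> x $ i \<le> real r" for i
        proof -
          have "- int r * int m \<le> z i \<and> z i < int r * int m" using z by (simp add: Z_def PiE_def Pi_def)
          then have zi: "- int r * int m \<le> z i" "z i + 1 \<le> int r * int m" by simp_all
          have "real_of_int (- int r * int m) \<le> real_of_int (z i)" "real_of_int (z i + 1) \<le> real_of_int (int r * int m)"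
            using zi by (simp_all only: of_int_le_iff)
          moreover have "real_of_int (z i) < x $ i * real m" "x $ i * real m \<le> real_of_int (z i + 1)"
            using c m0 by (auto simp: cell_def lo_def hi_def divide_less_eq le_divide_eq)
          ultimately have "- real r * real m < x $ i * real m" "x $ i * real m \<le> real r * real m" by auto
          then show ?thesis using m0 by (simp only: mult_less_cancel_right_pos mult_le_cancel_right_pos)
        qed
        then have "x \<in> V r" by (auto simp: V_def cell_def)
        with out show False by blast
      qed
      then show ?thesis by (simp add: g_def)
    qed
    have close: "\<bar>f x - g x\<bar> \<le> e + B * indicator (- V r) x" for x
    proof (cases "x \<in> V r")
      case True
      define z where "z = (\<lambda>i. \<lceil>x $ i * real m\<rceil> - 1)"
      have gx: "g x = f (hi z)" by (rule g_in[OF True z_def])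
      have comp: "\<bar>(hi z - x) $ i\<bar> \<le> 1 / real m" "- real r \<le> hi z $ i \<and> hi z $ i \<le> real r" for i
      proof -
        have hz: "hi z $ i = real_of_int \<lceil>x $ i * real m\<rceil> / real m" by (simp add: hi_def z_def)
        have "x $ i = x $ i * real m / real m" using m0 by simp
        then have "(hi z - x) $ i = (real_of_int \<lceil>x $ i * real m\<rceil> - x $ i * real m) / real m"
          by (simp only: vector_minus_component hz diff_divide_distrib)
        moreover have "0 \<le> real_of_int \<lceil>x $ i * real m\<rceil> - x $ i * real m" "real_of_int \<lceil>x $ i * real m\<rceil> - x $ i * real m \<le> 1"
          by linarith+
        ultimately have d: "0 \<le> (hi z - x) $ i \<and> (hi z - x) $ i \<le> 1 / real m"
          using m0 by (simp add: divide_right_mono)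
        then show "\<bar>(hi z - x) $ i\<bar> \<le> 1 / real m" by simp
        have xi: "- real r < x $ i" "x $ i \<le> real r" using True by (auto simp: V_def cell_def)
        have "x $ i * real m \<le> real_of_int (int r * int m)" using xi m0 by (simp add: mult_right_mono)
        then have "\<lceil>x $ i * real m\<rceil> \<le> int r * int m" by (simp only: ceiling_le_iff)
        then have "real_of_int \<lceil>x $ i * real m\<rceil> \<le> real_of_int (int r * int m)" by (simp only: of_int_le_iff)
        then have "hi z $ i \<le> real r" unfolding hz using m0 by (simp add: divide_le_eq)
        then show "- real r \<le> hi z $ i \<and> hi z $ i \<le> real r" using d xi by simp
      qed
      have "norm (hi z - x) \<le> real CARD('k) * (1 / real m)" by (rule norm_le_of_components) (rule comp)
      also have "\<dots> < s" using m m0 s(1) by (simp add: field_simps)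
      finally have "dist (hi z) x < s" by (simp add: dist_norm)
      moreover have "x \<in> K" unfolding inK using True by (auto simp: V_def cell_def less_imp_le)
      moreover have "hi z \<in> K" unfolding inK using comp(2) by blast
      ultimately have "dist (f (hi z)) (f x) < e" using s(2) by blast
      then show ?thesis using True gx by (simp add: dist_real_def)
    next
      case False
      then show ?thesis using B(2)[of x] e g_out[OF False] by simp
    qed
    have approx: "\<bar>(\<integral>x. f x \<partial>Q) - (\<Sum>z\<in>Z. f (hi z) * measure Q (cell (lo z) (hi z)))\<bar> \<le> e + B * (1 - measure Q (V r))"
      if Q: "prob_space Q" "sets Q = sets borel" for Q
    proof -
      interpret Q: prob_space Q by (rule Q(1))
      have spQ: "space Q = UNIV" using sets_eq_imp_space_eq[OF Q(2)] by simp
      have cQ: "cell a b \<in> sets Q" for a b using cell_borel Q(2) by simp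
      have VQ: "V r \<in> sets Q" using cQ by (simp add: V_def)
      have compl: "space Q - V r = - V r" using spQ by auto
      have VQ': "- V r \<in> sets Q" using sets.compl_sets[OF VQ] unfolding compl .
      have indQ: "integrable Q (indicator (- V r) :: _ \<Rightarrow> real)"
        by (rule Q.integrable_const_bound[OF _ borel_measurable_indicator[OF VQ'], where B=1]) (simp add: indicator_def)
      have fmQ: "f \<in> borel_measurable Q" using fm unfolding measurable_cong_sets[OF Q(2) refl] .
      have fQ: "integrable Q f"
        by (rule Q.integrable_const_bound[OF _ fmQ, where B=B]) (simp add: B(2))
      have iQ: "integrable Q (\<lambda>x. f (hi z) * indicator (cell (lo z) (hi z)) x)" for z
      proof (rule integrable_mult_right)
        show "integrable Q (indicator (cell (lo z) (hi z)) :: _ \<Rightarrow> real)"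
          by (rule Q.integrable_const_bound[OF _ borel_measurable_indicator[OF cQ], where B=1]) (simp add: indicator_def)
      qed
      have gQ: "integrable Q g" unfolding g_def by (intro Bochner_Integration.integrable_sum iQ)
      have "(\<integral>x. g x \<partial>Q) = (\<Sum>z\<in>Z. f (hi z) * measure Q (cell (lo z) (hi z)))"
        unfolding g_def using iQ cQ spQ by (simp add: Bochner_Integration.integral_sum)
      then have "\<bar>(\<integral>x. f x \<partial>Q) - (\<Sum>z\<in>Z. f (hi z) * measure Q (cell (lo z) (hi z)))\<bar> = \<bar>\<integral>x. f x - g x \<partial>Q\<bar>"
        using fQ gQ by simp
      also have "\<dots> \<le> (\<integral>x. \<bar>f x - g x\<bar> \<partial>Q)" by (rule integral_abs_bound)
      also have "\<dots> \<le> (\<integral>x. e + B * indicator (- V r) x \<partial>Q)"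
      proof (rule integral_mono)
        show "integrable Q (\<lambda>x. e + B * indicator (- V r) x)"
          by (intro Bochner_Integration.integrable_add integrable_mult_right indQ) simp
      qed (use fQ gQ close in auto)
      also have "\<dots> = e + B * measure Q (- V r)"
      proof -
        have "(\<integral>x. e + B * indicator (- V r) x \<partial>Q) = e * measure Q (space Q) + B * measure Q (- V r \<inter> space Q)"
          using indQ by simp
        then show ?thesis using Q.prob_space spQ by simp
      qed
      also have "measure Q (- V r) = 1 - measure Q (V r)" using Q.prob_compl[OF VQ] unfolding compl .
      finally show ?thesis .
    qed
    have "(\<lambda>n. \<Sum>z\<in>Z. f (hi z) * measure (L n) (cell (lo z) (hi z))) \<longlonglongrightarrow> (\<Sum>z\<in>Z. f (hi z) * measure N (cell (lo z) (hi z)))"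
      by (intro tendsto_sum tendsto_mult tendsto_const cells) (simp add: lo_def hi_def divide_right_mono)
    then have e1: "eventually (\<lambda>n. dist (\<Sum>z\<in>Z. f (hi z) * measure (L n) (cell (lo z) (hi z))) (\<Sum>z\<in>Z. f (hi z) * measure N (cell (lo z) (hi z))) < e) sequentially"
      using e(1) by (rule tendstoD)
    have "(\<lambda>n. measure (L n) (V r)) \<longlonglongrightarrow> measure N (V r)" unfolding V_def by (rule cells) simp
    then have e2: "eventually (\<lambda>n. 1 - e < measure (L n) (V r)) sequentially" using r(2) by (rule order_tendstoD)
    show "eventually (\<lambda>n. dist (\<integral>x. f x \<partial>(L n)) (\<integral>x. f x \<partial>N) < e0) sequentially"
      using e1 e2 L
    proof eventually_elim
      case (elim n)
      have "B * (1 - measure (L n) (V r)) \<le> B * e" "B * (1 - measure N (V r)) \<le> B * e"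
        using elim(2) r(2) B(1) by (auto intro!: mult_left_mono)
      then have "dist (\<integral>x. f x \<partial>(L n)) (\<integral>x. f x \<partial>N) \<le> 3 * e + 2 * (B * e)"
        using approx[of "L n"] approx[OF N] elim(1,3) unfolding dist_real_def by linarith
      also have "\<dots> < (4 + 4 * B) * e"
      proof -
        have "0 < B * e" using B e by simp
        then show ?thesis using e(1) by (simp add: distrib_right)
      qed
      finally show ?case using e(2) by simp
    qed
  qed
qed

section \<open>Conditioning on the degrees of random vertices\<close>

lemma measure_normal_cell:
  fixes N :: "'b measure" and X :: "'k::finite \<Rightarrow> 'b \<Rightarrow> real"
  assumes N: "prob_space N" and ind: "prob_space.indep_vars N (\<lambda>_. borel) X UNIV"
    and X: "\<And>i. distributed N lborel (X i) std_normal_density"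
  shows "prob_space (distr N borel (\<lambda>\<omega>. \<chi> i. X i \<omega>))"
    "measure (distr N borel (\<lambda>\<omega>. \<chi> i. X i \<omega>)) (cell a b) = (\<Prod>i\<in>UNIV. measure std_normal_distribution {a $ i<..b $ i})"
proof -
  interpret N: prob_space N by (rule N)
  have Xm: "X i \<in> borel_measurable N" for i using distributed_measurable[OF X[of i]] by simp
  have vm: "(\<lambda>\<omega>. \<chi> i. X i \<omega>) \<in> N \<rightarrow>\<^sub>M borel"
  proof (rule borel_measurable_euclidean_space[THEN iffD2], rule ballI)
    fix B :: "real ^ 'k" assume "B \<in> Basis"
    then obtain i where "B = axis i 1" by (auto simp: Basis_vec_def)
    then show "(\<lambda>x. (\<chi> i. X i x) \<bullet> B) \<in> borel_measurable N" using Xm[of i] by (simp add: inner_axis)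
  qed
  show "prob_space (distr N borel (\<lambda>\<omega>. \<chi> i. X i \<omega>))" by (rule N.prob_space_distr[OF vm])
  have "measure (distr N borel (\<lambda>\<omega>. \<chi> i. X i \<omega>)) (cell a b) = measure N ((\<lambda>\<omega>. \<chi> i. X i \<omega>) -` cell a b \<inter> space N)"
    by (rule measure_distr[OF vm cell_borel])
  also have "(\<lambda>\<omega>. \<chi> i. X i \<omega>) -` cell a b \<inter> space N = (\<Inter>i\<in>UNIV. X i -` {a $ i<..b $ i} \<inter> space N)"
    by (auto simp: cell_def)
  also have "measure N \<dots> = (\<Prod>i\<in>UNIV. measure N (X i -` {a $ i<..b $ i} \<inter> space N))"
    by (rule N.indep_varsD[OF ind]) auto
  also have "\<dots> = (\<Prod>i\<in>UNIV. measure std_normal_distribution {a $ i<..b $ i})"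
  proof (rule prod.cong[OF refl])
    fix i
    have "measure N (X i -` {a $ i<..b $ i} \<inter> space N) = measure (distr N lborel (X i)) {a $ i<..b $ i}"
      using distributed_measurable[OF X[of i]] by (subst measure_distr) auto
    then show "measure N (X i -` {a $ i<..b $ i} \<inter> space N) = measure std_normal_distribution {a $ i<..b $ i}"
      unfolding distributed_distr_eq_density[OF X[of i]] .
  qed
  finally show "measure (distr N borel (\<lambda>\<omega>. \<chi> i. X i \<omega>)) (cell a b) = (\<Prod>i\<in>UNIV. measure std_normal_distribution {a $ i<..b $ i})" .
qed

lemma finite_injective_tuples: "finite {u :: 'k::finite \<Rightarrow> nat. inj u \<and> range u \<subseteq> {1..n}}"
proof (rule finite_subset)
  show "{u :: 'k \<Rightarrow> nat. inj u \<and> range u \<subseteq> {1..n}} \<subseteq> PiE UNIV (\<lambda>_. {1..n})"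
    unfolding PiE_def Pi_def extensional_def by blast
qed (auto intro: finite_PiE)

lemma injective_tuples_nonempty:
  assumes "CARD('k::finite) \<le> n" shows "{u :: 'k \<Rightarrow> nat. inj u \<and> range u \<subseteq> {1..n}} \<noteq> {}"
proof -
  have "card (UNIV :: 'k set) \<le> card {1..n}" using assms by simp
  then obtain f :: "'k \<Rightarrow> nat" where "f ` UNIV \<subseteq> {1..n}" "inj_on f UNIV"
    using card_le_inj[of "UNIV :: 'k set" "{1..n}"] by auto
  then show ?thesis by blast
qed

context weighted_tree
begin

lemma degree_event_eq:
  assumes "\<And>i. 0 \<le> d i n"
  shows "degree_event M par v d n = {\<omega> \<in> space M. \<forall>i. nat (d i n) \<le> deg n (v n \<omega> i) \<omega>}"
proof -
  have "(d i n \<le> int (in_degree (recursive_tree (\<lambda>m. par m \<omega>) n) (v n \<omega> i))) = (nat (d i n) \<le> deg n (v n \<omega> i) \<omega>)" for i \<omega>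
    unfolding in_degree_recursive_tree deg_def using assms[of i] by linarith
  then show ?thesis unfolding degree_event_def by simp
qed

text \<open>The selected tuple is independent of the weights and the tree, so the event can be split
  by its value and every tuple treated as deterministic.\<close>

lemma prob_selected:
  fixes v :: "nat \<Rightarrow> 'a \<Rightarrow> 'k::finite \<Rightarrow> nat" and k :: "'k \<Rightarrow> nat"
  assumes v: "uniform_vertices M W par v" and n: "CARD('k) \<le> n"
  defines "T \<equiv> {u :: 'k \<Rightarrow> nat. inj u \<and> range u \<subseteq> {1..n}}"
  shows "{\<omega> \<in> space M. Q (v n \<omega>) \<and> (\<forall>i. k i \<le> deg n (v n \<omega> i) \<omega>)} \<in> sets M"
    "prob {\<omega> \<in> space M. Q (v n \<omega>) \<and> (\<forall>i. k i \<le> deg n (v n \<omega> i) \<omega>)} = (\<Sum>u\<in>{u \<in> T. Q u}. prob (deg_event u n k)) / real (card T)"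
proof -
  let ?H = "history M W par {2..}"
  have vm: "v n \<in> M \<rightarrow>\<^sub>M count_space UNIV"
    and vd: "distr M (count_space UNIV) (v n) = measure_pmf (pmf_of_set T)"
    and vi: "indep_set (sets (vimage_algebra (space M) (v n) (count_space UNIV))) (sets ?H)"
    using v n unfolding uniform_vertices_def T_def by auto
  have finT: "finite T" unfolding T_def by (rule finite_injective_tuples)
  have neT: "T \<noteq> {}" unfolding T_def by (rule injective_tuples_nonempty[OF n])
  let ?V = "\<lambda>u. {\<omega> \<in> space M. v n \<omega> = u}"
  have V_eq: "?V u = v n -` {u} \<inter> space M" for u by auto
  have V_sets: "?V u \<in> sets M" for u unfolding V_eq by (rule measurable_sets[OF vm]) simp
  have V_prob: "prob (?V u) = pmf (pmf_of_set T) u" for u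
  proof -
    have "prob (?V u) = measure (distr M (count_space UNIV) (v n)) {u}"
      unfolding V_eq by (rule measure_distr[symmetric, OF vm]) simp
    then show ?thesis unfolding vd by (simp add: measure_pmf_single)
  qed
  have E_H: "deg_event u n k \<in> sets ?H" for u :: "'k \<Rightarrow> nat"
  proof -
    have "{\<omega> \<in> space M. k i \<le> deg n (u i) \<omega>} \<in> sets ?H" for i
      using measurable_sets[OF deg_history[of n "{2..}" "u i"], of "{k i..}"] by (simp add: vimage_def Int_def conj_commute)
    then have "(\<Inter>i\<in>UNIV. {\<omega> \<in> space M. k i \<le> deg n (u i) \<omega>}) \<in> sets ?H"
      by (intro sets.finite_INT) simp_all
    moreover have "(\<Inter>i\<in>UNIV. {\<omega> \<in> space M. k i \<le> deg n (u i) \<omega>}) = deg_event u n k"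
      unfolding deg_event_def by blast
    ultimately show ?thesis by simp
  qed
  have VE: "prob (?V u \<inter> deg_event u n k) = prob (?V u) * prob (deg_event u n k)" for u
  proof (rule indep_setD[OF vi _ E_H])
    show "?V u \<in> sets (vimage_algebra (space M) (v n) (count_space UNIV))"
      unfolding V_eq by (rule in_vimage_algebra) simp
  qed
  let ?A = "{\<omega> \<in> space M. Q (v n \<omega>) \<and> (\<forall>i. k i \<le> deg n (v n \<omega> i) \<omega>)}"
  \<comment> \<open>Measurability needs this exact identity as a countable union over all tuples;
    the reduction to the finite set \<open>T\<close> holds only almost surely.\<close>
  have A_eq: "?A = (\<Union>u\<in>{u. Q u}. ?V u \<inter> deg_event u n k)"
    unfolding deg_event_def by blast
  show A_sets: "?A \<in> sets M"
    unfolding A_eq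
    by (rule sets.countable_UN'[OF countable_subset[OF subset_UNIV countableI_type]])
      (rule image_subsetI, rule sets.Int[OF V_sets deg_event_sets])
  have null: "AE \<omega> in M. v n \<omega> \<in> T"
  proof -
    have "AE u in distr M (count_space UNIV) (v n). u \<in> T"
      unfolding vd using finT neT by (simp add: AE_measure_pmf_iff)
    from AE_distrD[OF vm this] show ?thesis .
  qed
  have "prob ?A = prob (\<Union>u\<in>{u \<in> T. Q u}. ?V u \<inter> deg_event u n k)"
  proof (rule finite_measure_eq_AE)
    show "AE \<omega> in M. (\<omega> \<in> ?A) = (\<omega> \<in> (\<Union>u\<in>{u \<in> T. Q u}. ?V u \<inter> deg_event u n k))"
      using null by eventually_elim (auto simp: deg_event_def)
    show "(\<Union>u\<in>{u \<in> T. Q u}. ?V u \<inter> deg_event u n k) \<in> sets M"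
      by (rule sets.finite_UN) (use finT in simp, rule sets.Int[OF V_sets deg_event_sets])
  qed (rule A_sets)
  also have "\<dots> = (\<Sum>u\<in>{u \<in> T. Q u}. prob (?V u \<inter> deg_event u n k))"
  proof (rule finite_measure_finite_Union)
    show "(\<lambda>u. ?V u \<inter> deg_event u n k) ` {u \<in> T. Q u} \<subseteq> sets M"
      using sets.Int[OF V_sets deg_event_sets] by blast
  qed (use finT in \<open>auto simp: disjoint_family_on_def\<close>)
  also have "\<dots> = (\<Sum>u\<in>{u \<in> T. Q u}. prob (deg_event u n k) / real (card T))"
    unfolding VE V_prob using finT neT by (intro sum.cong) (auto simp: pmf_of_set)
  finally show "prob ?A = (\<Sum>u\<in>{u \<in> T. Q u}. prob (deg_event u n k)) / real (card T)"
    by (simp add: sum_divide_distrib)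
qed

end

context joint_labels
begin

text \<open>Numerator and normalising probability are \<open>box_mass\<close> times the same factor,
  which cancels. So the limit for a box is divided by the limit for \<open>UNIV\<close>, which is 1
  and also shows that the conditioning event eventually has positive probability.\<close>

lemma conditional_law_tendsto:
  fixes v :: "nat \<Rightarrow> 'a \<Rightarrow> 'k \<Rightarrow> nat" and d' :: "'k \<Rightarrow> nat \<Rightarrow> int"
  assumes v: "uniform_vertices M W par v" and d': "\<And>i n. d i n = nat (d' i n)"
  shows "eventually (\<lambda>n. prob_space (conditional_label_law M \<theta> par v d' n) \<and> sets (conditional_label_law M \<theta> par v d' n) = sets borel) sequentially"
    "(\<And>i. a $ i \<le> b $ i) \<Longrightarrow> (\<lambda>n. measure (conditional_label_law M \<theta> par v d' n) (cell a b))
      \<longlonglongrightarrow> (\<Prod>i\<in>UNIV. measure std_normal_distribution {a $ i<..b $ i})"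
proof -
  have full: "box_mass (\<lambda>_. UNIV) \<longlonglongrightarrow> 1"
    using box_mass_tendsto[of "\<lambda>_. UNIV"] std_normal_UNIV by simp
  have pos_ev: "eventually (\<lambda>n. 0 < box_mass (\<lambda>_. UNIV) n) sequentially"
    by (rule order_tendstoD(1)[OF full]) simp
  have d1: "eventually (\<lambda>n. \<forall>i. 1 \<le> d i n) sequentially"
    by (rule eventually_all_finite) (use d_top in \<open>simp add: filterlim_at_top\<close>)
  define T where "T n = {u :: 'k \<Rightarrow> nat. inj u \<and> range u \<subseteq> {1..n}}" for n
  define E where "E n = degree_event M par v d' n" for n
  define Y where "Y n = rescaled_labels \<theta> v d' n" for n
  have main: "eventually (\<lambda>n. E n \<in> sets M \<and> 0 < prob (E n) \<and> Y n \<in> M \<rightarrow>\<^sub>M borel \<and>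
      (\<forall>a b. prob (E n \<inter> Y n -` cell a b) / prob (E n) = box_mass (\<lambda>i. {a $ i<..b $ i}) n / box_mass (\<lambda>_. UNIV) n)) sequentially"
    using pos_ev d1 eventually_ge_at_top[of "CARD('k)"]
  proof eventually_elim
    case (elim n)
    have d0: "0 \<le> d' i n" and dd: "real_of_int (d' i n) = real (d i n)" for i
      using elim(2)[rule_format, of i] unfolding d' by linarith+
    have vm: "v n \<in> M \<rightarrow>\<^sub>M count_space UNIV" using v elim(3) unfolding uniform_vertices_def by blast
    have E_eq: "E n = {\<omega> \<in> space M. \<forall>i. d i n \<le> deg n (v n \<omega> i) \<omega>}"
      unfolding E_def degree_event_eq[of d' n, OF d0] d' ..
    have Y_eq: "Y n \<omega> $ i = pos i n (v n \<omega> i)" for \<omega> i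
    proof -
      have g: "1 - 1 / \<theta> = wl.gam" by (simp add: wl.gam_def)
      have "sqrt (wl.gam\<^sup>2 * real (d i n)) = wl.gam * sqrt (real (d i n))"
        using wl.gam_pos by (simp add: real_sqrt_mult)
      then show ?thesis unfolding Y_def rescaled_labels_def g dd pos_def by simp
    qed
    have Ym: "Y n \<in> M \<rightarrow>\<^sub>M borel"
      unfolding Y_def rescaled_labels_def
      by (rule measurable_compose[OF vm, where g = "\<lambda>u. \<chi> i. (ln (real (u i)) - (ln (real n) - (1 - 1 / \<theta>) * real_of_int (d' i n)))
           / sqrt ((1 - 1 / \<theta>)\<^sup>2 * real_of_int (d' i n))"]) simp
    define N where "N = real n ^ CARD('k) * (\<Prod>i\<in>UNIV. G i n)"
    have n: "0 < n" using elim(3) zero_less_card_finite[where 'a='k] by linarith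
    have N: "0 < N" unfolding N_def using n wl.geo_moment_pos by (intro mult_pos_pos prod_pos zero_less_power) auto
    have cT: "0 < real (card (T n))"
      using finite_injective_tuples[where 'k='k, of n] injective_tuples_nonempty[OF elim(3)] by (simp add: T_def card_gt_0_iff)
    have key: "{\<omega> \<in> space M. (\<forall>i. pos i n (v n \<omega> i) \<in> I i) \<and> (\<forall>i. d i n \<le> deg n (v n \<omega> i) \<omega>)} \<in> sets M"
      "prob {\<omega> \<in> space M. (\<forall>i. pos i n (v n \<omega> i) \<in> I i) \<and> (\<forall>i. d i n \<le> deg n (v n \<omega> i) \<omega>)} = box_mass I n * (N / real (card (T n)))" for I
    proof -
      note sel = prob_selected[OF v elim(3), of "\<lambda>u. \<forall>i. pos i n (u i) \<in> I i" "\<lambda>i. d i n"]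
      show "{\<omega> \<in> space M. (\<forall>i. pos i n (v n \<omega> i) \<in> I i) \<and> (\<forall>i. d i n \<le> deg n (v n \<omega> i) \<omega>)} \<in> sets M" by (rule sel(1))
      have "{u \<in> T n. \<forall>i. pos i n (u i) \<in> I i} = {u \<in> box I n. inj u}"
        by (auto simp: T_def box_def PiE_def Pi_def image_subset_iff)
      then show "prob {\<omega> \<in> space M. (\<forall>i. pos i n (v n \<omega> i) \<in> I i) \<and> (\<forall>i. d i n \<le> deg n (v n \<omega> i) \<omega>)} = box_mass I n * (N / real (card (T n)))"
        using sel(2) N unfolding T_def[symmetric] box_mass_def N_def[symmetric] by simp
    qed
    have E_key: "E n = {\<omega> \<in> space M. (\<forall>i. pos i n (v n \<omega> i) \<in> UNIV) \<and> (\<forall>i. d i n \<le> deg n (v n \<omega> i) \<omega>)}"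
      unfolding E_eq by simp
    have Es: "E n \<in> sets M" unfolding E_key by (rule key(1))
    have Ep: "prob (E n) = box_mass (\<lambda>_. UNIV) n * (N / real (card (T n)))" unfolding E_key by (rule key(2))
    have c: "0 < N / real (card (T n))" using N cT by simp
    have Ep0: "0 < prob (E n)" unfolding Ep using elim(1) c by (rule mult_pos_pos)
    have "prob (E n \<inter> Y n -` cell a b) / prob (E n) = box_mass (\<lambda>i. {a $ i<..b $ i}) n / box_mass (\<lambda>_. UNIV) n" for a b
    proof -
      have "E n \<inter> Y n -` cell a b = {\<omega> \<in> space M. (\<forall>i. pos i n (v n \<omega> i) \<in> {a $ i<..b $ i}) \<and> (\<forall>i. d i n \<le> deg n (v n \<omega> i) \<omega>)}"
        unfolding E_eq cell_def by (auto simp: Y_eq)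
      then have "prob (E n \<inter> Y n -` cell a b) = box_mass (\<lambda>i. {a $ i<..b $ i}) n * (N / real (card (T n)))"
        using key(2)[of "\<lambda>i. {a $ i<..b $ i}"] by simp
      then show ?thesis unfolding Ep
        by (simp only: mult_divide_mult_cancel_right[OF less_imp_neq[OF c, symmetric]])
    qed
    then show ?case using Es Ep0 Ym by blast
  qed
  show "eventually (\<lambda>n. prob_space (conditional_label_law M \<theta> par v d' n) \<and> sets (conditional_label_law M \<theta> par v d' n) = sets borel) sequentially"
    using main
  proof eventually_elim
    case (elim n)
    have "prob_space (uniform_measure M (E n))"
      by (rule prob_space_uniform_measure) (use elim in \<open>auto simp: emeasure_eq_measure\<close>)
    moreover have "Y n \<in> uniform_measure M (E n) \<rightarrow>\<^sub>M borel" using elim by (simp add: measurable_def)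
    ultimately show ?case
      unfolding conditional_label_law_def E_def[symmetric] Y_def[symmetric] by (simp add: prob_space.prob_space_distr)
  qed
  assume ab: "\<And>i. a $ i \<le> b $ i"
  have "box_mass (\<lambda>i. {a $ i<..b $ i}) \<longlonglongrightarrow> (\<Prod>i\<in>UNIV. measure std_normal_distribution {a $ i<..b $ i})"
    by (rule box_mass_tendsto) (use ab in blast)
  then have "(\<lambda>n. box_mass (\<lambda>i. {a $ i<..b $ i}) n / box_mass (\<lambda>_. UNIV) n) \<longlonglongrightarrow> (\<Prod>i\<in>UNIV. measure std_normal_distribution {a $ i<..b $ i}) / 1"
    by (intro tendsto_divide full) auto
  moreover have "eventually (\<lambda>n. box_mass (\<lambda>i. {a $ i<..b $ i}) n / box_mass (\<lambda>_. UNIV) n = measure (conditional_label_law M \<theta> par v d' n) (cell a b)) sequentially"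
    using main
  proof eventually_elim
    case (elim n)
    have Ym: "Y n \<in> uniform_measure M (E n) \<rightarrow>\<^sub>M borel" using elim by (simp add: measurable_def)
    have Ysets: "Y n -` cell a b \<inter> space M \<in> sets M" using elim cell_borel by (auto intro: measurable_sets)
    have "measure (conditional_label_law M \<theta> par v d' n) (cell a b) = measure (uniform_measure M (E n)) (Y n -` cell a b \<inter> space M)"
      unfolding conditional_label_law_def E_def[symmetric] Y_def[symmetric]
      by (subst measure_distr[OF Ym cell_borel]) simp
    also have "\<dots> = prob (E n \<inter> (Y n -` cell a b \<inter> space M)) / prob (E n)"
      by (rule measure_uniform_measure) (use elim Ysets in \<open>auto simp: emeasure_eq_measure\<close>)
    also have "E n \<inter> (Y n -` cell a b \<inter> space M) = E n \<inter> Y n -` cell a b"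
      using elim sets.sets_into_space[of "E n" M] by blast
    finally show ?case using elim by simp
  qed
  ultimately show "(\<lambda>n. measure (conditional_label_law M \<theta> par v d' n) (cell a b))
      \<longlonglongrightarrow> (\<Prod>i\<in>UNIV. measure std_normal_distribution {a $ i<..b $ i})"
    by (simp add: Lim_transform_eventually)
qed

end

section \<open>Choice of the parameters\<close>

lemma limsup_less_eventually_le:
  fixes d :: "nat \<Rightarrow> int"
  assumes "limsup (\<lambda>n. ereal (real_of_int (d n) / ln (real n))) < ereal r" "0 \<le> r"
  shows "eventually (\<lambda>n. real (nat (d n)) \<le> r * ln (real n)) sequentially"
  using Limsup_lessD[OF assms(1)] eventually_gt_at_top[of 1]
proof eventually_elim
  case (elim n)
  have L: "0 < ln (real n)" using elim by simp
  have "real_of_int (d n) / ln (real n) < r" using elim(1) by simp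
  then have "real_of_int (d n) < r * ln (real n)" using L by (simp add: divide_less_eq)
  moreover have "0 \<le> r * ln (real n)" using L assms(2) by simp
  ultimately show ?case by linarith
qed

theorem conditional_labels_converge:
  fixes M :: "'a measure" and \<mu> :: "real measure"
    and W :: "nat \<Rightarrow> 'a \<Rightarrow> real" and par :: "nat \<Rightarrow> 'a \<Rightarrow> nat"
    and v :: "nat \<Rightarrow> 'a \<Rightarrow> 'k::finite \<Rightarrow> nat" and d :: "'k \<Rightarrow> nat \<Rightarrow> int"
    and \<theta> :: real and N :: "'b measure" and X :: "'k \<Rightarrow> 'b \<Rightarrow> real"
  assumes wrt: "weighted_recursive_tree M \<mu> W par"
    and C1: "cond_C1 \<mu>" and C2: "cond_C2 \<mu>"
    and theta: "\<theta> = 1 + (\<integral>x. x \<partial>\<mu>)"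
    and d_top: "\<And>i. filterlim (d i) at_top sequentially"
    and limsup: "\<And>i. limsup (\<lambda>n. ereal (real_of_int (d i n) / ln (real n))) < ereal (\<theta> / (\<theta> - 1))"
    and v: "uniform_vertices M W par v"
    and N: "prob_space N" and ind: "prob_space.indep_vars N (\<lambda>_. borel) X UNIV"
    and X: "\<And>i. distributed N lborel (X i) std_normal_density"
  shows "converges_in_law (conditional_label_law M \<theta> par v d) (distr N borel (\<lambda>\<omega>. \<chi> i. X i \<omega>))"
proof -
  interpret wrt: weighted_recursive_tree M \<mu> W par by (rule wrt)
  interpret wl: weight_law \<mu> \<theta>
    by unfold_locales (rule wrt.law_pos C1 C2 theta)+
  interpret weighted_tree M \<mu> W par \<theta> by unfold_locales
  have th: "1 < \<theta>" "\<theta> \<le> 2" by (rule wl.theta_gt_1 wl.theta_le_2)+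
  define g where "g = 1 / wl.gam"
  have g: "g = \<theta> / (\<theta> - 1)" unfolding g_def by (rule wl.inverse_gam)
  have g1: "1 < g" unfolding g using th by simp
  have "\<exists>r. 0 \<le> r \<and> r < g \<and> limsup (\<lambda>n. ereal (real_of_int (d i n) / ln (real n))) < ereal r" for i
  proof -
    have "max 0 (limsup (\<lambda>n. ereal (real_of_int (d i n) / ln (real n)))) < ereal g"
      using limsup[of i] g1 by (simp add: g)
    then obtain y where y: "max 0 (limsup (\<lambda>n. ereal (real_of_int (d i n) / ln (real n)))) < y" "y < ereal g"
      using dense by blast
    then obtain r where "y = ereal r" by (cases y) auto
    then show ?thesis using y by (intro exI[of _ r]) (auto simp: less_imp_le)
  qed
  then obtain r where r: "\<And>i. 0 \<le> r i" "\<And>i. r i < g" "\<And>i. limsup (\<lambda>n. ereal (real_of_int (d i n) / ln (real n))) < ereal (r i)"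
    by metis
  \<comment> \<open>The locale uses one bound for all coordinates; as the maximum of finitely many
    values below \<open>g = 1 / gam\<close> it stays below \<open>g\<close>.\<close>
  define c' where "c' = Max (range r)"
  have c'r: "r i \<le> c'" for i unfolding c'_def by (rule Max_ge) auto
  have c': "0 \<le> c'" "c' < g"
  proof -
    show "0 \<le> c'" by (rule order_trans[OF r(1) c'r])
    show "c' < g" unfolding c'_def by (subst Max_less_iff) (auto simp: r(2))
  qed
  \<comment> \<open>A quarter of \<open>g - c'\<close> leaves \<open>c' < g - 2 \<beta>\<close>, and
    the remaining room is given to \<open>\<delta>\<close> by way of \<open>\<rho>0\<close>.\<close>
  define \<beta> where "\<beta> = min (1/2) ((g - c') / 4)"
  have \<beta>: "0 < \<beta>" "\<beta> < 1" "2 * \<beta> < g" "c' < g - 2 * \<beta>"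
  proof -
    have "\<beta> \<le> 1/2" "\<beta> \<le> (g - c') / 4"
      unfolding \<beta>_def by (rule min.cobounded1, rule min.cobounded2)
    moreover from this(2) have "4 * \<beta> \<le> g - c'" by (simp add: le_divide_eq)
    ultimately show "\<beta> < 1" "2 * \<beta> < g" "c' < g - 2 * \<beta>" using c' g1 by linarith+
    show "0 < \<beta>" using c' by (simp add: \<beta>_def)
  qed
  define \<rho>0 where "\<rho>0 = c' / (g - 2 * \<beta>)"
  have \<rho>0: "\<rho>0 < 1" "0 \<le> \<rho>0" using \<beta> c' by (auto simp: \<rho>0_def)
  \<comment> \<open>The midpoint of \<open>c' (\<theta> - 1)\<close> and \<open>\<theta>\<close>:
    above the former, so that the loss ratio \<open>\<rho>\<close> is below 1, and below the latter,
    so that \<open>\<eta>\<close> is positive.\<close>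
  define z where "z = max 1 ((c' * (\<theta> - 1) + \<theta>) / 2)"
  have c\<theta>: "c' * (\<theta> - 1) < \<theta>" using c'(2) th unfolding g by (simp add: less_divide_eq)
  have z: "1 \<le> z" "z < \<theta>" "c' * (\<theta> - 1) < z" using c\<theta> th by (auto simp: z_def max_def)
  define \<rho> \<eta> where "\<rho> = c' * (\<theta> - 1) / z" and "\<eta> = (\<theta> - z) / (\<theta> - 1)"
  have \<rho>: "\<rho> < 1" "0 \<le> \<rho>" using z c' th by (auto simp: \<rho>_def)
  have \<eta>: "0 < \<eta>" using z th by (simp add: \<eta>_def)
  \<comment> \<open>A quarter of the available gap \<open>\<eta> (1 - \<rho>)\<close>; the losses
    \<open>\<epsilon>\<close>, \<open>\<delta> / \<kappa>\<close> and \<open>\<eta> \<delta>\<close>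
    take at most one quarter each.\<close>
  define \<epsilon> where "\<epsilon> = \<eta> * (1 - \<rho>) / 4"
  have \<epsilon>: "0 < \<epsilon>" using \<rho> \<eta> by (simp add: \<epsilon>_def)
  define A where "A = real CARD('k) * (c' * ln \<theta> + 1) + 1"
  have A: "0 < A" unfolding A_def using c' th by (intro add_nonneg_pos mult_nonneg_nonneg add_nonneg_nonneg) auto
  have "\<exists>\<kappa>>0. \<forall>\<delta>>0. eventually (\<lambda>n. measure M {\<omega> \<in> space M. \<not> sums_ok \<epsilon> \<kappa> \<delta> n \<omega>} \<le> 2 * real n powr (- A)) sequentially"
    by (rule sums_ok_prob[OF A \<epsilon>]) blast
  then obtain \<kappa> where \<kappa>: "0 < \<kappa>"
    and ok: "\<And>\<delta>. 0 < \<delta> \<Longrightarrow> eventually (\<lambda>n. measure M {\<omega> \<in> space M. \<not> sums_ok \<epsilon> \<kappa> \<delta> n \<omega>} \<le> 2 * real n powr (- A)) sequentially"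
    by blast
  \<comment> \<open>The four bounds serve, in turn, the assumption on \<open>c'\<close>,
    \<open>\<delta> < 1/2\<close>, the loss \<open>\<eta> \<delta>\<close>, and the loss
    \<open>\<delta> / \<kappa>\<close>.\<close>
  define \<delta> where "\<delta> = min (min ((1 - \<rho>0) / 4) (1/4)) (min ((1 - \<rho>) / 4) (\<kappa> * \<epsilon>))"
  have \<delta>: "0 < \<delta>" "\<delta> \<le> (1 - \<rho>0) / 4" "\<delta> \<le> 1/4" "\<delta> \<le> (1 - \<rho>) / 4" "\<delta> \<le> \<kappa> * \<epsilon>"
  proof -
    have "0 < \<kappa> * \<epsilon>" using \<kappa> \<epsilon> by simp
    then show "0 < \<delta>" unfolding \<delta>_def using \<rho>0(1) \<rho>(1) by simp
    show "\<delta> \<le> (1 - \<rho>0) / 4" "\<delta> \<le> 1/4" "\<delta> \<le> (1 - \<rho>) / 4" "\<delta> \<le> \<kappa> * \<epsilon>"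
      unfolding \<delta>_def by (meson min.cobounded1 min.cobounded2 order_trans)+
  qed
  have c'\<delta>: "c' < (g - 2 * \<beta>) * (1 - 2 * \<delta>)"
  proof -
    have gb: "0 < g - 2 * \<beta>" using \<beta> by simp
    have "4 * \<delta> \<le> 1 - \<rho>0" using \<delta>(2) by (simp add: le_divide_eq)
    then have "\<rho>0 < 1 - 2 * \<delta>" using \<rho>0 by linarith
    then have "(g - 2 * \<beta>) * \<rho>0 < (g - 2 * \<beta>) * (1 - 2 * \<delta>)" using gb by (rule mult_strict_left_mono)
    then show ?thesis using gb by (simp add: \<rho>0_def)
  qed
  have gap: "c' * (\<theta> - 1) / z * ((\<theta> - z) / (\<theta> - 1)) + (\<epsilon> + \<delta> / \<kappa>) < (\<theta> - z) / (\<theta> - 1) * (1 - \<delta>)"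
  proof -
    have "\<delta> / \<kappa> \<le> \<epsilon>" using \<delta>(5) \<kappa> by (simp add: divide_le_eq mult.commute)
    moreover have "\<eta> * \<delta> \<le> \<eta> * ((1 - \<rho>) / 4)" using \<delta>(4) \<eta> by (intro mult_left_mono) auto
    moreover have "0 < \<eta> * (1 - \<rho>)" using \<eta> \<rho> by simp
    moreover have "4 * \<epsilon> = \<eta> * (1 - \<rho>)" "\<eta> * ((1 - \<rho>) / 4) = \<epsilon>" by (simp_all add: \<epsilon>_def)
    moreover have "\<eta> * (1 - \<rho>) = \<eta> - \<rho> * \<eta>" "\<eta> * (1 - \<delta>) = \<eta> - \<eta> * \<delta>" by (simp_all add: algebra_simps)
    ultimately have "\<rho> * \<eta> + (\<epsilon> + \<delta> / \<kappa>) < \<eta> * (1 - \<delta>)"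
      by linarith
    then show ?thesis unfolding \<rho>_def \<eta>_def .
  qed
  interpret J: joint_labels M \<mu> W par \<theta> "\<lambda>i n. nat (d i n)" c' \<beta> \<delta> \<epsilon> \<kappa> z A
  proof unfold_locales
    show "filterlim (\<lambda>n. nat (d i n)) at_top sequentially" for i
      unfolding filterlim_at_top
    proof
      fix Z :: nat
      have "eventually (\<lambda>n. int Z \<le> d i n) sequentially" using d_top[of i] unfolding filterlim_at_top by blast
      then show "eventually (\<lambda>n. Z \<le> nat (d i n)) sequentially" by eventually_elim simp
    qed
    show "eventually (\<lambda>n. real (nat (d i n)) \<le> c' * ln (real n)) sequentially" for i
      using limsup_less_eventually_le[OF r(3)[of i] r(1)] eventually_ge_at_top[of 1]
    proof eventually_elim
      case (elim n)
      have "r i * ln (real n) \<le> c' * ln (real n)" using c'r[of i] elim(2) by (intro mult_right_mono) auto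
      then show ?case using elim(1) by linarith
    qed
    show "2 * \<beta> < 1 / wl.gam" "c' < (1 / wl.gam - 2 * \<beta>) * (1 - 2 * \<delta>)"
      using \<beta>(3) c'\<delta> unfolding g_def by auto
    show "real CARD('k) * (c' * ln \<theta> + 1) < A" by (simp add: A_def)
    show "eventually (\<lambda>n. measure M {\<omega> \<in> space M. \<not> sums_ok \<epsilon> \<kappa> \<delta> n \<omega>} \<le> 2 * real n powr (- A)) sequentially"
      by (rule ok[OF \<delta>(1)])
  qed (use c' \<beta> \<delta> \<epsilon> \<kappa> z gap in auto)
  show ?thesis
  proof (rule converges_in_law_of_cells)
    show "eventually (\<lambda>n. prob_space (conditional_label_law M \<theta> par v d n) \<and> sets (conditional_label_law M \<theta> par v d n) = sets borel) sequentially"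
      by (rule J.conditional_law_tendsto(1)[OF v refl])
    show "prob_space (distr N borel (\<lambda>\<omega>. \<chi> i. X i \<omega>))" by (rule measure_normal_cell(1)[OF N ind X])
    fix a b :: "real ^ 'k" assume ab: "\<And>i. a $ i \<le> b $ i"
    show "(\<lambda>n. measure (conditional_label_law M \<theta> par v d n) (cell a b)) \<longlonglongrightarrow> measure (distr N borel (\<lambda>\<omega>. \<chi> i. X i \<omega>)) (cell a b)"
      unfolding measure_normal_cell(2)[OF N ind X] by (rule J.conditional_law_tendsto(2)[OF v refl ab])
  qed simp
qed

theorem theorem2p7:
  fixes M :: "'a measure" and \<mu> :: "real measure"
    and W :: "nat \<Rightarrow> 'a \<Rightarrow> real" and par :: "nat \<Rightarrow> 'a \<Rightarrow> nat"
    and v :: "nat \<Rightarrow> 'a \<Rightarrow> 'k::finite \<Rightarrow> nat" and d :: "'k \<Rightarrow> nat \<Rightarrow> int"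
    and c :: "'k \<Rightarrow> ereal" and \<theta> :: real
    and N :: "'b measure" and X :: "'k \<Rightarrow> 'b \<Rightarrow> real"
  assumes "weighted_recursive_tree M \<mu> W par"
    and "cond_C1 \<mu>" and "cond_C2 \<mu>"
    and "\<theta> = 1 + (\<integral>x. x \<partial>\<mu>)"
    and "\<And>i. filterlim (d i) at_top sequentially"
    and "\<And>i. c i = limsup (\<lambda>n. ereal (real_of_int (d i n) / ln (real n)))"
    and "uniform_vertices M W par v"
    and "prob_space N"
    and "prob_space.indep_vars N (\<lambda>_. borel) X UNIV"
    and "\<And>i. distributed N lborel (X i) std_normal_density"
  shows "((\<forall>i. 0 \<le> c i \<and> c i < ereal (1 / ln \<theta>)) \<longrightarrow>
           converges_in_law (conditional_label_law M \<theta> par v d) (distr N borel (\<lambda>\<omega>. \<chi> i. X i \<omega>))) \<and>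
         (cond_C3 \<mu> \<and> (\<forall>i. ereal (1 / ln \<theta>) \<le> c i \<and> c i < ereal (\<theta> / (\<theta> - 1))) \<longrightarrow>
           converges_in_law (conditional_label_law M \<theta> par v d) (distr N borel (\<lambda>\<omega>. \<chi> i. X i \<omega>)))"
proof -
  interpret wrt: weighted_recursive_tree M \<mu> W par by (rule assms(1))
  interpret wl: weight_law \<mu> \<theta>
    by unfold_locales (rule wrt.law_pos assms(2-4))+
  have "1 < \<theta>" by (rule wl.theta_gt_1)
  \<comment> \<open>Places both ranges of \<open>c\<close> below
    \<open>\<theta> / (\<theta> - 1)\<close>; it is \<open>ln x \<le> x - 1\<close> at
    \<open>x = 1 / \<theta>\<close>.\<close>
  have "1 / ln \<theta> \<le> \<theta> / (\<theta> - 1)"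
  proof -
    have "ln (1 / \<theta>) \<le> 1 / \<theta> - 1" using \<open>1 < \<theta>\<close> by (intro ln_le_minus_one) auto
    then have "(\<theta> - 1) / \<theta> \<le> ln \<theta>" using \<open>1 < \<theta>\<close> by (simp add: ln_div diff_divide_distrib)
    then have "1 / ln \<theta> \<le> 1 / ((\<theta> - 1) / \<theta>)" using \<open>1 < \<theta>\<close> by (intro divide_left_mono) auto
    then show ?thesis by simp
  qed
  then have le: "ereal (1 / ln \<theta>) \<le> ereal (\<theta> / (\<theta> - 1))" by simp
  have "converges_in_law (conditional_label_law M \<theta> par v d) (distr N borel (\<lambda>\<omega>. \<chi> i. X i \<omega>))"
    if "\<And>i. c i < ereal (\<theta> / (\<theta> - 1))"
    by (rule conditional_labels_converge[OF assms(1-5) _ assms(7-10)]) (use that assms(6) in simp)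
  then show ?thesis using le less_le_trans by blast
qed

end
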